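(* Let $(u,B)$ be a weak solution of the ideal MHD equations on $\mathbb{T}^3\times(0,T)$ (with $u$ and $B$ weakly divergence-free, in the sense given in the context). Let $0<\alpha_1<\alpha_2<1$ be such that $u\in L^2((0,T);B^{\alpha_2}_{4,\infty}(\mathbb{T}^3))$ and $B\in L^2((0,T);B^{-\alpha_1}_{4,\infty}(\mathbb{T}^3))$. Then the magnetic helicity $\int_{\mathbb{T}^3}A(x,t)\cdot B(x,t)\,dx$ is conserved, i.e. $$\int_{\mathbb{T}^3}A(x,t_1)\cdot B(x,t_1)\,dx=\int_{\mathbb{T}^3}A(x,t_2)\cdot B(x,t_2)\,dx\qquad\text{for almost every }t_1,t_2\in(0,T).$$
   Context: $\mathbb{T}^3$ is the three-dimensional torus, $T>0$, $\mathcal{D}$ denotes $C_c^\infty$, $B^s_{p,q}$ are Besov spaces. $(a\otimes b)_{ij}=a_ib_j$, $(\nabla\psi)_{ij}=\partial_i\psi_j$, $M:N=\sum_{i,j}M_{ij}N_{ij}$. The ideal MHD equations are $\partial_tu+u\cdot\nabla u-B\cdot\nabla B+\nabla p=0$, $\partial_tB+u\cdot\nabla B-B\cdot\nabla u=0$, $\nabla\cdot u=0$. A weak solution is a pair $(u,B)$ with $u,B\in L^\infty((0,T);L^2(\mathbb{T}^3))$, both weakly divergence-free, such that for all divergence-free $\psi_1,\psi_2\in\mathcal{D}(\mathbb{T}^3\times(0,T);\mathbb{R}^3)$ $$\int_0^T\!\!\int_{\mathbb{T}^3}\big[u\cdot\partial_t\psi_1+u\otimes u:\nabla\psi_1-B\otimes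 B:\nabla\psi_1\big]dx\,dt=0,$$ $$\int_0^T\!\!\int_{\mathbb{T}^3}\big[B\cdot\partial_t\psi_2+u\otimes B:\nabla\psi_2-B\otimes u:\nabla\psi_2\big]dx\,dt=0.$$ Standing assumption: $B$ is mean-free. The vector potential is $A=\nabla\times(-\Delta)^{-1}B$, where $(-\Delta)^{-1}B$ is taken mean-free; thus $\nabla\times A=B$ and $\nabla\cdot A=0$. *)

theory Defs
  imports "HOL-Analysis.Analysis"
begin

text \<open>
  The torus is $\mathbb{R}^3/\mathbb{Z}^3$: functions on it are 1-periodic functions on
  \<open>real^3\<close>, integrated over the unit cube.
\<close>

definition periodic :: "(real^3 \<Rightarrow> 'b) \<Rightarrow> bool" where
  "periodic f \<longleftrightarrow> (\<forall>x i. f (x + axis i 1) = f x)"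

definition torus_integral :: "(real^3 \<Rightarrow> 'b::euclidean_space) \<Rightarrow> 'b" where
  "torus_integral f = (LINT x:cbox 0 1|lebesgue. f x)"

definition torus_L2 :: "(real^3 \<Rightarrow> real^3) \<Rightarrow> bool" where
  "torus_L2 f \<longleftrightarrow> periodic f \<and> f \<in> borel_measurable lebesgue \<and>
     set_integrable lebesgue (cbox 0 1) (\<lambda>x. (norm (f x))\<^sup>2)"


subsection \<open>Smooth functions and differential operators\<close>

primrec C_k :: "nat \<Rightarrow> ('a::euclidean_space \<Rightarrow> 'b::real_normed_vector) \<Rightarrow> bool" where
  "C_k 0 f \<longleftrightarrow> continuous_on UNIV f"
| "C_k (Suc n) f \<longleftrightarrow> (\<forall>x. f differentiable (at x)) \<and>
     (\<forall>v. C_k n (\<lambda>x. frechet_derivative f (at x) v))"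

definition smooth :: "('a::euclidean_space \<Rightarrow> 'b::real_normed_vector) \<Rightarrow> bool" where
  "smooth f \<longleftrightarrow> (\<forall>n. C_k n f)"

definition pd :: "3 \<Rightarrow> (real^3 \<Rightarrow> 'b::real_normed_vector) \<Rightarrow> real^3 \<Rightarrow> 'b" where
  "pd i f x = frechet_derivative f (at x) (axis i 1)"

definition grad :: "(real^3 \<Rightarrow> real) \<Rightarrow> real^3 \<Rightarrow> real^3" where
  "grad f x = (\<chi> i. pd i f x)"

text \<open>Row \<open>i\<close>, column \<open>j\<close> of the gradient of a vector field is $\partial_i \psi_j$.\<close>

definition vgrad :: "(real^3 \<Rightarrow> real^3) \<Rightarrow> real^3 \<Rightarrow> real^3^3" where
  "vgrad \<psi> x = (\<chi> i j. pd i \<psi> x $ j)"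

definition divergence :: "(real^3 \<Rightarrow> real^3) \<Rightarrow> real^3 \<Rightarrow> real" where
  "divergence \<psi> x = (\<Sum>i\<in>UNIV. pd i \<psi> x $ i)"

definition curl :: "(real^3 \<Rightarrow> real^3) \<Rightarrow> real^3 \<Rightarrow> real^3" where
  "curl \<psi> x = vector [pd 2 \<psi> x $ 3 - pd 3 \<psi> x $ 2,
                      pd 3 \<psi> x $ 1 - pd 1 \<psi> x $ 3,
                      pd 1 \<psi> x $ 2 - pd 2 \<psi> x $ 1]"

definition laplacian :: "(real^3 \<Rightarrow> real^3) \<Rightarrow> real^3 \<Rightarrow> real^3" where
  "laplacian \<psi> x = (\<Sum>i\<in>UNIV. pd i (pd i \<psi>) x)"

definition outer :: "real^3 \<Rightarrow> real^3 \<Rightarrow> real^3^3" where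
  "outer a b = (\<chi> i j. a $ i * b $ j)"

definition ddot :: "real^3^3 \<Rightarrow> real^3^3 \<Rightarrow> real" where
  "ddot M N = (\<Sum>i\<in>UNIV. \<Sum>j\<in>UNIV. M $ i $ j * N $ i $ j)"


subsection \<open>Weak solutions of ideal MHD\<close>

text \<open>Test functions are extended by zero to all times.\<close>

definition test_function :: "real \<Rightarrow> (real \<Rightarrow> real^3 \<Rightarrow> 'b::real_normed_vector) \<Rightarrow> bool" where
  "test_function T \<psi> \<longleftrightarrow> smooth (\<lambda>z. \<psi> (fst z) (snd z)) \<and> (\<forall>t. periodic (\<psi> t)) \<and>
     (\<exists>a b. 0 < a \<and> b < T \<and> (\<forall>t x. t \<notin> {a..b} \<longrightarrow> \<psi> t x = 0))"

definition div_free_test_function :: "real \<Rightarrow> (real \<Rightarrow> real^3 \<Rightarrow> real^3) \<Rightarrow> bool" where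
  "div_free_test_function T \<psi> \<longleftrightarrow> test_function T \<psi> \<and> (\<forall>t x. divergence (\<psi> t) x = 0)"

definition time_deriv :: "(real \<Rightarrow> real^3 \<Rightarrow> real^3) \<Rightarrow> real \<Rightarrow> real^3 \<Rightarrow> real^3" where
  "time_deriv \<psi> t x = vector_derivative (\<lambda>s. \<psi> s x) (at t)"

definition spacetime_field :: "real \<Rightarrow> (real \<Rightarrow> real^3 \<Rightarrow> real^3) \<Rightarrow> bool" where
  "spacetime_field T u \<longleftrightarrow> (\<forall>t\<in>{0<..<T}. periodic (u t)) \<and>
     (\<lambda>z. u (fst z) (snd z)) \<in> borel_measurable (lebesgue_on ({0<..<T} \<times> UNIV))"

definition Linf_L2 :: "real \<Rightarrow> (real \<Rightarrow> real^3 \<Rightarrow> real^3) \<Rightarrow> bool" where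
  "Linf_L2 T u \<longleftrightarrow> spacetime_field T u \<and>
     (\<exists>C. AE t in lebesgue_on {0<..<T}.
        torus_L2 (u t) \<and> torus_integral (\<lambda>x. (norm (u t x))\<^sup>2) \<le> C)"

definition spacetime_integral :: "real \<Rightarrow> (real \<Rightarrow> real^3 \<Rightarrow> real) \<Rightarrow> real" where
  "spacetime_integral T f = (LINT t:{0<..<T}|lebesgue. torus_integral (f t))"

definition weakly_div_free :: "real \<Rightarrow> (real \<Rightarrow> real^3 \<Rightarrow> real^3) \<Rightarrow> bool" where
  "weakly_div_free T u \<longleftrightarrow>
     (\<forall>\<phi>. test_function T \<phi> \<longrightarrow> spacetime_integral T (\<lambda>t x. u t x \<bullet> grad (\<phi> t) x) = 0)"

definition ideal_MHD_weak_solution ::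
  "real \<Rightarrow> (real \<Rightarrow> real^3 \<Rightarrow> real^3) \<Rightarrow> (real \<Rightarrow> real^3 \<Rightarrow> real^3) \<Rightarrow> bool" where
  "ideal_MHD_weak_solution T u B \<longleftrightarrow>
     Linf_L2 T u \<and> Linf_L2 T B \<and> weakly_div_free T u \<and> weakly_div_free T B \<and>
     (\<forall>\<psi>. div_free_test_function T \<psi> \<longrightarrow>
        spacetime_integral T (\<lambda>t x. u t x \<bullet> time_deriv \<psi> t x
          + ddot (outer (u t x) (u t x)) (vgrad (\<psi> t) x)
          - ddot (outer (B t x) (B t x)) (vgrad (\<psi> t) x)) = 0) \<and>
     (\<forall>\<psi>. div_free_test_function T \<psi> \<longrightarrow>
        spacetime_integral T (\<lambda>t x. B t x \<bullet> time_deriv \<psi> t x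
          + ddot (outer (u t x) (B t x)) (vgrad (\<psi> t) x)
          - ddot (outer (B t x) (u t x)) (vgrad (\<psi> t) x)) = 0)"

definition mean_free :: "(real^3 \<Rightarrow> real^3) \<Rightarrow> bool" where
  "mean_free f \<longleftrightarrow> torus_integral f = 0"


subsection \<open>The vector potential\<close>

text \<open>
  \<open>is_inv_neg_laplacian b \<Phi>\<close>: $\Phi = (-\Delta)^{-1} b$, the mean-free solution of
  $-\Delta\Phi = b$ in the sense of distributions on the torus. \<open>is_weak_curl \<Phi> A\<close>:
  $A = \nabla\times\Phi$ in the sense of distributions (the curl is its own formal adjoint).
  Both determine the second argument up to a null set.
\<close>

definition is_inv_neg_laplacian :: "(real^3 \<Rightarrow> real^3) \<Rightarrow> (real^3 \<Rightarrow> real^3) \<Rightarrow> bool" where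
  "is_inv_neg_laplacian b \<Phi> \<longleftrightarrow> torus_L2 \<Phi> \<and> mean_free \<Phi> \<and>
     (\<forall>\<psi>. smooth \<psi> \<and> periodic \<psi> \<longrightarrow>
        torus_integral (\<lambda>x. \<Phi> x \<bullet> (- laplacian \<psi> x)) = torus_integral (\<lambda>x. b x \<bullet> \<psi> x))"

definition is_weak_curl :: "(real^3 \<Rightarrow> real^3) \<Rightarrow> (real^3 \<Rightarrow> real^3) \<Rightarrow> bool" where
  "is_weak_curl \<Phi> A \<longleftrightarrow> torus_L2 A \<and>
     (\<forall>\<psi>. smooth \<psi> \<and> periodic \<psi> \<longrightarrow>
        torus_integral (\<lambda>x. A x \<bullet> \<psi> x) = torus_integral (\<lambda>x. \<Phi> x \<bullet> curl \<psi> x))"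

definition is_vector_potential :: "(real^3 \<Rightarrow> real^3) \<Rightarrow> (real^3 \<Rightarrow> real^3) \<Rightarrow> bool" where
  "is_vector_potential b A \<longleftrightarrow> (\<exists>\<Phi>. is_inv_neg_laplacian b \<Phi> \<and> is_weak_curl \<Phi> A)"


subsection \<open>Besov spaces\<close>

text \<open>
  A smooth radial cutoff \<open>X\<close> generates the dyadic partition of unity
  $1 = X(\xi) + \sum_{j\ge 0}\varphi(2^{-j}\xi)$ with $\varphi(\xi) = X(\xi/2) - X(\xi)$ supported in
  the annulus $3/4 \le |\xi| \le 8/3$. The Besov spaces do not depend on \<open>X\<close>, up to equivalence
  of norms.
\<close>

definition littlewood_paley_cutoff :: "(real^3 \<Rightarrow> real) \<Rightarrow> bool" where
  "littlewood_paley_cutoff X \<longleftrightarrow> smooth X \<and> (\<forall>\<xi> \<eta>. norm \<xi> = norm \<eta> \<longrightarrow> X \<xi> = X \<eta>) \<and>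
     (\<forall>\<xi>. 0 \<le> X \<xi> \<and> X \<xi> \<le> 1) \<and>
     (\<forall>\<xi>. norm \<xi> \<le> 3/4 \<longrightarrow> X \<xi> = 1) \<and> (\<forall>\<xi>. 4/3 \<le> norm \<xi> \<longrightarrow> X \<xi> = 0)"

text \<open>Index \<open>n\<close> stands for the dyadic level $j = n - 1 \ge -1$.\<close>

fun lp_multiplier :: "(real^3 \<Rightarrow> real) \<Rightarrow> nat \<Rightarrow> real^3 \<Rightarrow> real" where
  "lp_multiplier X 0 \<xi> = X \<xi>"
| "lp_multiplier X (Suc j) \<xi> = X ((1 / 2 ^ Suc j) *\<^sub>R \<xi>) - X ((1 / 2 ^ j) *\<^sub>R \<xi>)"

definition freq :: "int^3 \<Rightarrow> real^3" where
  "freq k = (\<chi> i. of_int (k $ i))"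

definition fourier_coeff :: "(real^3 \<Rightarrow> real) \<Rightarrow> int^3 \<Rightarrow> complex" where
  "fourier_coeff f k = torus_integral (\<lambda>x. complex_of_real (f x) * cis (- 2 * pi * (freq k \<bullet> x)))"

definition lp_block :: "(real^3 \<Rightarrow> real) \<Rightarrow> nat \<Rightarrow> (real^3 \<Rightarrow> real) \<Rightarrow> real^3 \<Rightarrow> complex" where
  "lp_block X n f x = (\<Sum>k | lp_multiplier X n (freq k) \<noteq> 0.
     complex_of_real (lp_multiplier X n (freq k)) * fourier_coeff f k * cis (2 * pi * (freq k \<bullet> x)))"

definition torus_Lp_norm :: "real \<Rightarrow> (real^3 \<Rightarrow> complex) \<Rightarrow> real" where
  "torus_Lp_norm p g = torus_integral (\<lambda>x. norm (g x) powr p) powr (1 / p)"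

text \<open>
  The norm of $B^s_{p,\infty}$, $1 \le p < \infty$, of an integrable periodic function; \<open>s\<close> may be
  negative. The blocks are trigonometric polynomials, so each of their norms is finite.
\<close>

definition besov_norm :: "(real^3 \<Rightarrow> real) \<Rightarrow> real \<Rightarrow> real \<Rightarrow> (real^3 \<Rightarrow> real) \<Rightarrow> ennreal" where
  "besov_norm X s p f =
     (SUP n. ennreal (2 powr (s * (real n - 1)) * torus_Lp_norm p (lp_block X n f)))"

text \<open>A vector field lies in $L^2((0,T);B^s_{p,\infty})$ iff each of its components does.\<close>

definition L2_besov ::
  "(real^3 \<Rightarrow> real) \<Rightarrow> real \<Rightarrow> real \<Rightarrow> real \<Rightarrow> (real \<Rightarrow> real^3 \<Rightarrow> real^3) \<Rightarrow> bool" where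
  "L2_besov X T s p u \<longleftrightarrow> spacetime_field T u \<and>
     (\<forall>i. (\<integral>\<^sup>+t\<in>{0<..<T}. (besov_norm X s p (\<lambda>x. u t x $ i))\<^sup>2 \<partial>lebesgue) < \<infinity>)"

end

theory Submission
  imports Defs "HOL-Analysis.Cross3"
begin

text \<open>
  Let \<open>J\<close> be the Jackson kernel of order \<open>N = 2^r\<close>, a nonnegative trigonometric polynomial, so that
  $J * J * B$ has finitely many Fourier modes. Testing the induction equation with products of a
  trigonometric field and a function of time, and applying the lemma of du Bois-Reymond, shows that
  almost everywhere each Fourier coefficient of $B$ is an indefinite integral in time of the
  coefficient of $\nabla \times (u \times B)$. Hence the mollified helicity $\int A \cdot (J * J * B)$ is the
  indefinite integral of $2 \int (u \times B) \cdot (J * J * B)$. As $(u \times b) \cdot b = 0$, this flux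
  equals $2 \int (J * (u \times B) - u \times (J * B)) \cdot (J * B)$, a commutator that gains increments of
  \<open>u\<close>. The increments are of order $2^{-\theta r}$ in $L^4$ for $\theta < \alpha_2$ while \<open>J * B\<close> grows like
  $2^{\alpha_1 r}$ up to a factor \<open>r\<close>, and the remaining factor \<open>B\<close> is bounded in $L^2$. Choosing $\theta$
  between $\alpha_1$ and $\alpha_2$, the flux tends to zero as $r \to \infty$.
\<close>

text \<open>The kernel is applied twice because one of the two convolutions has to be moved onto
  \<open>u \<times> B\<close>; only then does the pairing have the form in which the cancellation
  can be subtracted. A trigonometric kernel, rather than a compactly supported mollifier, turns each
  mollified helicity into a finite sum over modes, so that the null sets and product rules of single
  modes suffice. Besides positivity, the estimates need a first moment of order 1/N, which dictates
  the tent profile below.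

  A Besov norm with a supremum over dyadic levels is not summable at its own exponent. This explains
  both losses: with \<theta> < \<alpha>2 the levels of \<open>u\<close> form a convergent geometric
  series, while the levels of \<open>J * B\<close> are simply counted. In time, the product of the
  two Besov norms is integrable because each is square integrable.

  Divergence free test fields see only the part of a Fourier coefficient orthogonal to its
  frequency; the other part of the coefficient of \<open>B\<close> vanishes for almost every time
  because \<open>B\<close> is weakly divergence free.\<close>

section \<open>The torus as a Borel probability measure, and its translation invariance\<close>

definition unit_cell :: "(real^3) set" where
  "unit_cell = {x. \<forall>i. 0 \<le> x $ i \<and> x $ i < 1}"

text \<open>The half-open cell makes integer translates disjoint, and the Borel sigma-algebra allows
  Fubini on products. The difference from Lebesgue measure on the closed cube is a null set.\<close>

definition torus :: "(real^3) measure" where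
  "torus = density lborel (indicator unit_cell)"

text \<open>The projection onto the fundamental cell. Composing with it makes any function exactly
  periodic without changing it on the cell.\<close>

definition frac3 :: "real^3 \<Rightarrow> real^3" where
  "frac3 x = (\<chi> i. frac (x $ i))"

lemma borel_measurable_vec_nth [measurable]: "(\<lambda>x::real^3. x $ i) \<in> borel_measurable borel"
  by (intro borel_measurable_continuous_onI continuous_intros)

lemma borel_measurable_vec_lambda [measurable (raw)]:
  fixes f :: "3 \<Rightarrow> 'a \<Rightarrow> real"
  assumes "\<And>i. f i \<in> borel_measurable M"
  shows "(\<lambda>x. (\<chi> i. f i x) :: real^3) \<in> borel_measurable M"
proof (rule borel_measurableI)
  have "(\<lambda>x. (\<chi> i. f i x) :: real^3) = (\<lambda>x. \<Sum>i\<in>UNIV. f i x *\<^sub>R axis i 1)"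
    by (rule ext) (simp add: vec_eq_iff axis_def if_distrib cong: if_cong)
  moreover have "(\<lambda>x. \<Sum>i\<in>UNIV. f i x *\<^sub>R axis i (1::real) :: real^3) \<in> borel_measurable M"
    using assms by (intro borel_measurable_sum borel_measurable_scaleR) auto
  ultimately show "\<And>S. open S \<Longrightarrow> (\<lambda>x. (\<chi> i. f i x) :: real^3) -` S \<inter> space M \<in> sets M"
    by (simp add: measurable_sets)
qed

lemma unit_cell_sets [measurable]: "unit_cell \<in> sets borel"
  unfolding unit_cell_def by measurable

lemma frac_borel_measurable [measurable]: "(frac :: real \<Rightarrow> real) \<in> borel_measurable borel"
  unfolding frac_def by measurable

lemma frac3_measurable [measurable]: "frac3 \<in> borel_measurable borel"
  unfolding frac3_def by measurable

lemma sets_torus [simp, measurable_cong]: "sets torus = sets borel"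
  and space_torus [simp]: "space torus = UNIV"
  by (simp_all add: torus_def)

lemma frac3_in_unit_cell: "frac3 x \<in> unit_cell"
  by (simp add: frac3_def unit_cell_def frac_lt_1)

lemma frac3_unit_cell: "x \<in> unit_cell \<Longrightarrow> frac3 x = x"
  by (simp add: frac3_def unit_cell_def frac_eq vec_eq_iff)

lemma AE_lborel_component_neq: "AE x in lborel. (x::real^3) $ i \<noteq> c"
proof -
  have "negligible {x::real^3. axis i 1 \<bullet> x = c}"
    by (rule negligible_hyperplane) (simp add: axis_eq_0_iff)
  then have "AE x in lebesgue. (x::real^3) $ i \<noteq> c"
    by (auto simp: negligible_iff_null_sets inner_axis' dest: AE_not_in)
  then show ?thesis by (simp add: AE_completion_iff)
qed

lemma unit_cell_AE_cbox: "AE x in lborel. x \<in> unit_cell \<longleftrightarrow> x \<in> cbox (0::real^3) 1"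
proof -
  have "AE x in lborel. \<forall>i. (x::real^3) $ i \<noteq> 1"
    using AE_lborel_component_neq by (simp add: AE_all_countable)
  then show ?thesis
    by eventually_elim (auto simp: unit_cell_def mem_box_cart less_le)
qed

lemma nn_integral_torus:
  "f \<in> borel_measurable borel \<Longrightarrow> nn_integral torus f = (\<integral>\<^sup>+x. f x * indicator unit_cell x \<partial>lborel)"
  unfolding torus_def by (subst nn_integral_density) (auto simp: mult.commute)

lemma emeasure_torus: "A \<in> sets borel \<Longrightarrow> emeasure torus A = emeasure lborel (A \<inter> unit_cell)"
  unfolding torus_def by (subst emeasure_density) (auto simp flip: indicator_inter_arith simp: Int_commute)

lemma emeasure_torus_UNIV [simp]: "emeasure torus UNIV = 1"
proof -
  have "emeasure torus UNIV = emeasure lborel unit_cell"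
    by (simp add: emeasure_torus)
  also have "\<dots> = emeasure lborel (cbox (0::real^3) 1)"
    by (rule emeasure_eq_AE) (use unit_cell_AE_cbox in auto)
  also have "\<dots> = 1"
    by (subst emeasure_lborel_cbox) (auto simp: Basis_vec_def inner_axis intro!: prod.neutral)
  finally show ?thesis .
qed

interpretation torus: finite_measure torus
  by standard simp

interpretation torus2: pair_sigma_finite torus torus ..

lemma measure_torus_UNIV [simp]: "measure torus UNIV = 1"
  by (simp add: measure_def)

lemma AE_torus_iff: "(AE x in torus. P x) \<longleftrightarrow> (AE x in lborel. x \<in> unit_cell \<longrightarrow> P x)"
  unfolding torus_def by (subst AE_density) auto

lemma AE_torus_unit_cell: "AE x in torus. x \<in> unit_cell"
  by (simp add: AE_torus_iff)

lemma periodic_of_int: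
  assumes "periodic f" shows "f (x + axis i (of_int n)) = f x"
proof -
  have nat: "f (x + axis i (real m)) = f x" for x m
  proof (induction m arbitrary: x)
    case 0 then show ?case by (simp add: axis_def zero_vec_def[symmetric])
  next
    case (Suc m)
    have "x + axis i (real (Suc m)) = (x + axis i (real m)) + axis i 1"
      by (simp add: vec_eq_iff axis_def)
    with Suc assms show ?case unfolding periodic_def by metis
  qed
  show ?thesis
  proof (cases "n \<ge> 0")
    case True then show ?thesis using nat[of x "nat n"] by simp
  next
    case False
    have "f ((x + axis i (of_int n)) + axis i (real (nat (-n)))) = f (x + axis i (of_int n))"
      by (rule nat)
    moreover have "(x + axis i (of_int n)) + axis i (real (nat (-n))) = x"
      using False by (simp add: vec_eq_iff axis_def)
    ultimately show ?thesis by simp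
  qed
qed

lemma vec3_sum_axis: "(y::real^3) = axis 1 (y$1) + axis 2 (y$2) + axis 3 (y$3)"
  by (simp add: vec_eq_iff axis_def forall_3)

lemma periodic_frac3: assumes "periodic f" shows "f (frac3 x) = f x"
proof -
  define n where "n i = \<lfloor>x $ i\<rfloor>" for i
  have "x = frac3 x + axis 1 (of_int (n 1)) + axis 2 (of_int (n 2)) + axis 3 (of_int (n 3))"
    by (simp add: vec_eq_iff axis_def forall_3 frac3_def frac_def n_def)
  then have "f x = f (frac3 x + axis 1 (of_int (n 1)) + axis 2 (of_int (n 2)) + axis 3 (of_int (n 3)))"
    by simp
  also have "\<dots> = f (frac3 x)" by (simp only: periodic_of_int[OF assms])
  finally show ?thesis ..
qed

lemma frac3_periodic: "periodic frac3"
proof -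
  have "frac (x + (if a = b then 1 else 0)) = frac (x::real)" for x and a b :: 3
    using frac_1_eq[of x] by simp
  then show ?thesis by (simp add: periodic_def frac3_def vec_eq_iff axis_def)
qed

lemma periodic_comp_frac3: "periodic (\<lambda>x. f (frac3 x))"
  using frac3_periodic by (simp add: periodic_def)

lemma periodic_translate: "periodic f \<Longrightarrow> periodic (\<lambda>x. f (x + y))"
  unfolding periodic_def by (metis add.assoc add.commute)

text \<open>Shifting the cell in one direction moves a slab out of it, and periodicity moves that slab
  back in.\<close>

lemma nn_integral_torus_translate_axis:
  assumes f [measurable]: "f \<in> borel_measurable borel" and p: "periodic f" and s: "0 \<le> s" "s < 1"
  shows "(\<integral>\<^sup>+x. f (x + axis i s) \<partial>torus) = nn_integral torus f"
proof -
  define I where "I a b = {x::real^3. a \<le> x $ i \<and> x $ i < b \<and> (\<forall>j. j \<noteq> i \<longrightarrow> 0 \<le> x $ j \<and> x $ j < 1)}" for a b :: real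
  have I [measurable]: "I a b \<in> sets borel" for a b unfolding I_def by measurable
  have cell: "unit_cell = I 0 1" unfolding I_def unit_cell_def by (intro set_eqI) auto
  have tr: "(\<integral>\<^sup>+x. f x * indicator (I a b) x \<partial>lborel) = (\<integral>\<^sup>+x. f (axis i c + x) * indicator (I (a-c) (b-c)) x \<partial>lborel)" for a b c
  proof -
    have "(\<integral>\<^sup>+x. f x * indicator (I a b) x \<partial>lborel) = (\<integral>\<^sup>+x. f x * indicator (I a b) x \<partial>distr lborel borel ((+) (axis i c)))"
      by (simp add: lborel_distr_plus)
    also have "\<dots> = (\<integral>\<^sup>+x. f (axis i c + x) * indicator (I a b) (axis i c + x) \<partial>lborel)"
      by (subst nn_integral_distr) auto
    also have "\<dots> = (\<integral>\<^sup>+x. f (axis i c + x) * indicator (I (a-c) (b-c)) x \<partial>lborel)"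
      by (intro nn_integral_cong) (auto simp: indicator_def I_def axis_def)
    finally show ?thesis .
  qed
  have "(\<integral>\<^sup>+x. f (x + axis i s) \<partial>torus) = (\<integral>\<^sup>+x. f x * indicator (I s (1+s)) x \<partial>lborel)"
    by (subst nn_integral_torus) (auto simp: cell tr[of s "1+s" s] add.commute)
  also have "\<dots> = (\<integral>\<^sup>+x. f x * indicator (I s 1) x + f x * indicator (I 1 (1+s)) x \<partial>lborel)"
    using s by (intro nn_integral_cong) (auto simp: indicator_def I_def)
  also have "\<dots> = (\<integral>\<^sup>+x. f x * indicator (I s 1) x \<partial>lborel) + (\<integral>\<^sup>+x. f x * indicator (I 1 (1+s)) x \<partial>lborel)"
    by (subst nn_integral_add) auto
  also have "(\<integral>\<^sup>+x. f x * indicator (I 1 (1+s)) x \<partial>lborel) = (\<integral>\<^sup>+x. f x * indicator (I 0 s) x \<partial>lborel)"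
    using p by (subst tr[of _ _ 1]) (simp add: periodic_def add.commute)
  also have "(\<integral>\<^sup>+x. f x * indicator (I s 1) x \<partial>lborel) + (\<integral>\<^sup>+x. f x * indicator (I 0 s) x \<partial>lborel) =
      (\<integral>\<^sup>+x. f x * indicator (I s 1) x + f x * indicator (I 0 s) x \<partial>lborel)"
    by (subst nn_integral_add) auto
  also have "\<dots> = (\<integral>\<^sup>+x. f x * indicator (I 0 1) x \<partial>lborel)"
    using s by (intro nn_integral_cong) (auto simp: indicator_def I_def)
  also have "\<dots> = nn_integral torus f"
    by (subst nn_integral_torus) (auto simp: cell)
  finally show ?thesis .
qed

text \<open>A shift splits into three axis shifts, and periodicity replaces the length of each by
  its fractional part, to which the slab argument applies.\<close>

lemma nn_integral_torus_translate:
  assumes f [measurable]: "f \<in> borel_measurable borel" and p: "periodic f"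
  shows "(\<integral>\<^sup>+x. f (x + y) \<partial>torus) = nn_integral torus f"
proof -
  have one: "(\<integral>\<^sup>+x. g (x + axis i s) \<partial>torus) = nn_integral torus g"
    if [measurable]: "g \<in> borel_measurable borel" and g: "periodic g" for g :: "real^3 \<Rightarrow> ennreal" and i s
  proof -
    have "g (x + axis i s) = g (x + axis i (frac s))" for x
    proof -
      have "x + axis i s = (x + axis i (frac s)) + axis i (of_int \<lfloor>s\<rfloor>)"
        by (simp add: vec_eq_iff axis_def frac_def)
      then show ?thesis by (metis periodic_of_int[OF g])
    qed
    then show ?thesis
      using nn_integral_torus_translate_axis[OF that, of "frac s" i] by (simp add: frac_lt_1)
  qed
  have "(\<integral>\<^sup>+x. f (x + y) \<partial>torus) = (\<integral>\<^sup>+x. f (((x + axis 1 (y$1)) + axis 2 (y$2)) + axis 3 (y$3)) \<partial>torus)"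
    by (subst vec3_sum_axis[of y]) (simp add: add.assoc)
  also have "\<dots> = (\<integral>\<^sup>+x. f ((x + axis 2 (y$2)) + axis 3 (y$3)) \<partial>torus)"
    by (rule one[where g="\<lambda>x. f ((x + axis 2 (y$2)) + axis 3 (y$3))"])
       (auto intro!: periodic_translate[where f="\<lambda>x. f (x + axis 3 (y$3))"] periodic_translate p)
  also have "\<dots> = (\<integral>\<^sup>+x. f (x + axis 3 (y$3)) \<partial>torus)"
    by (rule one[where g="\<lambda>x. f (x + axis 3 (y$3))"]) (auto intro!: periodic_translate p)
  also have "\<dots> = nn_integral torus f" by (rule one) (auto simp: p)
  finally show ?thesis .
qed

text \<open>As an identity of measures, invariance passes to Bochner integrals and to integrability
  in any Banach space.\<close>

lemma distr_torus_translate: "distr torus borel (\<lambda>x. frac3 (x + y)) = torus"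
proof (rule measure_eqI)
  fix A assume "A \<in> sets (distr torus borel (\<lambda>x. frac3 (x + y)))"
  then have A [measurable]: "A \<in> sets borel" by simp
  have "emeasure (distr torus borel (\<lambda>x. frac3 (x + y))) A = (\<integral>\<^sup>+x. indicator A (frac3 (x + y)) \<partial>torus)"
    by (subst nn_integral_indicator[symmetric], simp, subst nn_integral_distr) auto
  also have "\<dots> = (\<integral>\<^sup>+x. indicator A (frac3 x) \<partial>torus)"
    by (rule nn_integral_torus_translate[where f="\<lambda>x. indicator A (frac3 x)"]) (auto intro: periodic_comp_frac3)
  also have "\<dots> = (\<integral>\<^sup>+x. indicator A x \<partial>torus)"
    using AE_torus_unit_cell by (intro nn_integral_cong_AE) (auto simp: frac3_unit_cell)
  also have "\<dots> = emeasure torus A" by (subst nn_integral_indicator) auto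
  finally show "emeasure (distr torus borel (\<lambda>x. frac3 (x + y))) A = emeasure torus A" .
qed simp

lemma
  fixes f :: "real^3 \<Rightarrow> 'b::{banach, second_countable_topology}"
  assumes f [measurable]: "f \<in> borel_measurable borel" and p: "periodic f"
  shows integral_torus_translate: "(\<integral>x. f (x + y) \<partial>torus) = integral\<^sup>L torus f"
    and integrable_torus_translate: "integrable torus (\<lambda>x. f (x + y)) \<longleftrightarrow> integrable torus f"
proof -
  have "(\<integral>x. f (x + y) \<partial>torus) = (\<integral>x. f (frac3 (x + y)) \<partial>torus)"
    by (simp add: periodic_frac3[OF p])
  also have "\<dots> = (\<integral>x. f x \<partial>distr torus borel (\<lambda>x. frac3 (x + y)))"
    by (subst integral_distr) auto
  finally show "(\<integral>x. f (x + y) \<partial>torus) = integral\<^sup>L torus f" by (simp add: distr_torus_translate)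
  have "integrable torus (\<lambda>x. f (x + y)) \<longleftrightarrow> integrable torus (\<lambda>x. f (frac3 (x + y)))"
    by (simp add: periodic_frac3[OF p])
  also have "\<dots> \<longleftrightarrow> integrable (distr torus borel (\<lambda>x. frac3 (x + y))) f"
    by (subst integrable_distr_eq) auto
  finally show "integrable torus (\<lambda>x. f (x + y)) \<longleftrightarrow> integrable torus f" by (simp add: distr_torus_translate)
qed

subsection \<open>Characters\<close>

definition ch :: "int^3 \<Rightarrow> real^3 \<Rightarrow> complex" where
  "ch k x = cis (2 * pi * (freq k \<bullet> x))"

lemma cnj_measurable [measurable]: "cnj \<in> borel_measurable borel"
  by (intro borel_measurable_continuous_onI continuous_intros)

lemma ch_measurable [measurable]: "ch k \<in> borel_measurable borel"
  unfolding ch_def cis_conv_exp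
  by (intro borel_measurable_continuous_onI continuous_intros)

lemma norm_ch [simp]: "norm (ch k x) = 1"
  by (simp add: ch_def)

lemma freq_simps [simp]: "freq 0 = 0" "freq (k + l) = freq k + freq l" "freq (- k) = - freq k"
    "freq (k - l) = freq k - freq l"
  by (simp_all add: freq_def vec_eq_iff)

lemma ch_zero_freq [simp]: "ch 0 x = 1"
  by (simp add: ch_def)

lemma ch_add_freq: "ch (k + l) x = ch k x * ch l x"
  by (simp add: ch_def cis_mult inner_add_left algebra_simps)

lemma ch_add: "ch k (x + y) = ch k x * ch k y"
  by (simp add: ch_def cis_mult inner_add_right algebra_simps)

lemma ch_uminus_freq: "ch (- k) x = cnj (ch k x)"
  by (simp add: ch_def cis_cnj)

lemma ch_diff_freq: "ch (k - l) x = ch k x * cnj (ch l x)"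
  using ch_add_freq[of k "-l" x] by (simp add: ch_uminus_freq)

lemma inner_freq_axis: "freq k \<bullet> axis i s = s * of_int (k $ i)"
  by (simp add: inner_axis freq_def)

lemma periodic_ch: "periodic (ch k)"
proof -
  have "ch k (axis i 1) = 1" for i
    using cis_multiple_2pi[of "of_int (k $ i)"] by (simp add: ch_def inner_freq_axis)
  then show ?thesis by (simp add: periodic_def ch_add)
qed

lemma integrable_torus_bounded:
  fixes f :: "real^3 \<Rightarrow> 'b::{banach, second_countable_topology}"
  assumes "f \<in> borel_measurable borel" "\<And>x. norm (f x) \<le> C"
  shows "integrable torus f"
  using assms by (intro torus.integrable_const_bound[where B=C]) auto

lemma integrable_ch [simp]: "integrable torus (ch k)"
  by (rule integrable_torus_bounded[where C=1]) auto

lemma integral_ch: "(\<integral>x. ch k x \<partial>torus) = (if k = 0 then 1 else 0)"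
proof (cases "k = 0")
  case False
  then obtain i where i: "k $ i \<noteq> 0" by (auto simp: vec_eq_iff)
  \<comment> \<open>Half a period of \<open>ch k\<close>: this shift changes its sign, so its
    integral equals its own negative.\<close>
  define y where "y = axis i (1 / (2 * of_int (k $ i)) :: real)"
  have "freq k \<bullet> y = 1/2" using i by (simp add: y_def inner_freq_axis)
  then have "2 * pi * (freq k \<bullet> y) = pi" by simp
  then have y: "ch k y = -1" unfolding ch_def by (simp only: cis_pi)
  have "(\<integral>x. ch k x \<partial>torus) = (\<integral>x. ch k (x + y) \<partial>torus)"
    by (rule integral_torus_translate[symmetric]) (auto intro: periodic_ch)
  also have "\<dots> = - (\<integral>x. ch k x \<partial>torus)" by (simp add: ch_add y)
  finally show ?thesis using False by simp
qed (simp add: one_neq_zero)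

lemma integral_ch_cnj: "(\<integral>x. ch k x * cnj (ch l x) \<partial>torus) = (if k = l then 1 else 0)"
  using integral_ch[of "k - l"] by (simp add: ch_diff_freq)

lemma finite_Parseval:
  fixes c :: "int^3 \<Rightarrow> complex"
  assumes "finite K"
  shows "(\<integral>x. (norm (\<Sum>k\<in>K. c k * ch k x))\<^sup>2 \<partial>torus) = (\<Sum>k\<in>K. (norm (c k))\<^sup>2)"
proof -
  have int: "integrable torus (\<lambda>x. a * (ch k x * cnj (ch l x)))" for a k l
    by (rule integrable_torus_bounded[where C="norm a"]) (auto simp: norm_mult)
  have "complex_of_real (\<integral>x. (norm (\<Sum>k\<in>K. c k * ch k x))\<^sup>2 \<partial>torus) =
     (\<integral>x. (\<Sum>k\<in>K. \<Sum>l\<in>K. (c k * cnj (c l)) * (ch k x * cnj (ch l x))) \<partial>torus)"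
    unfolding integral_complex_of_real[symmetric] complex_norm_square cnj_sum sum_product complex_cnj_mult
    by (simp add: algebra_simps)
  also have "\<dots> = (\<Sum>k\<in>K. \<Sum>l\<in>K. (c k * cnj (c l)) * (if k = l then 1 else 0))"
    by (simp add: Bochner_Integration.integral_sum Bochner_Integration.integrable_sum int integral_ch_cnj)
  also have "\<dots> = (\<Sum>k\<in>K. c k * cnj (c k))"
    using assms by (simp add: if_distrib sum.delta cong: if_cong)
  also have "\<dots> = complex_of_real (\<Sum>k\<in>K. (norm (c k))\<^sup>2)"
    by (simp only: complex_norm_square of_real_sum)
  finally show ?thesis by (simp only: of_real_eq_iff)
qed

subsection \<open>Lebesgue norms on the torus\<close>

lemma ennreal_power_le_cancel:
  assumes "x ^ n \<le> ennreal (c ^ n)" "0 \<le> c" "0 < n"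
  shows "x \<le> ennreal c"
proof (cases x)
  case (real r)
  with assms show ?thesis
    by (simp add: ennreal_power power_mono_iff)
next
  case top
  with assms show ?thesis by (simp add: top_power_ennreal top_unique)
qed

lemma nn_integral_Cauchy_Schwarz_bound:
  assumes [measurable]: "f \<in> borel_measurable M" "g \<in> borel_measurable M"
    and "(\<integral>\<^sup>+x. f x ^ 2 \<partial>M) \<le> ennreal (a\<^sup>2)" "(\<integral>\<^sup>+x. g x ^ 2 \<partial>M) \<le> ennreal (b\<^sup>2)"
    and "0 \<le> a" "0 \<le> b"
  shows "(\<integral>\<^sup>+x. f x * g x \<partial>M) \<le> ennreal (a * b)"
proof -
  have "(\<integral>\<^sup>+x. f x * g x \<partial>M)\<^sup>2 \<le> (\<integral>\<^sup>+x. f x ^ 2 \<partial>M) * (\<integral>\<^sup>+x. g x ^ 2 \<partial>M)"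
    by (rule Cauchy_Schwarz_nn_integral) auto
  also have "\<dots> \<le> ennreal (a\<^sup>2) * ennreal (b\<^sup>2)" by (intro mult_mono assms) auto
  also have "\<dots> = ennreal ((a * b)\<^sup>2)"
    unfolding power_mult_distrib by (rule ennreal_mult[symmetric]) auto
  finally show ?thesis by (rule ennreal_power_le_cancel) (use assms in auto)
qed

text \<open>As 1/4 + 1/2 + 1/4 = 1, two uses of Cauchy-Schwarz suffice. The exponents are those of
  the flux: increments of \<open>u\<close> and the mollified \<open>B\<close> in L4, the unmollified
  \<open>B\<close> in L2.\<close>

lemma nn_integral_Holder_424_bound:
  assumes [measurable]: "f \<in> borel_measurable M" "g \<in> borel_measurable M" "h \<in> borel_measurable M"
    and "(\<integral>\<^sup>+x. f x ^ 4 \<partial>M) \<le> ennreal (a ^ 4)" "(\<integral>\<^sup>+x. g x ^ 2 \<partial>M) \<le> ennreal (b\<^sup>2)"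
        "(\<integral>\<^sup>+x. h x ^ 4 \<partial>M) \<le> ennreal (c ^ 4)"
    and "0 \<le> a" "0 \<le> b" "0 \<le> c"
  shows "(\<integral>\<^sup>+x. f x * g x * h x \<partial>M) \<le> ennreal (a * b * c)"
proof -
  have "(\<integral>\<^sup>+x. (f x)\<^sup>2 * (h x)\<^sup>2 \<partial>M) \<le> ennreal (a\<^sup>2 * c\<^sup>2)"
    by (rule nn_integral_Cauchy_Schwarz_bound) (use assms in auto)
  then have "(\<integral>\<^sup>+x. (f x * h x)\<^sup>2 \<partial>M) \<le> ennreal ((a * c)\<^sup>2)"
    by (simp add: power_mult_distrib)
  then have "(\<integral>\<^sup>+x. (f x * h x) * g x \<partial>M) \<le> ennreal ((a * c) * b)"
    by (intro nn_integral_Cauchy_Schwarz_bound) (use assms in auto)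
  then show ?thesis by (simp add: ac_simps)
qed

text \<open>Cauchy-Schwarz for the measure with density \<open>w\<close>, obtained by splitting
  \<open>w\<close> into two square roots.\<close>

lemma nn_integral_weighted_Cauchy_Schwarz:
  assumes [measurable]: "w \<in> borel_measurable M" "h \<in> borel_measurable M" and w: "\<And>x. 0 \<le> w x"
  shows "(\<integral>\<^sup>+x. ennreal (w x) * h x \<partial>M)\<^sup>2 \<le> (\<integral>\<^sup>+x. ennreal (w x) \<partial>M) * (\<integral>\<^sup>+x. ennreal (w x) * h x ^ 2 \<partial>M)"
proof -
  have sq: "ennreal (sqrt (w x)) * ennreal (sqrt (w x)) = ennreal (w x)" for x
    using w[of x] by (simp flip: ennreal_mult)
  have "(\<integral>\<^sup>+x. ennreal (sqrt (w x)) * (ennreal (sqrt (w x)) * h x) \<partial>M)\<^sup>2 \<le>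
     (\<integral>\<^sup>+x. ennreal (sqrt (w x)) ^ 2 \<partial>M) * (\<integral>\<^sup>+x. (ennreal (sqrt (w x)) * h x) ^ 2 \<partial>M)"
    by (rule Cauchy_Schwarz_nn_integral) auto
  moreover have "ennreal (sqrt (w x)) * (ennreal (sqrt (w x)) * h x) = ennreal (w x) * h x"
      "ennreal (sqrt (w x)) ^ 2 = ennreal (w x)" for x
    by (simp_all add: mult.assoc[symmetric] power2_eq_square sq)
  ultimately show ?thesis by (simp only: power_mult_distrib)
qed

lemma nn_integral_torus_convolution:
  assumes [measurable]: "w \<in> borel_measurable borel" "h \<in> borel_measurable borel" and p: "periodic h"
  shows "(\<integral>\<^sup>+x. (\<integral>\<^sup>+z. w z * h (x + z) \<partial>torus) \<partial>torus) = nn_integral torus w * nn_integral torus (h :: _ \<Rightarrow> ennreal)"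
proof -
  have "(\<integral>\<^sup>+x. (\<integral>\<^sup>+z. w z * h (x + z) \<partial>torus) \<partial>torus) = (\<integral>\<^sup>+z. (\<integral>\<^sup>+x. w z * h (x + z) \<partial>torus) \<partial>torus)"
    by (rule torus2.Fubini') measurable
  also have "\<dots> = (\<integral>\<^sup>+z. w z * nn_integral torus h \<partial>torus)"
    by (intro nn_integral_cong) (simp add: nn_integral_cmult nn_integral_torus_translate p)
  also have "\<dots> = nn_integral torus w * nn_integral torus h"
    by (rule nn_integral_multc) simp
  finally show ?thesis .
qed

lemma periodic_power: "periodic h \<Longrightarrow> periodic (\<lambda>x. h x ^ n)"
  by (simp add: periodic_def)

lemma Young_2:
  assumes [measurable]: "w \<in> borel_measurable borel" "h \<in> borel_measurable borel" and p: "periodic h"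
    and w: "\<And>x. 0 \<le> w x"
  shows "(\<integral>\<^sup>+x. (\<integral>\<^sup>+z. ennreal (w z) * h (x + z) \<partial>torus)\<^sup>2 \<partial>torus) \<le> (\<integral>\<^sup>+x. ennreal (w x) \<partial>torus)\<^sup>2 * (\<integral>\<^sup>+x. h x ^ 2 \<partial>torus)"
proof -
  define W where "W = (\<integral>\<^sup>+x. ennreal (w x) \<partial>torus)"
  have "(\<integral>\<^sup>+x. (\<integral>\<^sup>+z. ennreal (w z) * h (x + z) \<partial>torus)\<^sup>2 \<partial>torus) \<le>
     (\<integral>\<^sup>+x. W * (\<integral>\<^sup>+z. ennreal (w z) * h (x + z) ^ 2 \<partial>torus) \<partial>torus)"
    unfolding W_def by (intro nn_integral_mono nn_integral_weighted_Cauchy_Schwarz w) auto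
  also have "\<dots> = W * (W * (\<integral>\<^sup>+x. h x ^ 2 \<partial>torus))"
    by (subst nn_integral_cmult, measurable, subst nn_integral_torus_convolution)
       (auto simp: W_def periodic_power p)
  finally show ?thesis by (simp add: W_def power2_eq_square mult.assoc)
qed

text \<open>Since 4 is a square of 2, one weighted Cauchy-Schwarz reduces the exponent 4 to
  \<open>Young_2\<close> for the square of \<open>h\<close>.\<close>

lemma Young_4:
  assumes [measurable]: "w \<in> borel_measurable borel" "h \<in> borel_measurable borel" and p: "periodic h"
    and w: "\<And>x. 0 \<le> w x"
  shows "(\<integral>\<^sup>+x. (\<integral>\<^sup>+z. ennreal (w z) * h (x + z) \<partial>torus) ^ 4 \<partial>torus) \<le> (\<integral>\<^sup>+x. ennreal (w x) \<partial>torus) ^ 4 * (\<integral>\<^sup>+x. h x ^ 4 \<partial>torus)"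
proof -
  define W where "W = (\<integral>\<^sup>+x. ennreal (w x) \<partial>torus)"
  have "(\<integral>\<^sup>+z. ennreal (w z) * h (x + z) \<partial>torus) ^ 4 \<le> W\<^sup>2 * (\<integral>\<^sup>+z. ennreal (w z) * h (x + z) ^ 2 \<partial>torus)\<^sup>2" for x
  proof -
    have "(\<integral>\<^sup>+z. ennreal (w z) * h (x + z) \<partial>torus) ^ 4 = ((\<integral>\<^sup>+z. ennreal (w z) * h (x + z) \<partial>torus)\<^sup>2)\<^sup>2"
      by (simp flip: power_mult)
    also have "\<dots> \<le> (W * (\<integral>\<^sup>+z. ennreal (w z) * h (x + z) ^ 2 \<partial>torus))\<^sup>2"
      unfolding W_def by (intro power_mono nn_integral_weighted_Cauchy_Schwarz w) auto
    finally show ?thesis by (simp add: power_mult_distrib)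
  qed
  then have "(\<integral>\<^sup>+x. (\<integral>\<^sup>+z. ennreal (w z) * h (x + z) \<partial>torus) ^ 4 \<partial>torus) \<le>
     (\<integral>\<^sup>+x. W\<^sup>2 * (\<integral>\<^sup>+z. ennreal (w z) * h (x + z) ^ 2 \<partial>torus)\<^sup>2 \<partial>torus)"
    by (intro nn_integral_mono)
  also have "\<dots> = W\<^sup>2 * (\<integral>\<^sup>+x. (\<integral>\<^sup>+z. ennreal (w z) * h (x + z) ^ 2 \<partial>torus)\<^sup>2 \<partial>torus)"
    by (rule nn_integral_cmult) measurable
  also have "\<dots> \<le> W\<^sup>2 * (W\<^sup>2 * (\<integral>\<^sup>+x. (h x ^ 2)\<^sup>2 \<partial>torus))"
    unfolding W_def by (intro mult_left_mono Young_2[where h="\<lambda>x. h x ^ 2"] w) (auto intro: periodic_power p)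
  finally show ?thesis by (simp add: W_def power_mult[symmetric] mult.assoc[symmetric] power_add[symmetric])
qed

lemma ennreal_norm_integral_le:
  fixes f :: "'a \<Rightarrow> 'b::{banach, second_countable_topology}"
  shows "ennreal (norm (integral\<^sup>L M f)) \<le> (\<integral>\<^sup>+x. ennreal (norm (f x)) \<partial>M)"
  by (cases "integrable M f") (auto simp: integral_norm_bound_ennreal not_integrable_integral_eq)

text \<open>A bound on the L4 norm that needs no integrability in advance. The sign of
  \<open>a\<close> is lost in the fourth power, so \<open>0 \<le> a\<close> is carried
  separately.\<close>

definition L4_le :: "(real^3 \<Rightarrow> complex) \<Rightarrow> real \<Rightarrow> bool" where
  "L4_le f a \<longleftrightarrow> (\<integral>\<^sup>+x. ennreal (norm (f x)) ^ 4 \<partial>torus) \<le> ennreal (a ^ 4)"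

lemma L4_le_convolution:
  assumes [measurable]: "V \<in> borel_measurable borel" "f \<in> borel_measurable borel" and p: "periodic f"
    and V: "(\<integral>\<^sup>+z. ennreal (norm (V z)) \<partial>torus) \<le> ennreal c" "0 \<le> c"
    and f: "L4_le f a" and a: "0 \<le> a"
  shows "L4_le (\<lambda>x. \<integral>z. V z * f (x + z) \<partial>torus) (c * a)"
proof -
  have "(\<integral>\<^sup>+x. ennreal (norm (\<integral>z. V z * f (x + z) \<partial>torus)) ^ 4 \<partial>torus) \<le>
    (\<integral>\<^sup>+x. (\<integral>\<^sup>+z. ennreal (norm (V z)) * ennreal (norm (f (x + z))) \<partial>torus) ^ 4 \<partial>torus)"
    using ennreal_norm_integral_le[of torus "\<lambda>z. V z * f (_ + z)"]
    by (intro nn_integral_mono power_mono) (auto simp: norm_mult ennreal_mult)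
  also have "\<dots> \<le> (\<integral>\<^sup>+x. ennreal (norm (V x)) \<partial>torus) ^ 4 * (\<integral>\<^sup>+x. ennreal (norm (f x)) ^ 4 \<partial>torus)"
    using p by (intro Young_4[where h="\<lambda>x. ennreal (norm (f x))"]) (auto simp: periodic_def)
  also have "\<dots> \<le> ennreal c ^ 4 * ennreal (a ^ 4)"
    using f by (intro mult_mono power_mono V) (auto simp: L4_le_def)
  also have "\<dots> = ennreal ((c * a) ^ 4)"
    using V(2) a by (simp add: ennreal_power ennreal_mult power_mult_distrib)
  finally show ?thesis by (simp add: L4_le_def)
qed

subsection \<open>The translation form of Bernstein's inequality\<close>

definition cube :: "nat \<Rightarrow> (int^3) set" where
  "cube R = {k. \<forall>i. \<bar>k $ i\<bar> \<le> int R}"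

lemma bij_betw_cube: "bij_betw (\<lambda>k. (k $ 1, k $ 2, k $ 3)) (cube R) ({-int R..int R} \<times> {-int R..int R} \<times> {-int R..int R})"
  by (rule bij_betw_byWitness[where f'="\<lambda>(a,b,c). vector [a,b,c]"])
     (auto simp: cube_def vec_eq_iff forall_3 vector_3)

lemma finite_cube [simp]: "finite (cube R)"
  using bij_betw_finite[OF bij_betw_cube, of R] by simp

lemma card_cube: "card (cube R) = (2 * R + 1) ^ 3"
proof -
  have "card {- int R..int R} = 2 * R + 1" by auto
  then show ?thesis
    using bij_betw_same_card[OF bij_betw_cube, of R]
    by (simp only: card_cartesian_product power3_eq_cube mult.assoc)
qed

text \<open>A chordal distance to the integer lattice. It is periodic, and multiplying a
  trigonometric sum by one of its factors \<open>cis - 1\<close> takes differences of neighbouring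
  coefficients; this makes its mean against a kernel computable.\<close>

definition tdist :: "real^3 \<Rightarrow> real" where
  "tdist y = (\<Sum>i\<in>UNIV. norm (cis (2 * pi * y $ i) - 1))"

lemma tdist_nonneg [simp]: "0 \<le> tdist y"
  by (simp add: tdist_def sum_nonneg)

lemma tdist_measurable [measurable]: "tdist \<in> borel_measurable borel"
  unfolding tdist_def cis_conv_exp
  by (intro borel_measurable_continuous_onI continuous_intros)

lemma tdist_uminus [simp]: "tdist (- y) = tdist y"
proof -
  have "norm (cis (- a) - 1) = norm (cis a - 1)" for a
    using complex_mod_cnj[of "cis a - 1"] by (simp add: cis_cnj)
  then show ?thesis by (simp add: tdist_def)
qed

lemma norm_cis_mult_diff_1: "norm (cis (real_of_int n * s) - 1) \<le> \<bar>n\<bar> * norm (cis s - 1)"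
proof -
  have nat: "norm (cis (real m * s) - 1) \<le> m * norm (cis s - 1)" for m
  proof (induction m)
    case (Suc m)
    have "cis (real (Suc m) * s) - 1 = cis (real m * s) * (cis s - 1) + (cis (real m * s) - 1)"
      by (simp add: algebra_simps cis_mult)
    then have "norm (cis (real (Suc m) * s) - 1) \<le> norm (cis s - 1) + norm (cis (real m * s) - 1)"
      by (metis mult_1 norm_cis norm_mult norm_triangle_ineq)
    with Suc show ?case by (simp add: algebra_simps)
  qed simp
  show ?thesis
  proof (cases "n \<ge> 0")
    case True then show ?thesis using nat[of "nat n"] by simp
  next
    case False
    have "norm (cis (real_of_int n * s) - 1) = norm (cnj (cis (real_of_int n * s) - 1))" by (rule complex_mod_cnj[symmetric])
    also have "\<dots> = norm (cis (real (nat (- n)) * s) - 1)" using False by (simp add: cis_cnj)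
    also have "\<dots> \<le> real (nat (-n)) * norm (cis s - 1)" by (rule nat)
    finally show ?thesis using False by simp
  qed
qed

text \<open>A character is a product of three unit factors; telescoping the product minus 1 costs
  one chord per coordinate, multiplied by the size of the frequency.\<close>

lemma norm_ch_diff_1: assumes "k \<in> cube R" shows "norm (ch k y - 1) \<le> R * tdist y"
proof -
  define c where "c i = cis (real_of_int (k $ i) * (2 * pi * y $ i))" for i
  have "ch k y = c 1 * c 2 * c 3"
    by (simp add: ch_def c_def cis_mult inner_vec_def sum_3 freq_def algebra_simps)
  then have "ch k y - 1 = c 1 * c 2 * (c 3 - 1) + c 1 * (c 2 - 1) + (c 1 - 1)" by (simp add: algebra_simps)
  then have "norm (ch k y - 1) \<le> norm (c 1 * c 2 * (c 3 - 1)) + norm (c 1 * (c 2 - 1)) + norm (c 1 - 1)"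
    by (metis norm_triangle_ineq norm_triangle_le add_mono order_refl)
  also have "\<dots> = (\<Sum>i\<in>UNIV. norm (c i - 1))"
    by (simp add: norm_mult sum_3 c_def)
  also have "\<dots> \<le> (\<Sum>i\<in>UNIV. R * norm (cis (2 * pi * y $ i) - 1))"
  proof (rule sum_mono)
    fix i
    have "norm (c i - 1) \<le> \<bar>k $ i\<bar> * norm (cis (2 * pi * y $ i) - 1)"
      using norm_cis_mult_diff_1[of "k $ i" "2 * pi * y $ i"] by (simp add: c_def)
    also have "\<dots> \<le> R * norm (cis (2 * pi * y $ i) - 1)"
      using assms of_int_le_iff[of "\<bar>k $ i\<bar>" "int R", where 'a=real]
      by (intro mult_right_mono) (auto simp: cube_def)
    finally show "norm (c i - 1) \<le> R * norm (cis (2 * pi * y $ i) - 1)" .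
  qed
  finally show ?thesis by (simp add: tdist_def sum_distrib_left)
qed

lemma nn_integral_norm2_trig:
  assumes "finite K"
  shows "(\<integral>\<^sup>+x. ennreal (norm (\<Sum>k\<in>K. c k * ch k x)) ^ 2 \<partial>torus) = ennreal (\<Sum>k\<in>K. (norm (c k))\<^sup>2)"
proof -
  have "integrable torus (\<lambda>x. (norm (\<Sum>k\<in>K. c k * ch k x))\<^sup>2)"
    by (rule integrable_torus_bounded[where C="(\<Sum>k\<in>K. norm (c k))\<^sup>2"])
       (auto intro!: power_mono sum_norm_le simp: norm_mult)
  then show ?thesis
    by (simp add: ennreal_power nn_integral_eq_integral finite_Parseval[OF assms])
qed

text \<open>The kernel is $V = D_R D_{2R} / |G_R|$ with $D_R$ the sum of the characters in the cube $G_R$: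
  it reproduces the frequencies in $G_R$, and Cauchy--Schwarz with Parseval controls its $L^1$
  modulus of continuity.\<close>

lemma Bernstein_translation:
  assumes K: "finite K" "K \<subseteq> cube R" and f: "f = (\<lambda>x. \<Sum>k\<in>K. c k * ch k x)"
    and a: "L4_le f a" "0 \<le> a"
  shows "L4_le (\<lambda>x. f (x + y) - f x) (9 * R * tdist y * a)"
proof -
  define D where "D R z = (\<Sum>k\<in>cube R. ch k z)" for R z
  define V where "V z = D R z * D (2*R) z / of_nat (card (cube R))" for z
  have D_meas [measurable]: "D R \<in> borel_measurable borel" for R unfolding D_def by measurable
  have V_meas [measurable]: "V \<in> borel_measurable borel" unfolding V_def by measurable
  have f_meas [measurable]: "f \<in> borel_measurable borel" unfolding f by measurable
  have pf: "periodic f" using periodic_ch unfolding f periodic_def by simp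
  have pV: "periodic V" using periodic_ch unfolding V_def D_def periodic_def by simp
  have card: "card (cube R) > 0" by (simp add: card_cube)
  have Dn: "(\<integral>\<^sup>+z. ennreal (norm (D R (z + s))) ^ 2 \<partial>torus) = ennreal (card (cube R))" for R s
    using nn_integral_norm2_trig[of "cube R" "\<lambda>k. ch k s"]
    by (simp add: D_def ch_add mult.commute)
  have Dd: "(\<integral>\<^sup>+z. ennreal (norm (D S (z + s) - D S z)) ^ 2 \<partial>torus) \<le> ennreal (card (cube S) * (S * tdist s)\<^sup>2)" for S s
  proof -
    have "D S (z + s) - D S z = (\<Sum>k\<in>cube S. (ch k s - 1) * ch k z)" for z
      by (simp add: D_def ch_add sum_subtractf algebra_simps)
    then have "(\<integral>\<^sup>+z. ennreal (norm (D S (z + s) - D S z)) ^ 2 \<partial>torus) = ennreal (\<Sum>k\<in>cube S. (norm (ch k s - 1))\<^sup>2)"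
      using nn_integral_norm2_trig[of "cube S" "\<lambda>k. ch k s - 1"] by simp
    also have "\<dots> \<le> ennreal (card (cube S) * (S * tdist s)\<^sup>2)"
      by (intro ennreal_leI sum_bounded_above) (auto intro!: power_mono norm_ch_diff_1)
    finally show ?thesis .
  qed
  have V1: "(\<integral>\<^sup>+z. ennreal (norm (V (z + s) - V z)) \<partial>torus) \<le> ennreal (9 * R * tdist s)" for s
  proof -
    let ?c = "real (card (cube R))" and ?c2 = "real (card (cube (2*R)))"
    have 1: "(\<integral>\<^sup>+z. ennreal (norm (D R (z + s) - D R z)) * ennreal (norm (D (2*R) (z + s))) \<partial>torus) \<le>
       ennreal ((sqrt ?c * (R * tdist s)) * sqrt ?c2)"
      using Dd[of R s] Dn[of "2*R" s]
      by (intro nn_integral_Cauchy_Schwarz_bound) (auto simp: power_mult_distrib)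
    have 2: "(\<integral>\<^sup>+z. ennreal (norm (D R z)) * ennreal (norm (D (2*R) (z + s) - D (2*R) z)) \<partial>torus) \<le>
       ennreal (sqrt ?c * (sqrt ?c2 * (real (2 * R) * tdist s)))"
      using Dd[of "2*R" s] Dn[of R 0]
      by (intro nn_integral_Cauchy_Schwarz_bound) (auto simp: power_mult_distrib)
    have "norm (V (z + s) - V z) \<le> (norm (D R (z + s) - D R z) * norm (D (2*R) (z + s)) +
        norm (D R z) * norm (D (2*R) (z + s) - D (2*R) z)) / ?c" for z
    proof -
      have "V (z + s) - V z = ((D R (z + s) - D R z) * D (2*R) (z + s) + D R z * (D (2*R) (z + s) - D (2*R) z)) / of_nat (card (cube R))"
        by (simp add: V_def algebra_simps flip: diff_divide_distrib add_divide_distrib)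
      then show ?thesis
        by (simp add: norm_divide divide_right_mono norm_triangle_le norm_mult)
    qed
    then have "(\<integral>\<^sup>+z. ennreal (norm (V (z + s) - V z)) \<partial>torus) \<le>
       (\<integral>\<^sup>+z. ennreal (1/?c) * (ennreal (norm (D R (z + s) - D R z)) * ennreal (norm (D (2*R) (z + s))) +
         ennreal (norm (D R z)) * ennreal (norm (D (2*R) (z + s) - D (2*R) z))) \<partial>torus)"
      by (intro nn_integral_mono)
         (simp flip: ennreal_mult ennreal_plus add: ennreal_leI)
    also have "\<dots> = ennreal (1/?c) * ((\<integral>\<^sup>+z. ennreal (norm (D R (z + s) - D R z)) * ennreal (norm (D (2*R) (z + s))) \<partial>torus) +
       (\<integral>\<^sup>+z. ennreal (norm (D R z)) * ennreal (norm (D (2*R) (z + s) - D (2*R) z)) \<partial>torus))"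
      by (subst nn_integral_cmult, measurable, subst nn_integral_add) auto
    also have "\<dots> \<le> ennreal (1/?c) * (ennreal ((sqrt ?c * (R * tdist s)) * sqrt ?c2) + ennreal (sqrt ?c * (sqrt ?c2 * (real (2 * R) * tdist s))))"
      by (intro mult_left_mono add_mono 1 2) auto
    also have "\<dots> = ennreal (1/?c * (3 * (sqrt ?c * sqrt ?c2) * (R * tdist s)))"
      by (simp flip: ennreal_mult ennreal_plus add: algebra_simps)
    also have "\<dots> \<le> ennreal (9 * R * tdist s)"
    proof -
      \<comment> \<open>The ratio of the cardinalities is at most 8; the value 9 makes the square
        root exact. That 3, times the 1 + 2 from the radii \<open>R\<close> and
        \<open>2 * R\<close>, is the constant 9 of the lemma.\<close>
      have "?c2 \<le> 9 * ?c"
      proof -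
        have "real (4 * R + 1) \<le> real (2 * (2 * R + 1))" by simp
        then have "real (4 * R + 1) ^ 3 \<le> real (2 * (2 * R + 1)) ^ 3" by (intro power_mono) auto
        also have "\<dots> = 8 * real (2 * R + 1) ^ 3" by (simp only: of_nat_mult power_mult_distrib) simp
        also have "\<dots> \<le> 9 * real (2 * R + 1) ^ 3" by (intro mult_right_mono) auto
        finally show ?thesis by (simp add: card_cube)
      qed
      then have "sqrt ?c * sqrt ?c2 \<le> sqrt ?c * sqrt (9 * ?c)" by (intro mult_left_mono) auto
      also have "\<dots> = 3 * ?c" by (simp add: real_sqrt_mult)
      finally have "(1/?c) * (sqrt ?c * sqrt ?c2) \<le> 3" using card by (simp add: field_simps)
      then have "3 * ((1/?c) * (sqrt ?c * sqrt ?c2)) * (R * tdist s) \<le> 3 * 3 * (R * tdist s)"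
        by (intro mult_right_mono mult_left_mono) auto
      then show ?thesis by (intro ennreal_leI) (simp add: mult_ac)
    qed
    finally show ?thesis .
  qed
  have rep1: "(\<integral>z. V z * ch k (x + z) \<partial>torus) = ch k x" if k: "k \<in> cube R" for k x
  proof -
    \<comment> \<open>The second factor of the kernel has twice the radius so that every
      \<open>j\<close> finds its partner \<open>- k - j\<close> there; hence exactly as many pairs
      survive as the normalization counts.\<close>
    have 1: "(\<Sum>l\<in>cube (2*R). if j + l = - k then 1 else 0) = (1::complex)" if "j \<in> cube R" for j
    proof -
      have "- k - j \<in> cube (2*R)"
      proof -
        have "\<bar>- k $ i - j $ i\<bar> \<le> 2 * int R" for i
        proof -
          have "\<bar>k $ i\<bar> \<le> int R" "\<bar>j $ i\<bar> \<le> int R" using k that by (auto simp: cube_def)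
          then show ?thesis by linarith
        qed
        then show ?thesis by (simp add: cube_def)
      qed
      moreover have "(j + l = - k) = (- k - j = l)" for l by (auto simp: algebra_simps)
      ultimately show ?thesis by simp
    qed
    have "(\<integral>z. V z * ch k (x + z) \<partial>torus) = (\<integral>z. (\<Sum>j\<in>cube R. \<Sum>l\<in>cube (2*R). (ch k x / of_nat (card (cube R))) * ch (j + l + k) z) \<partial>torus)"
    proof (intro Bochner_Integration.integral_cong refl)
      fix z
      have "V z * ch k (x + z) = (\<Sum>j\<in>cube R. \<Sum>l\<in>cube (2*R). ch j z * ch l z) * ((ch k x / of_nat (card (cube R))) * ch k z)"
        by (simp add: V_def D_def sum_product ch_add)
      also have "\<dots> = (\<Sum>j\<in>cube R. \<Sum>l\<in>cube (2*R). (ch k x / of_nat (card (cube R))) * ch (j + l + k) z)"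
        unfolding sum_distrib_right ch_add_freq by (simp only: mult_ac)
      finally show "V z * ch k (x + z) = (\<Sum>j\<in>cube R. \<Sum>l\<in>cube (2*R). (ch k x / of_nat (card (cube R))) * ch (j + l + k) z)" .
    qed
    also have "\<dots> = (\<Sum>j\<in>cube R. \<Sum>l\<in>cube (2*R). (ch k x / of_nat (card (cube R))) * (if j + l + k = 0 then 1 else 0))"
      by (simp add: Bochner_Integration.integral_sum Bochner_Integration.integrable_sum integral_ch)
    also have "\<dots> = (ch k x / of_nat (card (cube R))) * (\<Sum>j\<in>cube R. \<Sum>l\<in>cube (2*R). if j + l = - k then 1 else 0)"
      by (simp add: sum_distrib_left eq_neg_iff_add_eq_0)
    also have "\<dots> = ch k x" using card by (auto simp: 1 card_gt_0_iff)
    finally show ?thesis .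
  qed
  have bV: "norm (D S z) \<le> card (cube S)" for S z
    unfolding D_def by (rule order_trans[OF norm_sum]) simp
  have V_bound: "norm (V z) \<le> card (cube (2*R))" for z
    using mult_mono[OF bV[of R z] bV[of "2*R" z]] card by (simp add: V_def norm_divide norm_mult field_simps)
  have f_bound: "norm (f z) \<le> (\<Sum>k\<in>K. norm (c k))" for z
    unfolding f by (rule sum_norm_le) (simp add: norm_mult)
  have intV: "integrable torus (\<lambda>z. V (z + s) * f (x + z))" for s x
    by (rule integrable_torus_bounded[where C="card (cube (2*R)) * (\<Sum>k\<in>K. norm (c k))"])
       (auto simp: norm_mult intro!: mult_mono V_bound f_bound)
  have rep: "(\<integral>z. V z * f (x + z) \<partial>torus) = f x" for x
  proof -
    have int: "integrable torus (\<lambda>z. V z * ch k (x + z))" for k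
      by (rule integrable_torus_bounded[where C="card (cube (2*R))"]) (auto simp: norm_mult V_bound)
    have "(\<integral>z. V z * f (x + z) \<partial>torus) = (\<integral>z. (\<Sum>k\<in>K. c k * (V z * ch k (x + z))) \<partial>torus)"
      by (simp add: f sum_distrib_left mult_ac)
    also have "\<dots> = (\<Sum>k\<in>K. c k * (\<integral>z. V z * ch k (x + z) \<partial>torus))"
      by (subst Bochner_Integration.integral_sum) (auto intro!: int)
    also have "\<dots> = f x" using K unfolding f by (intro sum.cong refl) (auto simp: rep1)
    finally show ?thesis .
  qed
  \<comment> \<open>By reproduction and translation invariance the increment moves from
    \<open>f\<close> to the kernel, whose L1 modulus is known.\<close>
  have "f (x + y) - f x = (\<integral>z. (V (z - y) - V z) * f (x + z) \<partial>torus)" for x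
  proof -
    have "f (x + y) = (\<integral>z. V z * f (x + y + z) \<partial>torus)" by (rule rep[symmetric])
    also have "\<dots> = (\<integral>z. V (z + y - y) * f (x + (z + y)) \<partial>torus)" by (simp add: ac_simps)
    also have "\<dots> = (\<integral>z. V (z - y) * f (x + z) \<partial>torus)"
    proof (rule integral_torus_translate[where f="\<lambda>z. V (z - y) * f (x + z)"])
      show "periodic (\<lambda>z. V (z - y) * f (x + z))"
        using periodic_translate[OF pV, of "-y"] periodic_translate[OF pf, of x]
        by (simp add: periodic_def ac_simps)
    qed measurable
    finally show ?thesis
      using intV[of "-y" x] intV[of 0 x]
      by (simp add: rep[of x, symmetric] left_diff_distrib Bochner_Integration.integral_diff)
  qed
  moreover have "L4_le (\<lambda>x. \<integral>z. (V (z - y) - V z) * f (x + z) \<partial>torus) (9 * R * tdist y * a)"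
    using V1[of "-y"] a by (intro L4_le_convolution) (auto intro: pf)
  ultimately show ?thesis by simp
qed

text \<open>Convexity gives (s + t)^4 <= 8 (s^4 + t^4), and 8 * 2 = 2^4, so the constant is that of
  the triangle inequality for the L4 norm.\<close>

lemma L4_le_diff:
  assumes [measurable]: "f \<in> borel_measurable borel" and p: "periodic f" and a: "L4_le f a"
  shows "L4_le (\<lambda>x. f (x + y) - f x) (2 * a)"
proof -
  have le: "norm (u - v) ^ 4 \<le> 8 * (norm u ^ 4 + norm v ^ 4)" for u v :: complex
  proof -
    have "norm (u - v) ^ 4 \<le> (norm u + norm v) ^ 4" by (intro power_mono norm_triangle_ineq4) auto
    also have "\<dots> \<le> 8 * (norm u ^ 4 + norm v ^ 4)"
    proof -
      have sq: "(s + t)\<^sup>2 \<le> 2 * (s\<^sup>2 + t\<^sup>2)" for s t :: real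
        using sum_squares_bound[of s t] by (simp add: power2_sum)
      have "((norm u + norm v)\<^sup>2)\<^sup>2 \<le> (2 * ((norm u)\<^sup>2 + (norm v)\<^sup>2))\<^sup>2"
        by (intro power_mono sq) auto
      also have "\<dots> \<le> 4 * (2 * (((norm u)\<^sup>2)\<^sup>2 + ((norm v)\<^sup>2)\<^sup>2))"
        using mult_left_mono[OF sq[of "(norm u)\<^sup>2" "(norm v)\<^sup>2"], of "2\<^sup>2"]
        unfolding power_mult_distrib[of 2] by simp
      finally show ?thesis by simp
    qed
    finally show ?thesis .
  qed
  have "(\<integral>\<^sup>+x. ennreal (norm (f (x + y) - f x)) ^ 4 \<partial>torus) \<le>
    (\<integral>\<^sup>+x. 8 * (ennreal (norm (f (x + y))) ^ 4 + ennreal (norm (f x)) ^ 4) \<partial>torus)"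
    using le by (intro nn_integral_mono) (simp add: ennreal_power ennreal_leI flip: ennreal_plus ennreal_mult ennreal_numeral)
  also have "\<dots> = 8 * ((\<integral>\<^sup>+x. ennreal (norm (f (x + y))) ^ 4 \<partial>torus) + (\<integral>\<^sup>+x. ennreal (norm (f x)) ^ 4 \<partial>torus))"
    by (subst nn_integral_cmult, measurable, subst nn_integral_add) auto
  also have "(\<integral>\<^sup>+x. ennreal (norm (f (x + y))) ^ 4 \<partial>torus) = (\<integral>\<^sup>+x. ennreal (norm (f x)) ^ 4 \<partial>torus)"
    using p by (intro nn_integral_torus_translate[where f="\<lambda>x. ennreal (norm (f x)) ^ 4"]) (auto simp: periodic_def)
  also have "8 * ((\<integral>\<^sup>+x. ennreal (norm (f x)) ^ 4 \<partial>torus) + (\<integral>\<^sup>+x. ennreal (norm (f x)) ^ 4 \<partial>torus)) \<le> 8 * (ennreal (a ^ 4) + ennreal (a ^ 4))"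
    using a by (intro mult_left_mono add_mono) (auto simp: L4_le_def)
  also have "ennreal (a ^ 4) + ennreal (a ^ 4) = ennreal (a ^ 4 + a ^ 4)"
    by (rule ennreal_plus[symmetric]) auto
  also have "8 * ennreal (a ^ 4 + a ^ 4) = ennreal 8 * ennreal (a ^ 4 + a ^ 4)"
    by simp
  also have "\<dots> = ennreal (8 * (a ^ 4 + a ^ 4))"
    by (rule ennreal_mult[symmetric]) auto
  also have "8 * (a ^ 4 + a ^ 4) = (2 * a) ^ 4"
    by (simp add: power_mult_distrib)
  finally show ?thesis by (simp add: L4_le_def)
qed

subsection \<open>The Jackson kernel\<close>

text \<open>A tent of height \<open>N\<close> over the cube of radius \<open>N\<close>. Its slope is
  at most 1, while its sum of squares is of order N^5.\<close>

definition jw :: "nat \<Rightarrow> int^3 \<Rightarrow> real" where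
  "jw N j = max 0 (real N - infnorm (freq j))"

definition jnorm :: "nat \<Rightarrow> real" where
  "jnorm N = (\<Sum>j\<in>cube N. (jw N j)\<^sup>2)"

text \<open>The square gives positivity, and Parseval shows that \<open>jnorm\<close> is the total
  mass before normalization. A flat profile would give a Fejer kernel, whose first moment is only of
  order log N / N. For \<open>N = 0\<close> the quotient is 0, whence the hypotheses
  \<open>0 < N\<close> later on.\<close>

definition jackson :: "nat \<Rightarrow> real^3 \<Rightarrow> real" where
  "jackson N y = (norm (\<Sum>j\<in>cube N. of_real (jw N j) * ch j y))\<^sup>2 / jnorm N"

text \<open>The Fourier coefficients of \<open>jackson N\<close>: the normalized autocorrelation of
  the tent.\<close>

definition lam :: "nat \<Rightarrow> int^3 \<Rightarrow> real" where
  "lam N k = (\<Sum>j\<in>cube N. jw N j * jw N (j - k)) / jnorm N"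

lemma jw_nonneg [simp]: "0 \<le> jw N j"
  by (simp add: jw_def)

lemma jw_uminus [simp]: "jw N (- j) = jw N j"
  by (simp add: jw_def infnorm_neg)

lemma jw_outside: assumes "j \<notin> cube N" shows "jw N j = 0"
proof -
  obtain i where "\<not> \<bar>j $ i\<bar> \<le> int N" using assms by (auto simp: cube_def)
  then have "real N \<le> real_of_int \<bar>j $ i\<bar>" by linarith
  also have "\<dots> \<le> infnorm (freq j)"
    using component_le_infnorm_cart[of "freq j" i] by (simp add: freq_def)
  finally show ?thesis by (simp add: jw_def)
qed

lemma jw_Lipschitz: "\<bar>jw N (j - axis i 1) - jw N j\<bar> \<le> 1"
proof -
  have "freq j - freq (j - axis i 1) = axis i 1"
    by (simp add: freq_def axis_def vec_eq_iff)
  then have "\<bar>infnorm (freq j) - infnorm (freq (j - axis i 1))\<bar> \<le> infnorm (axis i (1::real))"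
    using absdiff_infnorm[of "freq j" "freq (j - axis i 1)"] by simp
  also have "\<dots> \<le> 1" using infnorm_le_norm[of "axis i (1::real)"] by simp
  finally show ?thesis by (auto simp: jw_def max_def abs_if split: if_splits)
qed

lemma jw_lower: assumes "j \<in> cube (N div 2)" shows "real N / 2 \<le> jw N j"
proof -
  have "infnorm (freq j) \<le> real (N div 2)"
    unfolding infnorm_cart
  proof (rule cSup_least)
    fix z assume "z \<in> {\<bar>freq j $ i\<bar> |i. i \<in> UNIV}"
    then obtain i where z: "z = \<bar>freq j $ i\<bar>" by auto
    have "\<bar>j $ i\<bar> \<le> int (N div 2)" using assms by (auto simp: cube_def)
    then have "real_of_int \<bar>j $ i\<bar> \<le> real_of_int (int (N div 2))" by (simp only: of_int_le_iff)
    then show "z \<le> real (N div 2)" by (simp add: z freq_def)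
  qed auto
  also have "\<dots> \<le> real N / 2" by simp
  finally show ?thesis by (simp add: jw_def)
qed

text \<open>On the cube of half the radius there are at least N^3 lattice points, each carrying a
  weight of at least N / 2.\<close>

lemma jnorm_lower: "real N ^ 5 / 4 \<le> jnorm N"
proof -
  have sub: "cube (N div 2) \<subseteq> cube N" unfolding cube_def by (auto intro: order_trans)
  have "real N ^ 5 / 4 = real N ^ 3 * (real N / 2)\<^sup>2" by (simp add: power2_eq_square power_numeral_reduce)
  also have "\<dots> \<le> real (card (cube (N div 2))) * (real N / 2)\<^sup>2"
  proof (intro mult_right_mono)
    have "real N \<le> real (2 * (N div 2) + 1)" by linarith
    then have "real N ^ 3 \<le> real (2 * (N div 2) + 1) ^ 3" by (intro power_mono) auto
    then show "real N ^ 3 \<le> real (card (cube (N div 2)))" unfolding card_cube by simp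
  qed auto
  also have "\<dots> \<le> (\<Sum>j\<in>cube (N div 2). (jw N j)\<^sup>2)"
    by (intro sum_bounded_below power_mono jw_lower) auto
  also have "\<dots> \<le> jnorm N" unfolding jnorm_def by (intro sum_mono2 sub) auto
  finally show ?thesis .
qed

lemma jnorm_pos: "0 < N \<Longrightarrow> 0 < jnorm N"
  by (rule less_le_trans[OF _ jnorm_lower]) simp

lemma sum_jw_reindex:
  assumes "bij \<sigma>" "finite S" "\<And>k. \<sigma> k \<in> cube N \<Longrightarrow> k \<in> S"
  shows "(\<Sum>l\<in>cube N. of_real (jw N l) * g l) = (\<Sum>k\<in>S. of_real (jw N (\<sigma> k)) * (g (\<sigma> k) :: 'b :: real_normed_algebra_1))"
proof -
  have "(\<Sum>l\<in>cube N. of_real (jw N l) * g l) = (\<Sum>k\<in>\<sigma> -` cube N. of_real (jw N (\<sigma> k)) * g (\<sigma> k))"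
    by (rule sum.reindex_bij_betw[symmetric])
       (metis assms(1) bij_betw_def bij_vimage_eq_inv_image bij_is_surj inj_on_subset subset_UNIV surj_image_vimage_eq)
  also have "\<dots> = (\<Sum>k\<in>S. of_real (jw N (\<sigma> k)) * g (\<sigma> k))"
    using assms by (intro sum.mono_neutral_left) (auto simp: jw_outside)
  finally show ?thesis .
qed

lemma cube_uminus [simp]: "- k \<in> cube N \<longleftrightarrow> k \<in> cube N"
  by (simp add: cube_def)

lemma cube_diff: assumes "j \<in> cube N" "l \<in> cube M" shows "j - l \<in> cube (N + M)"
  unfolding cube_def
proof safe
  fix i
  have "\<bar>j $ i\<bar> \<le> int N" "\<bar>l $ i\<bar> \<le> int M" using assms by (auto simp: cube_def)
  then show "\<bar>(j - l) $ i\<bar> \<le> int (N + M)" by simp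
qed

lemma bij_minus_left: "bij (\<lambda>k. j - k :: 'a :: ab_group_add)"
  by (rule bijI') (auto intro: exI[of _ "j - _"])

lemma bij_minus_right: "bij (\<lambda>k. k - j :: 'a :: ab_group_add)"
  by (rule bijI') (auto intro: exI[of _ "_ + j"])

lemma lam_outside: assumes "k \<notin> cube (2 * N)" shows "lam N k = 0"
proof -
  have "jw N (j - k) = 0" if "j \<in> cube N" for j
  proof (rule jw_outside)
    show "j - k \<notin> cube N" using cube_diff[of j N "j - k" N] that assms by (auto simp: mult_2)
  qed
  then show ?thesis by (simp add: lam_def)
qed

lemma lam_uminus: "lam N (- k) = lam N k"
proof -
  have "(\<Sum>j\<in>cube N. jw N j * jw N (j + k)) = (\<Sum>j\<in>cube N. jw N (- j) * jw N (- j + k))"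
    by (rule sum.reindex_bij_witness[of _ uminus uminus]) auto
  also have "\<dots> = (\<Sum>j\<in>cube N. jw N j * jw N (j - k))"
    by (intro sum.cong refl arg_cong2[where f="(*)"]) (simp_all flip: jw_uminus[of N "_ - k"])
  finally show ?thesis by (simp add: lam_def)
qed

lemma jackson_nonneg [simp]: "0 \<le> jackson N y"
  by (simp add: jackson_def jnorm_def sum_nonneg)

lemma jackson_measurable [measurable]: "jackson N \<in> borel_measurable borel"
  unfolding jackson_def by measurable

text \<open>Expand the squared modulus as a double sum and collect the pairs with the same
  difference of frequencies; differences of points in \<open>cube N\<close> lie in
  \<open>cube (2 * N)\<close>.\<close>

lemma jackson_eq_sum: "complex_of_real (jackson N y) = (\<Sum>k\<in>cube (2 * N). of_real (lam N k) * ch k y)"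
proof -
  have inner: "(\<Sum>l\<in>cube N. of_real (jw N l) * ch (j - l) y) = (\<Sum>k\<in>cube (2 * N). of_real (jw N (j - k)) * ch k y)"
    if "j \<in> cube N" for j
  proof (subst sum_jw_reindex[of "\<lambda>k. j - k" "cube (2*N)"])
    show "k \<in> cube (2 * N)" if "j - k \<in> cube N" for k
      using cube_diff[OF \<open>j \<in> cube N\<close> that] by (simp add: mult_2)
  qed (simp_all add: bij_minus_left)
  have "complex_of_real (jackson N y) = (\<Sum>j\<in>cube N. of_real (jw N j) * ch j y) * cnj (\<Sum>l\<in>cube N. of_real (jw N l) * ch l y) / of_real (jnorm N)"
    by (simp add: jackson_def complex_norm_square del: of_real_power)
  also have "\<dots> = (\<Sum>j\<in>cube N. of_real (jw N j) * (\<Sum>l\<in>cube N. of_real (jw N l) * ch (j - l) y)) / of_real (jnorm N)"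
    unfolding cnj_sum sum_product
    by (simp only: sum_distrib_left ch_diff_freq complex_cnj_mult complex_cnj_complex_of_real mult_ac)
  also have "\<dots> = (\<Sum>j\<in>cube N. of_real (jw N j) * (\<Sum>k\<in>cube (2 * N). of_real (jw N (j - k)) * ch k y)) / of_real (jnorm N)"
    by (simp add: inner)
  also have "\<dots> = (\<Sum>k\<in>cube (2*N). \<Sum>j\<in>cube N. of_real (jw N j) * (of_real (jw N (j - k)) * ch k y)) / of_real (jnorm N)"
    by (subst sum.swap) (simp add: sum_distrib_left)
  also have "\<dots> = (\<Sum>k\<in>cube (2 * N). of_real (lam N k) * ch k y)"
    by (simp add: lam_def sum_divide_distrib sum_distrib_left sum_distrib_right mult_ac)
  finally show ?thesis .
qed

lemma Re_ch: "Re (ch k y) = cos (2 * pi * (freq k \<bullet> y))" and Im_ch: "Im (ch k y) = sin (2 * pi * (freq k \<bullet> y))"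
  by (simp_all add: ch_def)

lemma jackson_cos: "jackson N y = (\<Sum>k\<in>cube (2 * N). lam N k * cos (2 * pi * (freq k \<bullet> y)))"
  using arg_cong[OF jackson_eq_sum[of N y], of Re] by (simp add: Re_ch)

lemma jackson_bounded: "jackson N y \<le> (\<Sum>k\<in>cube (2 * N). \<bar>lam N k\<bar>)"
  unfolding jackson_cos
proof (rule sum_mono)
  fix k
  have "lam N k * cos (2 * pi * (freq k \<bullet> y)) \<le> \<bar>lam N k\<bar> * \<bar>cos (2 * pi * (freq k \<bullet> y))\<bar>"
    by (metis abs_ge_self abs_mult)
  also have "\<dots> \<le> \<bar>lam N k\<bar> * 1" by (intro mult_left_mono) auto
  finally show "lam N k * cos (2 * pi * (freq k \<bullet> y)) \<le> \<bar>lam N k\<bar>" by simp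
qed

lemma periodic_jackson: "periodic (jackson N)"
  using periodic_ch unfolding jackson_def periodic_def by simp

lemma integrable_jackson [simp]: "integrable torus (jackson N)"
  using jackson_bounded by (intro integrable_torus_bounded[where C="\<Sum>k\<in>cube (2 * N). \<bar>lam N k\<bar>"]) auto

lemma integral_jackson: assumes "0 < N" shows "integral\<^sup>L torus (jackson N) = 1"
  using finite_Parseval[of "cube N" "\<lambda>j. of_real (jw N j)"] jnorm_pos[OF assms]
  by (simp add: jackson_def[abs_def] jnorm_def)

lemma nn_integral_jackson: "0 < N \<Longrightarrow> (\<integral>\<^sup>+y. ennreal (jackson N y) \<partial>torus) = 1"
  by (subst nn_integral_eq_integral) (auto simp: integral_jackson)

text \<open>With \<open>P\<close> the trigonometric sum under the square, one splits the weight as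
  \<open>((cis - 1) * P)\<close> times \<open>P\<close>. The first factor has coefficients bounded
  by the slope of the tent, hence an L2 norm of order N^(3/2); the second has L2 norm
  \<open>sqrt (jnorm N)\<close>. Dividing by \<open>jnorm N\<close>, of order N^5, leaves
  1/N.\<close>

lemma nn_integral_jackson_tdist:
  assumes "0 < N" shows "(\<integral>\<^sup>+y. ennreal (jackson N y) * ennreal (tdist y) \<partial>torus) \<le> ennreal (69 / N)"
proof -
  define P where "P y = (\<Sum>j\<in>cube N. of_real (jw N j) * ch j y)" for y
  define e where "e i = (axis i 1 :: int^3)" for i :: 3
  have [measurable]: "P \<in> borel_measurable borel" unfolding P_def by measurable
  have che: "ch (e i) y = cis (2 * pi * y $ i)" for i y
  proof -
    have "freq (e i) = axis i 1" by (simp add: e_def freq_def axis_def vec_eq_iff)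
    then show ?thesis by (simp add: ch_def inner_axis')
  qed
  have J: "jackson N y = (norm (P y))\<^sup>2 / jnorm N" for y by (simp add: jackson_def P_def)
  have i: "(\<integral>\<^sup>+y. ennreal (jackson N y) * ennreal (norm (cis (2 * pi * y $ i) - 1)) \<partial>torus) \<le> ennreal (23 / N)" for i
  proof -
    have mul: "(cis (2 * pi * y $ i) - 1) * P y = (\<Sum>j\<in>cube (N+1). of_real (jw N (j - e i) - jw N j) * ch j y)" for y
    proof -
      have sub: "cube N \<subseteq> cube (N+1)" unfolding cube_def by (auto intro: order_trans)
      have mem: "k \<in> cube (N+1)" if "k - e i \<in> cube N" for k
      proof -
        have "- e i \<in> cube 1" by (simp add: cube_def e_def axis_def)
        from cube_diff[OF that this] show ?thesis by simp
      qed
      have "cis (2 * pi * y $ i) * P y = (\<Sum>j\<in>cube N. of_real (jw N j) * ch (j + e i) y)"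
        unfolding che[symmetric] P_def sum_distrib_left ch_add_freq by (simp only: mult_ac)
      also have "\<dots> = (\<Sum>j\<in>cube (N+1). of_real (jw N (j - e i)) * ch j y)"
      proof (subst sum_jw_reindex[of "\<lambda>k. k - e i" "cube (N+1)"])
        show "k \<in> cube (N + 1)" if "k - e i \<in> cube N" for k using that by (rule mem)
      qed (simp_all add: bij_minus_right)
      finally have 1: "cis (2 * pi * y $ i) * P y = (\<Sum>j\<in>cube (N+1). of_real (jw N (j - e i)) * ch j y)" .
      have "P y = (\<Sum>j\<in>cube (N+1). of_real (jw N j) * ch j y)"
        unfolding P_def using sub by (intro sum.mono_neutral_left) (auto simp: jw_outside)
      with 1 show ?thesis by (simp add: left_diff_distrib sum_subtractf)
    qed
    have "(\<integral>\<^sup>+y. ennreal (norm ((cis (2 * pi * y $ i) - 1) * P y)) ^ 2 \<partial>torus) = ennreal (\<Sum>j\<in>cube (N+1). (norm (complex_of_real (jw N (j - e i) - jw N j)))\<^sup>2)"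
      unfolding mul by (rule nn_integral_norm2_trig) simp
    also have "\<dots> \<le> ennreal (real (card (cube (N+1))) * 1)"
    proof (intro ennreal_leI sum_bounded_above)
      fix j
      have "\<bar>jw N (j - e i) - jw N j\<bar> \<le> 1" unfolding e_def by (rule jw_Lipschitz)
      then show "(norm (complex_of_real (jw N (j - e i) - jw N j)))\<^sup>2 \<le> 1"
        unfolding norm_of_real by (simp add: abs_square_le_1)
    qed
    also have "\<dots> \<le> ennreal ((sqrt (125 * real N ^ 3))\<^sup>2)"
    proof (intro ennreal_leI)
      have "real (2 * (N + 1) + 1) ^ 3 \<le> (5 * real N) ^ 3" using assms by (intro power_mono) auto
      also have "\<dots> = 125 * real N ^ 3" by (simp add: power_mult_distrib)
      finally show "real (card (cube (N+1))) * 1 \<le> (sqrt (125 * real N ^ 3))\<^sup>2" unfolding card_cube by simp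
    qed
    finally have a: "(\<integral>\<^sup>+y. ennreal (norm ((cis (2 * pi * y $ i) - 1) * P y)) ^ 2 \<partial>torus) \<le> ennreal ((sqrt (125 * real N ^ 3))\<^sup>2)" .
    have b: "(\<integral>\<^sup>+y. ennreal (norm (P y)) ^ 2 \<partial>torus) \<le> ennreal ((sqrt (jnorm N))\<^sup>2)"
      unfolding P_def using nn_integral_norm2_trig[of "cube N" "\<lambda>j. of_real (jw N j)"] jnorm_pos[OF assms]
      by (simp add: jnorm_def)
    have jp: "0 < jnorm N" by (rule jnorm_pos[OF assms])
    have "(\<integral>\<^sup>+y. ennreal (jackson N y) * ennreal (norm (cis (2 * pi * y $ i) - 1)) \<partial>torus) =
      (\<integral>\<^sup>+y. ennreal (1 / jnorm N) * (ennreal (norm ((cis (2 * pi * y $ i) - 1) * P y)) * ennreal (norm (P y))) \<partial>torus)"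
      using jp by (intro nn_integral_cong) (simp add: J norm_mult power2_eq_square flip: ennreal_mult')
    also have "\<dots> = ennreal (1 / jnorm N) * (\<integral>\<^sup>+y. ennreal (norm ((cis (2 * pi * y $ i) - 1) * P y)) * ennreal (norm (P y)) \<partial>torus)"
      by (rule nn_integral_cmult) (simp add: cis_conv_exp)
    also have "\<dots> \<le> ennreal (1 / jnorm N) * ennreal (sqrt (125 * real N ^ 3) * sqrt (jnorm N))"
      using jp by (intro mult_left_mono nn_integral_Cauchy_Schwarz_bound a b) (auto simp: cis_conv_exp)
    also have "\<dots> = ennreal (1 / jnorm N * (sqrt (125 * real N ^ 3) * sqrt (jnorm N)))"
      using jp by (intro ennreal_mult[symmetric]) auto
    also have "\<dots> \<le> ennreal (23 / N)"
    proof (intro ennreal_leI)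
      \<comment> \<open>Here 125 = 5^3 comes from 2 N + 3 <= 5 N, the factor 4 in 500 from
        \<open>jnorm_lower\<close>, and 23^2 = 529 exceeds 500. Three coordinates then give
        69.\<close>
      have "1 / jnorm N * (sqrt (125 * real N ^ 3) * sqrt (jnorm N)) = sqrt (125 * real N ^ 3) / sqrt (jnorm N)"
        using jp real_sqrt_mult_self[of "jnorm N"] by (simp add: field_simps)
      also have "\<dots> \<le> sqrt (125 * real N ^ 3) / sqrt (real N ^ 5 / 4)"
        using assms jnorm_lower[of N] jp by (intro divide_left_mono) auto
      also have "\<dots> = sqrt (500 / (real N)\<^sup>2)"
        using assms by (simp flip: real_sqrt_divide) (simp add: field_simps power2_eq_square power_numeral_reduce)
      also have "\<dots> = sqrt 500 / N" by (simp add: real_sqrt_divide)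
      also have "\<dots> \<le> 23 / N" by (intro divide_right_mono real_le_lsqrt) auto
      finally show "1 / jnorm N * (sqrt (125 * real N ^ 3) * sqrt (jnorm N)) \<le> 23 / N" .
    qed
    finally show ?thesis .
  qed
  have "(\<integral>\<^sup>+y. ennreal (jackson N y) * ennreal (tdist y) \<partial>torus) =
     (\<integral>\<^sup>+y. (\<Sum>i\<in>UNIV. ennreal (jackson N y) * ennreal (norm (cis (2 * pi * y $ i) - 1))) \<partial>torus)"
    unfolding tdist_def by (intro nn_integral_cong) (simp add: sum_distrib_left flip: sum_ennreal)
  also have "\<dots> = (\<Sum>i\<in>UNIV. \<integral>\<^sup>+y. ennreal (jackson N y) * ennreal (norm (cis (2 * pi * y $ i) - 1)) \<partial>torus)"
    by (rule nn_integral_sum) (simp add: cis_conv_exp)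
  also have "\<dots> \<le> (\<Sum>i\<in>(UNIV::3 set). ennreal (23 / N))" by (intro sum_mono i)
  also have "\<dots> = ennreal (69 / N)" by (simp flip: ennreal_mult' ennreal_numeral)
  finally show ?thesis .
qed

lemma integral_ch_jackson: "(\<integral>y. of_real (jackson N y) * ch k y \<partial>torus) = of_real (lam N k)"
proof -
  have "(\<integral>y. of_real (jackson N y) * ch k y \<partial>torus) = (\<integral>y. (\<Sum>l\<in>cube (2*N). of_real (lam N l) * ch (l + k) y) \<partial>torus)"
    unfolding jackson_eq_sum sum_distrib_right ch_add_freq by (simp only: mult_ac)
  also have "\<dots> = (\<Sum>l\<in>cube (2*N). of_real (lam N l) * (if l + k = 0 then 1 else 0))"
    by (simp add: Bochner_Integration.integral_sum integral_ch)
  also have "\<dots> = (\<Sum>l\<in>cube (2*N). if l = - k then of_real (lam N l) else 0)"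
    by (intro sum.cong) (auto simp: eq_neg_iff_add_eq_0)
  also have "\<dots> = of_real (lam N k)"
    using lam_outside[of k N] by (auto simp: lam_uminus)
  finally show ?thesis .
qed

subsection \<open>Convolution with the Jackson kernel\<close>

text \<open>The kernel is even, so \<open>x + y\<close> in place of \<open>x - y\<close> still gives
  the convolution; this form displays the increments \<open>f (x + y) - f x\<close>.\<close>

definition conv :: "nat \<Rightarrow> (real^3 \<Rightarrow> 'b::euclidean_space) \<Rightarrow> real^3 \<Rightarrow> 'b" where
  "conv N f x = (\<integral>y. jackson N y *\<^sub>R f (x + y) \<partial>torus)"

text \<open>Cosine and sine coefficients are kept apart so that vector fields keep real vectors as
  coefficients and cross products apply to them directly.\<close>

definition cosc :: "int^3 \<Rightarrow> (real^3 \<Rightarrow> 'b::euclidean_space) \<Rightarrow> 'b" where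
  "cosc k f = (\<integral>x. cos (2 * pi * (freq k \<bullet> x)) *\<^sub>R f x \<partial>torus)"

definition sinc :: "int^3 \<Rightarrow> (real^3 \<Rightarrow> 'b::euclidean_space) \<Rightarrow> 'b" where
  "sinc k f = (\<integral>x. sin (2 * pi * (freq k \<bullet> x)) *\<^sub>R f x \<partial>torus)"

lemma integrable_bounded_scaleR:
  fixes f :: "real^3 \<Rightarrow> 'b::{banach, second_countable_topology}"
  assumes f: "integrable torus f" and [measurable]: "w \<in> borel_measurable borel" and w: "\<And>x. \<bar>w x\<bar> \<le> C"
  shows "integrable torus (\<lambda>x. w x *\<^sub>R f x)"
proof (rule Bochner_Integration.integrable_bound)
  have [measurable]: "f \<in> borel_measurable torus" using f by simp
  show "(\<lambda>x. w x *\<^sub>R f x) \<in> borel_measurable torus" by measurable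
  show "integrable torus (\<lambda>x. C *\<^sub>R f x)" using f by simp
  show "AE x in torus. norm (w x *\<^sub>R f x) \<le> norm (C *\<^sub>R f x)"
    using w by (intro AE_I2) (auto intro!: mult_right_mono order_trans[OF w])
qed

lemma integrable_cos [simp]:
  fixes f :: "real^3 \<Rightarrow> 'b::euclidean_space"
  shows "integrable torus f \<Longrightarrow> integrable torus (\<lambda>x. cos (2 * pi * (freq k \<bullet> x)) *\<^sub>R f x)"
  by (rule integrable_bounded_scaleR[where C=1]) auto

lemma integrable_sin [simp]:
  fixes f :: "real^3 \<Rightarrow> 'b::euclidean_space"
  shows "integrable torus f \<Longrightarrow> integrable torus (\<lambda>x. sin (2 * pi * (freq k \<bullet> x)) *\<^sub>R f x)"
  by (rule integrable_bounded_scaleR[where C=1]) auto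

lemma jackson_abs_bounded: "\<bar>jackson N y\<bar> \<le> (\<Sum>k\<in>cube (2 * N). \<bar>lam N k\<bar>)"
  using jackson_bounded by simp

lemma integrable_jackson_translate:
  fixes f :: "real^3 \<Rightarrow> 'b::euclidean_space"
  assumes "f \<in> borel_measurable borel" "periodic f" "integrable torus f"
  shows "integrable torus (\<lambda>y. jackson N y *\<^sub>R f (x + y))"
  using assms integrable_torus_translate[of f x]
  by (intro integrable_bounded_scaleR[OF _ _ jackson_abs_bounded]) (auto simp: add.commute)

lemma periodic_conv: "periodic f \<Longrightarrow> periodic (conv N f)"
  unfolding periodic_def conv_def by (simp add: add.assoc add.commute[of "axis _ _"]) (simp add: add.assoc[symmetric])

text \<open>Moving the shift onto the kernel and using the addition theorem separates
  \<open>x\<close> from \<open>y\<close>. Mere integrability of \<open>f\<close> already yields a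
  trigonometric polynomial.\<close>

lemma conv_trig:
  fixes f :: "real^3 \<Rightarrow> 'b::euclidean_space"
  assumes [measurable]: "f \<in> borel_measurable borel" and p: "periodic f" and int [simp]: "integrable torus f"
  shows "conv N f x = (\<Sum>k\<in>cube (2*N). lam N k *\<^sub>R
    (cos (2 * pi * (freq k \<bullet> x)) *\<^sub>R cosc k f + sin (2 * pi * (freq k \<bullet> x)) *\<^sub>R sinc k f))"
proof -
  have "conv N f x = (\<integral>y. jackson N ((y + x) - x) *\<^sub>R f (y + x) \<partial>torus)"
    by (simp add: conv_def add.commute)
  also have "\<dots> = (\<integral>y. jackson N (y - x) *\<^sub>R f y \<partial>torus)"
  proof (rule integral_torus_translate[where f="\<lambda>y. jackson N (y - x) *\<^sub>R f y"])
    show "periodic (\<lambda>y. jackson N (y - x) *\<^sub>R f y)"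
      using p periodic_translate[OF periodic_jackson[of N], of "-x"] by (simp add: periodic_def)
  qed measurable
  also have "\<dots> = (\<integral>y. (\<Sum>k\<in>cube (2*N). (lam N k * cos (2 * pi * (freq k \<bullet> x))) *\<^sub>R (cos (2 * pi * (freq k \<bullet> y)) *\<^sub>R f y)
      + (lam N k * sin (2 * pi * (freq k \<bullet> x))) *\<^sub>R (sin (2 * pi * (freq k \<bullet> y)) *\<^sub>R f y)) \<partial>torus)"
  proof (intro Bochner_Integration.integral_cong refl)
    fix y
    have c: "cos (2 * pi * (freq k \<bullet> (y - x))) = cos (2 * pi * (freq k \<bullet> x)) * cos (2 * pi * (freq k \<bullet> y)) + sin (2 * pi * (freq k \<bullet> x)) * sin (2 * pi * (freq k \<bullet> y))" for k
      by (simp add: inner_diff_right right_diff_distrib cos_diff mult_ac)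
    show "jackson N (y - x) *\<^sub>R f y = (\<Sum>k\<in>cube (2*N). (lam N k * cos (2 * pi * (freq k \<bullet> x))) *\<^sub>R (cos (2 * pi * (freq k \<bullet> y)) *\<^sub>R f y)
      + (lam N k * sin (2 * pi * (freq k \<bullet> x))) *\<^sub>R (sin (2 * pi * (freq k \<bullet> y)) *\<^sub>R f y))"
      unfolding jackson_cos scaleR_sum_left c by (intro sum.cong refl) (simp add: algebra_simps)
  qed
  also have "\<dots> = (\<Sum>k\<in>cube (2*N). (lam N k * cos (2 * pi * (freq k \<bullet> x))) *\<^sub>R cosc k f + (lam N k * sin (2 * pi * (freq k \<bullet> x))) *\<^sub>R sinc k f)"
    unfolding cosc_def sinc_def
    by (subst Bochner_Integration.integral_sum)
       (simp_all del: scaleR_scaleR add: Bochner_Integration.integral_add)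
  finally show ?thesis by (simp add: scaleR_add_right)
qed

lemma conv_measurable [measurable]:
  fixes f :: "real^3 \<Rightarrow> 'b::euclidean_space"
  assumes [measurable]: "f \<in> borel_measurable borel"
  shows "conv N f \<in> borel_measurable borel"
  unfolding conv_def by measurable

lemma L4_le_conv:
  assumes "f \<in> borel_measurable borel" "periodic f" "L4_le f a" "0 \<le> a" "0 < N"
  shows "L4_le (conv N f) a"
  using L4_le_convolution[of "\<lambda>y. of_real (jackson N y)" f 1 a] assms
  by (simp add: conv_def[abs_def] scaleR_conv_of_real nn_integral_jackson)

lemma conv_L2_contraction:
  fixes f :: "real^3 \<Rightarrow> 'b::euclidean_space"
  assumes [measurable]: "f \<in> borel_measurable borel" and p: "periodic f" and N: "0 < N"
  shows "(\<integral>\<^sup>+x. ennreal (norm (conv N f x)) ^ 2 \<partial>torus) \<le> (\<integral>\<^sup>+x. ennreal (norm (f x)) ^ 2 \<partial>torus)"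
proof -
  have "(\<integral>\<^sup>+x. ennreal (norm (conv N f x)) ^ 2 \<partial>torus) \<le>
    (\<integral>\<^sup>+x. (\<integral>\<^sup>+z. ennreal (jackson N z) * ennreal (norm (f (x + z))) \<partial>torus) ^ 2 \<partial>torus)"
    using ennreal_norm_integral_le[of torus "\<lambda>z. jackson N z *\<^sub>R f (_ + z)"]
    unfolding conv_def by (intro nn_integral_mono power_mono) (auto simp: ennreal_mult)
  also have "\<dots> \<le> (\<integral>\<^sup>+x. ennreal (jackson N x) \<partial>torus) ^ 2 * (\<integral>\<^sup>+x. ennreal (norm (f x)) ^ 2 \<partial>torus)"
    using p by (intro Young_2[where h="\<lambda>x. ennreal (norm (f x))"]) (auto simp: periodic_def)
  finally show ?thesis by (simp add: nn_integral_jackson N)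
qed

subsection \<open>Approximation in the mean\<close>

lemma periodic_uniform_bound:
  fixes g :: "real^3 \<Rightarrow> real"
  assumes c: "continuous_on UNIV g" and p: "periodic g"
  obtains M where "\<And>x. \<bar>g x\<bar> \<le> M"
proof -
  have "compact (g ` cbox 0 1)"
    by (intro compact_continuous_image continuous_on_subset[OF c] compact_cbox) auto
  then have "bounded (g ` cbox 0 1)" by (rule compact_imp_bounded)
  then obtain M where M: "\<And>x. x \<in> cbox 0 1 \<Longrightarrow> \<bar>g x\<bar> \<le> M"
    by (auto simp: bounded_iff)
  have "\<bar>g x\<bar> \<le> M" for x
    using M[of "frac3 x"] frac3_in_unit_cell[of x] periodic_frac3[OF p, of x]
    by (auto simp: unit_cell_def mem_box_cart less_imp_le)
  then show ?thesis using that by blast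
qed

text \<open>Compactness: \<open>tdist\<close> vanishes only at lattice points, and 0 is the only one
  in the cube of side 1 centred at 0.\<close>

lemma tdist_lower:
  assumes "0 < \<delta>"
  obtains c where "0 < c" "\<And>y. y \<in> cbox (\<chi> i. -1/2) (\<chi> i. 1/2) \<Longrightarrow> \<delta> \<le> norm y \<Longrightarrow> c \<le> tdist y"
proof (cases "cbox (\<chi> i. -1/2) (\<chi> i. 1/2) \<inter> {y::real^3. \<delta> \<le> norm y} = {}")
  case True
  then show ?thesis using that[of 1] by (auto simp: disjoint_iff)
next
  case False
  let ?K = "cbox (\<chi> i. -1/2) (\<chi> i. 1/2) \<inter> {y::real^3. \<delta> \<le> norm y}"
  have "compact ?K"
    by (intro closed_Int_compact compact_Int_closed compact_cbox closed_Collect_le continuous_intros)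
  moreover have "continuous_on ?K tdist"
    unfolding tdist_def cis_conv_exp by (intro continuous_intros)
  ultimately obtain z where z: "z \<in> ?K" "\<And>y. y \<in> ?K \<Longrightarrow> tdist z \<le> tdist y"
    using continuous_attains_inf[OF _ False] by blast
  have "tdist z \<noteq> 0"
  proof
    assume "tdist z = 0"
    then have "cis (2 * pi * z $ i) = 1" for i
      by (simp add: tdist_def sum_nonneg_eq_0_iff)
    have "z $ i = 0" for i
    proof -
      have "cos (2 * pi * z $ i) = 1"
        using \<open>cis (2 * pi * z $ i) = 1\<close> by (metis cis.sel(1) one_complex.sel(1))
      then obtain n :: int where "2 * pi * z $ i = real_of_int n * 2 * pi" by (auto simp: cos_one_2pi_int)
      then have n: "z $ i = n" by simp
      have "\<bar>z $ i\<bar> \<le> 1/2" using z(1) by (auto simp: mem_box_cart abs_le_iff minus_le_iff) (smt (verit, best))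
      then have "n = 0" unfolding n by linarith
      with n show ?thesis by simp
    qed
    then have "z = 0" by (simp add: vec_eq_iff)
    with z(1) assms show False by simp
  qed
  with z that[of "tdist z"] show ?thesis by (metis IntI less_eq_real_def mem_Collect_eq tdist_nonneg)
qed

text \<open>Near the lattice uniform continuity gives the term \<open>e\<close>; away from it
  \<open>tdist\<close> is bounded below and absorbs the trivial bound \<open>2 * M\<close>. A
  modulus linear in \<open>tdist\<close> is what the first moment of the kernel can
  integrate.\<close>

lemma periodic_tdist_modulus:
  fixes g :: "real^3 \<Rightarrow> real"
  assumes c: "continuous_on UNIV g" and p: "periodic g" and e: "0 < e"
  obtains L where "0 \<le> L" "\<And>x y. \<bar>g (x + y) - g x\<bar> \<le> e + L * tdist y"
proof -
  obtain M where M: "\<And>x. \<bar>g x\<bar> \<le> M" using periodic_uniform_bound[OF c p] by blast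
  then have M0: "0 \<le> M" using abs_ge_zero order_trans by blast
  let ?K = "cbox (\<chi> i. -1) (\<chi> i. 2) :: (real^3) set"
  have "uniformly_continuous_on ?K g"
    by (intro compact_uniformly_continuous continuous_on_subset[OF c] compact_cbox) auto
  then obtain \<delta> where \<delta>: "0 < \<delta>" "\<And>x x'. x \<in> ?K \<Longrightarrow> x' \<in> ?K \<Longrightarrow> dist x' x < \<delta> \<Longrightarrow> dist (g x') (g x) < e"
    using e unfolding uniformly_continuous_on_def by metis
  obtain b where b: "0 < b" "\<And>y. y \<in> cbox (\<chi> i. -1/2) (\<chi> i. 1/2) \<Longrightarrow> \<delta> \<le> norm y \<Longrightarrow> b \<le> tdist y"
    using tdist_lower[OF \<delta>(1)] by blast
  have main: "\<bar>g (x + y) - g x\<bar> \<le> e + (2 * M / b) * tdist y" for x y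
  proof -
    define x' where "x' = frac3 x"
    \<comment> \<open>Reducing \<open>x\<close> to the cell and \<open>y\<close> to its
      representative nearest to 0 keeps \<open>x'\<close> and \<open>x' + y'\<close> in one fixed
      compact cube.\<close>
    define y' where "y' = (\<chi> i. y $ i - of_int (round (y $ i)))"
    have y': "\<bar>y' $ i\<bar> \<le> 1/2" for i
      using of_int_round_abs_le[of "y $ i"] by (simp add: y'_def abs_minus_commute)
    have x': "0 \<le> x' $ i \<and> x' $ i < 1" for i
      using frac3_in_unit_cell[of x] by (simp add: x'_def unit_cell_def)
    have fr: "frac3 (x' + y') = frac3 (x + y)"
    proof -
      have "frac (a - real_of_int m) = frac a" for a m by (simp add: frac_def)
      moreover have "(x' + y') $ i = (x + y) $ i - real_of_int (\<lfloor>x $ i\<rfloor> + round (y $ i))" for i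
        by (simp add: x'_def y'_def frac3_def frac_def)
      ultimately show ?thesis unfolding frac3_def by (metis (no_types, lifting))
    qed
    have gx: "g x' = g x" unfolding x'_def by (rule periodic_frac3[OF p])
    have gxy: "g (x' + y') = g (x + y)" by (metis fr periodic_frac3[OF p])
    have ty: "tdist y' = tdist y"
    proof -
      have "cis (2 * pi * (s - of_int m)) = cis (2 * pi * s)" for s and m :: int
      proof -
        have "cis (2 * pi * s) = cis (2 * pi * (s - of_int m)) * cis (2 * pi * of_int m)"
          unfolding cis_mult by (simp add: algebra_simps)
        also have "cis (2 * pi * of_int m) = 1" by (rule cis_multiple_2pi) simp
        finally show ?thesis by simp
      qed
      then show ?thesis by (simp add: tdist_def y'_def)
    qed
    have mem: "x' \<in> ?K" "x' + y' \<in> ?K" "y' \<in> cbox (\<chi> i. -1/2) (\<chi> i. 1/2)"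
    proof -
      have "-1 \<le> x' $ i \<and> x' $ i \<le> 2 \<and> -1 \<le> x' $ i + y' $ i \<and> x' $ i + y' $ i \<le> 2 \<and> -1/2 \<le> y' $ i \<and> y' $ i \<le> 1/2" for i
        using x'[of i] y'[of i] unfolding abs_le_iff by linarith
      then show "x' \<in> ?K" "x' + y' \<in> ?K" "y' \<in> cbox (\<chi> i. -1/2) (\<chi> i. 1/2)" by (simp_all add: mem_box_cart)
    qed
    show ?thesis
    proof (cases "norm y' < \<delta>")
      case True
      then have "dist (g (x' + y')) (g x') < e" using \<delta>(2)[OF mem(1,2)] by (simp add: dist_norm)
      moreover have "0 \<le> (2 * M / b) * tdist y" using M0 b(1) by simp
      ultimately show ?thesis by (simp add: gx gxy dist_real_def)
    next
      case False
      then have "b \<le> tdist y" using b(2)[OF mem(3)] ty by simp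
      then have "2 * M \<le> (2 * M / b) * tdist y" using b(1) M0 by (simp add: field_simps mult_left_mono)
      then show ?thesis using M[of "x+y"] M[of x] e by linarith
    qed
  qed
  show ?thesis using that[of "2 * M / b"] main M0 b(1) by simp
qed

lemma conv_uniform_bound:
  fixes g :: "real^3 \<Rightarrow> real"
  assumes c: "continuous_on UNIV g" and p: "periodic g" and e: "0 < e"
  obtains L where "0 \<le> L" "\<And>N x. 0 < N \<Longrightarrow> \<bar>conv N g x - g x\<bar> \<le> e + L / real N"
proof -
  obtain L where L: "0 \<le> L" "\<And>x y. \<bar>g (x + y) - g x\<bar> \<le> e + L * tdist y"
    using periodic_tdist_modulus[OF assms] by blast
  obtain M where M: "\<And>x. \<bar>g x\<bar> \<le> M" using periodic_uniform_bound[OF c p] by blast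
  have [measurable]: "g \<in> borel_measurable borel" using c by (rule borel_measurable_continuous_onI)
  have intg: "integrable torus g" using M by (intro integrable_torus_bounded[where C=M]) auto
  have "\<bar>conv N g x - g x\<bar> \<le> e + (L * 69) / N" if N: "0 < N" for N x
  proof -
    have "conv N g x - g x = (\<integral>y. jackson N y *\<^sub>R (g (x + y) - g x) \<partial>torus)"
      using integrable_jackson_translate[OF _ p intg, of N x] integral_jackson[OF N]
      by (simp add: conv_def right_diff_distrib Bochner_Integration.integral_diff)
    then have "ennreal \<bar>conv N g x - g x\<bar> \<le> (\<integral>\<^sup>+y. ennreal (norm (jackson N y *\<^sub>R (g (x + y) - g x))) \<partial>torus)"
      using ennreal_norm_integral_le[of torus "\<lambda>y. jackson N y *\<^sub>R (g (x + y) - g x)"] by simp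
    also have "\<dots> \<le> (\<integral>\<^sup>+y. ennreal e * ennreal (jackson N y) + ennreal L * (ennreal (jackson N y) * ennreal (tdist y)) \<partial>torus)"
    proof (intro nn_integral_mono)
      fix y
      have "norm (jackson N y *\<^sub>R (g (x + y) - g x)) \<le> jackson N y * (e + L * tdist y)"
        using L(2)[of x y] by (simp add: abs_mult mult_left_mono)
      also have "\<dots> = e * jackson N y + L * (jackson N y * tdist y)" by (simp add: algebra_simps)
      finally show "ennreal (norm (jackson N y *\<^sub>R (g (x + y) - g x))) \<le> ennreal e * ennreal (jackson N y) + ennreal L * (ennreal (jackson N y) * ennreal (tdist y))"
        using e L(1) by (simp add: ennreal_leI flip: ennreal_mult ennreal_plus)
    qed
    also have "\<dots> = ennreal e * (\<integral>\<^sup>+y. ennreal (jackson N y) \<partial>torus) + ennreal L * (\<integral>\<^sup>+y. ennreal (jackson N y) * ennreal (tdist y) \<partial>torus)"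
      by (subst nn_integral_add, simp, simp, subst nn_integral_cmult, simp, subst nn_integral_cmult) auto
    also have "\<dots> \<le> ennreal e * 1 + ennreal L * ennreal (69 / N)"
      by (intro add_mono mult_left_mono nn_integral_jackson_tdist N) (auto simp: nn_integral_jackson N)
    also have "\<dots> = ennreal (e + L * 69 / N)"
      using e L(1) by (simp flip: ennreal_mult ennreal_plus)
    finally show ?thesis using e L(1) by (subst (asm) ennreal_le_iff) auto
  qed
  then show ?thesis using that[of "L * 69"] L(1) by auto
qed

lemma nn_integral_sq_triangle:
  fixes f g h :: "'a \<Rightarrow> 'b::euclidean_space"
  assumes [measurable]: "f \<in> borel_measurable M" "g \<in> borel_measurable M" "h \<in> borel_measurable M"
  shows "(\<integral>\<^sup>+x. ennreal (norm (f x - h x)) ^ 2 \<partial>M) \<le>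
    2 * (\<integral>\<^sup>+x. ennreal (norm (f x - g x)) ^ 2 \<partial>M) + 2 * (\<integral>\<^sup>+x. ennreal (norm (g x - h x)) ^ 2 \<partial>M)"
proof -
  have "ennreal (norm (f x - h x)) ^ 2 \<le> 2 * ennreal (norm (f x - g x)) ^ 2 + 2 * ennreal (norm (g x - h x)) ^ 2" for x
  proof -
    have "norm (f x - h x) ^ 2 \<le> (norm (f x - g x) + norm (g x - h x)) ^ 2"
      by (intro power_mono) (auto intro: norm_triangle_le_diff simp: norm_triangle_sub dist_norm[symmetric] dist_triangle)
    also have "\<dots> \<le> 2 * norm (f x - g x) ^ 2 + 2 * norm (g x - h x) ^ 2"
      using sum_squares_bound[of "norm (f x - g x)" "norm (g x - h x)"] by (simp add: power2_sum)
    finally have "ennreal (norm (f x - h x) ^ 2) \<le> ennreal (2 * norm (f x - g x) ^ 2 + 2 * norm (g x - h x) ^ 2)"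
      by (rule ennreal_leI)
    then show ?thesis by (simp add: ennreal_power ennreal_mult)
  qed
  then have "(\<integral>\<^sup>+x. ennreal (norm (f x - h x)) ^ 2 \<partial>M) \<le> (\<integral>\<^sup>+x. 2 * ennreal (norm (f x - g x)) ^ 2 + 2 * ennreal (norm (g x - h x)) ^ 2 \<partial>M)"
    by (intro nn_integral_mono)
  also have "\<dots> = 2 * (\<integral>\<^sup>+x. ennreal (norm (f x - g x)) ^ 2 \<partial>M) + 2 * (\<integral>\<^sup>+x. ennreal (norm (g x - h x)) ^ 2 \<partial>M)"
    by (subst nn_integral_add, measurable, subst nn_integral_cmult, measurable, subst nn_integral_cmult) auto
  finally show ?thesis .
qed

lemma nn_integral_sq_triangle_bound:
  fixes f g h :: "'a \<Rightarrow> 'b::euclidean_space"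
  assumes "f \<in> borel_measurable M" "g \<in> borel_measurable M" "h \<in> borel_measurable M"
    and "(\<integral>\<^sup>+x. ennreal (norm (f x - g x)) ^ 2 \<partial>M) \<le> ennreal a" "(\<integral>\<^sup>+x. ennreal (norm (g x - h x)) ^ 2 \<partial>M) \<le> ennreal b"
    and "0 \<le> a" "0 \<le> b"
  shows "(\<integral>\<^sup>+x. ennreal (norm (f x - h x)) ^ 2 \<partial>M) \<le> ennreal (2 * a + 2 * b)"
proof -
  have "(\<integral>\<^sup>+x. ennreal (norm (f x - h x)) ^ 2 \<partial>M) \<le>
    2 * (\<integral>\<^sup>+x. ennreal (norm (f x - g x)) ^ 2 \<partial>M) + 2 * (\<integral>\<^sup>+x. ennreal (norm (g x - h x)) ^ 2 \<partial>M)"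
    by (rule nn_integral_sq_triangle) fact+
  also have "\<dots> \<le> 2 * ennreal a + 2 * ennreal b"
    by (intro add_mono mult_left_mono assms) auto
  also have "\<dots> = ennreal (2 * a + 2 * b)"
    using assms by (simp add: ennreal_mult)
  finally show ?thesis .
qed

lemma nn_integral_tendsto_0_dominated:
  fixes f :: "nat \<Rightarrow> 'a \<Rightarrow> ennreal"
  assumes "\<And>n. f n \<in> borel_measurable M" "w \<in> borel_measurable M" "\<And>n x. f n x \<le> w x"
    and "(\<integral>\<^sup>+x. w x \<partial>M) < \<infinity>" "AE x in M. (\<lambda>n. f n x) \<longlonglongrightarrow> 0"
  shows "(\<lambda>n. \<integral>\<^sup>+x. f n x \<partial>M) \<longlonglongrightarrow> 0"
  using nn_integral_dominated_convergence[of f M "\<lambda>_. 0" w] assms by simp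

lemma tendsto_0_ennreal_sq:
  assumes "f \<longlonglongrightarrow> (0::real)" shows "(\<lambda>n. ennreal \<bar>f n\<bar> ^ 2) \<longlonglongrightarrow> 0"
proof -
  have "(\<lambda>n. ennreal (\<bar>f n\<bar> ^ 2)) \<longlonglongrightarrow> ennreal (\<bar>0\<bar> ^ 2)" by (intro tendsto_intros assms)
  then show ?thesis by (simp add: ennreal_power)
qed

definition trunc :: "real \<Rightarrow> real \<Rightarrow> real" where "trunc M s = max (- M) (min M s)"

lemma trunc_abs: "0 \<le> M \<Longrightarrow> \<bar>trunc M s\<bar> \<le> M"
  and trunc_diff: "0 \<le> M \<Longrightarrow> \<bar>s - trunc M s\<bar> \<le> \<bar>s\<bar>"
  and trunc_eq: "\<bar>s\<bar> \<le> M \<Longrightarrow> trunc M s = s"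
  by (auto simp: trunc_def)

lemma trunc_continuous [continuous_intros]: "continuous_on S f \<Longrightarrow> continuous_on S (\<lambda>x. trunc M (f x))"
  unfolding trunc_def by (intro continuous_intros)

lemma trunc_measurable [measurable]: "trunc M \<in> borel_measurable borel"
  by (intro borel_measurable_continuous_onI continuous_intros)

text \<open>The factor \<open>min 1 (n * \<bar>sin (pi * x $ i)\<bar>)\<close> vanishes on the faces of the cells, so that the
  product with a function of the fractional parts is continuous.\<close>

lemma continuous_cell_cutoff:
  fixes h :: "real^3 \<Rightarrow> real"
  assumes h: "continuous_on UNIV h" and M: "\<And>x. \<bar>h x\<bar> \<le> M"
  shows "continuous_on UNIV (\<lambda>x. (\<Prod>i\<in>UNIV. min 1 (real n * \<bar>sin (pi * x $ i)\<bar>)) * h (frac3 x))"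
    (is "continuous_on UNIV (\<lambda>x. ?\<theta> x * h (frac3 x))")
proof (rule continuous_at_imp_continuous_on, intro ballI)
  fix x :: "real^3"
  have M0: "0 \<le> M" using M abs_ge_zero order_trans by blast
  have \<theta>c: "continuous_on UNIV ?\<theta>" by (intro continuous_intros)
  then have \<theta>x: "isCont ?\<theta> x" by (simp add: continuous_on_eq_continuous_at)
  show "isCont (\<lambda>x. ?\<theta> x * h (frac3 x)) x"
  proof (cases "\<exists>i. x $ i \<in> \<int>")
    case True
    then obtain i where "x $ i \<in> \<int>" by blast
    then have "sin (pi * x $ i) = 0" by (simp add: sin_zero_iff_int2 mult.commute) (metis Ints_cases mult.commute)
    then have \<theta>0: "?\<theta> x = 0" by (simp, intro exI[of _ i]) simp
    have "((\<lambda>y. ?\<theta> y * h (frac3 y)) \<longlongrightarrow> 0) (at x)"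
    proof (rule tendsto_0_le[where K=M])
      show "(?\<theta> \<longlongrightarrow> 0) (at x)" using \<theta>x \<theta>0 by (simp add: isCont_def)
      show "\<forall>\<^sub>F y in at x. norm (?\<theta> y * h (frac3 y)) \<le> norm (?\<theta> y) * M"
        using M by (intro always_eventually allI) (simp add: abs_mult mult_left_mono)
    qed
    then show ?thesis by (simp only: isCont_def \<theta>0 mult_zero_left)
  next
    case False
    have "isCont frac3 x"
      unfolding frac3_def isCont_def
    proof (rule tendsto_vec_lambda)
      fix i
      have "isCont (\<lambda>x. x $ i) x" by (intro continuous_intros)
      moreover have "isCont frac (x $ i)" using False by (intro continuous_frac) auto
      ultimately have "isCont (\<lambda>x. frac (x $ i)) x" by (rule isCont_o2)
      then show "((\<lambda>x. frac (x $ i)) \<longlongrightarrow> frac (x $ i)) (at x)" by (simp add: isCont_def)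
    qed
    moreover have "isCont h (frac3 x)" using h by (simp add: continuous_on_eq_continuous_at)
    ultimately have "isCont (\<lambda>x. h (frac3 x)) x" by (rule isCont_o2)
    with \<theta>x show ?thesis by (rule isCont_mult)
  qed
qed

text \<open>Truncation comes first so that the second limit has a constant majorant. The truncated
  function is an almost everywhere limit of continuous functions; these are clamped, made periodic
  through \<open>frac3\<close>, and multiplied by the cell cutoff, which repairs continuity across
  the faces.\<close>

lemma continuous_periodic_dense_L2:
  fixes f :: "real^3 \<Rightarrow> real"
  assumes f [measurable]: "f \<in> borel_measurable borel" and p: "periodic f"
    and L2: "(\<integral>\<^sup>+x. ennreal \<bar>f x\<bar> ^ 2 \<partial>torus) < \<infinity>" and e: "0 < e"
  obtains g where "continuous_on UNIV g" "periodic g" "(\<integral>\<^sup>+x. ennreal \<bar>f x - g x\<bar> ^ 2 \<partial>torus) \<le> ennreal e"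
proof -
  have "(\<lambda>M. \<integral>\<^sup>+x. ennreal \<bar>f x - trunc (real M) (f x)\<bar> ^ 2 \<partial>torus) \<longlonglongrightarrow> 0"
  proof (rule nn_integral_tendsto_0_dominated[where w="\<lambda>x. ennreal \<bar>f x\<bar> ^ 2"])
    show "AE x in torus. (\<lambda>M. ennreal \<bar>f x - trunc (real M) (f x)\<bar> ^ 2) \<longlonglongrightarrow> 0"
    proof (intro AE_I2 tendsto_0_ennreal_sq tendsto_eventually)
      fix x
      show "\<forall>\<^sub>F M in sequentially. f x - trunc (real M) (f x) = 0"
        using eventually_ge_at_top[of "nat \<lceil>\<bar>f x\<bar>\<rceil>"]
      proof eventually_elim
        case (elim M)
        then have "\<bar>f x\<bar> \<le> real M" by linarith
        then show ?case by (simp add: trunc_eq)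
      qed
    qed
  qed (use L2 in \<open>auto intro!: power_mono ennreal_leI trunc_diff\<close>)
  then obtain M where M: "(\<integral>\<^sup>+x. ennreal \<bar>f x - trunc (real M) (f x)\<bar> ^ 2 \<partial>torus) < ennreal (e / 4)"
    using order_tendstoD(2)[of _ 0 sequentially "ennreal (e/4)"] e by (auto simp: eventually_sequentially)
  have "(\<lambda>x. trunc (real M) (f x)) \<in> borel_measurable lebesgue"
    by (rule measurable_completion) simp
  then have "(\<lambda>x. trunc (real M) (f x)) measurable_on UNIV"
    by (simp add: measurable_on_iff_borel_measurable)
  then obtain S g where S: "negligible S" and g: "\<And>n. continuous_on UNIV (g n)"
    and lim: "\<And>x. x \<notin> S \<Longrightarrow> (\<lambda>n. g n x) \<longlonglongrightarrow> trunc (real M) (f x)"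
    unfolding measurable_on_def by auto
  define \<theta> where "\<theta> n x = (\<Prod>i\<in>UNIV. min 1 (real n * \<bar>sin (pi * x $ i)\<bar>))" for n and x :: "real^3"
  define G where "G n x = \<theta> n x * trunc (real M) (g n (frac3 x))" for n x
  have G_cont: "continuous_on UNIV (G n)" for n
    unfolding G_def[abs_def] \<theta>_def
    by (rule continuous_cell_cutoff[where M="real M"]) (auto intro!: continuous_intros g trunc_abs)
  then have [measurable]: "G n \<in> borel_measurable borel" for n by (rule borel_measurable_continuous_onI)
  have G_per: "periodic (G n)" for n
  proof -
    have "\<bar>sin (pi * (x + axis i 1) $ j)\<bar> = \<bar>sin (pi * x $ j)\<bar>" for x :: "real^3" and i j
      by (simp add: axis_def distrib_left)
    then show ?thesis using frac3_periodic unfolding periodic_def G_def \<theta>_def by simp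
  qed
  have \<theta>1: "0 \<le> \<theta> n x \<and> \<theta> n x \<le> 1" for n x
    unfolding \<theta>_def by (intro conjI prod_nonneg prod_le_1) auto
  have G_bd: "\<bar>G n x\<bar> \<le> M" for n x
    using mult_mono[of "\<theta> n x" 1 "\<bar>trunc (real M) (g n (frac3 x))\<bar>" "real M"] \<theta>1[of n x] trunc_abs[of "real M"]
    by (simp add: G_def abs_mult)
  have G_lim: "AE x in torus. (\<lambda>n. G n x) \<longlonglongrightarrow> trunc (real M) (f x)"
  proof -
    have "AE x in lborel. x \<notin> S"
      using AE_not_in[of S lebesgue] S by (simp add: negligible_iff_null_sets AE_completion_iff)
    moreover have "AE x in lborel. \<forall>i. (x::real^3) $ i \<noteq> 0"
      using AE_lborel_component_neq by (simp add: AE_all_countable)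
    ultimately have "AE x in lborel. x \<in> unit_cell \<longrightarrow> (\<lambda>n. G n x) \<longlonglongrightarrow> trunc (real M) (f x)"
    proof eventually_elim
      case (elim x)
      show ?case
      proof
        assume x: "x \<in> unit_cell"
        have "(\<lambda>n. min 1 (real n * \<bar>sin (pi * x $ i)\<bar>)) \<longlonglongrightarrow> 1" for i
        proof (rule tendsto_eventually)
          have "0 < x $ i" "x $ i < 1" using x elim(2) by (auto simp: unit_cell_def less_le)
          then have s: "0 < sin (pi * x $ i)" by (intro sin_gt_zero) auto
          show "\<forall>\<^sub>F n in sequentially. min 1 (real n * \<bar>sin (pi * x $ i)\<bar>) = 1"
            using eventually_ge_at_top[of "nat \<lceil>1 / sin (pi * x $ i)\<rceil>"]
          proof eventually_elim
            case (elim n)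
            then have "1 / sin (pi * x $ i) \<le> real n" by linarith
            then show ?case using s by (simp add: field_simps min_def)
          qed
        qed
        then have "(\<lambda>n. \<theta> n x) \<longlonglongrightarrow> (\<Prod>i\<in>(UNIV::3 set). 1)" unfolding \<theta>_def by (intro tendsto_prod)
        moreover have "(\<lambda>n. trunc (real M) (g n x)) \<longlonglongrightarrow> trunc (real M) (trunc (real M) (f x))"
          unfolding trunc_def[of "real M" "g _ x"] trunc_def[of "real M" "trunc _ _"] by (intro tendsto_intros lim elim)
        ultimately have "(\<lambda>n. \<theta> n x * trunc (real M) (g n x)) \<longlonglongrightarrow> 1 * trunc (real M) (trunc (real M) (f x))"
          by (intro tendsto_mult) simp_all
        then show "(\<lambda>n. G n x) \<longlonglongrightarrow> trunc (real M) (f x)"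
          using trunc_abs[of "real M" "f x"] by (simp add: G_def frac3_unit_cell[OF x] trunc_eq)
      qed
    qed
    then show ?thesis by (simp add: AE_torus_iff)
  qed
  have "(\<lambda>n. \<integral>\<^sup>+x. ennreal \<bar>trunc (real M) (f x) - G n x\<bar> ^ 2 \<partial>torus) \<longlonglongrightarrow> 0"
  proof (rule nn_integral_tendsto_0_dominated[where w="\<lambda>_. ennreal (2 * real M) ^ 2"])
    show "AE x in torus. (\<lambda>n. ennreal \<bar>trunc (real M) (f x) - G n x\<bar> ^ 2) \<longlonglongrightarrow> 0"
      using G_lim
    proof eventually_elim
      case (elim x)
      then show ?case by (auto intro!: tendsto_0_ennreal_sq tendsto_eq_intros)
    qed
    fix n x
    show "ennreal \<bar>trunc (real M) (f x) - G n x\<bar> ^ 2 \<le> ennreal (2 * real M) ^ 2"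
      using trunc_abs[of "real M" "f x"] G_bd[of n x] by (intro power_mono ennreal_leI) auto
  qed (auto simp: ennreal_power ennreal_mult_less_top)
  then obtain n where n: "(\<integral>\<^sup>+x. ennreal \<bar>trunc (real M) (f x) - G n x\<bar> ^ 2 \<partial>torus) < ennreal (e / 4)"
    using order_tendstoD(2)[of _ 0 sequentially "ennreal (e/4)"] e by (auto simp: eventually_sequentially)
  have "(\<integral>\<^sup>+x. ennreal (norm (f x - G n x)) ^ 2 \<partial>torus) \<le> ennreal (2 * (e/4) + 2 * (e/4))"
    by (rule nn_integral_sq_triangle_bound[where g="\<lambda>x. trunc (real M) (f x)"])
       (use M n e in \<open>auto intro: less_imp_le\<close>)
  then show ?thesis using that[of "G n"] G_cont G_per by simp
qed

lemma integrable_of_square_integrable: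
  fixes f :: "real^3 \<Rightarrow> 'b::euclidean_space"
  assumes [measurable]: "f \<in> borel_measurable borel" and "(\<integral>\<^sup>+x. ennreal (norm (f x)) ^ 2 \<partial>torus) < \<infinity>"
  shows "integrable torus f"
proof (rule integrableI_bounded)
  have "(\<integral>\<^sup>+x. ennreal (norm (f x)) * 1 \<partial>torus)\<^sup>2 \<le> (\<integral>\<^sup>+x. ennreal (norm (f x)) ^ 2 \<partial>torus) * (\<integral>\<^sup>+x. 1 ^ 2 \<partial>torus)"
    by (rule Cauchy_Schwarz_nn_integral) auto
  also have "\<dots> < \<infinity>" using assms by simp
  finally show "(\<integral>\<^sup>+x. ennreal (norm (f x)) \<partial>torus) < \<infinity>"
    by (cases "(\<integral>\<^sup>+x. ennreal (norm (f x)) \<partial>torus) = top") (auto simp: top_power_ennreal less_top)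
qed simp

lemma conv_diff:
  fixes f g :: "real^3 \<Rightarrow> 'b::euclidean_space"
  assumes "f \<in> borel_measurable borel" "periodic f" "integrable torus f"
    "g \<in> borel_measurable borel" "periodic g" "integrable torus g"
  shows "conv N (\<lambda>x. f x - g x) x = conv N f x - conv N g x"
  using integrable_jackson_translate[OF assms(1-3), of N x] integrable_jackson_translate[OF assms(4-6), of N x]
  by (simp add: conv_def scaleR_diff_right Bochner_Integration.integral_diff)

lemma conv_tendsto_L2_real:
  fixes f :: "real^3 \<Rightarrow> real"
  assumes f [measurable]: "f \<in> borel_measurable borel" and p: "periodic f"
    and L2: "(\<integral>\<^sup>+x. ennreal \<bar>f x\<bar> ^ 2 \<partial>torus) < \<infinity>"
  shows "(\<lambda>N. \<integral>\<^sup>+x. ennreal \<bar>conv N f x - f x\<bar> ^ 2 \<partial>torus) \<longlonglongrightarrow> 0"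
proof (rule order_tendstoI)
  fix a :: ennreal assume "0 < a"
  then obtain b where b: "0 < b" "b < a" using dense by blast
  obtain e where e: "0 < e" "ennreal e < a"
  proof (cases b)
    case (real r)
    then show ?thesis using b that[of r] by (auto simp: zero_less_iff_neq_zero ennreal_eq_0_iff not_le)
  next
    case top
    then show ?thesis using b by simp
  qed
  \<comment> \<open>Two squared triangle inequalities cost 2 d + 2 (2 d + 2 d) = 10 d, which is
    below \<open>e\<close>. The uniform error is split as r + r with r = sqrt d / 2.\<close>
  define d where "d = e / 16"
  have d: "0 < d" using e by (simp add: d_def)
  obtain g where g: "continuous_on UNIV g" "periodic g" "(\<integral>\<^sup>+x. ennreal \<bar>f x - g x\<bar> ^ 2 \<partial>torus) \<le> ennreal d"
    using continuous_periodic_dense_L2[OF f p L2 d] by blast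
  have gm [measurable]: "g \<in> borel_measurable borel" using g(1) by (rule borel_measurable_continuous_onI)
  obtain M where M: "\<And>x. \<bar>g x\<bar> \<le> M" using periodic_uniform_bound[OF g(1,2)] by blast
  have intg: "integrable torus g" using M by (intro integrable_torus_bounded[where C=M]) auto
  have intf: "integrable torus f" using L2 by (intro integrable_of_square_integrable) auto
  define r where "r = sqrt d / 2"
  have r: "0 < r" using d by (simp add: r_def)
  obtain L where L: "0 \<le> L" "\<And>N x. 0 < N \<Longrightarrow> \<bar>conv N g x - g x\<bar> \<le> r + L / real N"
    using conv_uniform_bound[OF g(1,2) r] by blast
  have "\<forall>\<^sub>F N in sequentially. L / r \<le> real N \<and> 0 < N"
    using eventually_ge_at_top[of "nat \<lceil>L / r\<rceil>"] eventually_gt_at_top[of 0]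
    by eventually_elim linarith
  then show "\<forall>\<^sub>F N in sequentially. (\<integral>\<^sup>+x. ennreal \<bar>conv N f x - f x\<bar> ^ 2 \<partial>torus) < a"
  proof eventually_elim
    case (elim N)
    have "L / real N \<le> r" using elim r by (simp add: field_simps)
    then have cg: "\<bar>conv N g x - g x\<bar> \<le> sqrt d" for x
    proof -
      have "sqrt d = r + r" by (simp add: r_def)
      then show ?thesis using L(2)[of N x] elim \<open>L / real N \<le> r\<close> by linarith
    qed
    have 1: "(\<integral>\<^sup>+x. ennreal \<bar>conv N f x - conv N g x\<bar> ^ 2 \<partial>torus) \<le> ennreal d"
    proof -
      have "(\<integral>\<^sup>+x. ennreal \<bar>conv N f x - conv N g x\<bar> ^ 2 \<partial>torus) = (\<integral>\<^sup>+x. ennreal (norm (conv N (\<lambda>x. f x - g x) x)) ^ 2 \<partial>torus)"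
        by (simp add: conv_diff[OF f p intf gm g(2) intg])
      also have "\<dots> \<le> (\<integral>\<^sup>+x. ennreal (norm (f x - g x)) ^ 2 \<partial>torus)"
        using p g(2) elim by (intro conv_L2_contraction) (auto simp: periodic_def)
      finally show ?thesis using g(3) by simp
    qed
    have 2: "(\<integral>\<^sup>+x. ennreal \<bar>conv N g x - g x\<bar> ^ 2 \<partial>torus) \<le> ennreal d"
    proof -
      have "(\<integral>\<^sup>+x. ennreal \<bar>conv N g x - g x\<bar> ^ 2 \<partial>torus) \<le> (\<integral>\<^sup>+x. ennreal (sqrt d) ^ 2 \<partial>torus)"
        by (intro nn_integral_mono power_mono ennreal_leI cg) auto
      also have "\<dots> = ennreal d" using d by (simp add: ennreal_power)
      finally show ?thesis .
    qed
    have 3: "(\<integral>\<^sup>+x. ennreal (norm (conv N g x - f x)) ^ 2 \<partial>torus) \<le> ennreal (2 * d + 2 * d)"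
      by (rule nn_integral_sq_triangle_bound[where g=g])
         (use 2 g(3) d in \<open>auto simp: abs_minus_commute\<close>)
    have "(\<integral>\<^sup>+x. ennreal (norm (conv N f x - f x)) ^ 2 \<partial>torus) \<le> ennreal (2 * d + 2 * (2 * d + 2 * d))"
      by (rule nn_integral_sq_triangle_bound[where g="conv N g"])
         (use 1 3 d in auto)
    also have "\<dots> \<le> ennreal e" using e(1) by (intro ennreal_leI) (simp add: d_def)
    finally show ?case using e(2) by simp
  qed
qed simp

subsection \<open>Square integrable periodic fields\<close>

definition L2per :: "(real^3 \<Rightarrow> 'b::euclidean_space) \<Rightarrow> bool" where
  "L2per f \<longleftrightarrow> f \<in> borel_measurable borel \<and> periodic f \<and> (\<integral>\<^sup>+x. ennreal (norm (f x)) ^ 2 \<partial>torus) < \<infinity>"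

lemma L2perD:
  assumes "L2per f"
  shows "f \<in> borel_measurable borel" "periodic f" "(\<integral>\<^sup>+x. ennreal (norm (f x)) ^ 2 \<partial>torus) < \<infinity>" "integrable torus f"
proof -
  show *: "f \<in> borel_measurable borel" "periodic f" "(\<integral>\<^sup>+x. ennreal (norm (f x)) ^ 2 \<partial>torus) < \<infinity>"
    using assms unfolding L2per_def by blast+
  show "integrable torus f" by (rule integrable_of_square_integrable[OF *(1,3)])
qed

lemma L2per_component: fixes f :: "real^3 \<Rightarrow> real^3" assumes "L2per f" shows "L2per (\<lambda>x. f x $ i)"
  unfolding L2per_def
proof (intro conjI)
  note [measurable] = L2perD(1)[OF assms]
  show "(\<lambda>x. f x $ i) \<in> borel_measurable borel" by measurable
  show "periodic (\<lambda>x. f x $ i)" using L2perD(2)[OF assms] by (simp add: periodic_def)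
  have "(\<integral>\<^sup>+x. ennreal (norm (f x $ i)) ^ 2 \<partial>torus) \<le> (\<integral>\<^sup>+x. ennreal (norm (f x)) ^ 2 \<partial>torus)"
    by (intro nn_integral_mono power_mono ennreal_leI) (auto simp: component_le_norm_cart)
  with L2perD(3)[OF assms] show "(\<integral>\<^sup>+x. ennreal (norm (f x $ i)) ^ 2 \<partial>torus) < \<infinity>" by (rule order.strict_trans1[rotated])
qed

lemma L2per_bounded:
  fixes f :: "real^3 \<Rightarrow> 'b::euclidean_space"
  assumes [measurable]: "f \<in> borel_measurable borel" and "periodic f" "\<And>x. norm (f x) \<le> C"
  shows "L2per f"
  unfolding L2per_def
proof (intro conjI assms)
  have "(\<integral>\<^sup>+x. ennreal (norm (f x)) ^ 2 \<partial>torus) \<le> (\<integral>\<^sup>+x. ennreal C ^ 2 \<partial>torus)"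
    by (intro nn_integral_mono power_mono ennreal_leI assms) auto
  also have "\<dots> < \<infinity>" by (simp add: power_less_top_ennreal)
  finally show "(\<integral>\<^sup>+x. ennreal (norm (f x)) ^ 2 \<partial>torus) < \<infinity>" .
qed

lemma integrable_L2_product:
  fixes f :: "real^3 \<Rightarrow> 'b::euclidean_space" and g :: "real^3 \<Rightarrow> 'c::euclidean_space" and h :: "real^3 \<Rightarrow> 'd::euclidean_space"
  assumes f: "L2per f" and g: "L2per g" and [measurable]: "h \<in> borel_measurable borel"
    and le: "\<And>x. norm (h x) \<le> norm (f x) * norm (g x)"
  shows "integrable torus h"
proof (rule integrableI_bounded)
  note [measurable] = L2perD(1)[OF f] L2perD(1)[OF g]
  have "(\<integral>\<^sup>+x. ennreal (norm (h x)) \<partial>torus)\<^sup>2 \<le> (\<integral>\<^sup>+x. ennreal (norm (f x)) * ennreal (norm (g x)) \<partial>torus)\<^sup>2"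
    using le by (intro power_mono nn_integral_mono) (auto simp flip: ennreal_mult intro!: ennreal_leI)
  also have "\<dots> \<le> (\<integral>\<^sup>+x. ennreal (norm (f x)) ^ 2 \<partial>torus) * (\<integral>\<^sup>+x. ennreal (norm (g x)) ^ 2 \<partial>torus)"
    by (rule Cauchy_Schwarz_nn_integral) auto
  also have "\<dots> < \<infinity>" using L2perD(3)[OF f] L2perD(3)[OF g] by (simp add: ennreal_mult_less_top)
  finally show "(\<integral>\<^sup>+x. ennreal (norm (h x)) \<partial>torus) < \<infinity>"
    by (cases "(\<integral>\<^sup>+x. ennreal (norm (h x)) \<partial>torus) = top") (auto simp: top_power_ennreal less_top)
qed simp

lemma integrable_inner_L2per:
  fixes f g :: "real^3 \<Rightarrow> 'b::euclidean_space"
  assumes f: "L2per f" and g: "L2per g"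
  shows "integrable torus (\<lambda>x. f x \<bullet> g x)"
proof -
  note [measurable] = L2perD(1)[OF f] L2perD(1)[OF g]
  show ?thesis by (rule integrable_L2_product[OF f g]) (auto simp: Cauchy_Schwarz_ineq2)
qed

lemma tendsto_0_ennreal_le:
  fixes f g :: "nat \<Rightarrow> ennreal"
  assumes "\<forall>\<^sub>F n in sequentially. f n \<le> g n" "g \<longlonglongrightarrow> 0"
  shows "f \<longlonglongrightarrow> 0"
  by (rule tendsto_sandwich[OF _ assms(1) tendsto_const assms(2)]) simp

lemma tendsto_inner_L2per:
  fixes f :: "nat \<Rightarrow> real^3 \<Rightarrow> 'b::euclidean_space"
  assumes fs: "\<And>s. L2per (f s)" and f: "L2per F" and g: "L2per g"
    and lim: "(\<lambda>s. \<integral>\<^sup>+x. ennreal (norm (f s x - F x)) ^ 2 \<partial>torus) \<longlonglongrightarrow> 0"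
  shows "(\<lambda>s. \<integral>x. f s x \<bullet> g x \<partial>torus) \<longlonglongrightarrow> (\<integral>x. F x \<bullet> g x \<partial>torus)"
proof -
  note [measurable] = L2perD(1)[OF fs] L2perD(1)[OF f] L2perD(1)[OF g]
  define G where "G = (\<integral>\<^sup>+x. ennreal (norm (g x)) ^ 2 \<partial>torus)"
  have G: "G < top" using L2perD(3)[OF g] by (simp add: G_def)
  have le: "ennreal (((\<integral>x. f s x \<bullet> g x \<partial>torus) - (\<integral>x. F x \<bullet> g x \<partial>torus))\<^sup>2) \<le> (\<integral>\<^sup>+x. ennreal (norm (f s x - F x)) ^ 2 \<partial>torus) * G" for s
  proof -
    let ?d = "(\<integral>x. f s x \<bullet> g x \<partial>torus) - (\<integral>x. F x \<bullet> g x \<partial>torus)"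
    have "?d = (\<integral>x. (f s x - F x) \<bullet> g x \<partial>torus)"
      using integrable_inner_L2per[OF fs g] integrable_inner_L2per[OF f g]
      by (simp add: inner_diff_left Bochner_Integration.integral_diff)
    then have "ennreal \<bar>?d\<bar> \<le> (\<integral>\<^sup>+x. ennreal (norm ((f s x - F x) \<bullet> g x)) \<partial>torus)"
      using ennreal_norm_integral_le[of torus "\<lambda>x. (f s x - F x) \<bullet> g x"] by simp
    also have "\<dots> \<le> (\<integral>\<^sup>+x. ennreal (norm (f s x - F x)) * ennreal (norm (g x)) \<partial>torus)"
      by (intro nn_integral_mono) (auto simp flip: ennreal_mult intro!: ennreal_leI Cauchy_Schwarz_ineq2)
    finally have "ennreal \<bar>?d\<bar> ^ 2 \<le> (\<integral>\<^sup>+x. ennreal (norm (f s x - F x)) * ennreal (norm (g x)) \<partial>torus) ^ 2"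
      by (intro power_mono) auto
    also have "\<dots> \<le> (\<integral>\<^sup>+x. ennreal (norm (f s x - F x)) ^ 2 \<partial>torus) * G"
      unfolding G_def by (rule Cauchy_Schwarz_nn_integral) auto
    finally show ?thesis by (simp add: ennreal_power)
  qed
  have "(\<lambda>s. G * (\<integral>\<^sup>+x. ennreal (norm (f s x - F x)) ^ 2 \<partial>torus)) \<longlonglongrightarrow> G * 0"
    using G by (intro ennreal_tendsto_cmult lim)
  then have "(\<lambda>s. G * (\<integral>\<^sup>+x. ennreal (norm (f s x - F x)) ^ 2 \<partial>torus)) \<longlonglongrightarrow> 0"
    by simp
  then have "(\<lambda>s. ennreal (((\<integral>x. f s x \<bullet> g x \<partial>torus) - (\<integral>x. F x \<bullet> g x \<partial>torus))\<^sup>2)) \<longlonglongrightarrow> 0"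
    by (rule tendsto_0_ennreal_le[rotated]) (auto simp: le mult.commute[of G])
  then have "(\<lambda>s. ennreal (((\<integral>x. f s x \<bullet> g x \<partial>torus) - (\<integral>x. F x \<bullet> g x \<partial>torus))\<^sup>2)) \<longlonglongrightarrow> ennreal 0"
    by simp
  then have "(\<lambda>s. ((\<integral>x. f s x \<bullet> g x \<partial>torus) - (\<integral>x. F x \<bullet> g x \<partial>torus))\<^sup>2) \<longlonglongrightarrow> 0"
    by (subst (asm) tendsto_ennreal_iff) auto
  then have "(\<lambda>s. sqrt (((\<integral>x. f s x \<bullet> g x \<partial>torus) - (\<integral>x. F x \<bullet> g x \<partial>torus))\<^sup>2)) \<longlonglongrightarrow> sqrt 0"
    by (rule tendsto_real_sqrt)
  then show ?thesis by (simp add: tendsto_rabs_zero_iff LIM_zero_iff)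
qed

text \<open>The expansion of the pairing in real coefficients is symmetric in \<open>f\<close> and
  \<open>g\<close>, and self-adjointness is read off from it.\<close>

lemma conv_self_adjoint:
  fixes f g :: "real^3 \<Rightarrow> 'b::euclidean_space"
  assumes f: "f \<in> borel_measurable borel" "periodic f" "integrable torus f"
    and g: "g \<in> borel_measurable borel" "periodic g" "integrable torus g"
  shows conv_inner: "(\<integral>x. conv N f x \<bullet> g x \<partial>torus) = (\<Sum>k\<in>cube (2*N). lam N k * (cosc k f \<bullet> cosc k g + sinc k f \<bullet> sinc k g))"
    and "(\<integral>x. conv N f x \<bullet> g x \<partial>torus) = (\<integral>x. f x \<bullet> conv N g x \<partial>torus)"
proof -
  have *: "(\<integral>x. conv N f x \<bullet> g x \<partial>torus) = (\<Sum>k\<in>cube (2*N). lam N k * (cosc k f \<bullet> cosc k g + sinc k f \<bullet> sinc k g))"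
    if f: "f \<in> borel_measurable borel" "periodic f" "integrable torus f"
      and g: "g \<in> borel_measurable borel" "periodic g" "integrable torus g" for f g :: "real^3 \<Rightarrow> 'b"
  proof -
    have "(\<integral>x. conv N f x \<bullet> g x \<partial>torus) = (\<integral>x. (\<Sum>k\<in>cube (2*N).
       lam N k * (cosc k f \<bullet> (cos (2 * pi * (freq k \<bullet> x)) *\<^sub>R g x)) + lam N k * (sinc k f \<bullet> (sin (2 * pi * (freq k \<bullet> x)) *\<^sub>R g x))) \<partial>torus)"
      by (simp add: conv_trig[OF f] inner_sum_left inner_add_left distrib_left mult_ac)
    also have "\<dots> = (\<Sum>k\<in>cube (2*N). lam N k * (cosc k f \<bullet> cosc k g) + lam N k * (sinc k f \<bullet> sinc k g))"
      unfolding cosc_def[of _ g] sinc_def[of _ g] using g(3)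
      by (subst Bochner_Integration.integral_sum)
         (simp_all del: inner_scaleR_right add: Bochner_Integration.integral_add)
    finally show ?thesis by (simp add: distrib_left)
  qed
  show "(\<integral>x. conv N f x \<bullet> g x \<partial>torus) = (\<Sum>k\<in>cube (2*N). lam N k * (cosc k f \<bullet> cosc k g + sinc k f \<bullet> sinc k g))"
    by (rule *[OF f g])
  show "(\<integral>x. conv N f x \<bullet> g x \<partial>torus) = (\<integral>x. f x \<bullet> conv N g x \<partial>torus)"
    using *[OF f g] *[OF g f] by (simp add: inner_commute)
qed

lemma norm_cosc_le: "integrable torus f \<Longrightarrow> norm (cosc k f) \<le> (\<integral>x. norm (f x) \<partial>torus)"
  and norm_sinc_le: "integrable torus f \<Longrightarrow> norm (sinc k f) \<le> (\<integral>x. norm (f x) \<partial>torus)"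
  unfolding cosc_def sinc_def
  by (rule order_trans[OF integral_norm_bound integral_mono[OF integrable_norm[OF integrable_cos]]],
      auto simp: mult_left_le_one_le)
     (rule order_trans[OF integral_norm_bound integral_mono[OF integrable_norm[OF integrable_sin]]],
      auto simp: mult_left_le_one_le)

lemma conv_bounded:
  fixes f :: "real^3 \<Rightarrow> 'b::euclidean_space"
  assumes "f \<in> borel_measurable borel" "periodic f" "integrable torus f"
  obtains C where "\<And>x. norm (conv N f x) \<le> C"
proof -
  have "norm (conv N f x) \<le> (\<Sum>k\<in>cube (2*N). \<bar>lam N k\<bar> * (norm (cosc k f) + norm (sinc k f)))" for x
    unfolding conv_trig[OF assms]
  proof (rule sum_norm_le)
    fix k
    have "norm (cos (2 * pi * (freq k \<bullet> x)) *\<^sub>R cosc k f + sin (2 * pi * (freq k \<bullet> x)) *\<^sub>R sinc k f) \<le> norm (cosc k f) + norm (sinc k f)"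
      by (rule order_trans[OF norm_triangle_ineq]) (auto intro!: add_mono mult_left_le_one_le)
    then show "norm (lam N k *\<^sub>R (cos (2 * pi * (freq k \<bullet> x)) *\<^sub>R cosc k f + sin (2 * pi * (freq k \<bullet> x)) *\<^sub>R sinc k f)) \<le> \<bar>lam N k\<bar> * (norm (cosc k f) + norm (sinc k f))"
      by (simp add: mult_left_mono)
  qed
  then show ?thesis using that by blast
qed

lemma L2per_conv:
  fixes f :: "real^3 \<Rightarrow> 'b::euclidean_space"
  assumes "f \<in> borel_measurable borel" "periodic f" "integrable torus f"
  shows "L2per (conv N f)"
proof -
  obtain C where "\<And>x. norm (conv N f x) \<le> C" using conv_bounded[OF assms] by blast
  then show ?thesis by (intro L2per_bounded) (use assms in \<open>auto intro: conv_measurable periodic_conv\<close>)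
qed

lemma conv_component:
  fixes f :: "real^3 \<Rightarrow> real^3"
  assumes "f \<in> borel_measurable borel" "periodic f" "integrable torus f"
  shows "conv N f x $ i = conv N (\<lambda>x. f x $ i) x"
proof -
  have "(\<integral>y. (jackson N y *\<^sub>R f (x + y)) \<bullet> axis i 1 \<partial>torus) = conv N f x \<bullet> axis i 1"
    unfolding conv_def by (rule integral_inner_left) (rule integrable_jackson_translate[OF assms])
  then show ?thesis by (simp add: inner_axis conv_def)
qed

lemma norm_sq_vec3: "ennreal (norm (v::real^3)) ^ 2 = (\<Sum>i\<in>UNIV. ennreal \<bar>v $ i\<bar> ^ 2)"
proof -
  have "(norm v)\<^sup>2 = (\<Sum>i\<in>UNIV. \<bar>v $ i\<bar>\<^sup>2)"
    by (simp add: norm_vec_def L2_set_def sum_nonneg)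
  then show ?thesis by (simp add: ennreal_power)
qed

lemma conv_tendsto_L2:
  fixes f :: "real^3 \<Rightarrow> real^3"
  assumes f: "L2per f"
  shows "(\<lambda>N. \<integral>\<^sup>+x. ennreal (norm (conv N f x - f x)) ^ 2 \<partial>torus) \<longlonglongrightarrow> 0"
proof -
  note [measurable] = L2perD(1)[OF f]
  have "(\<integral>\<^sup>+x. ennreal (norm (conv N f x - f x)) ^ 2 \<partial>torus) =
    (\<Sum>i\<in>UNIV. \<integral>\<^sup>+x. ennreal \<bar>conv N (\<lambda>x. f x $ i) x - f x $ i\<bar> ^ 2 \<partial>torus)" for N
    unfolding norm_sq_vec3
    by (subst nn_integral_sum) (auto simp: conv_component[OF L2perD(1,2,4)[OF f]])
  moreover have "(\<lambda>N. \<Sum>i\<in>UNIV. \<integral>\<^sup>+x. ennreal \<bar>conv N (\<lambda>x. f x $ i) x - f x $ i\<bar> ^ 2 \<partial>torus) \<longlonglongrightarrow> (\<Sum>i\<in>(UNIV::3 set). 0)"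
    using L2perD[OF L2per_component[OF f]] by (intro tendsto_sum conv_tendsto_L2_real) auto
  ultimately show ?thesis by simp
qed

text \<open>The outer convolution is an L2 contraction, so the error of two convolutions is
  controlled by the error of one.\<close>

lemma conv_conv_tendsto_L2:
  fixes f :: "real^3 \<Rightarrow> real^3"
  assumes f: "L2per f"
  shows "(\<lambda>N. \<integral>\<^sup>+x. ennreal (norm (conv N (conv N f) x - f x)) ^ 2 \<partial>torus) \<longlonglongrightarrow> 0"
proof -
  note [measurable] = L2perD(1)[OF f]
  let ?e = "\<lambda>N. \<integral>\<^sup>+x. ennreal (norm (conv N f x - f x)) ^ 2 \<partial>torus"
  have "(\<integral>\<^sup>+x. ennreal (norm (conv N (conv N f) x - f x)) ^ 2 \<partial>torus) \<le> 2 * ?e N + 2 * ?e N" if "0 < N" for N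
  proof -
    have c: "L2per (conv N f)" by (rule L2per_conv[OF L2perD(1,2,4)[OF f]])
    have "(\<integral>\<^sup>+x. ennreal (norm (conv N (conv N f) x - conv N f x)) ^ 2 \<partial>torus) = (\<integral>\<^sup>+x. ennreal (norm (conv N (\<lambda>x. conv N f x - f x) x)) ^ 2 \<partial>torus)"
      by (simp add: conv_diff[OF L2perD(1,2,4)[OF c] L2perD(1,2,4)[OF f]])
    also have "\<dots> \<le> ?e N"
      using L2perD(2)[OF f] L2perD(2)[OF c] that by (intro conv_L2_contraction) (auto simp: periodic_def)
    finally have "2 * (\<integral>\<^sup>+x. ennreal (norm (conv N (conv N f) x - conv N f x)) ^ 2 \<partial>torus) + 2 * ?e N \<le> 2 * ?e N + 2 * ?e N"
      by (intro add_mono mult_left_mono) auto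
    moreover have "(\<integral>\<^sup>+x. ennreal (norm (conv N (conv N f) x - f x)) ^ 2 \<partial>torus) \<le>
        2 * (\<integral>\<^sup>+x. ennreal (norm (conv N (conv N f) x - conv N f x)) ^ 2 \<partial>torus) + 2 * ?e N"
      by (rule nn_integral_sq_triangle) measurable
    ultimately show ?thesis by (rule order_trans[rotated])
  qed
  then have ev: "\<forall>\<^sub>F N in sequentially. (\<integral>\<^sup>+x. ennreal (norm (conv N (conv N f) x - f x)) ^ 2 \<partial>torus) \<le> 2 * ?e N + 2 * ?e N"
    using eventually_gt_at_top[of 0] by (rule eventually_mono[rotated])
  have "(\<lambda>N. 2 * ?e N + 2 * ?e N) \<longlonglongrightarrow> 2 * 0 + 2 * 0"
    by (intro tendsto_add ennreal_tendsto_cmult conv_tendsto_L2 f) auto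
  then have lim: "(\<lambda>N. 2 * ?e N + 2 * ?e N) \<longlonglongrightarrow> 0" by simp
  show ?thesis by (rule tendsto_0_ennreal_le[OF ev lim])
qed

subsection \<open>Littlewood--Paley blocks\<close>

lemma torus_integral_eq:
  fixes f :: "real^3 \<Rightarrow> 'b::euclidean_space"
  assumes f [measurable]: "f \<in> borel_measurable borel"
  shows "torus_integral f = integral\<^sup>L torus f"
proof -
  have "torus_integral f = (\<integral>x. indicator (cbox 0 1) x *\<^sub>R f x \<partial>lborel)"
    unfolding torus_integral_def set_lebesgue_integral_def by (rule integral_completion) simp
  also have "\<dots> = (\<integral>x. indicator unit_cell x *\<^sub>R f x \<partial>lborel)"
    using unit_cell_AE_cbox by (intro integral_cong_AE) (auto elim!: eventually_mono simp: indicator_def)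
  also have "\<dots> = integral\<^sup>L (density lborel (\<lambda>x. ennreal (indicator unit_cell x))) f"
    by (subst integral_density) auto
  also have "(\<lambda>x. ennreal (indicator unit_cell x)) = indicator unit_cell" by (auto simp: indicator_def)
  finally show ?thesis by (simp add: torus_def)
qed

definition fc :: "(real^3 \<Rightarrow> real) \<Rightarrow> int^3 \<Rightarrow> complex" where
  "fc f k = Complex (cosc k f) (- sinc k f)"

lemma fourier_coeff_eq:
  assumes [measurable]: "f \<in> borel_measurable borel" and f: "integrable torus f"
  shows "fourier_coeff f k = fc f k"
proof -
  have c: "cis (- 2 * pi * (freq k \<bullet> x)) = Complex (cos (2 * pi * (freq k \<bullet> x))) (- sin (2 * pi * (freq k \<bullet> x)))" for x
    by (simp add: complex_eq_iff)
  have [measurable]: "(\<lambda>x. cis (- 2 * pi * (freq k \<bullet> x))) \<in> borel_measurable borel"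
    unfolding cis_conv_exp by (intro borel_measurable_continuous_onI continuous_intros)
  have int: "integrable torus (\<lambda>x. of_real (f x) * cis (- 2 * pi * (freq k \<bullet> x)))"
    using f by (rule Bochner_Integration.integrable_bound) (measurable, auto simp: norm_mult)
  have "fourier_coeff f k = (\<integral>x. of_real (f x) * cis (- 2 * pi * (freq k \<bullet> x)) \<partial>torus)"
    unfolding fourier_coeff_def by (rule torus_integral_eq) measurable
  moreover have "Re (\<integral>x. of_real (f x) * cis (- 2 * pi * (freq k \<bullet> x)) \<partial>torus) = cosc k f"
    using integral_Re[OF int] by (simp add: cosc_def mult_ac)
  moreover have "Im (\<integral>x. of_real (f x) * cis (- 2 * pi * (freq k \<bullet> x)) \<partial>torus) = - sinc k f"
    using integral_Im[OF int] by (simp add: sinc_def mult_ac)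
  ultimately show ?thesis by (simp add: fc_def complex_eq_iff)
qed

text \<open>Block \<open>n\<close> lives in |\<xi>| <= (4/3) 2^n, which lies in the cube of radius
  2^(n+1).\<close>

lemma lp_multiplier_outside:
  assumes X: "littlewood_paley_cutoff X" and k: "k \<notin> cube (2 ^ (n + 1))"
  shows "lp_multiplier X n (freq k) = 0"
proof -
  obtain i where i: "\<not> \<bar>k $ i\<bar> \<le> int (2 ^ (n + 1))" using k by (auto simp: cube_def)
  then have "int (2 ^ (n + 1)) < \<bar>k $ i\<bar>" by simp
  then have "real_of_int (int (2 ^ (n + 1))) < real_of_int \<bar>k $ i\<bar>" by (simp only: of_int_less_iff)
  then have "2 ^ (n + 1) < \<bar>freq k $ i\<bar>" by (simp add: freq_def)
  also have "\<dots> \<le> norm (freq k)" by (rule component_le_norm_cart)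
  finally have k: "2 ^ (n + 1) < norm (freq k)" .
  have X0: "X \<xi> = 0" if "4/3 \<le> norm \<xi>" for \<xi> using X that unfolding littlewood_paley_cutoff_def by blast
  show ?thesis
  proof (cases n)
    case 0
    then show ?thesis using k by (simp add: X0)
  next
    case (Suc j)
    have 1: "2 < norm ((1 / 2 ^ Suc j) *\<^sub>R freq k)" "2 < norm ((1 / 2 ^ j) *\<^sub>R freq k)"
    proof -
      have a: "4 * 2 ^ j < norm (freq k)" using k by (simp add: Suc)
      moreover have "2 * 2 ^ j < norm (freq k)" using a zero_less_power[of "2::real" j] by linarith
      ultimately show "2 < norm ((1 / 2 ^ Suc j) *\<^sub>R freq k)" "2 < norm ((1 / 2 ^ j) *\<^sub>R freq k)"
        by (simp_all add: field_simps)
    qed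
    have "X ((1 / 2 ^ Suc j) *\<^sub>R freq k) = 0" "X ((1 / 2 ^ j) *\<^sub>R freq k) = 0"
      by (rule X0, use 1 in linarith)+
    then show ?thesis by (simp only: Suc lp_multiplier.simps)
  qed
qed

lemma sum_lp_multiplier: "(\<Sum>n\<le>m. lp_multiplier X n \<xi>) = X ((1 / 2 ^ m) *\<^sub>R \<xi>)"
  by (induction m) simp_all

lemma lp_block_eq:
  assumes X: "littlewood_paley_cutoff X" and f: "f \<in> borel_measurable borel" "integrable torus f"
    and S: "cube (2 ^ (n + 1)) \<subseteq> S" "finite S"
  shows "lp_block X n f x = (\<Sum>k\<in>S. (of_real (lp_multiplier X n (freq k)) * fc f k) * ch k x)"
  unfolding lp_block_def fourier_coeff_eq[OF f] ch_def[symmetric]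
  using lp_multiplier_outside[OF X] S by (intro sum.mono_neutral_left) auto

lemma conv_trig_polynomial:
  assumes "finite S"
  shows "conv N (\<lambda>x. \<Sum>k\<in>S. c k * ch k x) x = (\<Sum>k\<in>S. of_real (lam N k) * (c k * ch k x))"
proof -
  have int: "integrable torus (\<lambda>y. of_real (jackson N y) * ch k y)" for k
    using integrable_jackson[of N] by (rule Bochner_Integration.integrable_bound) (auto simp: norm_mult)
  have "conv N (\<lambda>x. \<Sum>k\<in>S. c k * ch k x) x = (\<integral>y. (\<Sum>k\<in>S. (c k * ch k x) * (of_real (jackson N y) * ch k y)) \<partial>torus)"
    by (simp add: conv_def scaleR_conv_of_real sum_distrib_left ch_add mult_ac)
  also have "\<dots> = (\<Sum>k\<in>S. (c k * ch k x) * (\<integral>y. of_real (jackson N y) * ch k y \<partial>torus))"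
    by (subst Bochner_Integration.integral_sum) (auto intro: int)
  also have "\<dots> = (\<Sum>k\<in>S. of_real (lam N k) * (c k * ch k x))"
    unfolding integral_ch_jackson by (simp only: mult_ac)
  finally show ?thesis .
qed

text \<open>Frequencies surviving the kernel have l1 norm at most 3 * 2 * 2^r = (3/4) 2^(r+3). There
  the telescoped multipliers up to index \<open>r + 3\<close> sum to \<open>X = 1\<close>, so no
  further block is seen.\<close>

lemma conv_block_decomposition:
  assumes X: "littlewood_paley_cutoff X" and f: "f \<in> borel_measurable borel" "periodic f" "integrable torus f"
  shows "conv (2^r) f x = (\<Sum>n\<le>r+3. Re (conv (2^r) (lp_block X n f) x))"
proof -
  define S where "S = cube (2 ^ (r + 4))"
  define N :: nat where "N = 2 ^ r"
  have sub: "cube (2 ^ (n + 1)) \<subseteq> S" if "n \<le> r + 3" for n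
  proof -
    have "(2::int) ^ (n + 1) \<le> 2 ^ (r + 4)" using that by (intro power_increasing) auto
    then show ?thesis by (auto simp: S_def cube_def intro: order_trans)
  qed
  have sub2: "cube (2 * N) \<subseteq> S" using sub[of r] by (simp add: N_def)
  have fin: "finite S" by (simp add: S_def)
  have mult: "of_real (lam N k) * of_real (X ((1 / 2 ^ (r+3)) *\<^sub>R freq k)) = (of_real (lam N k) :: complex)" for k
  proof (cases "k \<in> cube (2 * N)")
    case True
    have "norm (freq k) \<le> (\<Sum>i\<in>UNIV. \<bar>freq k $ i\<bar>)" by (rule norm_le_l1_cart)
    also have "\<dots> \<le> (\<Sum>i\<in>(UNIV::3 set). 2 * 2 ^ r)"
    proof (rule sum_mono)
      fix i
      have "\<bar>k $ i\<bar> \<le> int (2 * N)" using True by (simp add: cube_def)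
      then have "real_of_int \<bar>k $ i\<bar> \<le> real_of_int (int (2 * N))" by (simp only: of_int_le_iff)
      then show "\<bar>freq k $ i\<bar> \<le> 2 * 2 ^ r" by (simp add: freq_def N_def)
    qed
    finally have "norm ((1 / 2 ^ (r+3)) *\<^sub>R freq k) \<le> 3 / 4" by (simp add: power_add field_simps)
    then have "X ((1 / 2 ^ (r+3)) *\<^sub>R freq k) = 1" using X unfolding littlewood_paley_cutoff_def by blast
    then show ?thesis by simp
  qed (simp add: lam_outside)
  have "(\<Sum>n\<le>r+3. conv N (lp_block X n f) x) = (\<Sum>n\<le>r+3. \<Sum>k\<in>S. of_real (lam N k) * ((of_real (lp_multiplier X n (freq k)) * fc f k) * ch k x))"
  proof (rule sum.cong)
    fix n assume "n \<in> {..r+3}"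
    then have "lp_block X n f = (\<lambda>x. \<Sum>k\<in>S. (of_real (lp_multiplier X n (freq k)) * fc f k) * ch k x)"
      by (intro ext lp_block_eq[OF X f(1,3)] sub fin) auto
    then show "conv N (lp_block X n f) x = (\<Sum>k\<in>S. of_real (lam N k) * ((of_real (lp_multiplier X n (freq k)) * fc f k) * ch k x))"
      by (simp only: conv_trig_polynomial[OF fin])
  qed simp
  also have "\<dots> = (\<Sum>k\<in>S. (of_real (lam N k) * of_real (\<Sum>n\<le>r+3. lp_multiplier X n (freq k))) * (fc f k * ch k x))"
    by (subst sum.swap) (simp only: sum_distrib_left sum_distrib_right of_real_sum mult_ac)
  also have "\<dots> = (\<Sum>k\<in>S. of_real (lam N k) * (fc f k * ch k x))"
    unfolding sum_lp_multiplier mult ..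
  also have "\<dots> = (\<Sum>k\<in>cube (2 * N). of_real (lam N k) * (fc f k * ch k x))"
    using sub2 fin by (intro sum.mono_neutral_right) (auto simp: lam_outside)
  finally have "Re (\<Sum>n\<le>r+3. conv N (lp_block X n f) x) = Re (\<Sum>k\<in>cube (2 * N). of_real (lam N k) * (fc f k * ch k x))"
    by simp
  also have "\<dots> = conv N f x"
    by (simp add: conv_trig[OF f] fc_def Re_ch Im_ch algebra_simps)
  finally show ?thesis by (simp add: N_def)
qed

lemma L4_le_lp_block:
  assumes X: "littlewood_paley_cutoff X" and f: "f \<in> borel_measurable borel" "integrable torus f"
    and b: "besov_norm X s 4 f \<le> ennreal \<beta>" "0 \<le> \<beta>"
  shows "L4_le (lp_block X n f) (2 powr (- s * (real n - 1)) * \<beta>)"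
proof -
  define g where "g = lp_block X n f"
  have g: "g = (\<lambda>x. \<Sum>k\<in>cube (2 ^ (n+1)). (of_real (lp_multiplier X n (freq k)) * fc f k) * ch k x)"
    unfolding g_def by (intro ext lp_block_eq[OF X f]) auto
  have [measurable]: "g \<in> borel_measurable borel" unfolding g by measurable
  have bd: "norm (g x) \<le> (\<Sum>k\<in>cube (2 ^ (n+1)). norm (of_real (lp_multiplier X n (freq k)) * fc f k))" for x
    unfolding g by (rule sum_norm_le) (simp add: norm_mult)
  have int: "integrable torus (\<lambda>x. norm (g x) ^ 4)"
    by (rule integrable_torus_bounded[where C="(\<Sum>k\<in>cube (2 ^ (n+1)). norm (of_real (lp_multiplier X n (freq k)) * fc f k)) ^ 4"])
       (use bd in \<open>auto intro!: power_mono\<close>)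
  define I where "I = (\<integral>x. norm (g x) ^ 4 \<partial>torus)"
  have I0: "0 \<le> I" by (simp add: I_def)
  have pw: "norm z powr 4 = norm z ^ 4" for z :: complex by (cases "z = 0") (simp_all add: powr_numeral)
  have "torus_Lp_norm 4 g = I powr (1/4)"
    unfolding torus_Lp_norm_def I_def pw by (subst torus_integral_eq) auto
  moreover have "ennreal (2 powr (s * (real n - 1)) * torus_Lp_norm 4 g) \<le> besov_norm X s 4 f"
    unfolding besov_norm_def g_def by (rule SUP_upper) simp
  ultimately have "2 powr (s * (real n - 1)) * I powr (1/4) \<le> \<beta>"
    using b by (metis ennreal_le_iff order_trans)
  then have "2 powr (- s * (real n - 1)) * (2 powr (s * (real n - 1)) * I powr (1/4)) \<le> 2 powr (- s * (real n - 1)) * \<beta>"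
    by (intro mult_left_mono) auto
  moreover have "2 powr (- s * (real n - 1)) * 2 powr (s * (real n - 1)) = 1"
    by (simp flip: powr_add)
  ultimately have "I powr (1/4) \<le> 2 powr (- s * (real n - 1)) * \<beta>"
    by (metis mult.assoc mult_1)
  then have "(I powr (1/4)) ^ 4 \<le> (2 powr (- s * (real n - 1)) * \<beta>) ^ 4"
    by (intro power_mono) auto
  moreover have "(I powr (1/4)) ^ 4 = I"
    using I0 by (cases "I = 0") (auto simp: powr_powr simp flip: powr_realpow)
  ultimately have "I \<le> (2 powr (- s * (real n - 1)) * \<beta>) ^ 4" by simp
  moreover have "(\<integral>\<^sup>+x. ennreal (norm (g x)) ^ 4 \<partial>torus) = ennreal I"
    using int by (simp add: I_def ennreal_power nn_integral_eq_integral)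
  ultimately show ?thesis by (simp add: L4_le_def g_def ennreal_leI)
qed

lemma lp_block_measurable [measurable]:
  assumes "littlewood_paley_cutoff X" "f \<in> borel_measurable borel" "integrable torus f"
  shows "lp_block X n f \<in> borel_measurable borel"
proof -
  have "lp_block X n f = (\<lambda>x. \<Sum>k\<in>cube (2 ^ (n+1)). (of_real (lp_multiplier X n (freq k)) * fc f k) * ch k x)"
    by (intro ext lp_block_eq[OF assms]) auto
  then show ?thesis by simp
qed

lemma periodic_lp_block: "periodic (lp_block X n f)"
  using periodic_ch unfolding lp_block_def ch_def[symmetric] by (simp add: periodic_def)

subsection \<open>The commutator estimate\<close>

unbundle cross3_syntax

text \<open>Increments are always bounded by multiples of \<open>1 + N * tdist y\<close>; the kernel
  of order \<open>N\<close> averages this weight to at most 1 + 69.\<close>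

lemma nn_integral_jackson_tdist_affine:
  assumes "0 < N" shows "(\<integral>\<^sup>+y. ennreal (jackson N y * (1 + real N * tdist y)) \<partial>torus) \<le> ennreal 70"
proof -
  have "(\<integral>\<^sup>+y. ennreal (jackson N y * (1 + real N * tdist y)) \<partial>torus) =
     (\<integral>\<^sup>+y. ennreal (jackson N y) + ennreal (real N) * (ennreal (jackson N y) * ennreal (tdist y)) \<partial>torus)"
    by (intro nn_integral_cong) (simp add: algebra_simps flip: ennreal_mult ennreal_plus)
  also have "\<dots> = (\<integral>\<^sup>+y. ennreal (jackson N y) \<partial>torus) + ennreal (real N) * (\<integral>\<^sup>+y. ennreal (jackson N y) * ennreal (tdist y) \<partial>torus)"
    by (subst nn_integral_add, simp, simp, subst nn_integral_cmult) auto
  also have "\<dots> \<le> 1 + ennreal (real N) * ennreal (69 / N)"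
    by (intro add_mono mult_left_mono nn_integral_jackson_tdist assms) (auto simp: nn_integral_jackson assms)
  also have "ennreal (real N) * ennreal (69 / N) = ennreal 69"
    using assms by (simp flip: ennreal_mult del: ennreal_numeral)
  also have "1 + ennreal 69 = ennreal 70"
    by (simp flip: ennreal_1 ennreal_plus del: ennreal_numeral)
  finally show ?thesis .
qed

text \<open>Exchanging the integrals puts the increment \<open>y\<close> outside, so that for fixed
  \<open>y\<close> Holder with exponents 4, 2, 4 acts in \<open>x\<close>; translation invariance
  removes the shift in \<open>V\<close>, and the kernel then integrates the weight. The index sets
  \<open>P\<close> and \<open>Q\<close> carry components and dyadic blocks; bounding the factors
  pointwise by sums of pieces makes single pieces sufficient.\<close>

lemma commutator_bound:
  fixes b :: "'p \<Rightarrow> real^3 \<Rightarrow> complex" and \<omega> :: "'q \<Rightarrow> real^3 \<Rightarrow> complex" and V :: "real^3 \<Rightarrow> real^3"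
    and a :: "real^3 \<Rightarrow> real^3 \<Rightarrow> real" and w :: "real^3 \<Rightarrow> real"
  assumes N: "0 < N" and fin: "finite P" "finite Q"
    and [measurable]: "\<And>p. p \<in> P \<Longrightarrow> b p \<in> borel_measurable borel" "\<And>q. q \<in> Q \<Longrightarrow> \<omega> q \<in> borel_measurable borel"
      "V \<in> borel_measurable borel" "(\<lambda>(x, y). a x y) \<in> borel_measurable (borel \<Otimes>\<^sub>M borel)" "w \<in> borel_measurable borel"
    and pV: "periodic V"
    and a: "\<And>x y. a x y \<le> (\<Sum>p\<in>P. norm (b p (x + y) - b p x))" "\<And>x y. 0 \<le> a x y"
    and w: "\<And>x. w x \<le> (\<Sum>q\<in>Q. norm (\<omega> q x))" "\<And>x. 0 \<le> w x"
    and L4b: "\<And>p y. p \<in> P \<Longrightarrow> L4_le (\<lambda>x. b p (x + y) - b p x) (os p * (1 + real N * tdist y))"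
    and L4w: "\<And>q. q \<in> Q \<Longrightarrow> L4_le (\<omega> q) (c q)"
    and V: "(\<integral>\<^sup>+x. ennreal (norm (V x)) ^ 2 \<partial>torus) \<le> ennreal (v\<^sup>2)" "0 \<le> v"
    and nonneg: "\<And>p. p \<in> P \<Longrightarrow> 0 \<le> os p" "\<And>q. q \<in> Q \<Longrightarrow> 0 \<le> c q"
  shows "(\<integral>\<^sup>+x. (\<integral>\<^sup>+y. ennreal (jackson N y) * (ennreal (a x y) * ennreal (norm (V (x + y)))) \<partial>torus) * ennreal (w x) \<partial>torus)
     \<le> ennreal (70 * (\<Sum>p\<in>P. os p) * v * (\<Sum>q\<in>Q. c q))"
proof -
  let ?j = "\<lambda>y. ennreal (jackson N y)"
  have am: "(\<lambda>x. a (f x) (g x)) \<in> borel_measurable M"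
    if "f \<in> borel_measurable M" "g \<in> borel_measurable M" for f g and M :: "'z measure"
    using measurable_compose[OF measurable_Pair[OF that] assms(7)] by simp
  have inner: "(\<integral>\<^sup>+x. ennreal (a x y) * ennreal (norm (V (x + y))) * ennreal (w x) \<partial>torus) \<le>
     ennreal ((\<Sum>p\<in>P. os p) * v * (\<Sum>q\<in>Q. c q) * (1 + real N * tdist y))" for y
  proof -
    have "(\<integral>\<^sup>+x. ennreal (a x y) * ennreal (norm (V (x + y))) * ennreal (w x) \<partial>torus) \<le>
      (\<integral>\<^sup>+x. (\<Sum>p\<in>P. \<Sum>q\<in>Q. ennreal (norm (b p (x + y) - b p x)) * ennreal (norm (V (x + y))) * ennreal (norm (\<omega> q x))) \<partial>torus)"
    proof (intro nn_integral_mono)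
      fix x
      have "ennreal (a x y) * ennreal (norm (V (x + y))) * ennreal (w x) \<le>
         (\<Sum>p\<in>P. ennreal (norm (b p (x + y) - b p x))) * ennreal (norm (V (x + y))) * (\<Sum>q\<in>Q. ennreal (norm (\<omega> q x)))"
        using a(1)[of x y] w(1)[of x] by (intro mult_mono) (auto intro: ennreal_leI)
      also have "\<dots> = (\<Sum>p\<in>P. \<Sum>q\<in>Q. ennreal (norm (b p (x + y) - b p x)) * ennreal (norm (V (x + y))) * ennreal (norm (\<omega> q x)))"
        by (simp only: sum_distrib_left sum_distrib_right) (rule sum.swap)
      finally show "ennreal (a x y) * ennreal (norm (V (x + y))) * ennreal (w x) \<le> (\<Sum>p\<in>P. \<Sum>q\<in>Q. ennreal (norm (b p (x + y) - b p x)) * ennreal (norm (V (x + y))) * ennreal (norm (\<omega> q x)))" .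
    qed
    also have "\<dots> = (\<Sum>p\<in>P. \<Sum>q\<in>Q. \<integral>\<^sup>+x. ennreal (norm (b p (x + y) - b p x)) * ennreal (norm (V (x + y))) * ennreal (norm (\<omega> q x)) \<partial>torus)"
      by (subst nn_integral_sum, measurable, intro sum.cong refl, subst nn_integral_sum) auto
    also have "\<dots> \<le> (\<Sum>p\<in>P. \<Sum>q\<in>Q. ennreal ((os p * (1 + real N * tdist y)) * v * c q))"
    proof (intro sum_mono nn_integral_Holder_424_bound)
      fix p q assume pq: "p \<in> P" "q \<in> Q"
      have "(\<integral>\<^sup>+x. ennreal (norm (V (x + y))) ^ 2 \<partial>torus) = (\<integral>\<^sup>+x. ennreal (norm (V x)) ^ 2 \<partial>torus)"
        using pV by (intro nn_integral_torus_translate[where f="\<lambda>x. ennreal (norm (V x)) ^ 2"]) (auto simp: periodic_def)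
      then show "(\<integral>\<^sup>+x. ennreal (norm (V (x + y))) ^ 2 \<partial>torus) \<le> ennreal (v\<^sup>2)" using V by simp
      show "(\<integral>\<^sup>+x. ennreal (norm (b p (x + y) - b p x)) ^ 4 \<partial>torus) \<le> ennreal ((os p * (1 + real N * tdist y)) ^ 4)"
        using L4b[OF pq(1), of y] by (simp add: L4_le_def)
      show "(\<integral>\<^sup>+x. ennreal (norm (\<omega> q x)) ^ 4 \<partial>torus) \<le> ennreal (c q ^ 4)"
        using L4w[OF pq(2)] by (simp add: L4_le_def)
    qed (use V(2) nonneg in auto)
    also have "\<dots> = ennreal (\<Sum>p\<in>P. \<Sum>q\<in>Q. (os p * (1 + real N * tdist y)) * v * c q)"
      using nonneg V(2) by (simp add: sum_nonneg)
    also have "(\<Sum>p\<in>P. \<Sum>q\<in>Q. (os p * (1 + real N * tdist y)) * v * c q) = (\<Sum>p\<in>P. os p) * v * (\<Sum>q\<in>Q. c q) * (1 + real N * tdist y)"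
      by (simp add: sum_product sum_distrib_left sum_distrib_right mult_ac)
    finally show ?thesis .
  qed
  define S where "S = (\<Sum>p\<in>P. os p) * v * (\<Sum>q\<in>Q. c q)"
  have S0: "0 \<le> S"
    unfolding S_def using nonneg V(2) by (intro mult_nonneg_nonneg sum_nonneg) auto
  have "(\<integral>\<^sup>+x. (\<integral>\<^sup>+y. ?j y * (ennreal (a x y) * ennreal (norm (V (x + y)))) \<partial>torus) * ennreal (w x) \<partial>torus) =
     (\<integral>\<^sup>+x. \<integral>\<^sup>+y. ?j y * (ennreal (a x y) * ennreal (norm (V (x + y)))) * ennreal (w x) \<partial>torus \<partial>torus)"
    by (intro nn_integral_cong nn_integral_multc[symmetric]) (use am in measurable)
  also have "\<dots> = (\<integral>\<^sup>+y. \<integral>\<^sup>+x. ?j y * (ennreal (a x y) * ennreal (norm (V (x + y)))) * ennreal (w x) \<partial>torus \<partial>torus)"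
    by (rule torus2.Fubini') (use am in measurable)
  also have "\<dots> = (\<integral>\<^sup>+y. ?j y * (\<integral>\<^sup>+x. ennreal (a x y) * ennreal (norm (V (x + y))) * ennreal (w x) \<partial>torus) \<partial>torus)"
    by (intro nn_integral_cong, subst nn_integral_cmult[symmetric]) (use am in \<open>auto simp: mult.assoc\<close>)
  also have "\<dots> \<le> (\<integral>\<^sup>+y. ?j y * ennreal (S * (1 + real N * tdist y)) \<partial>torus)"
    unfolding S_def by (intro nn_integral_mono mult_left_mono inner) auto
  also have "\<dots> = (\<integral>\<^sup>+y. ennreal S * ennreal (jackson N y * (1 + real N * tdist y)) \<partial>torus)"
    using S0 by (intro nn_integral_cong) (simp flip: ennreal_mult add: mult.left_commute)
  also have "\<dots> = ennreal S * (\<integral>\<^sup>+y. ennreal (jackson N y * (1 + real N * tdist y)) \<partial>torus)"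
    by (rule nn_integral_cmult) measurable
  also have "\<dots> \<le> ennreal S * ennreal 70"
    by (intro mult_left_mono nn_integral_jackson_tdist_affine N) auto
  also have "\<dots> = ennreal (S * 70)"
    using S0 by (intro ennreal_mult[symmetric]) auto
  also have "S * 70 = 70 * (\<Sum>p\<in>P. os p) * v * (\<Sum>q\<in>Q. c q)"
    by (simp add: S_def)
  finally show ?thesis .
qed

lemma cross_measurable [measurable (raw)]:
  assumes "f \<in> borel_measurable M" "g \<in> borel_measurable M"
  shows "(\<lambda>x. f x \<times> (g x :: real^3)) \<in> borel_measurable M"
  using assms by (rule borel_measurable_continuous_Pair) (intro continuous_on_cross continuous_intros)

lemma norm_cross_le: "norm (x \<times> y) \<le> norm x * norm (y :: real^3)"
proof -
  have "(norm (x \<times> y))\<^sup>2 \<le> (norm x * norm y)\<^sup>2" using norm_cross_dot[of x y] zero_le_power2[of "x \<bullet> y"] by linarith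
  then show ?thesis by (rule power2_le_imp_le) simp
qed

lemma bounded_linear_cross_right: "bounded_linear (\<lambda>y. x \<times> (y :: real^3))"
proof (rule bounded_linear_intro[where K="norm x"])
  show "norm (x \<times> y) \<le> norm y * norm x" for y
    using norm_cross_le[of x y] by (simp only: mult.commute)
qed (simp_all add: cross_add_right cross_mult_right)

lemma integrable_cross_L2per: "L2per u \<Longrightarrow> L2per v \<Longrightarrow> integrable torus (\<lambda>x. u x \<times> v x)"
  by (rule integrable_L2_product[of u v]) (auto intro: cross_measurable L2perD(1) norm_cross_le)

definition flux :: "nat \<Rightarrow> (real^3 \<Rightarrow> real^3) \<Rightarrow> (real^3 \<Rightarrow> real^3) \<Rightarrow> real" where
  "flux N u v = (\<integral>x. (u x \<times> v x) \<bullet> conv N (conv N v) x \<partial>torus)"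

text \<open>The subtracted term is $\int (u \times (J * v)) \cdot (J * v) = 0$.\<close>

lemma flux_commutator:
  assumes u: "L2per u" "\<And>x. norm (u x) \<le> C" and v: "L2per v"
  shows "ennreal \<bar>flux N u v\<bar> \<le>
    (\<integral>\<^sup>+x. (\<integral>\<^sup>+y. ennreal (jackson N y) * (ennreal (norm (u (x + y) - u x)) * ennreal (norm (v (x + y)))) \<partial>torus) * ennreal (norm (conv N v x)) \<partial>torus)"
proof -
  note [measurable] = L2perD(1)[OF u(1)] L2perD(1)[OF v]
  note pu = L2perD(2)[OF u(1)] and pv = L2perD(2)[OF v]
  define E where "E x = u x \<times> v x" for x
  have E: "E \<in> borel_measurable borel" "periodic E" "integrable torus E"
    using pu pv integrable_cross_L2per[OF u(1) v] unfolding E_def by (simp_all add: periodic_def)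
  note [measurable] = E(1)
  have W: "L2per (conv N v)" by (rule L2per_conv[OF L2perD(1,2,4)[OF v]])
  note [measurable] = L2perD(1)[OF W]
  have "flux N u v = (\<integral>x. conv N E x \<bullet> conv N v x \<partial>torus)"
    unfolding flux_def E_def[symmetric] by (rule conv_self_adjoint(2)[symmetric, OF E L2perD(1,2,4)[OF W]])
  also have "\<dots> = (\<integral>x. (conv N E x - u x \<times> conv N v x) \<bullet> conv N v x \<partial>torus)"
    by (simp add: inner_diff_left dot_cross_self)
  finally have fl: "flux N u v = (\<integral>x. (conv N E x - u x \<times> conv N v x) \<bullet> conv N v x \<partial>torus)" .
  have diff: "conv N E x - u x \<times> conv N v x = (\<integral>y. jackson N y *\<^sub>R ((u (x + y) - u x) \<times> v (x + y)) \<partial>torus)" for x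
  proof -
    have iv: "integrable torus (\<lambda>y. jackson N y *\<^sub>R v (x + y))" by (rule integrable_jackson_translate[OF L2perD(1,2,4)[OF v]])
    have iE: "integrable torus (\<lambda>y. jackson N y *\<^sub>R E (x + y))" by (rule integrable_jackson_translate[OF E])
    have "u x \<times> conv N v x = (\<integral>y. u x \<times> (jackson N y *\<^sub>R v (x + y)) \<partial>torus)"
      unfolding conv_def by (rule integral_bounded_linear[OF bounded_linear_cross_right iv, symmetric])
    moreover have "integrable torus (\<lambda>y. u x \<times> (jackson N y *\<^sub>R v (x + y)))"
      by (rule integrable_bounded_linear[OF bounded_linear_cross_right iv])
    ultimately have "conv N E x - u x \<times> conv N v x = (\<integral>y. jackson N y *\<^sub>R E (x + y) - u x \<times> (jackson N y *\<^sub>R v (x + y)) \<partial>torus)"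
      using iE by (simp add: conv_def Bochner_Integration.integral_diff)
    also have "\<dots> = (\<integral>y. jackson N y *\<^sub>R ((u (x + y) - u x) \<times> v (x + y)) \<partial>torus)"
      by (simp add: E_def cross_mult_right Cross3.left_diff_distrib scaleR_diff_right)
    finally show ?thesis .
  qed
  have pt: "ennreal (norm (conv N E x - u x \<times> conv N v x)) \<le> (\<integral>\<^sup>+y. ennreal (jackson N y) * (ennreal (norm (u (x + y) - u x)) * ennreal (norm (v (x + y)))) \<partial>torus)" for x
  proof -
    have "ennreal (norm (conv N E x - u x \<times> conv N v x)) \<le> (\<integral>\<^sup>+y. ennreal (norm (jackson N y *\<^sub>R ((u (x + y) - u x) \<times> v (x + y)))) \<partial>torus)"
      unfolding diff by (rule ennreal_norm_integral_le)
    also have "\<dots> \<le> (\<integral>\<^sup>+y. ennreal (jackson N y) * (ennreal (norm (u (x + y) - u x)) * ennreal (norm (v (x + y)))) \<partial>torus)"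
      by (intro nn_integral_mono) (simp flip: ennreal_mult add: ennreal_leI mult_left_mono norm_cross_le)
    finally show ?thesis .
  qed
  have "ennreal \<bar>flux N u v\<bar> \<le> (\<integral>\<^sup>+x. ennreal (norm ((conv N E x - u x \<times> conv N v x) \<bullet> conv N v x)) \<partial>torus)"
    unfolding fl using ennreal_norm_integral_le[of torus "\<lambda>x. (conv N E x - u x \<times> conv N v x) \<bullet> conv N v x"] by simp
  also have "\<dots> \<le> (\<integral>\<^sup>+x. ennreal (norm (conv N E x - u x \<times> conv N v x)) * ennreal (norm (conv N v x)) \<partial>torus)"
    by (intro nn_integral_mono) (auto simp flip: ennreal_mult intro!: ennreal_leI Cauchy_Schwarz_ineq2)
  also have "\<dots> \<le> (\<integral>\<^sup>+x. (\<integral>\<^sup>+y. ennreal (jackson N y) * (ennreal (norm (u (x + y) - u x)) * ennreal (norm (v (x + y)))) \<partial>torus) * ennreal (norm (conv N v x)) \<partial>torus)"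
    by (intro nn_integral_mono mult_right_mono pt) auto
  finally show ?thesis .
qed

section \<open>Increments of dyadic blocks and the bound on the flux\<close>

text \<open>Interpolates between the trivial bound 2 on a relative increment and the Bernstein bound
  \<open>18 * z\<close>, where 18 = 9 * 2 because block \<open>n\<close> lies in the cube of radius
  2^(n+1).\<close>

lemma oscillation_interpolation:
  fixes \<theta> z :: real
  assumes "0 < \<theta>" "\<theta> < 1" "0 \<le> z" shows "min 2 (18 * z) \<le> 18 * z powr \<theta>"
proof (cases "z \<le> 1")
  case True
  then show ?thesis using powr_mono'[of \<theta> 1 z] assms by (cases "z = 0") auto
next
  case False
  then show ?thesis using ge_one_powr_ge_zero[of z \<theta>] assms by auto
qed

text \<open>This is s^\<theta> <= 1 + s at s = N d. It extracts the gain
  \<open>N powr (- \<theta>)\<close> and leaves the weight that the kernel averages to a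
  constant.\<close>

lemma powr_interpolation:
  fixes \<theta> d N :: real
  assumes "0 < \<theta>" "\<theta> < 1" "0 \<le> d" "0 < N" shows "d powr \<theta> \<le> N powr (- \<theta>) * (1 + N * d)"
proof -
  have "(N * d) powr \<theta> \<le> 1 + N * d"
  proof (cases "N * d \<le> 1")
    case True
    then have "(N * d) powr \<theta> \<le> 1" using powr_mono2[of \<theta> "N * d" 1] assms by simp
    moreover have "0 \<le> N * d" using assms by simp
    ultimately show ?thesis by linarith
  next
    case False
    then have "(N * d) powr \<theta> \<le> (N * d) powr 1" using assms by (intro powr_mono) auto
    then show ?thesis using False by simp
  qed
  then have "N powr (- \<theta>) * (N * d) powr \<theta> \<le> N powr (- \<theta>) * (1 + N * d)" by (intro mult_left_mono) auto
  moreover have "N powr (- \<theta>) * (N * d) powr \<theta> = d powr \<theta>"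
    using assms by (simp add: powr_mult powr_minus)
  ultimately show ?thesis by simp
qed

lemma L4_le_mono: "L4_le f a \<Longrightarrow> 0 \<le> a \<Longrightarrow> a \<le> b \<Longrightarrow> L4_le f b"
  unfolding L4_le_def by (erule order_trans) (intro ennreal_leI power_mono)

text \<open>The loss \<open>(2 ^ n) powr \<theta>\<close> of interpolation is paid by the regularity
  of \<open>f\<close>, and the gain \<open>N powr (- \<theta>)\<close> is kept. As
  \<open>conv M\<close> contracts L4, the bound does not depend on \<open>M\<close>.\<close>

lemma L4_le_oscillation:
  assumes X: "littlewood_paley_cutoff X" and f: "f \<in> borel_measurable borel" "periodic f" "integrable torus f"
    and \<theta>: "0 < \<theta>" "\<theta> < 1" and M: "0 < M" and N: "0 < N"
    and a: "L4_le (lp_block X n f) a" "0 \<le> a"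
  shows "L4_le (\<lambda>x. conv M (lp_block X n f) (x + y) - conv M (lp_block X n f) x)
    ((18 * (2 ^ n) powr \<theta> * real N powr (- \<theta>) * a) * (1 + real N * tdist y))"
proof -
  define g where "g = conv M (lp_block X n f)"
  define c where "c k = of_real (lam M k) * (of_real (lp_multiplier X n (freq k)) * fc f k)" for k
  have lb: "lp_block X n f = (\<lambda>x. \<Sum>k\<in>cube (2 ^ (n+1)). (of_real (lp_multiplier X n (freq k)) * fc f k) * ch k x)"
    by (intro ext lp_block_eq[OF X f(1,3)]) auto
  have g: "g = (\<lambda>x. \<Sum>k\<in>cube (2 ^ (n+1)). c k * ch k x)"
    unfolding g_def lb c_def by (rule ext, subst conv_trig_polynomial) (auto simp: mult.assoc)
  have gm [measurable]: "g \<in> borel_measurable borel" unfolding g by measurable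
  have gp: "periodic g" unfolding g_def by (intro periodic_conv periodic_lp_block)
  have ga: "L4_le g a" unfolding g_def
    by (intro L4_le_conv a M periodic_lp_block lp_block_measurable X f)
  have 1: "L4_le (\<lambda>x. g (x + y) - g x) (2 * a)" by (rule L4_le_diff[OF gm gp ga])
  have 2: "L4_le (\<lambda>x. g (x + y) - g x) (9 * real (2 ^ (n+1)) * tdist y * a)"
    by (rule Bernstein_translation[OF _ _ g ga a(2)]) auto
  have "L4_le (\<lambda>x. g (x + y) - g x) (min 2 (18 * (2 ^ n * tdist y)) * a)"
    using 1 2 by (auto simp: min_def mult_ac)
  moreover have "min 2 (18 * (2 ^ n * tdist y)) \<le> (18 * (2 ^ n) powr \<theta> * real N powr (- \<theta>)) * (1 + real N * tdist y)"
  proof -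
    have "min 2 (18 * (2 ^ n * tdist y)) \<le> 18 * (2 ^ n * tdist y) powr \<theta>"
      by (rule oscillation_interpolation[OF \<theta>]) simp
    also have "\<dots> = (18 * (2 ^ n) powr \<theta>) * tdist y powr \<theta>" by (simp add: powr_mult)
    also have "\<dots> \<le> (18 * (2 ^ n) powr \<theta>) * (real N powr (- \<theta>) * (1 + real N * tdist y))"
      using N by (intro mult_left_mono powr_interpolation \<theta>) auto
    finally show ?thesis by (simp add: mult.assoc)
  qed
  then have "min 2 (18 * (2 ^ n * tdist y)) * a \<le> (18 * (2 ^ n) powr \<theta> * real N powr (- \<theta>)) * (1 + real N * tdist y) * a"
    using a(2) by (intro mult_right_mono)
  ultimately have "L4_le (\<lambda>x. g (x + y) - g x) ((18 * (2 ^ n) powr \<theta> * real N powr (- \<theta>)) * (1 + real N * tdist y) * a)"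
    using a(2) by (elim L4_le_mono) auto
  then show ?thesis by (simp add: g_def mult_ac)
qed

lemma norm_vec3_le: "norm (x::real^3) \<le> (\<Sum>i\<in>UNIV. \<bar>x $ i\<bar>)"
  by (rule norm_le_l1_cart)

text \<open>Each factor has a source: 70 from the averaged weight, each 3 from vector components, 18
  from interpolation, the quotient from the geometric series over blocks of \<open>u\<close>,
  \<open>r + 4\<close> from the number of blocks of \<open>J * v\<close>, and the two remaining
  powers of 2 from the offset between index \<open>n\<close> and level \<open>n - 1\<close>.\<close>

definition flux_const :: "real \<Rightarrow> real \<Rightarrow> real \<Rightarrow> nat \<Rightarrow> real" where
  "flux_const \<alpha>1 \<alpha>2 \<theta> r = 70 * (3 * (18 * 2 powr \<alpha>2 * (1 / (1 - 2 powr (\<theta> - \<alpha>2))))) *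
     (3 * real (r + 4) * 2 powr (2 * \<alpha>1)) * (2 powr (\<alpha>1 - \<theta>)) ^ r"

text \<open>Replacing \<open>u\<close> by \<open>conv (2^s) u\<close> makes the decomposition into
  blocks a finite sum. The bound is free of \<open>s\<close>, which prepares the limit.\<close>

lemma flux_bound_smooth:
  assumes X: "littlewood_paley_cutoff X" and u: "L2per u" and v: "L2per v"
    and ex: "0 < \<alpha>1" "\<alpha>1 < \<theta>" "\<theta> < \<alpha>2" "\<alpha>2 < 1"
    and bu: "\<And>i. besov_norm X \<alpha>2 4 (\<lambda>x. u x $ i) \<le> ennreal \<beta>u" "0 \<le> \<beta>u"
    and bv: "\<And>i. besov_norm X (- \<alpha>1) 4 (\<lambda>x. v x $ i) \<le> ennreal \<beta>v" "0 \<le> \<beta>v"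
    and V: "(\<integral>\<^sup>+x. ennreal (norm (v x)) ^ 2 \<partial>torus) \<le> ennreal (b\<^sup>2)" "0 \<le> b"
  shows "\<bar>flux (2^r) (conv (2^s) u) v\<bar> \<le> flux_const \<alpha>1 \<alpha>2 \<theta> r * \<beta>u * \<beta>v * b"
proof -
  let ?N = "2 ^ r :: nat" and ?M = "2 ^ s :: nat"
  note fu = L2perD(1,2,4)[OF L2per_component[OF u]] and fv = L2perD(1,2,4)[OF L2per_component[OF v]]
  have u': "L2per (conv ?M u)" by (rule L2per_conv[OF L2perD(1,2,4)[OF u]])
  note [measurable] = L2perD(1)[OF u'] L2perD(1)[OF v] L2perD(1)[OF u]
  obtain C where C: "\<And>x. norm (conv ?M u x) \<le> C" using conv_bounded[OF L2perD(1,2,4)[OF u]] by blast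
  define bb where "bb p = conv ?M (lp_block X (snd p) (\<lambda>x. u x $ fst p))" for p :: "3 \<times> nat"
  define \<omega> where "\<omega> q = conv ?N (lp_block X (snd q) (\<lambda>x. v x $ fst q))" for q :: "3 \<times> nat"
  define os where "os p = 18 * (2 ^ snd p) powr \<theta> * real ?N powr (- \<theta>) * (2 powr (- \<alpha>2 * (real (snd p) - 1)) * \<beta>u)" for p :: "3 \<times> nat"
  define cc where "cc q = 2 powr (\<alpha>1 * (real (snd q) - 1)) * \<beta>v" for q :: "3 \<times> nat"
  define P where "P = Sigma (UNIV :: 3 set) (\<lambda>_. {..s+3})"
  define Q where "Q = Sigma (UNIV :: 3 set) (\<lambda>_. {..r+3})"
  have \<theta>: "0 < \<theta>" "\<theta> < 1" using ex by auto
  have decomp: "\<bar>conv (2^m) w x $ i - conv (2^m) w z $ i\<bar> \<le> (\<Sum>n\<le>m+3. norm (conv (2^m) (lp_block X n (\<lambda>x. w x $ i)) x - conv (2^m) (lp_block X n (\<lambda>x. w x $ i)) z))"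
    if w: "L2per w" for w :: "real^3 \<Rightarrow> real^3" and m i x z
  proof -
    note fw = L2perD(1,2,4)[OF L2per_component[OF w]]
    have "conv (2^m) w x $ i - conv (2^m) w z $ i = (\<Sum>n\<le>m+3. Re (conv (2^m) (lp_block X n (\<lambda>x. w x $ i)) x - conv (2^m) (lp_block X n (\<lambda>x. w x $ i)) z))"
      by (simp add: conv_component[OF L2perD(1,2,4)[OF w]] conv_block_decomposition[OF X fw] sum_subtractf)
    also have "\<bar>\<dots>\<bar> \<le> (\<Sum>n\<le>m+3. norm (conv (2^m) (lp_block X n (\<lambda>x. w x $ i)) x - conv (2^m) (lp_block X n (\<lambda>x. w x $ i)) z))"
      by (rule order_trans[OF sum_abs]) (intro sum_mono abs_Re_le_cmod)
    finally show ?thesis .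
  qed
  have decomp0: "\<bar>conv (2^m) w x $ i\<bar> \<le> (\<Sum>n\<le>m+3. norm (conv (2^m) (lp_block X n (\<lambda>x. w x $ i)) x))"
    if w: "L2per w" for w :: "real^3 \<Rightarrow> real^3" and m i x
  proof -
    note fw = L2perD(1,2,4)[OF L2per_component[OF w]]
    have "conv (2^m) w x $ i = (\<Sum>n\<le>m+3. Re (conv (2^m) (lp_block X n (\<lambda>x. w x $ i)) x))"
      by (simp add: conv_component[OF L2perD(1,2,4)[OF w]] conv_block_decomposition[OF X fw])
    also have "\<bar>\<dots>\<bar> \<le> (\<Sum>n\<le>m+3. norm (conv (2^m) (lp_block X n (\<lambda>x. w x $ i)) x))"
      by (rule order_trans[OF sum_abs]) (intro sum_mono abs_Re_le_cmod)
    finally show ?thesis .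
  qed
  have "ennreal \<bar>flux ?N (conv ?M u) v\<bar> \<le>
    (\<integral>\<^sup>+x. (\<integral>\<^sup>+y. ennreal (jackson ?N y) * (ennreal (norm (conv ?M u (x + y) - conv ?M u x)) * ennreal (norm (v (x + y)))) \<partial>torus) * ennreal (norm (conv ?N v x)) \<partial>torus)"
    by (rule flux_commutator[OF u' C v])
  also have "\<dots> \<le> ennreal (70 * (\<Sum>p\<in>P. os p) * b * (\<Sum>q\<in>Q. cc q))"
  proof (rule commutator_bound[where b=bb and \<omega>=\<omega>])
    show "norm (conv ?M u (x + y) - conv ?M u x) \<le> (\<Sum>p\<in>P. norm (bb p (x + y) - bb p x))" for x y
    proof -
      have "norm (conv ?M u (x + y) - conv ?M u x) \<le> (\<Sum>i\<in>UNIV. \<bar>conv ?M u (x + y) $ i - conv ?M u x $ i\<bar>)"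
        using norm_vec3_le[of "conv ?M u (x + y) - conv ?M u x"] by simp
      also have "\<dots> \<le> (\<Sum>i\<in>UNIV. \<Sum>n\<le>s+3. norm (bb (i, n) (x + y) - bb (i, n) x))"
        unfolding bb_def fst_conv snd_conv by (intro sum_mono decomp u)
      finally show ?thesis by (simp add: P_def sum.cartesian_product)
    qed
    show "norm (conv ?N v x) \<le> (\<Sum>q\<in>Q. norm (\<omega> q x))" for x
    proof -
      have "norm (conv ?N v x) \<le> (\<Sum>i\<in>UNIV. \<bar>conv ?N v x $ i\<bar>)" by (rule norm_vec3_le)
      also have "\<dots> \<le> (\<Sum>i\<in>UNIV. \<Sum>n\<le>r+3. norm (\<omega> (i, n) x))"
        unfolding \<omega>_def fst_conv snd_conv by (intro sum_mono decomp0 v)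
      finally show ?thesis by (simp add: Q_def sum.cartesian_product)
    qed
    show "L4_le (\<lambda>x. bb p (x + y) - bb p x) (os p * (1 + real ?N * tdist y))" for p y
      unfolding bb_def os_def
      by (rule L4_le_oscillation[OF X fu \<theta> _ _ L4_le_lp_block[OF X fu(1,3) bu]]) (simp_all add: bu(2))
    show "L4_le (\<omega> q) (cc q)" for q
      unfolding \<omega>_def cc_def using L4_le_lp_block[OF X fv(1,3) bv, where n="snd q"] bv(2)
      by (intro L4_le_conv periodic_lp_block lp_block_measurable X fv) auto
    show "bb p \<in> borel_measurable borel" for p
      unfolding bb_def by (intro conv_measurable lp_block_measurable X fu)
    show "\<omega> q \<in> borel_measurable borel" for q
      unfolding \<omega>_def by (intro conv_measurable lp_block_measurable X fv)
    show "0 \<le> os p" for p using bu(2) by (simp add: os_def)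
    show "0 \<le> cc q" for q using bv(2) by (simp add: cc_def)
  qed (use V L2perD(2)[OF v] in \<open>auto simp: P_def Q_def\<close>)
  finally have fin: "\<bar>flux ?N (conv ?M u) v\<bar> \<le> 70 * (\<Sum>p\<in>P. os p) * b * (\<Sum>q\<in>Q. cc q)"
    using bu(2) bv(2) V(2) by (subst (asm) ennreal_le_iff) (auto intro!: mult_nonneg_nonneg sum_nonneg simp: os_def cc_def)
  define q where "q = 2 powr (\<theta> - \<alpha>2)"
  have q: "0 \<le> q" "q < 1" using ex powr_less_mono[of "\<theta> - \<alpha>2" 0 2] by (simp_all add: q_def)
  \<comment> \<open>Block \<open>n\<close> contributes a multiple of \<open>q ^ n\<close> with q =
    2^(\<theta> - \<alpha>2) < 1; the full geometric series bounds the sum uniformly in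
    \<open>s\<close>.\<close>
  have Ps: "(\<Sum>p\<in>P. os p) \<le> 3 * (18 * 2 powr \<alpha>2 * (1 / (1 - q))) * real ?N powr (- \<theta>) * \<beta>u"
  proof -
    have os: "os (i, n) = (18 * 2 powr \<alpha>2 * real ?N powr (- \<theta>) * \<beta>u) * q ^ n" for i n
    proof -
      have "(2 ^ n) powr \<theta> * 2 powr (- \<alpha>2 * (real n - 1)) = 2 powr \<alpha>2 * q ^ n"
        by (simp add: q_def powr_powr algebra_simps flip: powr_realpow powr_add)
      then show ?thesis by (simp add: os_def mult_ac)
    qed
    have "(\<Sum>n\<le>s+3. q ^ n) \<le> 1 / (1 - q)"
      using q by (subst sum_gp0) (auto intro!: divide_right_mono)
    then have "(18 * 2 powr \<alpha>2 * real ?N powr (- \<theta>) * \<beta>u) * (\<Sum>n\<le>s+3. q ^ n) \<le> (18 * 2 powr \<alpha>2 * real ?N powr (- \<theta>) * \<beta>u) * (1 / (1 - q))"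
      using bu(2) by (intro mult_left_mono) auto
    moreover have "(\<Sum>p\<in>P. os p) = 3 * ((18 * 2 powr \<alpha>2 * real ?N powr (- \<theta>) * \<beta>u) * (\<Sum>n\<le>s+3. q ^ n))"
      unfolding P_def sum.cartesian_product[symmetric, where g="\<lambda>i n. os (i, n)", simplified] os
      by (simp add: sum_distrib_left)
    ultimately have "(\<Sum>p\<in>P. os p) \<le> 3 * ((18 * 2 powr \<alpha>2 * real ?N powr (- \<theta>) * \<beta>u) * (1 / (1 - q)))"
      by linarith
    also have "\<dots> = 3 * (18 * 2 powr \<alpha>2 * (1 / (1 - q))) * real ?N powr (- \<theta>) * \<beta>u"
      by (simp only: mult_ac)
    finally show ?thesis .
  qed
  \<comment> \<open>Here the exponent is positive, so each of the \<open>r + 4\<close> blocks is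
    bounded by the top one, whose level is \<open>r + 2\<close>.\<close>
  have Qs: "(\<Sum>q\<in>Q. cc q) \<le> (3 * real (r + 4) * 2 powr (2 * \<alpha>1)) * 2 powr (\<alpha>1 * r) * \<beta>v"
  proof -
    have "(\<Sum>q\<in>Q. cc q) \<le> of_nat (card Q) * (2 powr (\<alpha>1 * (r + 2)) * \<beta>v)"
    proof (rule sum_bounded_above)
      fix q assume "q \<in> Q"
      then have "real (snd q) - 1 \<le> real r + 2" by (auto simp: Q_def)
      then have "2 powr (\<alpha>1 * (real (snd q) - 1)) \<le> 2 powr (\<alpha>1 * (r + 2))"
        using ex by (intro powr_mono mult_left_mono) auto
      then show "cc q \<le> 2 powr (\<alpha>1 * (r + 2)) * \<beta>v"
        unfolding cc_def using bv(2) by (intro mult_right_mono)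
    qed
    also have "\<dots> = (3 * real (r + 4) * 2 powr (2 * \<alpha>1)) * 2 powr (\<alpha>1 * r) * \<beta>v"
      by (simp add: Q_def card_cartesian_product algebra_simps powr_add)
    finally show ?thesis .
  qed
  have "70 * (\<Sum>p\<in>P. os p) * b * (\<Sum>q\<in>Q. cc q) \<le> 70 * (3 * (18 * 2 powr \<alpha>2 * (1 / (1 - q))) * real ?N powr (- \<theta>) * \<beta>u) * b * ((3 * real (r + 4) * 2 powr (2 * \<alpha>1)) * 2 powr (\<alpha>1 * r) * \<beta>v)"
    using Ps Qs V(2) bu(2) bv(2) q
    by (intro mult_mono mult_left_mono mult_right_mono order_refl) (auto intro!: mult_nonneg_nonneg sum_nonneg simp: os_def cc_def)
  also have "\<dots> = flux_const \<alpha>1 \<alpha>2 \<theta> r * \<beta>u * \<beta>v * b"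
  proof -
    have e: "(2 powr (\<alpha>1 - \<theta>)) ^ r = real ?N powr (- \<theta>) * 2 powr (\<alpha>1 * r)"
      by (simp add: powr_powr algebra_simps flip: powr_realpow powr_add)
    show ?thesis unfolding flux_const_def q_def e by (simp only: mult_ac)
  qed
  finally show ?thesis using fin by linarith
qed

text \<open>For fixed \<open>r\<close> the twice mollified \<open>v\<close> is bounded, so the flux
  is continuous in \<open>u\<close> with respect to L2, and the uniform bound survives the limit in
  \<open>s\<close>.\<close>

lemma flux_bound:
  assumes X: "littlewood_paley_cutoff X" and u: "L2per u" and v: "L2per v"
    and ex: "0 < \<alpha>1" "\<alpha>1 < \<theta>" "\<theta> < \<alpha>2" "\<alpha>2 < 1"
    and bu: "\<And>i. besov_norm X \<alpha>2 4 (\<lambda>x. u x $ i) \<le> ennreal \<beta>u" "0 \<le> \<beta>u"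
    and bv: "\<And>i. besov_norm X (- \<alpha>1) 4 (\<lambda>x. v x $ i) \<le> ennreal \<beta>v" "0 \<le> \<beta>v"
    and V: "(\<integral>\<^sup>+x. ennreal (norm (v x)) ^ 2 \<partial>torus) \<le> ennreal (b\<^sup>2)" "0 \<le> b"
  shows "\<bar>flux (2^r) u v\<bar> \<le> flux_const \<alpha>1 \<alpha>2 \<theta> r * \<beta>u * \<beta>v * b"
proof -
  define W where "W = conv (2^r) (conv (2^r) v)"
  have cv: "L2per (conv (2^r) v)" by (rule L2per_conv[OF L2perD(1,2,4)[OF v]])
  have W: "L2per W" unfolding W_def by (rule L2per_conv[OF L2perD(1,2,4)[OF cv]])
  obtain C where C: "\<And>x. norm (W x) \<le> C" unfolding W_def using conv_bounded[OF L2perD(1,2,4)[OF cv]] by blast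
  note [measurable] = L2perD(1)[OF u] L2perD(1)[OF v] L2perD(1)[OF W]
  have g: "L2per (\<lambda>x. v x \<times> W x)"
    unfolding L2per_def
  proof (intro conjI)
    show "periodic (\<lambda>x. v x \<times> W x)" using L2perD(2)[OF v] L2perD(2)[OF W] by (simp add: periodic_def)
    have "(\<integral>\<^sup>+x. ennreal (norm (v x \<times> W x)) ^ 2 \<partial>torus) \<le> (\<integral>\<^sup>+x. ennreal C ^ 2 * ennreal (norm (v x)) ^ 2 \<partial>torus)"
    proof (intro nn_integral_mono)
      fix x
      have "norm (v x \<times> W x) \<le> C * norm (v x)"
        using norm_cross_le[of "v x" "W x"] mult_left_mono[OF C[of x], of "norm (v x)"] by (simp add: mult.commute)
      moreover have "0 \<le> C" using norm_ge_zero[of "W 0"] C[of 0] by linarith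
      ultimately have "ennreal (norm (v x \<times> W x)) ^ 2 \<le> (ennreal C * ennreal (norm (v x))) ^ 2"
        by (intro power_mono) (auto simp flip: ennreal_mult intro: ennreal_leI)
      then show "ennreal (norm (v x \<times> W x)) ^ 2 \<le> ennreal C ^ 2 * ennreal (norm (v x)) ^ 2" by (simp add: power_mult_distrib)
    qed
    also have "\<dots> = ennreal C ^ 2 * (\<integral>\<^sup>+x. ennreal (norm (v x)) ^ 2 \<partial>torus)" by (rule nn_integral_cmult) measurable
    also have "\<dots> < \<infinity>" using L2perD(3)[OF v] by (simp add: ennreal_mult_less_top power_less_top_ennreal)
    finally show "(\<integral>\<^sup>+x. ennreal (norm (v x \<times> W x)) ^ 2 \<partial>torus) < \<infinity>" .
  qed measurable
  \<comment> \<open>The triple product exhibits the flux as a pairing of \<open>u\<close> with a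
    fixed L2 field.\<close>
  have tr: "(w \<times> v x) \<bullet> W x = w \<bullet> (v x \<times> W x)" for w x
    by (simp add: cross3_simps)
  have "(\<lambda>s. \<integral>\<^sup>+x. ennreal (norm (conv (2^s) u x - u x)) ^ 2 \<partial>torus) \<longlonglongrightarrow> 0"
  proof -
    have "strict_mono (\<lambda>s. 2 ^ s :: nat)" by (rule strict_monoI) simp
    from LIMSEQ_subseq_LIMSEQ[OF conv_tendsto_L2[OF u] this] show ?thesis by (simp add: o_def)
  qed
  then have "(\<lambda>s. \<integral>x. conv (2^s) u x \<bullet> (v x \<times> W x) \<partial>torus) \<longlonglongrightarrow> (\<integral>x. u x \<bullet> (v x \<times> W x) \<partial>torus)"
    by (intro tendsto_inner_L2per L2per_conv L2perD[OF u] u g)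
  then have "(\<lambda>s. flux (2^r) (conv (2^s) u) v) \<longlonglongrightarrow> flux (2^r) u v"
    unfolding flux_def W_def[symmetric] tr .
  then have "(\<lambda>s. \<bar>flux (2^r) (conv (2^s) u) v\<bar>) \<longlonglongrightarrow> \<bar>flux (2^r) u v\<bar>"
    by (rule tendsto_rabs)
  then show ?thesis
    by (rule LIMSEQ_le_const2) (intro exI allI impI flux_bound_smooth[OF X u v ex bu bv V])
qed

lemma flux_const_tendsto:
  assumes "\<alpha>1 < \<theta>" shows "flux_const \<alpha>1 \<alpha>2 \<theta> \<longlonglongrightarrow> 0"
proof -
  define x where "x = 2 powr (\<alpha>1 - \<theta>)"
  have x: "\<bar>x\<bar> < 1" using assms powr_less_mono[of "\<alpha>1 - \<theta>" 0 2] by (simp add: x_def)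
  have "(\<lambda>r. real r * x ^ r) \<longlonglongrightarrow> 0" using powser_times_n_limit_0[of x] x by simp
  moreover have "(\<lambda>r. x ^ r) \<longlonglongrightarrow> 0" using x by (intro LIMSEQ_power_zero) simp
  ultimately have "(\<lambda>r. (70 * (3 * (18 * 2 powr \<alpha>2 * (1 / (1 - 2 powr (\<theta> - \<alpha>2))))) * (3 * 2 powr (2 * \<alpha>1))) * (real r * x ^ r + 4 * x ^ r)) \<longlonglongrightarrow>
    (70 * (3 * (18 * 2 powr \<alpha>2 * (1 / (1 - 2 powr (\<theta> - \<alpha>2))))) * (3 * 2 powr (2 * \<alpha>1))) * (0 + 4 * 0)"
    by (intro tendsto_mult tendsto_add tendsto_const)
  moreover have e: "A * (3 * real (r + 4) * D) * x ^ r = (A * (3 * D)) * (real r * x ^ r + 4 * x ^ r)" for A D r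
    by (simp add: algebra_simps)
  have "flux_const \<alpha>1 \<alpha>2 \<theta> = (\<lambda>r. (70 * (3 * (18 * 2 powr \<alpha>2 * (1 / (1 - 2 powr (\<theta> - \<alpha>2))))) * (3 * 2 powr (2 * \<alpha>1))) * (real r * x ^ r + 4 * x ^ r))"
    by (rule ext) (simp only: flux_const_def x_def[symmetric] e)
  ultimately show ?thesis by simp
qed

subsection \<open>Smooth functions\<close>

lemma C_k_SucI:
  assumes "\<And>x. (f has_derivative f' x) (at x)" "\<And>v. C_k n (\<lambda>x. f' x v)"
  shows "C_k (Suc n) f"
proof -
  have "frechet_derivative f (at x) = f' x" for x
    using frechet_derivative_at[OF assms(1)] by simp
  with assms show ?thesis by (auto simp: differentiable_def)
qed

lemma C_k_has_derivative:
  "C_k (Suc n) f \<Longrightarrow> (f has_derivative frechet_derivative f (at x)) (at x)"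
  by (simp add: frechet_derivative_works)

lemma C_k_Suc_imp: "C_k (Suc n) f \<Longrightarrow> C_k n f"
proof (induction n arbitrary: f)
  case 0
  then have "\<forall>x. f differentiable (at x)" by simp
  then show ?case by (simp add: continuous_at_imp_continuous_on differentiable_imp_continuous_within)
next
  case (Suc n)
  have "C_k n (\<lambda>x. frechet_derivative f (at x) v)" for v
    by (rule Suc.IH) (use Suc.prems in simp)
  then show ?case using Suc.prems by simp
qed

lemma C_k_const: "C_k n (\<lambda>x. c)"
  by (induction n arbitrary: c) auto

lemma C_k_add: "C_k n f \<Longrightarrow> C_k n g \<Longrightarrow> C_k n (\<lambda>x. f x + g x)"
proof (induction n arbitrary: f g)
  case 0 then show ?case by (simp add: continuous_on_add)
next
  case (Suc n)
  show ?case
    by (rule C_k_SucI[OF has_derivative_add[OF C_k_has_derivative[OF Suc.prems(1)] C_k_has_derivative[OF Suc.prems(2)]]])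
       (use Suc in auto)
qed

lemma C_k_scaleR: "C_k n f \<Longrightarrow> C_k n g \<Longrightarrow> C_k n (\<lambda>x. f x *\<^sub>R g x)"
proof (induction n arbitrary: f g)
  case 0 then show ?case by (simp add: continuous_on_scaleR)
next
  case (Suc n)
  show ?case
    by (rule C_k_SucI[OF has_derivative_scaleR[OF C_k_has_derivative[OF Suc.prems(1)] C_k_has_derivative[OF Suc.prems(2)]]])
       (intro C_k_add Suc.IH C_k_Suc_imp[OF Suc.prems(1)] C_k_Suc_imp[OF Suc.prems(2)], use Suc.prems in auto)
qed

lemma C_k_affine:
  fixes L :: "'a::euclidean_space \<Rightarrow> 'b::euclidean_space"
  assumes "bounded_linear L"
  shows "C_k n f \<Longrightarrow> C_k n (\<lambda>x. f (L x + c))"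
proof (induction n arbitrary: f)
  case 0
  have L: "continuous_on UNIV (\<lambda>x. L x + c)"
    by (intro continuous_on_add linear_continuous_on continuous_on_const assms)
  have f: "continuous_on UNIV f" using 0 by simp
  show ?case unfolding C_k.simps by (rule continuous_on_compose2[OF f L]) auto
next
  case (Suc n)
  have d: "((\<lambda>x. f (L x + c)) has_derivative (\<lambda>v. frechet_derivative f (at (L x + c)) (L v))) (at x)" for x
    by (rule has_derivative_compose[of "\<lambda>x. L x + c" L, OF _ C_k_has_derivative[OF Suc.prems]])
       (auto intro!: derivative_eq_intros bounded_linear_imp_has_derivative assms)
  have "C_k n (\<lambda>x. frechet_derivative f (at (L x + c)) (L v))" for v
    by (rule Suc.IH[where f="\<lambda>y. frechet_derivative f (at y) (L v)"]) (use Suc.prems in simp)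
  with d show ?case by (rule C_k_SucI)
qed

lemma smooth_scaleR: "smooth f \<Longrightarrow> smooth g \<Longrightarrow> smooth (\<lambda>x. f x *\<^sub>R g x)"
  and smooth_const: "smooth (\<lambda>x. c)"
  and smooth_add: "smooth f \<Longrightarrow> smooth h \<Longrightarrow> smooth (\<lambda>x. f x + h x)"
  by (simp_all add: smooth_def C_k_scaleR C_k_const C_k_add)

lemma smooth_affine:
  fixes L :: "'a::euclidean_space \<Rightarrow> 'b::euclidean_space"
  assumes "bounded_linear L" "smooth f" shows "smooth (\<lambda>x. f (L x + c))"
  using C_k_affine[OF assms(1), of _ f c] assms(2) by (simp add: smooth_def)

lemma smooth_linear:
  fixes L :: "'a::euclidean_space \<Rightarrow> 'b::euclidean_space"
  assumes "bounded_linear L" "smooth f" shows "smooth (\<lambda>x. f (L x))"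
  using smooth_affine[OF assms, of 0] by simp

lemma smooth_mult: "smooth f \<Longrightarrow> smooth g \<Longrightarrow> smooth (\<lambda>x. f x * g x :: real)"
  using smooth_scaleR[of f g] by simp

lemma smooth_antiderivative:
  fixes f g :: "real \<Rightarrow> real"
  assumes "\<And>x. (f has_real_derivative g x) (at x)" "smooth g"
  shows "smooth f"
  unfolding smooth_def
proof
  fix n
  have "C_k (Suc n) f"
  proof (rule C_k_SucI)
    show "(f has_derivative (\<lambda>v. g x * v)) (at x)" for x
      using assms(1)[of x] by (simp add: has_field_derivative_def)
    show "C_k n (\<lambda>x. g x * v)" for v
      using smooth_mult[OF assms(2) smooth_const] by (simp add: smooth_def)
  qed
  then show "C_k n f" by (rule C_k_Suc_imp)
qed

text \<open>A class closed under differentiation consists of smooth functions. The factor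
  \<open>c\<close> is there because \<open>C_k\<close> asks for derivatives in every direction, and
  the derivative in direction \<open>c\<close> is \<open>g x * c\<close>.\<close>

lemma smooth_coinduct:
  fixes F :: "(real \<Rightarrow> real) set"
  assumes "f \<in> F" and step: "\<And>f. f \<in> F \<Longrightarrow> \<exists>g. (\<forall>x. (f has_real_derivative g x) (at x)) \<and> (\<forall>c. (\<lambda>x. g x * c) \<in> F)"
  shows "smooth f"
proof -
  have "C_k n f" if "f \<in> F" for n f using that
  proof (induction n arbitrary: f)
    case 0
    then obtain g where "\<And>x. (f has_real_derivative g x) (at x)" using step by metis
    then show ?case by (auto intro!: continuous_at_imp_continuous_on DERIV_isCont)
  next
    case (Suc n)
    then obtain g where g: "\<And>x. (f has_real_derivative g x) (at x)" "\<And>c. (\<lambda>x. g x * c) \<in> F" using step by metis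
    show ?case
    proof (rule C_k_SucI)
      show "(f has_derivative (\<lambda>v. g x * v)) (at x)" for x
        using g(1)[of x] by (simp add: has_field_derivative_def)
      show "C_k n (\<lambda>x. g x * v)" for v by (rule Suc.IH[OF g(2)])
    qed
  qed
  with assms(1) show ?thesis by (simp add: smooth_def)
qed

lemma smooth_cos: "smooth (cos :: real \<Rightarrow> real)" and smooth_sin: "smooth (sin :: real \<Rightarrow> real)"
proof -
  define F where "F = range (\<lambda>(a, b). \<lambda>x::real. a * cos x + b * sin x)"
  have F: "(\<lambda>x. a * cos x + b * sin x) \<in> F" for a b by (auto simp: F_def)
  have step: "\<exists>g. (\<forall>x. (f has_real_derivative g x) (at x)) \<and> (\<forall>c. (\<lambda>x. g x * c) \<in> F)" if f: "f \<in> F" for f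
  proof -
    obtain a b where f: "f = (\<lambda>x. a * cos x + b * sin x)" using f by (auto simp: F_def)
    have "(f has_real_derivative (b * cos x + (- a) * sin x)) (at x)" for x
      unfolding f by (auto intro!: derivative_eq_intros)
    moreover have "(\<lambda>x. (b * cos x + (- a) * sin x) * c) \<in> F" for c
      using F[of "b * c" "- a * c"] by (simp add: algebra_simps)
    ultimately show ?thesis by (intro exI[of _ "\<lambda>x. b * cos x + (- a) * sin x"] conjI allI)
  qed
  show "smooth (cos :: real \<Rightarrow> real)" "smooth (sin :: real \<Rightarrow> real)"
    by (rule smooth_coinduct[OF _ step], use F[of 1 0] F[of 0 1] in simp_all)+
qed

section \<open>A class of functions flat at the origin, and the smooth cutoffs built from it\<close>

text \<open>The polynomial parameter closes the class of exp(-1/x) under differentiation: with y =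
  1/x, the derivative replaces p by y^2 (p - p'), and \<open>[:0, 0, 1:]\<close> is y^2.\<close>

definition flat :: "real poly \<Rightarrow> real \<Rightarrow> real" where
  "flat p x = (if 0 < x then poly p (1 / x) * exp (- (1 / x)) else 0)"

lemma poly_over_exp: "((\<lambda>y. poly p y * exp (- y)) \<longlongrightarrow> (0::real)) at_top"
proof -
  have "((\<lambda>y. \<Sum>i\<le>degree p. coeff p i * (y ^ i / exp y)) \<longlongrightarrow> (\<Sum>i\<le>degree p. coeff p i * 0)) at_top"
    by (intro tendsto_intros tendsto_power_div_exp_0)
  then show ?thesis
    by (simp add: poly_altdef exp_minus field_simps sum_distrib_left sum_distrib_right sum_divide_distrib)
qed

lemma flat_has_derivative: "(flat p has_real_derivative flat ([:0, 0, 1:] * (p - pderiv p)) x) (at x)"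
proof -
  consider "0 < x" | "x < 0" | "x = 0" by linarith
  then show ?thesis
  proof cases
    case 1
    have "((\<lambda>x. poly p (1 / x) * exp (- (1 / x))) has_real_derivative flat ([:0, 0, 1:] * (p - pderiv p)) x) (at x)"
      using 1 by (auto intro!: derivative_eq_intros DERIV_chain2[OF poly_DERIV] simp: flat_def field_simps power2_eq_square)
    moreover have "\<forall>\<^sub>F y in nhds x. poly p (1 / y) * exp (- (1 / y)) = flat p y"
      using eventually_nhds_in_open[of "{0<..}" x] 1 by (auto elim!: eventually_mono simp: flat_def)
    ultimately show ?thesis by (simp only: DERIV_cong_ev[OF refl _ refl])
  next
    case 2
    have "((\<lambda>x. 0) has_real_derivative 0) (at x)" by simp
    moreover have "\<forall>\<^sub>F y in nhds x. 0 = flat p y"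
      using eventually_nhds_in_open[of "{..<0}" x] 2 by (auto elim!: eventually_mono simp: flat_def)
    ultimately have "(flat p has_real_derivative 0) (at x)" by (simp only: DERIV_cong_ev[OF refl _ refl])
    then show ?thesis using 2 by (simp add: flat_def)
  next
    case 3
    \<comment> \<open>Dividing \<open>flat p h\<close> by \<open>h\<close> multiplies the polynomial
      by its variable, which is \<open>pCons 0 p\<close>; the exponential still wins.\<close>
    have "((\<lambda>h. poly (pCons 0 p) (inverse h) * exp (- inverse h)) \<longlongrightarrow> 0) (at_right 0)"
      by (rule filterlim_compose[OF poly_over_exp filterlim_inverse_at_top_right])
    moreover have "\<forall>\<^sub>F h in at_right 0. poly (pCons 0 p) (inverse h) * exp (- inverse h) = flat p h / h"
      by (auto simp: eventually_at_filter flat_def field_simps)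
    ultimately have r: "((\<lambda>h. flat p h / h) \<longlongrightarrow> 0) (at_right 0)" by (rule Lim_transform_eventually)
    have "\<forall>\<^sub>F h in at_left (0::real). 0 = flat p h / h"
      by (auto simp: eventually_at_filter flat_def)
    then have l: "((\<lambda>h. flat p h / h) \<longlongrightarrow> 0) (at_left 0)" by (rule Lim_transform_eventually[OF tendsto_const])
    have "((\<lambda>h. flat p h / h) \<longlongrightarrow> 0) (at 0)" using l r by (simp add: filterlim_at_split)
    then show ?thesis using 3 by (simp add: DERIV_def flat_def)
  qed
qed

lemma smooth_flat: "smooth (flat p)"
proof (rule smooth_coinduct[where F="range flat"])
  fix f assume "f \<in> range flat"
  then obtain p where f: "f = flat p" by auto
  have "(\<lambda>x. flat ([:0, 0, 1:] * (p - pderiv p)) x * c) = flat (smult c ([:0, 0, 1:] * (p - pderiv p)))" for c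
    by (rule ext) (simp add: flat_def)
  then show "\<exists>g. (\<forall>x. (f has_real_derivative g x) (at x)) \<and> (\<forall>c. (\<lambda>x. g x * c) \<in> range flat)"
    unfolding f using flat_has_derivative[of p] by (metis rangeI)
qed simp

text \<open>As \<open>m\<close> grows, \<open>cutoff h m\<close> increases to the indicator of the interval from \<open>0\<close> to \<open>h\<close>.\<close>

definition cutoff :: "real \<Rightarrow> nat \<Rightarrow> real \<Rightarrow> real" where
  "cutoff h m x = flat 1 (real m * x) * flat 1 (real m * (h - x))"

lemma smooth_cutoff: "smooth (cutoff h m)"
proof -
  have "smooth (\<lambda>x. flat 1 (real m * x))"
    by (rule smooth_linear[OF bounded_linear_mult_right smooth_flat])
  moreover have "smooth (\<lambda>x. flat 1 ((- real m) * x + real m * h))"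
    by (rule smooth_affine[OF bounded_linear_mult_right smooth_flat])
  ultimately show ?thesis unfolding cutoff_def[abs_def]
    using smooth_mult by (auto simp: algebra_simps)
qed

lemma flat_1_bounds: "0 \<le> flat 1 x" "flat 1 x \<le> 1"
  by (auto simp: flat_def)

lemma cutoff_bounds: "0 \<le> cutoff h m x" "cutoff h m x \<le> 1"
  using flat_1_bounds by (auto simp: cutoff_def intro: mult_le_one)

lemma cutoff_outside: "x \<notin> {0<..<h} \<Longrightarrow> cutoff h m x = 0"
  by (auto simp: cutoff_def flat_def zero_less_mult_iff)

lemma cutoff_tendsto: "(\<lambda>m. cutoff h m x) \<longlonglongrightarrow> indicator {0<..<h} x"
proof (cases "x \<in> {0<..<h}")
  case True
  have "(\<lambda>m. flat 1 (real m * c)) \<longlonglongrightarrow> 1" if c: "0 < c" for c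
  proof -
    have "(\<lambda>m. exp (- ((1 / c) * inverse (real m)))) \<longlonglongrightarrow> exp (- ((1 / c) * 0))"
      by (intro tendsto_intros lim_inverse_n)
    moreover have "\<forall>\<^sub>F m in sequentially. exp (- ((1 / c) * inverse (real m))) = flat 1 (real m * c)"
      using eventually_gt_at_top[of 0] by eventually_elim (use c in \<open>auto simp: flat_def field_simps\<close>)
    ultimately show ?thesis by (simp add: Lim_transform_eventually)
  qed
  from tendsto_mult[OF this[of x] this[of "h - x"]] True show ?thesis
    by (simp add: cutoff_def)
qed (simp add: cutoff_outside)

subsection \<open>Integrals in time\<close>

lemma bounded_borel_integrable_on:
  fixes f :: "real \<Rightarrow> 'b::euclidean_space"
  assumes f [measurable]: "f \<in> borel_measurable borel" and C: "\<And>x. norm (f x) \<le> C"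
  shows "f integrable_on {a..b}" "set_integrable lborel {a..b} f"
proof -
  show "set_integrable lborel {a..b} f"
    unfolding set_integrable_def
  proof (rule Bochner_Integration.integrable_bound)
    have "integrable lborel (indicator {a..b} :: real \<Rightarrow> real)"
      by (rule integrable_real_indicator) (auto simp: emeasure_lborel_Icc_eq)
    then show "integrable lborel (\<lambda>x. C *\<^sub>R indicator {a..b} x :: real)" by simp
    show "AE x in lborel. norm (indicator {a..b} x *\<^sub>R f x) \<le> norm (C *\<^sub>R indicator {a..b} x :: real)"
      using order_trans[OF C abs_ge_self] by (intro AE_I2) (auto simp: indicator_def)
  qed simp
  then show "f integrable_on {a..b}" by (rule set_borel_integral_eq_integral(1))
qed

lemma norm_integral_le:
  fixes f :: "real \<Rightarrow> 'b::euclidean_space"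
  assumes "f integrable_on {a..b}" "\<And>x. x \<in> {a..b} \<Longrightarrow> norm (f x) \<le> K" "a \<le> b" "0 \<le> K"
  shows "norm (integral {a..b} f) \<le> K * (b - a)"
  using integral_bound[of a b f K] has_integral_bound[of K f "integral {a..b} f" a b] assms by (simp add: integrable_integral cbox_interval)

text \<open>With n + 1 equal steps the increments add up to at most K (b - a)^2 / (n + 1), which
  tends to 0.\<close>

lemma quadratic_variation_zero:
  fixes D :: "real \<Rightarrow> 'b::euclidean_space"
  assumes D: "\<And>s t. a \<le> s \<Longrightarrow> s \<le> t \<Longrightarrow> t \<le> b \<Longrightarrow> norm (D t - D s) \<le> K * (t - s)\<^sup>2"
    and ab: "a \<le> b"
  shows "D b = D a"
proof -
  have le: "norm (D b - D a) \<le> (K * (b - a)\<^sup>2) * inverse (real (Suc n))" for n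
  proof -
    define c where "c = (b - a) / real (Suc n)"
    have c: "0 \<le> c" "real (Suc n) * c = b - a" using ab by (simp_all add: c_def)
    define p where "p i = a + real i * c" for i
    have p: "a \<le> p i" "p i \<le> p (Suc i)" for i using c(1) by (auto simp: p_def intro!: mult_right_mono)
    have pn: "p (Suc n) = b" unfolding p_def c(2) by simp
    have pb: "p i \<le> b" if "i \<le> Suc n" for i
    proof -
      have "real i * c \<le> real (Suc n) * c"
        using that c(1) by (intro mult_right_mono) auto
      then show ?thesis unfolding c(2) by (simp add: p_def)
    qed
    have "(\<Sum>i<Suc n. D (p (Suc i)) - D (p i)) = D (p (Suc n)) - D (p 0)"
      by (rule sum_lessThan_telescope)
    then have "D b - D a = (\<Sum>i<Suc n. D (p (Suc i)) - D (p i))"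
      unfolding pn by (simp only: p_def) simp
    also have "norm \<dots> \<le> (\<Sum>i<Suc n. K * c\<^sup>2)"
    proof (rule sum_norm_le)
      fix i assume "i \<in> {..<Suc n}"
      then have "norm (D (p (Suc i)) - D (p i)) \<le> K * (p (Suc i) - p i)\<^sup>2"
        by (intro D p pb) auto
      also have "p (Suc i) - p i = c" by (simp add: p_def algebra_simps)
      finally show "norm (D (p (Suc i)) - D (p i)) \<le> K * c\<^sup>2" .
    qed
    also have "\<dots> = (K * (b - a)\<^sup>2) * inverse (real (Suc n))"
    proof -
      have "(\<Sum>i<Suc n. K * c\<^sup>2) = K * (real (Suc n) * c) * c" by (simp add: power2_eq_square)
      then show ?thesis unfolding c(2) by (simp add: c_def power2_eq_square divide_inverse)
    qed
    finally show ?thesis .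
  qed
  have "(\<lambda>n. (K * (b - a)\<^sup>2) * inverse (real (Suc n))) \<longlonglongrightarrow> (K * (b - a)\<^sup>2) * 0"
    by (intro tendsto_mult tendsto_const LIMSEQ_inverse_real_of_nat)
  from LIMSEQ_le_const[OF this] le have "norm (D b - D a) \<le> (K * (b - a)\<^sup>2) * 0" by blast
  then show ?thesis by simp
qed

lemma integral_diff_le:
  fixes g :: "real \<Rightarrow> 'b::euclidean_space"
  assumes g: "g \<in> borel_measurable borel" "\<And>x. norm (g x) \<le> C" and st: "s \<le> t"
  shows "a \<le> s \<Longrightarrow> integral {a..t} g - integral {a..s} g = integral {s..t} g"
    and "norm (integral {a..t} g - integral {a..s} g) \<le> C * (t - s)"
proof -
  have C0: "0 \<le> C" using g(2)[of 0] norm_ge_zero order_trans by blast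
  show *: "integral {a..t} g - integral {a..s} g = integral {s..t} g" if "a \<le> s" for a
    using Henstock_Kurzweil_Integration.integral_combine[of a s t g] that st bounded_borel_integrable_on(1)[OF g]
    by (simp add: algebra_simps)
  have le: "norm (integral {s'..t} g) \<le> C * (t - s')" if "s' \<le> t" for s'
    by (rule norm_integral_le) (use g that C0 bounded_borel_integrable_on(1)[OF g] in auto)
  \<comment> \<open>For upper limits below \<open>a\<close> the interval is empty and the integral
    is 0, so the Lipschitz bound holds on the whole line.\<close>
  consider "a \<le> s" | "s < a" "a \<le> t" | "t < a" by linarith
  then show "norm (integral {a..t} g - integral {a..s} g) \<le> C * (t - s)"
  proof cases
    case 1 then show ?thesis using *[of a] le[of s] st by simp
  next
    case 2
    have "C * (t - a) \<le> C * (t - s)" using 2 C0 by (intro mult_left_mono) auto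
    then show ?thesis using le[of a] 2 by simp
  next
    case 3 then show ?thesis using st C0 by simp
  qed
qed

lemma Lipschitz_continuous:
  fixes f :: "real \<Rightarrow> 'b::euclidean_space"
  assumes "\<And>s t. s \<le> t \<Longrightarrow> norm (f t - f s) \<le> C * (t - s)"
  shows "continuous_on UNIV f"
proof -
  have C: "0 \<le> C" using order_trans[OF norm_ge_zero assms[of 0 1]] by simp
  have "C-lipschitz_on UNIV f"
  proof (rule lipschitz_onI)
    fix x y :: real
    show "dist (f x) (f y) \<le> C * dist x y"
    proof (cases "x \<le> y")
      case True
      then show ?thesis using assms[OF True] by (simp add: dist_norm norm_minus_commute abs_minus_commute)
    next
      case False
      then show ?thesis using assms[of y x] by (simp add: dist_norm)
    qed
  qed (rule C)
  then show ?thesis by (rule lipschitz_on_continuous_on)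
qed

text \<open>The difference of the two sides varies quadratically, so it is constant.\<close>

lemma product_rule_indefinite_integrals:
  fixes b g :: "real \<Rightarrow> 'a::euclidean_space" and c h :: "real \<Rightarrow> 'b::euclidean_space"
    and pr :: "'a \<Rightarrow> 'b \<Rightarrow> 'c::euclidean_space"
  assumes pr: "bounded_bilinear pr"
    and g: "g \<in> borel_measurable borel" "\<And>x. norm (g x) \<le> C"
    and h: "h \<in> borel_measurable borel" "\<And>x. norm (h x) \<le> C"
    and b: "\<And>s t. \<alpha> \<le> s \<Longrightarrow> s \<le> t \<Longrightarrow> t \<le> \<beta> \<Longrightarrow> b t - b s = integral {s..t} g"
    and c: "\<And>s t. \<alpha> \<le> s \<Longrightarrow> s \<le> t \<Longrightarrow> t \<le> \<beta> \<Longrightarrow> c t - c s = integral {s..t} h"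
    and ab: "\<alpha> \<le> \<beta>"
  shows "pr (b \<beta>) (c \<beta>) - pr (b \<alpha>) (c \<alpha>) = integral {\<alpha>..\<beta>} (\<lambda>r. pr (g r) (c r) + pr (b r) (h r))"
proof -
  interpret bounded_bilinear pr by (rule pr)
  obtain K where K: "0 < K" "\<And>a b. norm (pr a b) \<le> norm a * norm b * K" using pos_bounded by blast
  have C0: "0 \<le> C" using g(2)[of 0] norm_ge_zero order_trans by blast
  \<comment> \<open>Only the values of \<open>b\<close> and \<open>c\<close> between \<alpha> and
    \<beta> are controlled; \<open>b'\<close> and \<open>c'\<close> agree with them there and are
    Lipschitz, hence Borel, on the whole line.\<close>
  define b' where "b' t = b \<alpha> + integral {\<alpha>..t} g" for t
  define c' where "c' t = c \<alpha> + integral {\<alpha>..t} h" for t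
  have b'_lip: "norm (b' t - b' s) \<le> C * (t - s)" if "s \<le> t" for s t
    using integral_diff_le(2)[OF g that, of \<alpha>] by (simp add: b'_def)
  have c'_lip: "norm (c' t - c' s) \<le> C * (t - s)" if "s \<le> t" for s t
    using integral_diff_le(2)[OF h that, of \<alpha>] by (simp add: c'_def)
  have b'c: "continuous_on UNIV b'" and c'c: "continuous_on UNIV c'"
    by (rule Lipschitz_continuous, erule b'_lip) (rule Lipschitz_continuous, erule c'_lip)
  have [measurable]: "b' \<in> borel_measurable borel" "c' \<in> borel_measurable borel"
    "g \<in> borel_measurable borel" "h \<in> borel_measurable borel"
    using b'c c'c g h by (auto intro: borel_measurable_continuous_onI)
  have eq: "b' t = b t" "c' t = c t" if "t \<in> {\<alpha>..\<beta>}" for t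
    using b[of \<alpha> t] c[of \<alpha> t] that by (auto simp: b'_def c'_def algebra_simps)
  define k where "k r = pr (g r) (c' r) + pr (b' r) (h r)" for r
  have prm [measurable]: "(\<lambda>r. pr (f r) (f' r)) \<in> borel_measurable borel"
    if "f \<in> borel_measurable borel" "f' \<in> borel_measurable borel" for f :: "real \<Rightarrow> 'a" and f' :: "real \<Rightarrow> 'b"
    using that by (rule borel_measurable_continuous_Pair) (intro continuous_on continuous_intros)
  have k_int: "k integrable_on {s..t}" if st: "\<alpha> \<le> s" "s \<le> t" "t \<le> \<beta>" for s t
  proof -
    obtain B where B: "\<And>x. x \<in> {\<alpha>..\<beta>} \<Longrightarrow> norm (b' x) \<le> B \<and> norm (c' x) \<le> B"
    proof -
      have "bounded (b' ` {\<alpha>..\<beta>})" "bounded (c' ` {\<alpha>..\<beta>})"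
        by (intro compact_imp_bounded compact_continuous_image continuous_on_subset[OF b'c] continuous_on_subset[OF c'c] compact_Icc subset_UNIV)+
      then obtain B1 B2 where "\<forall>x\<in>{\<alpha>..\<beta>}. norm (b' x) \<le> B1" "\<forall>x\<in>{\<alpha>..\<beta>}. norm (c' x) \<le> B2"
        unfolding bounded_iff by blast
      then have "norm (b' x) \<le> max B1 B2 \<and> norm (c' x) \<le> max B1 B2" if "x \<in> {\<alpha>..\<beta>}" for x
        using that by (auto simp: le_max_iff_disj)
      then show ?thesis using that by blast
    qed
    have k_meas: "(\<lambda>r. indicator {\<alpha>..\<beta>} r *\<^sub>R k r) \<in> borel_measurable borel" unfolding k_def by measurable
    have "norm (indicator {\<alpha>..\<beta>} r *\<^sub>R k r) \<le> 2 * (C * B * K)" for r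
    proof (cases "r \<in> {\<alpha>..\<beta>}")
      case True
      have "norm (k r) \<le> norm (g r) * norm (c' r) * K + norm (b' r) * norm (h r) * K"
        unfolding k_def by (intro norm_triangle_le add_mono K)
      also have "\<dots> \<le> C * B * K + B * C * K"
        using B[OF True] g(2)[of r] h(2)[of r] K(1) C0
        by (intro add_mono mult_right_mono mult_mono) (auto intro: order_trans[OF norm_ge_zero])
      finally show ?thesis using True by (simp add: mult_ac)
    next
      case False
      have "0 \<le> B" using B[of \<alpha>] ab norm_ge_zero order_trans by (metis atLeastAtMost_iff order_refl)
      then show ?thesis using False C0 K(1) by simp
    qed
    then have "(\<lambda>r. indicator {\<alpha>..\<beta>} r *\<^sub>R k r) integrable_on {s..t}"
      by (rule bounded_borel_integrable_on(1)[OF k_meas])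
    then show ?thesis
      by (rule integrable_eq) (use st in auto)
  qed
  define D where "D t = pr (b t) (c t) - integral {\<alpha>..t} k" for t
  have "D \<beta> = D \<alpha>"
  proof (rule quadratic_variation_zero[where K="2 * (C * C * K)"])
    fix s t assume st: "\<alpha> \<le> s" "s \<le> t" "t \<le> \<beta>"
    have gi: "g integrable_on {s..t}" and hi: "h integrable_on {s..t}"
      using bounded_borel_integrable_on(1)[OF g] bounded_borel_integrable_on(1)[OF h] by auto
    \<comment> \<open>Freezing one factor at the right end and the other at the left end makes the
      increment exact, with no quadratic remainder at this stage.\<close>
    have "pr (b t) (c t) - pr (b s) (c s) = pr (b t - b s) (c t) + pr (b s) (c t - c s)"
      by (simp add: diff_left diff_right)
    also have "\<dots> = pr (integral {s..t} g) (c t) + pr (b s) (integral {s..t} h)"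
      using b[OF st] c[OF st] by simp
    also have "pr (integral {s..t} g) (c t) = integral {s..t} (\<lambda>r. pr (g r) (c t))"
      using integral_linear[OF gi bounded_linear_left, of "c t"] by (simp add: o_def)
    also have "pr (b s) (integral {s..t} h) = integral {s..t} (\<lambda>r. pr (b s) (h r))"
      using integral_linear[OF hi bounded_linear_right, of "b s"] by (simp add: o_def)
    finally have 1: "pr (b t) (c t) - pr (b s) (c s) = integral {s..t} (\<lambda>r. pr (g r) (c t)) + integral {s..t} (\<lambda>r. pr (b s) (h r))" .
    have i1: "(\<lambda>r. pr (g r) (c t)) integrable_on {s..t}" using integrable_linear[OF gi bounded_linear_left, of "c t"] by (simp add: o_def)
    have i2: "(\<lambda>r. pr (b s) (h r)) integrable_on {s..t}" using integrable_linear[OF hi bounded_linear_right, of "b s"] by (simp add: o_def)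
    have "integral {\<alpha>..t} k = integral {\<alpha>..s} k + integral {s..t} k"
      using Henstock_Kurzweil_Integration.integral_combine[of \<alpha> s t k] st k_int[of \<alpha> t] by simp
    then have "D t - D s = integral {s..t} (\<lambda>r. pr (g r) (c t)) + integral {s..t} (\<lambda>r. pr (b s) (h r)) - integral {s..t} k"
      using 1 by (simp add: D_def algebra_simps)
    also have "\<dots> = integral {s..t} (\<lambda>r. pr (g r) (c t) + pr (b s) (h r) - k r)"
      using i1 i2 k_int[OF st] by (simp add: Henstock_Kurzweil_Integration.integral_add Henstock_Kurzweil_Integration.integral_diff integrable_add)
    finally have 2: "D t - D s = integral {s..t} (\<lambda>r. pr (g r) (c t) + pr (b s) (h r) - k r)" .
    \<comment> \<open>Unfreezing costs one factor \<open>t - s\<close> by the Lipschitz bounds, and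
      integration over the interval costs the other.\<close>
    have "norm (D t - D s) \<le> (2 * (C * C * K) * (t - s)) * (t - s)"
      unfolding 2
    proof (rule norm_integral_le)
      show "(\<lambda>r. pr (g r) (c t) + pr (b s) (h r) - k r) integrable_on {s..t}"
        by (intro integrable_diff integrable_add i1 i2 k_int st)
      fix r assume r: "r \<in> {s..t}"
      have "pr (g r) (c t) + pr (b s) (h r) - k r = pr (g r) (c' t - c' r) + pr (b' s - b' r) (h r)"
        using eq[of t] eq[of s] st r unfolding k_def by (simp add: diff_left diff_right)
      also have "norm \<dots> \<le> norm (g r) * norm (c' t - c' r) * K + norm (b' s - b' r) * norm (h r) * K"
        by (intro norm_triangle_le add_mono K)
      also have "\<dots> \<le> C * (C * (t - s)) * K + (C * (t - s)) * C * K"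
      proof (intro add_mono mult_right_mono mult_mono g h)
        show "norm (c' t - c' r) \<le> C * (t - s)"
          using c'_lip[of r t] r C0 by (intro order_trans[OF c'_lip mult_left_mono]) auto
        show "norm (b' s - b' r) \<le> C * (t - s)"
          using r C0 unfolding norm_minus_commute[of "b' s"] by (intro order_trans[OF b'_lip mult_left_mono]) auto
      qed (use K(1) C0 st in auto)
      finally show "norm (pr (g r) (c t) + pr (b s) (h r) - k r) \<le> 2 * (C * C * K) * (t - s)" by (simp add: mult_ac)
    qed (use st C0 K(1) in auto)
    then show "norm (D t - D s) \<le> 2 * (C * C * K) * (t - s)\<^sup>2" by (simp add: power2_eq_square mult_ac)
  qed (rule ab)
  then have "pr (b \<beta>) (c \<beta>) = integral {\<alpha>..\<beta>} k + pr (b \<alpha>) (c \<alpha>)" by (simp add: D_def diff_eq_eq add.commute)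
  then have "pr (b \<beta>) (c \<beta>) - pr (b \<alpha>) (c \<alpha>) = integral {\<alpha>..\<beta>} k" by simp
  also have "\<dots> = integral {\<alpha>..\<beta>} (\<lambda>r. pr (g r) (c r) + pr (b r) (h r))"
    by (rule Henstock_Kurzweil_Integration.integral_cong) (simp add: k_def eq)
  finally show ?thesis .
qed

subsection \<open>The lemma of du Bois-Reymond\<close>

definition time_bump :: "real \<Rightarrow> (real \<Rightarrow> real) \<Rightarrow> bool" where
  "time_bump T \<eta> \<longleftrightarrow> smooth \<eta> \<and> (\<exists>a b. 0 < a \<and> b < T \<and> (\<forall>t. t \<notin> {a..b} \<longrightarrow> \<eta> t = 0))"

lemma continuous_cutoff: "continuous_on S (cutoff h m)"
proof -
  have "C_k 0 (cutoff h m)" using smooth_cutoff[of h m] by (simp only: smooth_def)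
  then show ?thesis by (auto intro: continuous_on_subset)
qed

lemma cutoff_antiderivative:
  obtains F where "\<And>r. (F has_real_derivative cutoff h m r) (at r)" "\<And>r. r \<le> 0 \<Longrightarrow> F r = 0" "\<And>r. h \<le> r \<Longrightarrow> F r = F h"
proof -
  \<comment> \<open>Starting at -1, where the integrand still vanishes, makes 0 an interior point,
    so that the derivative there is two-sided.\<close>
  define F where "F r = integral {-1..r} (cutoff h m)" for r
  have zero: "integral {a..b} (cutoff h m) = 0" if "\<And>x. x \<in> {a..b} \<Longrightarrow> x \<notin> {0<..<h}" for a b
  proof -
    have "integral {a..b} (cutoff h m) = integral {a..b} (\<lambda>_. 0 :: real)"
      using that by (intro Henstock_Kurzweil_Integration.integral_cong cutoff_outside)
    then show ?thesis by simp
  qed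
  have F0: "F r = 0" if "r \<le> 0" for r unfolding F_def using that by (intro zero) auto
  have Fh: "F r = F h" if "h \<le> r" for r
  proof (cases "-1 \<le> h")
    case True
    have "integral {h..r} (cutoff h m) = 0" by (rule zero) auto
    moreover have "integral {-1..h} (cutoff h m) + integral {h..r} (cutoff h m) = integral {-1..r} (cutoff h m)"
      using True that by (intro Henstock_Kurzweil_Integration.integral_combine integrable_continuous_real continuous_cutoff) auto
    ultimately show ?thesis by (simp add: F_def)
  next
    case False
    then show ?thesis unfolding F_def by (subst (1 2) zero) auto
  qed
  have D: "(F has_real_derivative cutoff h m r) (at r)" for r
  proof (cases "r < 0")
    case True
    have "((\<lambda>_. 0) has_real_derivative 0) (at r)" by simp
    moreover have "\<forall>\<^sub>F y in nhds r. F y = 0"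
      using eventually_nhds_in_open[of "{..<0}" r] True by (auto elim!: eventually_mono simp: F0)
    ultimately show ?thesis using True by (simp add: cutoff_outside DERIV_cong_ev[of r r F "\<lambda>_. 0"])
  next
    case False
    have "(F has_real_derivative cutoff h m r) (at r within {-1..r+1})"
      unfolding F_def using False by (intro integral_has_real_derivative continuous_cutoff) auto
    then show ?thesis using False by (simp add: at_within_Icc_at)
  qed
  show ?thesis by (rule that[OF D F0 Fh])
qed

lemma integral_cutoff_tendsto:
  fixes w :: "real \<Rightarrow> real"
  assumes w: "\<And>a b. w integrable_on {a..b}" "\<And>m. (\<lambda>r. cutoff h m (r - s) * w r) integrable_on {0..T}"
    and M: "\<And>r. r \<in> {0..T} \<Longrightarrow> \<bar>w r\<bar> \<le> M" and s: "0 \<le> s" "s + h \<le> T" "0 \<le> h"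
  shows "(\<lambda>m. integral {0..T} (\<lambda>r. cutoff h m (r - s) * w r)) \<longlonglongrightarrow> integral {s..s+h} w"
proof -
  have "(\<lambda>m. integral {0..T} (\<lambda>r. cutoff h m (r - s) * w r)) \<longlonglongrightarrow> integral {0..T} (\<lambda>r. if r \<in> {s<..<s+h} then w r else 0)"
  proof (rule dominated_convergence(2)[where h="\<lambda>_. M"])
    fix m r assume r: "r \<in> {0..T}"
    have "\<bar>cutoff h m (r - s)\<bar> * \<bar>w r\<bar> \<le> 1 * M"
      using cutoff_bounds[of h m "r - s"] M[OF r] by (intro mult_mono) auto
    then show "norm (cutoff h m (r - s) * w r) \<le> M" by (simp add: abs_mult)
  next
    fix r
    have "(\<lambda>m. cutoff h m (r - s) * w r) \<longlonglongrightarrow> indicator {0<..<h} (r - s) * w r"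
      by (intro tendsto_mult tendsto_const cutoff_tendsto)
    then show "(\<lambda>m. cutoff h m (r - s) * w r) \<longlonglongrightarrow> (if r \<in> {s<..<s+h} then w r else 0)"
      by (auto simp: indicator_def split: if_splits)
  qed (use w(2) in auto)
  also have "integral {0..T} (\<lambda>r. if r \<in> {s<..<s+h} then w r else 0) = integral ({s<..<s+h} \<inter> {0..T}) w"
    by (rule integral_restrict_Int)
  also have "{s<..<s+h} \<inter> {0..T} = {s<..<s+h}" using s by auto
  also have "integral {s<..<s+h} w = integral {s..s+h} w" by (rule integral_open_interval_real[symmetric])
  finally show ?thesis .
qed

text \<open>The difference \<open>w\<close> of \<open>b\<close> and the primitive of
  \<open>g\<close> has vanishing weak derivative. Testing with a primitive of the difference of two
  translated bumps shows that the integrals of \<open>w\<close> over any two windows of equal length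
  agree; Lebesgue differentiation turns this into equality of values off a null set.\<close>

lemma du_Bois_Reymond:
  fixes b g :: "real \<Rightarrow> real"
  assumes b: "b \<in> borel_measurable borel" "\<And>x. norm (b x) \<le> C"
    and g: "g \<in> borel_measurable borel" "\<And>x. norm (g x) \<le> C"
    and test: "\<And>\<eta> \<eta>'. time_bump T \<eta> \<Longrightarrow> (\<And>t. (\<eta> has_real_derivative \<eta>' t) (at t)) \<Longrightarrow>
       (LINT t:{0<..<T}|lborel. \<eta>' t * b t + \<eta> t * g t) = 0"
  obtains N where "negligible N" "\<And>s t. 0 < s \<Longrightarrow> s \<le> t \<Longrightarrow> t < T \<Longrightarrow> s \<notin> N \<Longrightarrow> t \<notin> N \<Longrightarrow> b t - b s = integral {s..t} g"
proof -
  have C0: "0 \<le> C" using b(2)[of 0] norm_ge_zero order_trans by blast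
  define G where "G t = integral {0..t} g" for t
  have G_lip: "norm (G t - G s) \<le> C * (t - s)" if "s \<le> t" for s t
    unfolding G_def by (rule integral_diff_le(2)[OF g that])
  have G_cont: "continuous_on S G" for S
    using Lipschitz_continuous[OF G_lip] by (auto intro: continuous_on_subset)
  have G_diff: "G t - G s = integral {s..t} g" if "0 \<le> s" "s \<le> t" for s t
    unfolding G_def by (rule integral_diff_le(1)[OF g that(2,1)])
  define w where "w t = b t - G t" for t
  have [measurable]: "b \<in> borel_measurable borel" "g \<in> borel_measurable borel" "G \<in> borel_measurable borel"
    using b g G_cont by (auto intro: borel_measurable_continuous_onI)
  have w_int: "w integrable_on {x..y}" for x y
    unfolding w_def by (intro integrable_diff bounded_borel_integrable_on(1)[OF b] integrable_continuous_real G_cont)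
  then have "w integrable_on cbox x y" for x y by (simp add: cbox_interval)
  \<comment> \<open>Lebesgue differentiation with one-sided windows; \<open>N\<close> is the
    exceptional set of the conclusion.\<close>
  then obtain N where N: "negligible N"
    "\<And>x e. \<lbrakk>x \<notin> N; 0 < e\<rbrakk> \<Longrightarrow> \<exists>d>0. \<forall>h. 0 < h \<and> h < d \<longrightarrow> norm (integral (cbox x (x + h *\<^sub>R One)) w /\<^sub>R h ^ DIM(real) - w x) < e"
    using integrable_ccontinuous_explicit[of w] by blast
  have G_le: "\<bar>G r\<bar> \<le> C * \<bar>T\<bar>" if "r \<in> {0..T}" for r
  proof -
    have "\<bar>G r\<bar> \<le> C * r" using G_lip[of 0 r] that by (simp add: G_def)
    also have "\<dots> \<le> C * \<bar>T\<bar>" using that C0 by (intro mult_left_mono) auto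
    finally show ?thesis .
  qed
  have w_le: "\<bar>w r\<bar> \<le> C + C * \<bar>T\<bar>" if "r \<in> {0..T}" for r
    using G_le[OF that] b(2)[of r] unfolding w_def real_norm_def by linarith
  have avg: "integral {s..s+h} w = integral {t..t+h} w" if st: "0 < s" "s < t" "t + h < T" "0 < h" for s t h
  proof -
    have int_cw: "(\<lambda>r. cutoff h m (r - c) * w r) integrable_on {0..T}" for m c
    proof -
      have [measurable]: "cutoff h m \<in> borel_measurable borel"
        by (intro borel_measurable_continuous_onI continuous_cutoff)
      have "(\<lambda>r. cutoff h m (r - c) * b r) integrable_on {0..T}"
      proof (rule bounded_borel_integrable_on(1)[where C=C])
        show "norm (cutoff h m (r - c) * b r) \<le> C" for r
          using mult_mono[of "\<bar>cutoff h m (r - c)\<bar>" 1 "\<bar>b r\<bar>" C] cutoff_bounds[of h m "r - c"] b(2)[of r]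
          by (simp add: abs_mult)
      qed measurable
      moreover have "(\<lambda>r. cutoff h m (r - c) * G r) integrable_on {0..T}"
        by (intro integrable_continuous_real continuous_on_mult G_cont
            continuous_on_compose2[OF continuous_cutoff[of UNIV]] continuous_intros) auto
      ultimately show ?thesis by (simp add: w_def right_diff_distrib integrable_diff)
    qed
    have zero: "integral {0..T} (\<lambda>r. cutoff h m (r - s) * w r) = integral {0..T} (\<lambda>r. cutoff h m (r - t) * w r)" for m
    proof -
      obtain F where F: "\<And>r. (F has_real_derivative cutoff h m r) (at r)" "\<And>r. r \<le> 0 \<Longrightarrow> F r = 0" "\<And>r. h \<le> r \<Longrightarrow> F r = F h"
        using cutoff_antiderivative[of h m] by blast
      \<comment> \<open>Each translate of \<open>F\<close> is eventually the constant
        \<open>F h\<close>, and the two constants cancel; hence the support lies in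
        \<open>{s..t+h}\<close>.\<close>
      define \<eta> where "\<eta> r = F (r - s) - F (r - t)" for r
      define \<eta>' where "\<eta>' r = cutoff h m (r - s) - cutoff h m (r - t)" for r
      have deriv: "(\<eta> has_real_derivative \<eta>' r) (at r)" for r
        unfolding \<eta>_def \<eta>'_def
        by (intro DERIV_diff DERIV_shift[THEN iffD1] F(1)[THEN DERIV_chain2, THEN DERIV_cong]) (auto intro!: derivative_eq_intros)
      have cs: "smooth (\<lambda>r. cutoff h m (r + c))" for c
        using smooth_affine[OF bounded_linear_ident smooth_cutoff[of h m], of c] by simp
      have "smooth \<eta>'"
      proof -
        have "smooth (\<lambda>r. cutoff h m (r + (- s)) + (-1) * cutoff h m (r + (- t)))"
          by (intro smooth_add smooth_mult smooth_const cs)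
        then show ?thesis by (simp add: \<eta>'_def[abs_def])
      qed
      then have smooth: "smooth \<eta>" by (rule smooth_antiderivative[OF deriv])
      have zero: "\<eta> r = 0" if "r \<notin> {s..t+h}" for r
      proof (cases "r < s")
        case True then show ?thesis using F(2) st by (simp add: \<eta>_def)
      next
        case False
        then have "t + h < r" using that by auto
        then show ?thesis using F(3)[of "r - s"] F(3)[of "r - t"] st by (simp add: \<eta>_def)
      qed
      have "time_bump T \<eta>" unfolding time_bump_def using smooth zero st by blast
      from test[OF this deriv] have t0: "(LINT t:{0<..<T}|lborel. \<eta>' t * b t + \<eta> t * g t) = 0" .
      have \<eta>'c: "continuous_on S \<eta>'" for S
        unfolding \<eta>'_def by (intro continuous_on_diff continuous_on_compose2[OF continuous_cutoff[of UNIV]] continuous_intros) auto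
      have \<eta>c: "continuous_on S \<eta>" for S
        using deriv by (auto intro!: continuous_at_imp_continuous_on DERIV_isCont)
      have [measurable]: "\<eta> \<in> borel_measurable borel" "\<eta>' \<in> borel_measurable borel"
        by (intro borel_measurable_continuous_onI \<eta>c \<eta>'c)+
      have \<eta>'_le: "\<bar>\<eta>' r\<bar> \<le> 2" for r
        using cutoff_bounds[of h m "r - s"] cutoff_bounds[of h m "r - t"] by (auto simp: \<eta>'_def abs_le_iff)
      have ftc: "\<eta> y - \<eta> x = integral {x..y} \<eta>'" if "x \<le> y" for x y
        using fundamental_theorem_of_calculus[of x y \<eta> \<eta>'] that deriv
        by (metis has_field_derivative_at_within has_real_derivative_iff_has_vector_derivative integral_unique)
      \<comment> \<open>The primitive \<open>G\<close> satisfies the weak equation by the product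
        rule; subtracting it from the equation for \<open>b\<close> removes \<open>g\<close> and
        leaves \<eta>' tested against \<open>w\<close>.\<close>
      have pr: "\<eta> T * G T - \<eta> 0 * G 0 = integral {0..T} (\<lambda>r. \<eta>' r * G r + \<eta> r * g r)"
      proof (rule product_rule_indefinite_integrals[OF bounded_bilinear_mult, where C="max C 2"])
        show "norm (\<eta>' x) \<le> max C 2" "norm (g x) \<le> max C 2" for x
          using \<eta>'_le[of x] g(2)[of x] by auto
        show "0 \<le> T" using st by simp
      qed (use ftc G_diff in auto)
      have "\<eta> T = 0" "\<eta> 0 = 0" using zero st by auto
      with pr have p0: "integral {0..T} (\<lambda>r. \<eta>' r * G r + \<eta> r * g r) = 0" by simp
      obtain B where B: "\<And>r. \<bar>\<eta> r\<bar> \<le> B"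
      proof -
        have "bounded (\<eta> ` {s..t+h})" by (intro compact_imp_bounded compact_continuous_image \<eta>c compact_Icc)
        then obtain B where "\<forall>r\<in>{s..t+h}. \<bar>\<eta> r\<bar> \<le> B" by (auto simp: bounded_iff)
        then have "\<bar>\<eta> r\<bar> \<le> max B 0" for r using zero[of r] by (cases "r \<in> {s..t+h}") (auto simp: le_max_iff_disj)
        then show ?thesis using that by blast
      qed
      have bd: "norm (\<eta>' r * b r + \<eta> r * g r) \<le> 2 * C + B * C" for r
      proof -
        have "norm (\<eta>' r * b r + \<eta> r * g r) \<le> \<bar>\<eta>' r\<bar> * \<bar>b r\<bar> + \<bar>\<eta> r\<bar> * \<bar>g r\<bar>"
          by (rule order_trans[OF norm_triangle_ineq]) (simp add: abs_mult)
        also have "\<dots> \<le> 2 * C + B * C"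
          using \<eta>'_le[of r] B[of r] b(2)[of r] g(2)[of r] by (intro add_mono mult_mono) auto
        finally show ?thesis .
      qed
      have m: "(\<lambda>r. \<eta>' r * b r + \<eta> r * g r) \<in> borel_measurable borel" by measurable
      have i1: "(\<lambda>r. \<eta>' r * b r + \<eta> r * g r) integrable_on {0..T}"
        by (rule bounded_borel_integrable_on(1)[OF m bd])
      have "set_integrable lborel {0<..<T} (\<lambda>r. \<eta>' r * b r + \<eta> r * g r)"
        by (rule set_integrable_subset[OF bounded_borel_integrable_on(2)[OF m bd, of 0 T]]) auto
      from set_borel_integral_eq_integral(2)[OF this] t0
      have b0: "integral {0..T} (\<lambda>r. \<eta>' r * b r + \<eta> r * g r) = 0" by (simp add: integral_open_interval_real)
      have i2: "(\<lambda>r. \<eta>' r * G r) integrable_on {0..T}"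
        by (intro integrable_continuous_real continuous_on_mult \<eta>'c G_cont)
      have i3: "(\<lambda>r. \<eta> r * g r) integrable_on {0..T}"
      proof (rule bounded_borel_integrable_on(1)[where C="B * C"])
        show "norm (\<eta> x * g x) \<le> B * C" for x
          using mult_mono[OF B[of x] g(2)[of x]] abs_ge_zero[of "\<eta> x"] B[of x] by (simp add: abs_mult)
      qed measurable
      have "0 = integral {0..T} (\<lambda>r. (\<eta>' r * b r + \<eta> r * g r) - (\<eta>' r * G r + \<eta> r * g r))"
        by (subst Henstock_Kurzweil_Integration.integral_diff) (use i1 i2 i3 b0 p0 in \<open>auto intro: integrable_add\<close>)
      also have "\<dots> = integral {0..T} (\<lambda>r. cutoff h m (r - s) * w r - cutoff h m (r - t) * w r)"
        by (rule Henstock_Kurzweil_Integration.integral_cong) (simp add: \<eta>'_def w_def algebra_simps)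
      also have "\<dots> = integral {0..T} (\<lambda>r. cutoff h m (r - s) * w r) - integral {0..T} (\<lambda>r. cutoff h m (r - t) * w r)"
        by (rule Henstock_Kurzweil_Integration.integral_diff[OF int_cw int_cw])
      finally show ?thesis by simp
    qed
    have "(\<lambda>m. integral {0..T} (\<lambda>r. cutoff h m (r - s) * w r)) \<longlonglongrightarrow> integral {s..s+h} w"
      by (rule integral_cutoff_tendsto[OF w_int int_cw w_le]) (use st in auto)
    moreover have "(\<lambda>m. integral {0..T} (\<lambda>r. cutoff h m (r - t) * w r)) \<longlonglongrightarrow> integral {t..t+h} w"
      by (rule integral_cutoff_tendsto[OF w_int int_cw w_le]) (use st in auto)
    ultimately show ?thesis unfolding zero by (rule LIMSEQ_unique)
  qed
  have N': "\<exists>d>0. \<forall>h. 0 < h \<and> h < d \<longrightarrow> \<bar>integral {x..x+h} w / h - w x\<bar> < e" if "x \<notin> N" "0 < e" for x e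
    using N(2)[OF that] by (simp add: cbox_interval divide_inverse mult.commute)
  have const: "w t = w s" if st: "0 < s" "s < t" "t < T" "s \<notin> N" "t \<notin> N" for s t
  proof (rule ccontr)
    assume "w t \<noteq> w s"
    then have e: "0 < \<bar>w t - w s\<bar> / 2" by simp
    obtain d1 where d1: "0 < d1" "\<forall>h. 0 < h \<and> h < d1 \<longrightarrow> \<bar>integral {s..s+h} w / h - w s\<bar> < \<bar>w t - w s\<bar> / 2"
      using N'[OF st(4) e] by blast
    obtain d2 where d2: "0 < d2" "\<forall>h. 0 < h \<and> h < d2 \<longrightarrow> \<bar>integral {t..t+h} w / h - w t\<bar> < \<bar>w t - w s\<bar> / 2"
      using N'[OF st(5) e] by blast
    define h where "h = min (min d1 d2) (T - t) / 2"
    have "0 < min (min d1 d2) (T - t)" using d1(1) d2(1) st by simp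
    moreover have "min (min d1 d2) (T - t) \<le> d1" "min (min d1 d2) (T - t) \<le> d2" "min (min d1 d2) (T - t) \<le> T - t" by auto
    ultimately have h: "0 < h" "h < d1" "h < d2" "t + h < T" unfolding h_def by linarith+
    have "\<bar>integral {s..s+h} w / h - w s\<bar> < \<bar>w t - w s\<bar> / 2" "\<bar>integral {t..t+h} w / h - w t\<bar> < \<bar>w t - w s\<bar> / 2"
      using d1 d2 h by auto
    then show False
      using abs_triangle_ineq4[of "integral {t..t+h} w / h - w s" "integral {t..t+h} w / h - w t"]
      unfolding avg[OF st(1,2) h(4,1)] by simp
  qed
  have "b t - b s = integral {s..t} g" if "0 < s" "s \<le> t" "t < T" "s \<notin> N" "t \<notin> N" for s t
  proof (cases "s = t")
    case False
    then have "w t = w s" using const[of s t] that by auto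
    then show ?thesis using G_diff[of s t] that by (simp add: w_def)
  qed simp
  with N(1) show ?thesis by (rule that)
qed

subsection \<open>Trigonometric test fields\<close>

definition ph :: "int^3 \<Rightarrow> real^3 \<Rightarrow> real" where
  "ph k x = 2 * pi * (freq k \<bullet> x)"

lemma ph_has_derivative [derivative_intros]: "(ph k has_derivative (\<lambda>d. ph k d)) (at x)"
  unfolding ph_def by (auto intro!: derivative_eq_intros)

lemma ph_axis: "ph k (axis i 1) = 2 * pi * freq k $ i"
  by (simp add: ph_def inner_axis)

lemma pd_cos: "pd i (\<lambda>x. cos (ph k x) *\<^sub>R v) = (\<lambda>x. sin (ph k x) *\<^sub>R ((- (2 * pi * freq k $ i)) *\<^sub>R v))"
proof
  fix x
  have d: "((\<lambda>x. cos (ph k x) *\<^sub>R v) has_derivative (\<lambda>d. (- sin (ph k x) * ph k d) *\<^sub>R v)) (at x)"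
    by (auto intro!: derivative_eq_intros)
  show "pd i (\<lambda>x. cos (ph k x) *\<^sub>R v) x = sin (ph k x) *\<^sub>R ((- (2 * pi * freq k $ i)) *\<^sub>R v)"
    by (simp add: pd_def frechet_derivative_at[OF d, symmetric] ph_axis)
qed

lemma pd_sin: "pd i (\<lambda>x. sin (ph k x) *\<^sub>R v) = (\<lambda>x. cos (ph k x) *\<^sub>R ((2 * pi * freq k $ i) *\<^sub>R v))"
proof
  fix x
  have d: "((\<lambda>x. sin (ph k x) *\<^sub>R v) has_derivative (\<lambda>d. (cos (ph k x) * ph k d) *\<^sub>R v)) (at x)"
    by (auto intro!: derivative_eq_intros)
  show "pd i (\<lambda>x. sin (ph k x) *\<^sub>R v) x = cos (ph k x) *\<^sub>R ((2 * pi * freq k $ i) *\<^sub>R v)"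
    by (simp add: pd_def frechet_derivative_at[OF d, symmetric] ph_axis)
qed

lemma curl_cos: "curl (\<lambda>x. cos (ph k x) *\<^sub>R v) x = sin (ph k x) *\<^sub>R ((- (2 * pi)) *\<^sub>R (freq k \<times> v))"
  by (simp add: curl_def pd_cos cross3_def vec_eq_iff forall_3 vector_3 algebra_simps)

lemma curl_sin: "curl (\<lambda>x. sin (ph k x) *\<^sub>R v) x = cos (ph k x) *\<^sub>R ((2 * pi) *\<^sub>R (freq k \<times> v))"
  by (simp add: curl_def pd_sin cross3_def vec_eq_iff forall_3 vector_3 algebra_simps)

lemma divergence_cos: "divergence (\<lambda>x. cos (ph k x) *\<^sub>R v) x = - (2 * pi) * sin (ph k x) * (freq k \<bullet> v)"
  by (simp add: divergence_def pd_cos inner_vec_def sum_3 algebra_simps)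

lemma divergence_sin: "divergence (\<lambda>x. sin (ph k x) *\<^sub>R v) x = 2 * pi * cos (ph k x) * (freq k \<bullet> v)"
  by (simp add: divergence_def pd_sin inner_vec_def sum_3 algebra_simps)

lemma laplacian_cos: "laplacian (\<lambda>x. cos (ph k x) *\<^sub>R v) x = cos (ph k x) *\<^sub>R ((- (4 * pi\<^sup>2 * (freq k \<bullet> freq k))) *\<^sub>R v)"
  unfolding laplacian_def pd_cos pd_sin by (simp add: inner_vec_def sum_3 algebra_simps power2_eq_square)

lemma laplacian_sin: "laplacian (\<lambda>x. sin (ph k x) *\<^sub>R v) x = sin (ph k x) *\<^sub>R ((- (4 * pi\<^sup>2 * (freq k \<bullet> freq k))) *\<^sub>R v)"
  unfolding laplacian_def pd_cos pd_sin by (simp add: inner_vec_def sum_3 algebra_simps power2_eq_square)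

lemma grad_cos: "grad (\<lambda>x. cos (ph k x) *\<^sub>R c) x = (- (2 * pi) * c * sin (ph k x)) *\<^sub>R freq k"
  unfolding grad_def pd_cos by (simp add: vec_eq_iff)

lemma grad_sin: "grad (\<lambda>x. sin (ph k x) *\<^sub>R c) x = (2 * pi * c * cos (ph k x)) *\<^sub>R freq k"
  unfolding grad_def pd_sin by (simp add: vec_eq_iff)

text \<open>An antisymmetric tensor pairs only with the antisymmetric part of the gradient. This
  rewrites the induction equation as evolution of \<open>B\<close> by the curl of
  \<open>u \<times> B\<close>.\<close>

lemma ddot_outer_antisymmetric:
  "ddot (outer a b) (vgrad \<psi> x) - ddot (outer b a) (vgrad \<psi> x) = (a \<times> b) \<bullet> curl \<psi> x"
  by (simp add: ddot_def outer_def vgrad_def curl_def cross3_def inner_vec_def sum_3 vector_3 algebra_simps)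

lemma smooth_phase: "smooth (\<lambda>x. cos (ph k x))" "smooth (\<lambda>x. sin (ph k x))"
proof -
  have "bounded_linear (ph k)"
    unfolding ph_def[abs_def] by (intro bounded_linear_const_mult bounded_linear_inner_right)
  then show "smooth (\<lambda>x. cos (ph k x))" "smooth (\<lambda>x. sin (ph k x))"
    by (rule smooth_linear[OF _ smooth_cos] smooth_linear[OF _ smooth_sin])+
qed

lemma periodic_phase: "periodic (\<lambda>x. cos (ph k x))" "periodic (\<lambda>x. sin (ph k x))"
  using periodic_ch[of k] unfolding periodic_def ph_def Re_ch[symmetric] Im_ch[symmetric] by simp_all

lemma smooth_spacetime:
  fixes f :: "real^3 \<Rightarrow> real" and v :: "'b::euclidean_space"
  assumes "smooth \<eta>" "smooth f" shows "smooth (\<lambda>z. f (snd z) *\<^sub>R (\<eta> (fst z) *\<^sub>R v))"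
  by (intro smooth_scaleR smooth_const smooth_linear[OF bounded_linear_fst assms(1)] smooth_linear[OF bounded_linear_snd assms(2)])

lemma test_function_product:
  fixes f :: "real^3 \<Rightarrow> real" and v :: "'b::euclidean_space"
  assumes "time_bump T \<eta>" "smooth f" "periodic f"
  shows "test_function T (\<lambda>t x. f x *\<^sub>R (\<eta> t *\<^sub>R v))"
  using assms smooth_spacetime[of \<eta> f v] unfolding test_function_def time_bump_def periodic_def by fastforce

lemma time_deriv_product:
  assumes "(\<eta> has_real_derivative e) (at t)"
  shows "time_deriv (\<lambda>t x. f x *\<^sub>R (\<eta> t *\<^sub>R v)) t x = f x *\<^sub>R (e *\<^sub>R v)"
  unfolding time_deriv_def
  by (rule vector_derivative_at)
     (use assms in \<open>auto intro!: derivative_eq_intros simp: has_real_derivative_iff_has_vector_derivative\<close>)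

subsection \<open>Borel representatives\<close>

lemma torus_integral_AE:
  fixes f f' :: "real^3 \<Rightarrow> 'b::euclidean_space"
  assumes f' [measurable]: "f' \<in> borel_measurable borel" and eq: "AE x in torus. f x = f' x"
  shows "torus_integral f = integral\<^sup>L torus f'"
proof -
  let ?g = "\<lambda>x. indicator (cbox 0 1) x *\<^sub>R f x" and ?g' = "\<lambda>x. indicator unit_cell x *\<^sub>R f' x"
  have "AE x in lborel. ?g' x = ?g x"
    using eq unit_cell_AE_cbox unfolding AE_torus_iff by eventually_elim (auto simp: indicator_def)
  then have ae: "AE x in lebesgue. ?g' x = ?g x" by (simp add: AE_completion_iff)
  have g': "?g' \<in> borel_measurable lebesgue" by (rule measurable_completion) simp
  have "torus_integral f = integral\<^sup>L lebesgue ?g"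
    by (simp add: torus_integral_def set_lebesgue_integral_def)
  also have "\<dots> = integral\<^sup>L lebesgue ?g'"
    using ae by (intro integral_cong_AE borel_measurable_AE[OF g' ae] g') auto
  also have "\<dots> = integral\<^sup>L lborel ?g'" by (rule integral_completion) simp
  also have "\<dots> = integral\<^sup>L (density lborel (\<lambda>x. ennreal (indicator unit_cell x))) f'"
    by (subst integral_density) auto
  also have "(\<lambda>x. ennreal (indicator unit_cell x)) = indicator unit_cell" by (auto simp: indicator_def)
  finally show ?thesis by (simp add: torus_def)
qed

lemma spacetime_integral_AE:
  assumes h [measurable]: "h \<in> borel_measurable borel"
    and eq: "AE t in lborel. t \<in> {0<..<T} \<longrightarrow> torus_integral (f t) = h t"
  shows "spacetime_integral T f = (LINT t:{0<..<T}|lborel. h t)"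
proof -
  let ?g = "\<lambda>t. indicator {0<..<T} t *\<^sub>R torus_integral (f t)" and ?g' = "\<lambda>t. indicator {0<..<T} t *\<^sub>R h t"
  have "AE t in lborel. ?g' t = ?g t"
    using eq by eventually_elim (auto simp: indicator_def)
  then have ae: "AE t in lebesgue. ?g' t = ?g t" by (simp add: AE_completion_iff)
  have g': "?g' \<in> borel_measurable lebesgue" by (rule measurable_completion) simp
  have "spacetime_integral T f = integral\<^sup>L lebesgue ?g"
    by (simp add: spacetime_integral_def set_lebesgue_integral_def)
  also have "\<dots> = integral\<^sup>L lebesgue ?g'"
    using ae by (intro integral_cong_AE borel_measurable_AE[OF g' ae] g') auto
  also have "\<dots> = integral\<^sup>L lborel ?g'" by (rule integral_completion) simp
  finally show ?thesis by (simp add: set_lebesgue_integral_def)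
qed

lemma Borel_vec_representative:
  fixes f :: "'a::euclidean_space \<Rightarrow> real^3"
  assumes f: "f \<in> borel_measurable lebesgue"
  obtains F where "F \<in> borel_measurable borel" "AE z in lborel. f z = F z"
proof -
  have "\<exists>g\<in>borel_measurable lborel. AE z in lborel. f z $ i = g z" for i
    by (rule completion_ex_borel_measurable_real) (use f in measurable)
  then obtain g where g: "\<And>i. g i \<in> borel_measurable borel" "\<And>i. AE z in lborel. f z $ i = g i z"
    by (metis measurable_lborel2)
  have "AE z in lborel. \<forall>i. f z $ i = g i z" using g(2) by (simp add: AE_all_countable)
  then have "AE z in lborel. f z = (\<chi> i. g i z)" by eventually_elim (simp add: vec_eq_iff)
  moreover have "(\<lambda>z. \<chi> i. g i z) \<in> borel_measurable borel" using g(1) by measurable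
  ultimately show ?thesis using that by blast
qed

lemma torus_L2_representative:
  assumes "torus_L2 a"
  obtains a' where "L2per a'" "AE x in torus. a x = a' x"
proof -
  have per: "periodic a" and m: "a \<in> borel_measurable lebesgue"
    and int: "set_integrable lebesgue (cbox 0 1) (\<lambda>x. (norm (a x))\<^sup>2)"
    using assms by (auto simp: torus_L2_def)
  obtain F where F [measurable]: "F \<in> borel_measurable borel" and ae: "AE x in lborel. a x = F x"
    using Borel_vec_representative[OF m] by blast
  define a' where "a' x = F (frac3 x)" for x
  have a'm [measurable]: "a' \<in> borel_measurable borel" unfolding a'_def by measurable
  have eq: "AE x in torus. a x = a' x"
    using ae unfolding AE_torus_iff by eventually_elim (auto simp: a'_def frac3_unit_cell)
  have "(\<integral>\<^sup>+x. ennreal (norm (a' x)) ^ 2 \<partial>torus) = (\<integral>\<^sup>+x. ennreal (norm (a' x)) ^ 2 * indicator unit_cell x \<partial>lborel)"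
    by (rule nn_integral_torus) measurable
  also have "\<dots> = (\<integral>\<^sup>+x. ennreal (norm (a' x)) ^ 2 * indicator unit_cell x \<partial>lebesgue)"
    by (rule nn_integral_completion[symmetric])
  also have "\<dots> = (\<integral>\<^sup>+x. ennreal (norm (indicator (cbox 0 1) x *\<^sub>R (norm (a x))\<^sup>2)) \<partial>lebesgue)"
  proof (rule nn_integral_cong_AE)
    have "AE x in lborel. ennreal (norm (a' x)) ^ 2 * indicator unit_cell x = ennreal (norm (indicator (cbox 0 1) x *\<^sub>R (norm (a x))\<^sup>2))"
      using eq unit_cell_AE_cbox unfolding AE_torus_iff
      by eventually_elim (auto simp: indicator_def ennreal_power)
    then show "AE x in lebesgue. ennreal (norm (a' x)) ^ 2 * indicator unit_cell x = ennreal (norm (indicator (cbox 0 1) x *\<^sub>R (norm (a x))\<^sup>2))"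
      by (simp add: AE_completion_iff)
  qed
  also have "\<dots> < \<infinity>" using int unfolding set_integrable_def by (simp add: integrable_iff_bounded)
  finally have "L2per a'"
    unfolding L2per_def a'_def[abs_def] using periodic_comp_frac3[of F] a'm by (simp add: a'_def[abs_def])
  then show ?thesis using that eq by blast
qed

lemma torus_L2_nn_integral:
  assumes a: "torus_L2 a" "AE x in torus. a x = a' x" "a' \<in> borel_measurable borel"
  shows "(\<integral>\<^sup>+x. ennreal (norm (a' x)) ^ 2 \<partial>torus) = ennreal (torus_integral (\<lambda>x. (norm (a x))\<^sup>2))"
proof -
  note [measurable] = a(3)
  obtain b where b: "L2per b" "AE x in torus. a x = b x" using torus_L2_representative[OF a(1)] by blast
  note [measurable] = L2perD(1)[OF b(1)]
  have "AE x in torus. a' x = b x" using a(2) b(2) by eventually_elim simp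
  then have "(\<integral>\<^sup>+x. ennreal (norm (a' x)) ^ 2 \<partial>torus) = (\<integral>\<^sup>+x. ennreal (norm (b x)) ^ 2 \<partial>torus)"
    by (intro nn_integral_cong_AE) (auto elim!: eventually_mono)
  also have "\<dots> = (\<integral>\<^sup>+x. ennreal ((norm (b x))\<^sup>2) \<partial>torus)" by (simp add: ennreal_power)
  also have "\<dots> = ennreal (\<integral>x. (norm (b x))\<^sup>2 \<partial>torus)"
    using integrable_inner_L2per[OF b(1) b(1)] by (intro nn_integral_eq_integral) (auto simp: power2_norm_eq_inner)
  also have "(\<integral>x. (norm (b x))\<^sup>2 \<partial>torus) = torus_integral (\<lambda>x. (norm (a x))\<^sup>2)"
    using b(2) by (intro torus_integral_AE[symmetric]) (auto elim!: eventually_mono)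
  finally show ?thesis .
qed

lemma fst_snd_borel:
  "(fst :: real \<times> (real^3) \<Rightarrow> real) \<in> borel_measurable borel"
  "(snd :: real \<times> (real^3) \<Rightarrow> real^3) \<in> borel_measurable borel"
  by (intro borel_measurable_continuous_onI continuous_intros)+

text \<open>The field is extended by 0 off the time slab to get a jointly Borel version; Fubini
  slices the exceptional null set, and \<open>frac3\<close> in space restores periodicity at every
  time.\<close>

lemma spacetime_field_representative:
  assumes "spacetime_field T u"
  obtains U where "(\<lambda>z. U (fst z) (snd z)) \<in> borel_measurable borel" "\<And>t. periodic (U t)"
    "AE t in lborel. t \<in> {0<..<T} \<longrightarrow> (AE x in torus. u t x = U t x)"
proof -
  define S where "S = Sigma {0<..<T} (\<lambda>_. UNIV :: (real^3) set)"
  have S: "S \<in> sets lebesgue" unfolding S_def by (intro sets_completionI_sets) (simp add: borel_open open_Times)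
  have "(\<lambda>z. u (fst z) (snd z)) \<in> borel_measurable (lebesgue_on S)"
    using assms by (simp add: spacetime_field_def S_def)
  then have "(\<lambda>z. if z \<in> S then u (fst z) (snd z) else 0) \<in> borel_measurable lebesgue"
    by (simp add: borel_measurable_if[OF S])
  then obtain F where F [measurable]: "F \<in> borel_measurable borel"
    and ae: "AE z in lborel. (if z \<in> S then u (fst z) (snd z) else 0) = F z"
    using Borel_vec_representative by blast
  define U where "U t x = F (t, frac3 x)" for t x
  have "AE z in lborel \<Otimes>\<^sub>M lborel. (if z \<in> S then u (fst z) (snd z) else 0) = F z"
    using ae by (simp only: lborel_prod)
  from lborel_pair.AE_pair[OF this]
  have "AE t in lborel. AE x in lborel. (if (t, x) \<in> S then u t x else 0) = F (t, x)"
    by (simp only: fst_conv snd_conv)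
  then have "AE t in lborel. t \<in> {0<..<T} \<longrightarrow> (AE x in torus. u t x = U t x)"
  proof eventually_elim
    case (elim t)
    show ?case
    proof
      assume t: "t \<in> {0<..<T}"
      show "AE x in torus. u t x = U t x"
        using elim unfolding AE_torus_iff by eventually_elim (use t in \<open>auto simp: S_def U_def frac3_unit_cell\<close>)
    qed
  qed
  moreover have "(\<lambda>z. U (fst z) (snd z)) \<in> borel_measurable borel"
    unfolding U_def
    using measurable_compose[OF borel_measurable_Pair[OF fst_snd_borel(1) measurable_compose[OF fst_snd_borel(2) frac3_measurable]] F]
    by simp
  moreover have "periodic (U t)" for t
    unfolding U_def[abs_def] by (rule periodic_comp_frac3)
  ultimately show ?thesis using that by blast
qed

lemma AE_lebesgue_on_iff: "(AE t in lebesgue_on {0<..<T::real}. P t) \<longleftrightarrow> (AE t in lborel. t \<in> {0<..<T} \<longrightarrow> P t)"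
  by (subst AE_restrict_space_iff) (auto simp: AE_completion_iff)

lemma jointly_measurable:
  fixes U :: "real \<Rightarrow> real^3 \<Rightarrow> 'c::topological_space"
  assumes U: "(\<lambda>z. U (fst z) (snd z)) \<in> borel_measurable borel"
    and "f \<in> borel_measurable M" "g \<in> borel_measurable M"
  shows "(\<lambda>x. U (f x) (g x)) \<in> borel_measurable M"
  using measurable_compose[OF borel_measurable_Pair[OF assms(2,3)] U] by simp

text \<open>At times where the energy bound fails the representative is reset to 0. The set of such
  times is Borel, so joint measurability survives, and the bounds then hold at every time instead of
  almost every time.\<close>

lemma Linf_L2_representative:
  assumes "Linf_L2 T u"
  obtains U K where "(\<lambda>z. U (fst z) (snd z)) \<in> borel_measurable borel" "\<And>t. L2per (U t)"
    "\<And>t. (\<integral>\<^sup>+x. ennreal (norm (U t x)) ^ 2 \<partial>torus) \<le> ennreal (K\<^sup>2)" "0 \<le> K"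
    "AE t in lborel. t \<in> {0<..<T} \<longrightarrow> (AE x in torus. u t x = U t x)"
proof -
  obtain C where C: "AE t in lebesgue_on {0<..<T}. torus_L2 (u t) \<and> torus_integral (\<lambda>x. (norm (u t x))\<^sup>2) \<le> C"
    using assms by (auto simp: Linf_L2_def)
  obtain U0 where U0: "(\<lambda>z. U0 (fst z) (snd z)) \<in> borel_measurable borel" "\<And>t. periodic (U0 t)"
    "AE t in lborel. t \<in> {0<..<T} \<longrightarrow> (AE x in torus. u t x = U0 t x)"
    using spacetime_field_representative[of T u] assms by (auto simp: Linf_L2_def)
  \<comment> \<open>Chosen so that \<open>C \<le> K\<^sup>2\<close> whatever the sign and size of
    \<open>C\<close>.\<close>
  define K where "K = 1 + \<bar>C\<bar>"
  have "C \<le> 1 + (2 * \<bar>C\<bar> + \<bar>C\<bar>\<^sup>2)"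
    using abs_ge_self[of C] abs_ge_zero[of C] zero_le_power2[of "\<bar>C\<bar>"] by linarith
  then have K: "0 \<le> K" "C \<le> K\<^sup>2" by (simp_all add: K_def power2_sum add_ac)
  define I where "I t = (\<integral>\<^sup>+x. ennreal (norm (U0 t x)) ^ 2 \<partial>torus)" for t
  have U0m: "(\<lambda>p. U0 (fst p) (snd p)) \<in> borel_measurable (borel \<Otimes>\<^sub>M torus)"
    by (rule jointly_measurable[OF U0(1)]) measurable
  have [measurable]: "I \<in> borel_measurable borel"
    unfolding I_def by (rule torus.borel_measurable_nn_integral) (use U0m in \<open>simp add: split_beta'\<close>)
  have [measurable]: "U0 t \<in> borel_measurable borel" for t
    using jointly_measurable[OF U0(1), of "\<lambda>_. t" borel "\<lambda>x. x"] by simp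
  define U where "U t x = (if I t \<le> ennreal (K\<^sup>2) then U0 t x else 0)" for t x
  have "(\<lambda>z :: real \<times> (real^3). I (fst z)) \<in> borel_measurable borel"
    by (rule measurable_compose[OF fst_snd_borel(1)]) measurable
  then have "(\<lambda>z. U (fst z) (snd z)) \<in> borel_measurable borel"
    unfolding U_def by (intro measurable_If U0(1) measurable_const borel_measurable_le) auto
  moreover have bd: "(\<integral>\<^sup>+x. ennreal (norm (U t x)) ^ 2 \<partial>torus) \<le> ennreal (K\<^sup>2)" for t
    by (cases "I t \<le> ennreal (K\<^sup>2)") (simp_all add: U_def I_def)
  moreover have "L2per (U t)" for t
    unfolding L2per_def
  proof (intro conjI)
    show "U t \<in> borel_measurable borel" unfolding U_def by measurable
    show "periodic (U t)" using U0(2)[of t] by (simp add: U_def periodic_def)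
    show "(\<integral>\<^sup>+x. ennreal (norm (U t x)) ^ 2 \<partial>torus) < \<infinity>" using bd[of t] by (rule order.strict_trans1) simp
  qed
  moreover have "AE t in lborel. t \<in> {0<..<T} \<longrightarrow> (AE x in torus. u t x = U t x)"
    using C[unfolded AE_lebesgue_on_iff] U0(3)
  proof eventually_elim
    case (elim t)
    show ?case
    proof
      assume t: "t \<in> {0<..<T}"
      with elim have e: "AE x in torus. u t x = U0 t x" "torus_L2 (u t)" "torus_integral (\<lambda>x. (norm (u t x))\<^sup>2) \<le> C" by auto
      have "I t = ennreal (torus_integral (\<lambda>x. (norm (u t x))\<^sup>2))"
        unfolding I_def by (rule torus_L2_nn_integral[OF e(2,1)]) simp
      also have "\<dots> \<le> ennreal (K\<^sup>2)" using e(3) K by (intro ennreal_leI) simp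
      finally show "AE x in torus. u t x = U t x" using e(1) by (simp add: U_def)
    qed
  qed
  ultimately show ?thesis using that K(1) by blast
qed

subsection \<open>Evolution of the Fourier coefficients\<close>

lemma smooth_derivative_measurable:
  fixes \<eta> \<eta>' :: "real \<Rightarrow> real"
  assumes "smooth \<eta>" "\<And>t. (\<eta> has_real_derivative \<eta>' t) (at t)"
  shows "\<eta>' \<in> borel_measurable borel"
proof -
  have "C_k (Suc 0) \<eta>" using assms(1) by (simp only: smooth_def)
  then have "continuous_on UNIV (\<lambda>x. frechet_derivative \<eta> (at x) 1)" by simp
  moreover have "frechet_derivative \<eta> (at x) 1 = \<eta>' x" for x
    using frechet_derivative_at[of \<eta> "(*) (\<eta>' x)" x] assms(2)[of x]
    by (simp add: has_field_derivative_def flip: frechet_derivative_at)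
  ultimately show ?thesis by (simp add: borel_measurable_continuous_onI)
qed

lemma cosc_ph: "cosc k f = (\<integral>x. cos (ph k x) *\<^sub>R f x \<partial>torus)" and sinc_ph: "sinc k f = (\<integral>x. sin (ph k x) *\<^sub>R f x \<partial>torus)"
  by (simp_all add: cosc_def sinc_def ph_def)

lemma ph_measurable [measurable]: "(\<lambda>x. cos (ph k x)) \<in> borel_measurable borel" "(\<lambda>x. sin (ph k x)) \<in> borel_measurable borel"
  unfolding ph_def by measurable

lemma
  fixes f :: "real^3 \<Rightarrow> 'b::euclidean_space"
  assumes "integrable torus f"
  shows integral_inner_cos: "(\<integral>x. f x \<bullet> (cos (ph k x) *\<^sub>R c) \<partial>torus) = cosc k f \<bullet> c"
    and integral_inner_sin: "(\<integral>x. f x \<bullet> (sin (ph k x) *\<^sub>R c) \<partial>torus) = sinc k f \<bullet> c"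
proof -
  have c: "integrable torus (\<lambda>x. cos (ph k x) *\<^sub>R f x)" and s: "integrable torus (\<lambda>x. sin (ph k x) *\<^sub>R f x)"
    using assms by (simp_all add: ph_def)
  have "(\<integral>x. (cos (ph k x) *\<^sub>R f x) \<bullet> c \<partial>torus) = cosc k f \<bullet> c" "(\<integral>x. (sin (ph k x) *\<^sub>R f x) \<bullet> c \<partial>torus) = sinc k f \<bullet> c"
    unfolding cosc_ph sinc_ph by (intro integral_inner_left c s)+
  then show "(\<integral>x. f x \<bullet> (cos (ph k x) *\<^sub>R c) \<partial>torus) = cosc k f \<bullet> c" "(\<integral>x. f x \<bullet> (sin (ph k x) *\<^sub>R c) \<partial>torus) = sinc k f \<bullet> c"
    by (simp_all add: inner_scaleR_left inner_scaleR_right)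
qed

lemma integral_norm_L2_bound:
  fixes f :: "real^3 \<Rightarrow> 'b::euclidean_space"
  assumes f: "L2per f" "(\<integral>\<^sup>+x. ennreal (norm (f x)) ^ 2 \<partial>torus) \<le> ennreal (K\<^sup>2)" "0 \<le> K"
  shows "(\<integral>x. norm (f x) \<partial>torus) \<le> K"
proof -
  note [measurable] = L2perD(1)[OF f(1)]
  have "(\<integral>\<^sup>+x. ennreal (norm (f x)) * 1 \<partial>torus) \<le> ennreal (K * 1)"
    by (rule nn_integral_Cauchy_Schwarz_bound) (use f in auto)
  moreover have "(\<integral>\<^sup>+x. ennreal (norm (f x)) \<partial>torus) = ennreal (\<integral>x. norm (f x) \<partial>torus)"
    using L2perD(4)[OF f(1)] by (intro nn_integral_eq_integral) auto
  ultimately show ?thesis using f(3) by simp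
qed

lemma integral_norm_cross_bound:
  assumes f: "L2per f" "(\<integral>\<^sup>+x. ennreal (norm (f x)) ^ 2 \<partial>torus) \<le> ennreal (K\<^sup>2)" "0 \<le> K"
    and g: "L2per g" "(\<integral>\<^sup>+x. ennreal (norm (g x)) ^ 2 \<partial>torus) \<le> ennreal (L\<^sup>2)" "0 \<le> L"
  shows "(\<integral>x. norm (f x \<times> g x) \<partial>torus) \<le> K * L"
proof -
  note [measurable] = L2perD(1)[OF f(1)] L2perD(1)[OF g(1)]
  have "(\<integral>\<^sup>+x. ennreal (norm (f x \<times> g x)) \<partial>torus) \<le> (\<integral>\<^sup>+x. ennreal (norm (f x)) * ennreal (norm (g x)) \<partial>torus)"
    by (intro nn_integral_mono) (auto simp flip: ennreal_mult intro!: ennreal_leI norm_cross_le)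
  also have "\<dots> \<le> ennreal (K * L)"
    by (rule nn_integral_Cauchy_Schwarz_bound) (use f g in auto)
  finally have "(\<integral>\<^sup>+x. ennreal (norm (f x \<times> g x)) \<partial>torus) \<le> ennreal (K * L)" .
  moreover have "(\<integral>\<^sup>+x. ennreal (norm (f x \<times> g x)) \<partial>torus) = ennreal (\<integral>x. norm (f x \<times> g x) \<partial>torus)"
    using integrable_cross_L2per[OF f(1) g(1)] by (intro nn_integral_eq_integral) auto
  ultimately show ?thesis using f(3) g(3) by simp
qed

text \<open>Taking \<open>b = 0\<close> in \<open>du_Bois_Reymond\<close> makes the integrals of
  \<open>g\<close> vanish between almost all endpoints, and differentiation of these integrals
  recovers \<open>g\<close>.\<close>

lemma du_Bois_Reymond_zero:
  fixes g :: "real \<Rightarrow> real"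
  assumes g: "g \<in> borel_measurable borel" "\<And>x. norm (g x) \<le> C"
    and test: "\<And>\<eta>. time_bump T \<eta> \<Longrightarrow> (LINT t:{0<..<T}|lborel. \<eta> t * g t) = 0"
  shows "AE t in lborel. t \<in> {0<..<T} \<longrightarrow> g t = 0"
proof -
  have C0: "0 \<le> C" using g(2)[of 0] norm_ge_zero order_trans by blast
  obtain N where N: "negligible N"
    and zero: "\<And>s t. 0 < s \<Longrightarrow> s \<le> t \<Longrightarrow> t < T \<Longrightarrow> s \<notin> N \<Longrightarrow> t \<notin> N \<Longrightarrow> 0 - 0 = integral {s..t} g"
    using du_Bois_Reymond[of "\<lambda>_. 0" C g T] g test C0 by auto
  have "g integrable_on cbox a b" for a b
    using bounded_borel_integrable_on(1)[OF g] by (simp add: cbox_interval)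
  then obtain N' where N': "negligible N'"
    "\<And>x e. \<lbrakk>x \<notin> N'; 0 < e\<rbrakk> \<Longrightarrow> \<exists>d>0. \<forall>h. 0 < h \<and> h < d \<longrightarrow> norm (integral (cbox x (x + h *\<^sub>R One)) g /\<^sub>R h ^ DIM(real) - g x) < e"
    using integrable_ccontinuous_explicit[of g] by blast
  have diff: "\<exists>d>0. \<forall>h. 0 < h \<and> h < d \<longrightarrow> \<bar>integral {x..x+h} g / h - g x\<bar> < e" if "x \<notin> N'" "0 < e" for x e
    using N'(2)[OF that] by (simp add: cbox_interval divide_inverse mult.commute)
  have g0: "g t = 0" if t: "0 < t" "t < T" "t \<notin> N \<union> N'" for t
  proof (rule ccontr)
    assume "g t \<noteq> 0"
    then have "0 < \<bar>g t\<bar>" by simp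
    then obtain d where d: "0 < d" "\<forall>h. 0 < h \<and> h < d \<longrightarrow> \<bar>integral {t..t+h} g / h - g t\<bar> < \<bar>g t\<bar>"
      using diff[of t "\<bar>g t\<bar>"] t by blast
    \<comment> \<open>The vanishing integral needs a right endpoint outside \<open>N\<close>; one
      exists arbitrarily close to \<open>t\<close> because a null set contains no interval.\<close>
    have "\<not> {t<..<min (t + d) T} \<subseteq> N"
    proof
      assume "{t<..<min (t + d) T} \<subseteq> N"
      then have "negligible {t<..<min (t + d) T}" using N negligible_subset by blast
      then show False using open_not_negligible[of "{t<..<min (t + d) T}"] d(1) t by auto
    qed
    then obtain r where "r \<in> {t<..<min (t + d) T}" "r \<notin> N" by blast
    then have r: "t < r" "r < t + d" "r < T" "r \<notin> N" by auto
    have "integral {t..r} g = 0" using zero[of t r] r t by simp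
    then show False using d(2)[rule_format, of "r - t"] r by simp
  qed
  have "AE t in lebesgue. t \<notin> N \<union> N'"
    using N N'(1) negligible_Un by (intro AE_not_in) (simp add: negligible_iff_null_sets)
  then have "AE t in lborel. t \<notin> N \<union> N'" by (simp only: AE_completion_iff)
  then show ?thesis by eventually_elim (use g0 in auto)
qed

text \<open>Off \<open>N\<close> the functions coincide with genuine indefinite integrals started at
  \<alpha>, and the null set does not affect the integral on the right.\<close>

lemma product_rule_AE:
  fixes b g :: "real \<Rightarrow> 'a::euclidean_space" and c h :: "real \<Rightarrow> 'b::euclidean_space"
    and pr :: "'a \<Rightarrow> 'b \<Rightarrow> 'c::euclidean_space"
  assumes pr: "bounded_bilinear pr"
    and g: "g \<in> borel_measurable borel" "\<And>x. norm (g x) \<le> C"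
    and h: "h \<in> borel_measurable borel" "\<And>x. norm (h x) \<le> C"
    and N: "negligible N"
    and b: "\<And>s t. 0 < s \<Longrightarrow> s \<le> t \<Longrightarrow> t < T \<Longrightarrow> s \<notin> N \<Longrightarrow> t \<notin> N \<Longrightarrow> b t - b s = integral {s..t} g"
    and c: "\<And>s t. 0 < s \<Longrightarrow> s \<le> t \<Longrightarrow> t < T \<Longrightarrow> s \<notin> N \<Longrightarrow> t \<notin> N \<Longrightarrow> c t - c s = integral {s..t} h"
    and ab: "0 < \<alpha>" "\<alpha> \<le> \<beta>" "\<beta> < T" "\<alpha> \<notin> N" "\<beta> \<notin> N"
  shows "pr (b \<beta>) (c \<beta>) - pr (b \<alpha>) (c \<alpha>) = integral {\<alpha>..\<beta>} (\<lambda>r. pr (g r) (c r) + pr (b r) (h r))"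
proof -
  define b' where "b' t = b \<alpha> + integral {\<alpha>..t} g" for t
  define c' where "c' t = c \<alpha> + integral {\<alpha>..t} h" for t
  have eq: "b' t = b t" "c' t = c t" if "t \<in> {\<alpha>..\<beta>}" "t \<notin> N" for t
    using b[of \<alpha> t] c[of \<alpha> t] that ab by (auto simp: b'_def c'_def algebra_simps)
  have "pr (b' \<beta>) (c' \<beta>) - pr (b' \<alpha>) (c' \<alpha>) = integral {\<alpha>..\<beta>} (\<lambda>r. pr (g r) (c' r) + pr (b' r) (h r))"
    by (rule product_rule_indefinite_integrals[OF pr g h])
       (use integral_diff_le(1)[OF g] integral_diff_le(1)[OF h] ab in \<open>auto simp: b'_def c'_def\<close>)
  also have "\<dots> = integral {\<alpha>..\<beta>} (\<lambda>r. pr (g r) (c r) + pr (b r) (h r))"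
    by (rule integral_spike[OF N]) (use eq in auto)
  finally show ?thesis using eq ab by simp
qed

text \<open>Here \<open>u\<close> and \<open>B\<close> carry the weak equations, while
  \<open>U\<close> and \<open>V\<close> are Borel representatives, periodic and bounded in L2 at
  every time, on which all the analysis is done.\<close>

locale induction_solution =
  fixes T K :: real and u B U V :: "real \<Rightarrow> real^3 \<Rightarrow> real^3"
  assumes K0: "0 \<le> K"
    and Um: "(\<lambda>z. U (fst z) (snd z)) \<in> borel_measurable borel" and Vm: "(\<lambda>z. V (fst z) (snd z)) \<in> borel_measurable borel"
    and UL2: "\<And>t. L2per (U t)" and VL2: "\<And>t. L2per (V t)"
    and Ub: "\<And>t. (\<integral>\<^sup>+x. ennreal (norm (U t x)) ^ 2 \<partial>torus) \<le> ennreal (K\<^sup>2)"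
    and Vb: "\<And>t. (\<integral>\<^sup>+x. ennreal (norm (V t x)) ^ 2 \<partial>torus) \<le> ennreal (K\<^sup>2)"
    and Ueq: "AE t in lborel. t \<in> {0<..<T} \<longrightarrow> (AE x in torus. u t x = U t x)"
    and Veq: "AE t in lborel. t \<in> {0<..<T} \<longrightarrow> (AE x in torus. B t x = V t x)"
    and induction: "\<And>\<psi>. div_free_test_function T \<psi> \<Longrightarrow>
        spacetime_integral T (\<lambda>t x. B t x \<bullet> time_deriv \<psi> t x
          + ddot (outer (u t x) (B t x)) (vgrad (\<psi> t) x)
          - ddot (outer (B t x) (u t x)) (vgrad (\<psi> t) x)) = 0"
    and div_free: "weakly_div_free T B"
begin

text \<open>The electromotive field up to sign; formally the time derivative of \<open>V\<close> is
  the curl of \<open>E\<close>.\<close>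

definition E :: "real \<Rightarrow> real^3 \<Rightarrow> real^3" where "E t x = U t x \<times> V t x"

lemma U_measurable [measurable]: "U t \<in> borel_measurable borel" and V_measurable [measurable]: "V t \<in> borel_measurable borel"
  using L2perD(1)[OF UL2] L2perD(1)[OF VL2] by auto

lemma E_measurable [measurable]: "E t \<in> borel_measurable borel"
  unfolding E_def by measurable

lemma integrable_V: "integrable torus (V t)" and integrable_E: "integrable torus (E t)"
  unfolding E_def[abs_def] by (intro L2perD(4) VL2 integrable_cross_L2per UL2)+

lemma joint_measurable:
  "(\<lambda>p. V (fst p) (snd p)) \<in> borel_measurable (borel \<Otimes>\<^sub>M torus)"
  "(\<lambda>p. E (fst p) (snd p)) \<in> borel_measurable (borel \<Otimes>\<^sub>M torus)"
  "(\<lambda>p. U (fst p) (snd p)) \<in> borel_measurable (borel \<Otimes>\<^sub>M torus)"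
  unfolding E_def
  by (intro cross_measurable jointly_measurable[OF Um] jointly_measurable[OF Vm]; measurable)+

lemma coeff_measurable [measurable]:
  "(\<lambda>t. cosc k (V t)) \<in> borel_measurable borel" "(\<lambda>t. sinc k (V t)) \<in> borel_measurable borel"
  "(\<lambda>t. cosc k (E t)) \<in> borel_measurable borel" "(\<lambda>t. sinc k (E t)) \<in> borel_measurable borel"
  unfolding cosc_ph sinc_ph using joint_measurable
  by (auto intro!: torus.borel_measurable_lebesgue_integral simp: split_beta')

lemma coeff_bounds:
  "norm (cosc k (V t)) \<le> K" "norm (sinc k (V t)) \<le> K" "norm (cosc k (E t)) \<le> K * K" "norm (sinc k (E t)) \<le> K * K"
  using integral_norm_L2_bound[OF VL2 Vb K0, of t] integral_norm_cross_bound[OF UL2 Ub K0 VL2 Vb K0, of t t]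
    norm_cosc_le[OF integrable_V, of k t] norm_sinc_le[OF integrable_V, of k t]
    norm_cosc_le[OF integrable_E, of k t] norm_sinc_le[OF integrable_E, of k t]
  unfolding E_def[abs_def] by linarith+

lemma integral_induction_term:
  assumes "AE x in torus. u t x = U t x" "AE x in torus. B t x = V t x" and [measurable]: "a \<in> borel_measurable borel"
      "(\<lambda>x. curl \<psi> x) \<in> borel_measurable borel"
  shows "torus_integral (\<lambda>x. B t x \<bullet> a x + ddot (outer (u t x) (B t x)) (vgrad \<psi> x) - ddot (outer (B t x) (u t x)) (vgrad \<psi> x)) =
    (\<integral>x. V t x \<bullet> a x + E t x \<bullet> curl \<psi> x \<partial>torus)"
proof -
  have eq: "(\<lambda>x. B t x \<bullet> a x + ddot (outer (u t x) (B t x)) (vgrad \<psi> x) - ddot (outer (B t x) (u t x)) (vgrad \<psi> x)) =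
     (\<lambda>x. B t x \<bullet> a x + (u t x \<times> B t x) \<bullet> curl \<psi> x)"
    using ddot_outer_antisymmetric[of "u t _" "B t _" \<psi>] by (intro ext) (simp add: add_diff_eq[symmetric]) have "torus_integral (\<lambda>x. B t x \<bullet> a x + (u t x \<times> B t x) \<bullet> curl \<psi> x) = (\<integral>x. V t x \<bullet> a x + E t x \<bullet> curl \<psi> x \<partial>torus)"
  proof (rule torus_integral_AE)
    show "AE x in torus. B t x \<bullet> a x + (u t x \<times> B t x) \<bullet> curl \<psi> x = V t x \<bullet> a x + E t x \<bullet> curl \<psi> x"
      using assms(1,2) by eventually_elim (simp add: E_def)
  qed measurable
  then show ?thesis unfolding eq .
qed

text \<open>The test field is a fixed divergence free field \<open>f(x) w\<close> with curl \<open>h(x) w'\<close>, times a function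
  of time.\<close>

lemma evolve_field:
  fixes f h :: "real^3 \<Rightarrow> real" and w w' :: "real^3"
  assumes f: "smooth f" "periodic f" and [measurable]: "f \<in> borel_measurable borel" "h \<in> borel_measurable borel"
    and fh: "\<And>x. \<bar>f x\<bar> \<le> 1" "\<And>x. \<bar>h x\<bar> \<le> 1"
    and div: "\<And>c x. divergence (\<lambda>x. f x *\<^sub>R (c *\<^sub>R w)) x = 0"
    and curl: "\<And>c x. curl (\<lambda>x. f x *\<^sub>R (c *\<^sub>R w)) x = h x *\<^sub>R (c *\<^sub>R w')"
  obtains N where "negligible N" "\<And>s t. 0 < s \<Longrightarrow> s \<le> t \<Longrightarrow> t < T \<Longrightarrow> s \<notin> N \<Longrightarrow> t \<notin> N \<Longrightarrow>
    (\<integral>x. f x *\<^sub>R V t x \<partial>torus) \<bullet> w - (\<integral>x. f x *\<^sub>R V s x \<partial>torus) \<bullet> w = integral {s..t} (\<lambda>r. (\<integral>x. h x *\<^sub>R E r x \<partial>torus) \<bullet> w')"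
proof -
  define b where "b t = (\<integral>x. f x *\<^sub>R V t x \<partial>torus) \<bullet> w" for t
  define g where "g t = (\<integral>x. h x *\<^sub>R E t x \<partial>torus) \<bullet> w'" for t
  define C where "C = max (K * norm w) (K * K * norm w')"
  have intV: "integrable torus (\<lambda>x. f x *\<^sub>R V t x)" and intE: "integrable torus (\<lambda>x. h x *\<^sub>R E t x)" for t
    by (rule integrable_bounded_scaleR[OF integrable_V assms(3) fh(1)], rule integrable_bounded_scaleR[OF integrable_E assms(4) fh(2)])
  have [measurable]: "b \<in> borel_measurable borel" "g \<in> borel_measurable borel"
    unfolding b_def g_def using joint_measurable
    by (auto intro!: borel_measurable_inner torus.borel_measurable_lebesgue_integral borel_measurable_scaleR simp: split_beta')
  have bd: "norm (\<integral>x. a x *\<^sub>R F x \<partial>torus) \<le> (\<integral>x. norm (F x) \<partial>torus)"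
    if "integrable torus (\<lambda>x. a x *\<^sub>R F x)" "integrable torus F" "\<And>x. \<bar>a x\<bar> \<le> 1" for a :: "real^3 \<Rightarrow> real" and F :: "real^3 \<Rightarrow> real^3"
    by (rule order_trans[OF integral_norm_bound integral_mono[OF integrable_norm[OF that(1)]]])
       (use that in \<open>auto simp: mult_left_le_one_le\<close>)
  show ?thesis
  proof (rule du_Bois_Reymond[of b C g T])
    show "norm (b t) \<le> C" for t
    proof -
      have "norm (b t) \<le> norm (\<integral>x. f x *\<^sub>R V t x \<partial>torus) * norm w" by (simp add: b_def Cauchy_Schwarz_ineq2)
      also have "\<dots> \<le> K * norm w"
        by (intro mult_right_mono order_trans[OF bd[OF intV integrable_V fh(1)]] integral_norm_L2_bound VL2 Vb K0) auto
      finally show ?thesis by (simp add: C_def)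
    qed
    show "norm (g t) \<le> C" for t
    proof -
      have "norm (g t) \<le> norm (\<integral>x. h x *\<^sub>R E t x \<partial>torus) * norm w'" by (simp add: g_def Cauchy_Schwarz_ineq2)
      also have "\<dots> \<le> K * K * norm w'"
        using integral_norm_cross_bound[OF UL2 Ub K0 VL2 Vb K0, of t t] bd[OF intE integrable_E fh(2), of t]
        by (intro mult_right_mono) (auto simp: E_def[abs_def])
      finally show ?thesis by (simp add: C_def)
    qed
    fix \<eta> \<eta>' assume \<eta>: "time_bump T \<eta>" "\<And>t. (\<eta> has_real_derivative \<eta>' t) (at t)"
    define \<psi> where "\<psi> t x = f x *\<^sub>R (\<eta> t *\<^sub>R w)" for t x
    have "div_free_test_function T \<psi>"
      unfolding div_free_test_function_def \<psi>_def using test_function_product[OF \<eta>(1) f, of w] div by blast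
    from induction[OF this] have "spacetime_integral T (\<lambda>t x. B t x \<bullet> time_deriv \<psi> t x
          + ddot (outer (u t x) (B t x)) (vgrad (\<psi> t) x) - ddot (outer (B t x) (u t x)) (vgrad (\<psi> t) x)) = 0" .
    moreover have "spacetime_integral T (\<lambda>t x. B t x \<bullet> time_deriv \<psi> t x
          + ddot (outer (u t x) (B t x)) (vgrad (\<psi> t) x) - ddot (outer (B t x) (u t x)) (vgrad (\<psi> t) x)) =
        (LINT t:{0<..<T}|lborel. \<eta>' t * b t + \<eta> t * g t)"
    proof (rule spacetime_integral_AE)
      show "AE t in lborel. t \<in> {0<..<T} \<longrightarrow> torus_integral (\<lambda>x. B t x \<bullet> time_deriv \<psi> t x
          + ddot (outer (u t x) (B t x)) (vgrad (\<psi> t) x) - ddot (outer (B t x) (u t x)) (vgrad (\<psi> t) x)) =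
         \<eta>' t * b t + \<eta> t * g t"
        using Ueq Veq
      proof eventually_elim
        case (elim t)
        show ?case
        proof
          assume t: "t \<in> {0<..<T}"
          have td: "time_deriv \<psi> t x = f x *\<^sub>R (\<eta>' t *\<^sub>R w)" for x
            unfolding \<psi>_def by (rule time_deriv_product[OF \<eta>(2)])
          have cu: "curl (\<psi> t) x = h x *\<^sub>R (\<eta> t *\<^sub>R w')" for x
            unfolding \<psi>_def by (rule curl)
          have "torus_integral (\<lambda>x. B t x \<bullet> time_deriv \<psi> t x
            + ddot (outer (u t x) (B t x)) (vgrad (\<psi> t) x) - ddot (outer (B t x) (u t x)) (vgrad (\<psi> t) x)) =
            (\<integral>x. V t x \<bullet> time_deriv \<psi> t x + E t x \<bullet> curl (\<psi> t) x \<partial>torus)"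
            by (rule integral_induction_term) (use elim t in \<open>auto simp: td cu\<close>)
          also have "\<dots> = (\<integral>x. \<eta>' t * ((f x *\<^sub>R V t x) \<bullet> w) + \<eta> t * ((h x *\<^sub>R E t x) \<bullet> w') \<partial>torus)"
            by (simp add: td cu mult_ac)
          also have "\<dots> = \<eta>' t * b t + \<eta> t * g t"
            unfolding b_def g_def integral_inner_left[OF intV, symmetric] integral_inner_left[OF intE, symmetric]
            by (subst Bochner_Integration.integral_add)
               (intro integrable_mult_right integrable_inner_left intV intE,
                intro integrable_mult_right integrable_inner_left intV intE, simp only: integral_mult_right_zero)
          finally show "torus_integral (\<lambda>x. B t x \<bullet> time_deriv \<psi> t x
            + ddot (outer (u t x) (B t x)) (vgrad (\<psi> t) x) - ddot (outer (B t x) (u t x)) (vgrad (\<psi> t) x)) =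
            \<eta>' t * b t + \<eta> t * g t" .
        qed
      qed
      have [measurable]: "\<eta> \<in> borel_measurable borel"
        using \<eta>(2) by (intro borel_measurable_continuous_onI continuous_at_imp_continuous_on) (auto intro: DERIV_isCont)
      have [measurable]: "\<eta>' \<in> borel_measurable borel"
        using \<eta> by (auto simp: time_bump_def intro: smooth_derivative_measurable)
      show "(\<lambda>t. \<eta>' t * b t + \<eta> t * g t) \<in> borel_measurable borel" by measurable
    qed
    ultimately show "(LINT t:{0<..<T}|lborel. \<eta>' t * b t + \<eta> t * g t) = 0" by simp
  qed (measurable, use that in \<open>unfold b_def g_def, blast\<close>)
qed

text \<open>Orthogonality of \<open>w\<close> to the frequency makes the trigonometric field
  divergence free. The curl exchanges cosine and sine, so cosine coefficients of \<open>V\<close>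
  are driven by sine coefficients of \<open>E\<close>.\<close>

lemma evolve_cos:
  assumes w: "freq k \<bullet> w = 0"
  obtains N where "negligible N" "\<And>s t. 0 < s \<Longrightarrow> s \<le> t \<Longrightarrow> t < T \<Longrightarrow> s \<notin> N \<Longrightarrow> t \<notin> N \<Longrightarrow>
    cosc k (V t) \<bullet> w - cosc k (V s) \<bullet> w = integral {s..t} (\<lambda>r. sinc k (E r) \<bullet> ((- (2 * pi)) *\<^sub>R (freq k \<times> w)))"
proof -
  have d: "divergence (\<lambda>x. cos (ph k x) *\<^sub>R (c *\<^sub>R w)) x = 0" for c x
    unfolding divergence_cos by (simp add: w)
  have c: "curl (\<lambda>x. cos (ph k x) *\<^sub>R (c *\<^sub>R w)) x = sin (ph k x) *\<^sub>R (c *\<^sub>R ((- (2 * pi)) *\<^sub>R (freq k \<times> w)))" for c x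
    unfolding curl_cos cross_mult_right by (simp add: mult_ac)
  show ?thesis
    using evolve_field[OF smooth_phase(1)[of k] periodic_phase(1)[of k] ph_measurable abs_cos_le_one abs_sin_le_one d c] that
    unfolding cosc_ph sinc_ph by blast
qed

lemma evolve_sin:
  assumes w: "freq k \<bullet> w = 0"
  obtains N where "negligible N" "\<And>s t. 0 < s \<Longrightarrow> s \<le> t \<Longrightarrow> t < T \<Longrightarrow> s \<notin> N \<Longrightarrow> t \<notin> N \<Longrightarrow>
    sinc k (V t) \<bullet> w - sinc k (V s) \<bullet> w = integral {s..t} (\<lambda>r. cosc k (E r) \<bullet> ((2 * pi) *\<^sub>R (freq k \<times> w)))"
proof -
  have d: "divergence (\<lambda>x. sin (ph k x) *\<^sub>R (c *\<^sub>R w)) x = 0" for c x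
    unfolding divergence_sin by (simp add: w)
  have c: "curl (\<lambda>x. sin (ph k x) *\<^sub>R (c *\<^sub>R w)) x = cos (ph k x) *\<^sub>R (c *\<^sub>R ((2 * pi) *\<^sub>R (freq k \<times> w)))" for c x
    unfolding curl_sin cross_mult_right by (simp add: mult_ac)
  show ?thesis
    using evolve_field[OF smooth_phase(2)[of k] periodic_phase(2)[of k] ph_measurable(2,1) abs_sin_le_one abs_cos_le_one d c] that
    unfolding cosc_ph sinc_ph by blast
qed

lemma double_cross_inner:
  fixes a k e :: "real^3"
  shows "a \<bullet> (c *\<^sub>R (k \<times> (e \<times> k))) = ((- c) *\<^sub>R (k \<times> (k \<times> a))) \<bullet> e"
  by (simp add: cross3_simps)

lemma vector_evolution:
  fixes X g :: "real \<Rightarrow> real^3"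
  assumes g: "g \<in> borel_measurable borel" "\<And>r. norm (g r) \<le> C"
    and ev: "\<And>i. \<exists>N. negligible N \<and> (\<forall>s t. 0 < s \<longrightarrow> s \<le> t \<longrightarrow> t < T \<longrightarrow> s \<notin> N \<longrightarrow> t \<notin> N \<longrightarrow>
      (X t - X s) $ i = integral {s..t} (\<lambda>r. g r $ i))"
  obtains N where "negligible N" "\<And>s t. 0 < s \<Longrightarrow> s \<le> t \<Longrightarrow> t < T \<Longrightarrow> s \<notin> N \<Longrightarrow> t \<notin> N \<Longrightarrow> X t - X s = integral {s..t} g"
proof -
  obtain N where N: "\<And>i. negligible (N i)" "\<And>i s t. 0 < s \<Longrightarrow> s \<le> t \<Longrightarrow> t < T \<Longrightarrow> s \<notin> N i \<Longrightarrow> t \<notin> N i \<Longrightarrow>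
      (X t - X s) $ i = integral {s..t} (\<lambda>r. g r $ i)"
    using ev by metis
  have comp: "integral {s..t} (\<lambda>r. g r $ i) = integral {s..t} g $ i" for s t i
    using integral_linear[OF bounded_borel_integrable_on(1)[OF g] bounded_linear_vec_nth, of s t i] by (simp add: o_def)
  have neg: "negligible (\<Union>i. N i)" using N(1) by (intro negligible_countable_Union) (auto intro: countable_finite)
  show ?thesis
  proof (rule that[OF neg])
    fix s t assume "0 < s" "s \<le> t" "t < T" "s \<notin> (\<Union>i. N i)" "t \<notin> (\<Union>i. N i)"
    then show "X t - X s = integral {s..t} g" using N(2)[of s t] by (simp add: vec_eq_iff comp)
  qed
qed

text \<open>The cross product with \<open>freq k\<close> discards the component along the frequency,
  which divergence free test fields do not control. The cosine coefficient of a curl is 2 pi k times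
  the sine coefficient in the sense of cross products; hence the form of \<open>P'\<close>, and
  likewise \<open>Q'\<close> with opposite sign.\<close>

definition P where "P k t = freq k \<times> cosc k (V t)"
definition Q where "Q k t = freq k \<times> sinc k (V t)"
definition P' where "P' k t = (2 * pi) *\<^sub>R (freq k \<times> (freq k \<times> sinc k (E t)))"
definition Q' where "Q' k t = (- (2 * pi)) *\<^sub>R (freq k \<times> (freq k \<times> cosc k (E t)))"

lemma P'Q'_measurable [measurable]: "P' k \<in> borel_measurable borel" "Q' k \<in> borel_measurable borel"
  unfolding P'_def Q'_def by measurable

lemma P'Q'_bounds:
  "norm (P' k t) \<le> 2 * pi * (norm (freq k) * (norm (freq k) * (K * K)))"
  "norm (Q' k t) \<le> 2 * pi * (norm (freq k) * (norm (freq k) * (K * K)))"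
proof -
  have "norm (freq k \<times> (freq k \<times> a)) \<le> norm (freq k) * (norm (freq k) * (K * K))" if "norm a \<le> K * K" for a
    by (rule order_trans[OF norm_cross_le] mult_left_mono that norm_ge_zero)+
  from this[OF coeff_bounds(3)] this[OF coeff_bounds(4)]
  show "norm (P' k t) \<le> 2 * pi * (norm (freq k) * (norm (freq k) * (K * K)))"
    "norm (Q' k t) \<le> 2 * pi * (norm (freq k) * (norm (freq k) * (K * K)))"
    by (simp_all add: P'_def Q'_def)
qed

text \<open>The vector \<open>axis i 1 \<times> freq k\<close> is an admissible test direction, and
  pairing with it reads off component \<open>i\<close> of the cross product with
  \<open>freq k\<close>.\<close>

lemma evolve_P:
  obtains N where "negligible N" "\<And>s t. 0 < s \<Longrightarrow> s \<le> t \<Longrightarrow> t < T \<Longrightarrow> s \<notin> N \<Longrightarrow> t \<notin> N \<Longrightarrow> P k t - P k s = integral {s..t} (P' k)"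
proof (rule vector_evolution[OF P'Q'_measurable(1) P'Q'_bounds(1), where X="P k"])
  fix i
  let ?w = "axis i 1 \<times> freq k"
  obtain N where N: "negligible N" "\<And>s t. 0 < s \<Longrightarrow> s \<le> t \<Longrightarrow> t < T \<Longrightarrow> s \<notin> N \<Longrightarrow> t \<notin> N \<Longrightarrow>
    cosc k (V t) \<bullet> ?w - cosc k (V s) \<bullet> ?w = integral {s..t} (\<lambda>r. sinc k (E r) \<bullet> ((- (2 * pi)) *\<^sub>R (freq k \<times> ?w)))"
    using evolve_cos[of k ?w] by (auto simp: dot_cross_self)
  have e1: "a \<bullet> ?w = (freq k \<times> a) $ i" for a
  proof -
    have "a \<bullet> ?w = (freq k \<times> a) \<bullet> axis i 1" by (simp add: cross3_simps)
    then show ?thesis by (simp add: inner_axis)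
  qed
  have e2: "sinc k (E r) \<bullet> ((- (2 * pi)) *\<^sub>R (freq k \<times> ?w)) = P' k r $ i" for r
    unfolding double_cross_inner P'_def by (simp add: inner_axis)
  show "\<exists>N. negligible N \<and> (\<forall>s t. 0 < s \<longrightarrow> s \<le> t \<longrightarrow> t < T \<longrightarrow> s \<notin> N \<longrightarrow> t \<notin> N \<longrightarrow>
      (P k t - P k s) $ i = integral {s..t} (\<lambda>r. P' k r $ i))"
    unfolding P_def vector_minus_component using N(1) N(2)[unfolded e2, unfolded e1] by blast
qed (use that in blast)

lemma evolve_Q:
  obtains N where "negligible N" "\<And>s t. 0 < s \<Longrightarrow> s \<le> t \<Longrightarrow> t < T \<Longrightarrow> s \<notin> N \<Longrightarrow> t \<notin> N \<Longrightarrow> Q k t - Q k s = integral {s..t} (Q' k)"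
proof (rule vector_evolution[OF P'Q'_measurable(2) P'Q'_bounds(2), where X="Q k"])
  fix i
  let ?w = "axis i 1 \<times> freq k"
  obtain N where N: "negligible N" "\<And>s t. 0 < s \<Longrightarrow> s \<le> t \<Longrightarrow> t < T \<Longrightarrow> s \<notin> N \<Longrightarrow> t \<notin> N \<Longrightarrow>
    sinc k (V t) \<bullet> ?w - sinc k (V s) \<bullet> ?w = integral {s..t} (\<lambda>r. cosc k (E r) \<bullet> ((2 * pi) *\<^sub>R (freq k \<times> ?w)))"
    using evolve_sin[of k ?w] by (auto simp: dot_cross_self)
  have e1: "a \<bullet> ?w = (freq k \<times> a) $ i" for a
  proof -
    have "a \<bullet> ?w = (freq k \<times> a) \<bullet> axis i 1" by (simp add: cross3_simps)
    then show ?thesis by (simp add: inner_axis)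
  qed
  have e2: "cosc k (E r) \<bullet> ((2 * pi) *\<^sub>R (freq k \<times> ?w)) = Q' k r $ i" for r
    unfolding double_cross_inner Q'_def by (simp add: inner_axis)
  show "\<exists>N. negligible N \<and> (\<forall>s t. 0 < s \<longrightarrow> s \<le> t \<longrightarrow> t < T \<longrightarrow> s \<notin> N \<longrightarrow> t \<notin> N \<longrightarrow>
      (Q k t - Q k s) $ i = integral {s..t} (\<lambda>r. Q' k r $ i))"
    unfolding Q_def vector_minus_component using N(1) N(2)[unfolded e2, unfolded e1] by blast
qed (use that in blast)

text \<open>Test functions that separate time from a single mode reduce weak solenoidality to a
  scalar function of time tested against all bumps; \<open>du_Bois_Reymond_zero\<close>
  applies.\<close>

lemma div_free_coeff:
  assumes f: "smooth f" "periodic f" and [measurable]: "h \<in> borel_measurable borel" and h: "\<And>x. \<bar>h x\<bar> \<le> 1"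
    and grad: "\<And>c x. grad (\<lambda>x. f x *\<^sub>R c) x = (c * h x) *\<^sub>R v"
  shows "AE t in lborel. t \<in> {0<..<T} \<longrightarrow> v \<bullet> (\<integral>x. h x *\<^sub>R V t x \<partial>torus) = 0"
proof -
  define g where "g t = v \<bullet> (\<integral>x. h x *\<^sub>R V t x \<partial>torus)" for t
  have int: "integrable torus (\<lambda>x. h x *\<^sub>R V t x)" for t
    by (rule integrable_bounded_scaleR[OF integrable_V assms(3) h])
  have gm [measurable]: "g \<in> borel_measurable borel"
    unfolding g_def using joint_measurable
    by (auto intro!: borel_measurable_inner torus.borel_measurable_lebesgue_integral borel_measurable_scaleR simp: split_beta')
  have "AE t in lborel. t \<in> {0<..<T} \<longrightarrow> g t = 0"
  proof (rule du_Bois_Reymond_zero[OF gm, where C="norm v * K"])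
    show "norm (g t) \<le> norm v * K" for t
    proof -
      have "norm (\<integral>x. h x *\<^sub>R V t x \<partial>torus) \<le> (\<integral>x. norm (V t x) \<partial>torus)"
        by (rule order_trans[OF integral_norm_bound integral_mono[OF integrable_norm[OF int]]])
           (use h integrable_V in \<open>auto simp: mult_left_le_one_le\<close>)
      also have "\<dots> \<le> K" by (rule integral_norm_L2_bound[OF VL2 Vb K0])
      finally have "norm v * norm (\<integral>x. h x *\<^sub>R V t x \<partial>torus) \<le> norm v * K" by (rule mult_left_mono) simp
      then show ?thesis unfolding g_def real_norm_def by (rule order_trans[OF Cauchy_Schwarz_ineq2])
    qed
    fix \<eta> assume \<eta>: "time_bump T \<eta>"
    have [measurable]: "\<eta> \<in> borel_measurable borel"
    proof -
      have "C_k 0 \<eta>" using \<eta> by (simp only: time_bump_def smooth_def)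
      then show ?thesis by (simp add: borel_measurable_continuous_onI)
    qed
    have "spacetime_integral T (\<lambda>t x. B t x \<bullet> grad (\<lambda>x. f x *\<^sub>R (\<eta> t *\<^sub>R (1::real))) x) = 0"
      using div_free test_function_product[OF \<eta> f, of "1::real"] unfolding weakly_div_free_def by blast
    moreover have "spacetime_integral T (\<lambda>t x. B t x \<bullet> grad (\<lambda>x. f x *\<^sub>R (\<eta> t *\<^sub>R (1::real))) x) = (LINT t:{0<..<T}|lborel. \<eta> t * g t)"
    proof (rule spacetime_integral_AE)
      show "AE t in lborel. t \<in> {0<..<T} \<longrightarrow> torus_integral (\<lambda>x. B t x \<bullet> grad (\<lambda>x. f x *\<^sub>R (\<eta> t *\<^sub>R (1::real))) x) = \<eta> t * g t"
        using Veq
      proof eventually_elim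
        case (elim t)
        show ?case
        proof
          assume t: "t \<in> {0<..<T}"
          have "torus_integral (\<lambda>x. B t x \<bullet> grad (\<lambda>x. f x *\<^sub>R (\<eta> t *\<^sub>R (1::real))) x) = (\<integral>x. \<eta> t * (v \<bullet> (h x *\<^sub>R V t x)) \<partial>torus)"
          proof (rule torus_integral_AE)
            have "AE x in torus. B t x = V t x" using elim t by blast
            then show "AE x in torus. B t x \<bullet> grad (\<lambda>x. f x *\<^sub>R (\<eta> t *\<^sub>R (1::real))) x = \<eta> t * (v \<bullet> (h x *\<^sub>R V t x))"
              by eventually_elim (simp only: grad, simp add: inner_commute)
          qed measurable
          also have "\<dots> = \<eta> t * g t" unfolding g_def integral_inner_right[OF int, symmetric] by (simp only: integral_mult_right_zero)
          finally show "torus_integral (\<lambda>x. B t x \<bullet> grad (\<lambda>x. f x *\<^sub>R (\<eta> t *\<^sub>R (1::real))) x) = \<eta> t * g t" .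
        qed
      qed
    qed measurable
    ultimately show "(LINT t:{0<..<T}|lborel. \<eta> t * g t) = 0" by simp
  qed
  then show ?thesis by (simp add: g_def)
qed

lemma div_free_cosc_sinc:
  "AE t in lborel. t \<in> {0<..<T} \<longrightarrow> freq k \<bullet> cosc k (V t) = 0 \<and> freq k \<bullet> sinc k (V t) = 0"
proof -
  have "AE t in lborel. t \<in> {0<..<T} \<longrightarrow> ((2 * pi) *\<^sub>R freq k) \<bullet> cosc k (V t) = 0"
    unfolding cosc_ph
    by (rule div_free_coeff[OF smooth_phase(2)[of k] periodic_phase(2)[of k]])
       (simp_all only: grad_sin ph_measurable abs_cos_le_one scaleR_scaleR mult_ac)
  moreover have "AE t in lborel. t \<in> {0<..<T} \<longrightarrow> ((- (2 * pi)) *\<^sub>R freq k) \<bullet> sinc k (V t) = 0"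
    unfolding sinc_ph
    by (rule div_free_coeff[OF smooth_phase(1)[of k] periodic_phase(1)[of k]])
       (simp_all only: grad_cos ph_measurable abs_sin_le_one scaleR_scaleR mult_ac)
  ultimately show ?thesis by eventually_elim auto
qed

end

subsection \<open>The mollified helicity\<close>

lemma periodic_ph: "periodic (\<lambda>x. cos (ph k x) *\<^sub>R e)" "periodic (\<lambda>x. sin (ph k x) *\<^sub>R e)"
  using periodic_phase[of k] by (simp_all add: periodic_def)

lemma L2per_phase:
  fixes e :: "'b::euclidean_space"
  shows "L2per (\<lambda>x. cos (ph k x) *\<^sub>R e)" "L2per (\<lambda>x. sin (ph k x) *\<^sub>R e)"
  by (rule L2per_bounded[where C="norm e"]; auto simp: periodic_ph mult_left_le_one_le)+

text \<open>Single modes are eigenfunctions of the convolution. The sine moment of the kernel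
  vanishes because its coefficient \<open>lam N k\<close> is real.\<close>

lemma conv_phase:
  fixes e :: "'b::euclidean_space"
  shows "conv N (\<lambda>x. cos (ph k x) *\<^sub>R e) x = lam N k *\<^sub>R (cos (ph k x) *\<^sub>R e)"
    and "conv N (\<lambda>x. sin (ph k x) *\<^sub>R e) x = lam N k *\<^sub>R (sin (ph k x) *\<^sub>R e)"
proof -
  have int: "integrable torus (\<lambda>y. jackson N y * cos (ph k y))" "integrable torus (\<lambda>y. jackson N y * sin (ph k y))"
    using integrable_cos[OF integrable_jackson[of N], of k] integrable_sin[OF integrable_jackson[of N], of k]
    by (simp_all add: ph_def mult.commute)
  have intc: "integrable torus (\<lambda>y. complex_of_real (jackson N y) * ch k y)"
    using integrable_jackson[of N] by (rule Bochner_Integration.integrable_bound) (auto simp: norm_mult)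
  have c: "(\<integral>y. jackson N y * cos (ph k y) \<partial>torus) = lam N k"
    using integral_Re[OF intc] unfolding integral_ch_jackson by (simp add: Re_ch ph_def)
  have s: "(\<integral>y. jackson N y * sin (ph k y) \<partial>torus) = 0"
    using integral_Im[OF intc] unfolding integral_ch_jackson by (simp add: Im_ch ph_def)
  have add: "ph k (x + y) = ph k x + ph k y" for y by (simp add: ph_def inner_add_right algebra_simps)
  have "(\<integral>y. (cos (ph k x) * (jackson N y * cos (ph k y)) - sin (ph k x) * (jackson N y * sin (ph k y))) *\<^sub>R e \<partial>torus) = (cos (ph k x) * lam N k) *\<^sub>R e"
    using int by (subst integral_scaleR_left) (auto simp: Bochner_Integration.integral_diff c s)
  then show "conv N (\<lambda>x. cos (ph k x) *\<^sub>R e) x = lam N k *\<^sub>R (cos (ph k x) *\<^sub>R e)"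
    by (simp add: conv_def add cos_add right_diff_distrib mult_ac)
  have "(\<integral>y. (sin (ph k x) * (jackson N y * cos (ph k y)) + cos (ph k x) * (jackson N y * sin (ph k y))) *\<^sub>R e \<partial>torus) = (sin (ph k x) * lam N k) *\<^sub>R e"
    using int by (subst integral_scaleR_left) (auto simp: Bochner_Integration.integral_add c s)
  then show "conv N (\<lambda>x. sin (ph k x) *\<^sub>R e) x = lam N k *\<^sub>R (sin (ph k x) *\<^sub>R e)"
    by (simp add: conv_def add sin_add distrib_left mult_ac)
qed

lemma coeff_conv:
  fixes f :: "real^3 \<Rightarrow> 'b::euclidean_space"
  assumes f: "L2per f"
  shows "cosc k (conv N f) = lam N k *\<^sub>R cosc k f" "sinc k (conv N f) = lam N k *\<^sub>R sinc k f"
proof -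
  have W: "L2per (conv N f)" by (rule L2per_conv[OF L2perD(1,2,4)[OF f]])
  have "cosc k (conv N f) \<bullet> e = (lam N k *\<^sub>R cosc k f) \<bullet> e" for e
    unfolding integral_inner_cos[OF L2perD(4)[OF W], symmetric]
    unfolding conv_self_adjoint(2)[OF L2perD(1,2,4)[OF f] L2perD(1,2,4)[OF L2per_phase(1)]] conv_phase
    by (simp only: inner_scaleR_right[of _ "lam N k"] integral_mult_right_zero integral_inner_cos[OF L2perD(4)[OF f]] inner_scaleR_left)
  then show "cosc k (conv N f) = lam N k *\<^sub>R cosc k f"
    using vector_eq_rdot[of "cosc k (conv N f)" "lam N k *\<^sub>R cosc k f"] by blast
  have "sinc k (conv N f) \<bullet> e = (lam N k *\<^sub>R sinc k f) \<bullet> e" for e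
    unfolding integral_inner_sin[OF L2perD(4)[OF W], symmetric]
    unfolding conv_self_adjoint(2)[OF L2perD(1,2,4)[OF f] L2perD(1,2,4)[OF L2per_phase(2)]] conv_phase
    by (simp only: inner_scaleR_right[of _ "lam N k"] integral_mult_right_zero integral_inner_sin[OF L2perD(4)[OF f]] inner_scaleR_left)
  then show "sinc k (conv N f) = lam N k *\<^sub>R sinc k f"
    using vector_eq_rdot[of "sinc k (conv N f)" "lam N k *\<^sub>R sinc k f"] by blast
qed

lemma integral_conv_conv:
  fixes f g :: "real^3 \<Rightarrow> 'b::euclidean_space"
  assumes f: "f \<in> borel_measurable borel" "periodic f" "integrable torus f" and g: "L2per g"
  shows "(\<integral>x. f x \<bullet> conv N (conv N g) x \<partial>torus) = (\<Sum>k\<in>cube (2*N). (lam N k)\<^sup>2 * (cosc k f \<bullet> cosc k g + sinc k f \<bullet> sinc k g))"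
proof -
  have W: "L2per (conv N g)" by (rule L2per_conv[OF L2perD(1,2,4)[OF g]])
  have "(\<integral>x. f x \<bullet> conv N (conv N g) x \<partial>torus) = (\<integral>x. conv N f x \<bullet> conv N g x \<partial>torus)"
    by (rule conv_self_adjoint(2)[OF f L2perD(1,2,4)[OF W], symmetric])
  also have "\<dots> = (\<Sum>k\<in>cube (2*N). lam N k * (cosc k f \<bullet> cosc k (conv N g) + sinc k f \<bullet> sinc k (conv N g)))"
    by (rule conv_inner[OF f L2perD(1,2,4)[OF W]])
  finally show ?thesis
    by (simp add: coeff_conv[OF g] power2_eq_square algebra_simps)
qed

lemma cross_cross_cross: "k \<times> (k \<times> (k \<times> a)) = (- (k \<bullet> k)) *\<^sub>R (k \<times> a)"
  by (simp add: cross3_simps)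

lemma inner_cross_cross: "(k \<times> a) \<bullet> (k \<times> b) = (k \<bullet> k) * (a \<bullet> b) - (k \<bullet> a) * (k \<bullet> (b::real^3))"
  by (simp add: cross3_simps)

lemma freq_eq_0_iff [simp]: "freq k = 0 \<longleftrightarrow> k = 0"
  by (simp add: freq_def vec_eq_iff)

text \<open>With \<open>C\<close> and \<open>S\<close> orthogonal to \<open>k\<close>, the triple
  cross products collapse by k \<times> (k \<times> (k \<times> a)) = - |k|^2 (k \<times> a), and
  each product yields 2 pi |k|^4. This is how the weight of the helicity turns the product rule into
  the Fourier density of twice the flux.\<close>

lemma flux_density_identity:
  fixes k C S CE SE :: "real^3"
  assumes k: "k \<noteq> 0" and C: "k \<bullet> C = 0" and S: "k \<bullet> S = 0"
  shows "1 / (pi * (k \<bullet> k)\<^sup>2) * ((k \<times> ((- (2 * pi)) *\<^sub>R (k \<times> (k \<times> CE)))) \<bullet> (k \<times> C) + (k \<times> (k \<times> S)) \<bullet> ((2 * pi) *\<^sub>R (k \<times> (k \<times> SE))))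
    = 2 * (CE \<bullet> C + SE \<bullet> S)"
proof -
  have kk: "k \<bullet> k \<noteq> 0" using k by simp
  have 1: "(k \<times> ((- (2 * pi)) *\<^sub>R (k \<times> (k \<times> CE)))) \<bullet> (k \<times> C) = 2 * pi * (k \<bullet> k)\<^sup>2 * (CE \<bullet> C)"
    unfolding cross_mult_right cross_cross_cross by (simp add: inner_cross_cross C power2_eq_square)
  have 2: "(k \<times> (k \<times> S)) \<bullet> ((2 * pi) *\<^sub>R (k \<times> (k \<times> SE))) = 2 * pi * (k \<bullet> k)\<^sup>2 * (SE \<bullet> S)"
    unfolding inner_scaleR_right inner_cross_cross[of k "k \<times> S"]
    by (simp add: inner_cross_cross S dot_cross_self power2_eq_square inner_commute[of SE S])
  show ?thesis unfolding 1 2 using kk by (simp add: field_simps)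
qed

lemma bounded_bilinear_cross_inner: "bounded_bilinear (\<lambda>q p. (k \<times> q) \<bullet> (p::real^3))"
proof
  show "\<exists>K. \<forall>a b. norm ((k \<times> a) \<bullet> b) \<le> norm a * norm b * K"
  proof (intro exI[of _ "norm k"] allI)
    fix a b :: "real^3"
    have "norm ((k \<times> a) \<bullet> b) \<le> norm (k \<times> a) * norm b" by (simp add: Cauchy_Schwarz_ineq2)
    also have "\<dots> \<le> (norm k * norm a) * norm b" by (intro mult_right_mono norm_cross_le) auto
    finally show "norm ((k \<times> a) \<bullet> b) \<le> norm a * norm b * norm k" by (simp add: mult_ac)
  qed
qed (simp_all add: cross_add_right cross_mult_right inner_add_left inner_add_right)

lemma torus_integral_inner_phase:
  fixes h h' :: "real^3 \<Rightarrow> real^3"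
  assumes h': "L2per h'" and eq: "AE x in torus. h x = h' x"
  shows "torus_integral (\<lambda>x. h x \<bullet> (cos (ph k x) *\<^sub>R w)) = cosc k h' \<bullet> w"
    and "torus_integral (\<lambda>x. h x \<bullet> (sin (ph k x) *\<^sub>R w)) = sinc k h' \<bullet> w"
proof -
  note [measurable] = L2perD(1)[OF h']
  show "torus_integral (\<lambda>x. h x \<bullet> (cos (ph k x) *\<^sub>R w)) = cosc k h' \<bullet> w"
    unfolding integral_inner_cos[OF L2perD(4)[OF h'], symmetric]
    by (rule torus_integral_AE) (measurable, use eq in \<open>auto elim!: eventually_mono\<close>)
  show "torus_integral (\<lambda>x. h x \<bullet> (sin (ph k x) *\<^sub>R w)) = sinc k h' \<bullet> w"
    unfolding integral_inner_sin[OF L2perD(4)[OF h'], symmetric]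
    by (rule torus_integral_AE) (measurable, use eq in \<open>auto elim!: eventually_mono\<close>)
qed

context induction_solution
begin

text \<open>Divergence free test fields only control $k \times \hat B(k)$, so the helicity is written in terms
  of \<open>P\<close> and \<open>Q\<close>; the factor $1 / (\pi |k|^4)$ combines the symbol of
  $\nabla \times (-\Delta)^{-1}$ with the identity $k \times (k \times b) = - |k|^2 b$ for $k \cdot b = 0$.\<close>

definition hweight :: "nat \<Rightarrow> int^3 \<Rightarrow> real" where
  "hweight N k = (lam N k)\<^sup>2 * (1 / (pi * (freq k \<bullet> freq k)\<^sup>2))"

definition helicity :: "nat \<Rightarrow> real \<Rightarrow> real" where
  "helicity N t = (\<Sum>k\<in>cube (2*N) - {0}. hweight N k * ((freq k \<times> Q k t) \<bullet> P k t))"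

lemma PQ_measurable [measurable]: "P k \<in> borel_measurable borel" "Q k \<in> borel_measurable borel"
  unfolding P_def Q_def by measurable

lemma PQ_bounds: "norm (P k t) \<le> norm (freq k) * K" "norm (Q k t) \<le> norm (freq k) * K"
  unfolding P_def Q_def
  by (rule order_trans[OF norm_cross_le mult_left_mono[OF coeff_bounds(1)]], simp,
      rule order_trans[OF norm_cross_le mult_left_mono[OF coeff_bounds(2)]], simp)

lemma flux_eq_sum: "flux N (U t) (V t) = (\<Sum>k\<in>cube (2*N). (lam N k)\<^sup>2 * (cosc k (E t) \<bullet> cosc k (V t) + sinc k (E t) \<bullet> sinc k (V t)))"
proof -
  have "periodic (E t)" using L2perD(2)[OF UL2, of t] L2perD(2)[OF VL2, of t] by (simp add: periodic_def E_def)
  from integral_conv_conv[OF E_measurable this integrable_E VL2] show ?thesis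
    by (simp add: flux_def E_def)
qed

text \<open>The sum over modes is finite, so one null set serves all of them and the product rule
  may be applied mode by mode. The resulting density equals twice the flux at almost every time,
  namely where all coefficients are orthogonal to their frequencies and the mean vanishes.\<close>

lemma helicity_evolution:
  assumes mean: "AE t in lborel. t \<in> {0<..<T} \<longrightarrow> cosc 0 (V t) = 0"
  obtains Z where "negligible Z" "\<And>\<alpha> \<beta>. 0 < \<alpha> \<Longrightarrow> \<alpha> \<le> \<beta> \<Longrightarrow> \<beta> < T \<Longrightarrow> \<alpha> \<notin> Z \<Longrightarrow> \<beta> \<notin> Z \<Longrightarrow>
    ennreal \<bar>helicity N \<beta> - helicity N \<alpha>\<bar> \<le> (\<integral>\<^sup>+t. ennreal (2 * \<bar>flux N (U t) (V t)\<bar>) * indicator {0<..<T} t \<partial>lborel)"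
proof -
  define f where "f k r = (freq k \<times> Q' k r) \<bullet> P k r + (freq k \<times> Q k r) \<bullet> P' k r" for k r
  have [measurable]: "f k \<in> borel_measurable borel" for k unfolding f_def by measurable
  have "\<exists>Z. negligible Z \<and> (\<forall>s t. 0 < s \<longrightarrow> s \<le> t \<longrightarrow> t < T \<longrightarrow> s \<notin> Z \<longrightarrow> t \<notin> Z \<longrightarrow>
      P k t - P k s = integral {s..t} (P' k) \<and> Q k t - Q k s = integral {s..t} (Q' k))" for k
  proof -
    obtain Z1 where Z1: "negligible Z1" "\<And>s t. 0 < s \<Longrightarrow> s \<le> t \<Longrightarrow> t < T \<Longrightarrow> s \<notin> Z1 \<Longrightarrow> t \<notin> Z1 \<Longrightarrow> P k t - P k s = integral {s..t} (P' k)"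
      using evolve_P by blast
    obtain Z2 where Z2: "negligible Z2" "\<And>s t. 0 < s \<Longrightarrow> s \<le> t \<Longrightarrow> t < T \<Longrightarrow> s \<notin> Z2 \<Longrightarrow> t \<notin> Z2 \<Longrightarrow> Q k t - Q k s = integral {s..t} (Q' k)"
      using evolve_Q by blast
    show ?thesis using Z1 Z2 negligible_Un[OF Z1(1) Z2(1)] by (intro exI[of _ "Z1 \<union> Z2"]) auto
  qed
  then obtain Zk where Zk: "\<And>k. negligible (Zk k)" "\<And>k s t. 0 < s \<Longrightarrow> s \<le> t \<Longrightarrow> t < T \<Longrightarrow> s \<notin> Zk k \<Longrightarrow> t \<notin> Zk k \<Longrightarrow>
      P k t - P k s = integral {s..t} (P' k) \<and> Q k t - Q k s = integral {s..t} (Q' k)"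
    by metis
  define Z where "Z = (\<Union>k\<in>cube (2*N). Zk k)"
  have Z: "negligible Z" unfolding Z_def using Zk(1) by (intro negligible_Union) auto
  have fb: "\<exists>C. \<forall>r. norm (f k r) \<le> C" for k
  proof -
    let ?n = "norm (freq k)" and ?B = "2 * pi * (norm (freq k) * (norm (freq k) * (K * K)))"
    have "norm (f k r) \<le> (?n * ?B) * (?n * K) + (?n * (?n * K)) * ?B" for r
    proof -
      have "norm (f k r) \<le> norm (freq k \<times> Q' k r) * norm (P k r) + norm (freq k \<times> Q k r) * norm (P' k r)"
        unfolding f_def by (rule order_trans[OF norm_triangle_ineq]) (auto intro!: add_mono Cauchy_Schwarz_ineq2)
      also have "\<dots> \<le> (?n * ?B) * (?n * K) + (?n * (?n * K)) * ?B"
        by (intro add_mono mult_mono order_trans[OF norm_cross_le] mult_left_mono PQ_bounds P'Q'_bounds)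
           (use K0 in auto)
      finally show ?thesis .
    qed
    then show ?thesis by blast
  qed
  have fi: "f k integrable_on {s..t}" for k s t
    using fb[of k] bounded_borel_integrable_on(1)[of "f k"] by auto
  have per_k: "(freq k \<times> Q k \<beta>) \<bullet> P k \<beta> - (freq k \<times> Q k \<alpha>) \<bullet> P k \<alpha> = integral {\<alpha>..\<beta>} (f k)"
    if k: "k \<in> cube (2*N)" and ab: "0 < \<alpha>" "\<alpha> \<le> \<beta>" "\<beta> < T" "\<alpha> \<notin> Z" "\<beta> \<notin> Z" for k \<alpha> \<beta>
    unfolding f_def
    by (rule product_rule_AE[OF bounded_bilinear_cross_inner P'Q'_measurable(2) P'Q'_bounds(2) P'Q'_measurable(1) P'Q'_bounds(1) Zk(1)])
       (use Zk(2)[of _ _ k] ab k in \<open>auto simp: Z_def\<close>)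
  define F where "F r = (\<Sum>k\<in>cube (2*N) - {0}. hweight N k * f k r)" for r
  have Fd: "helicity N \<beta> - helicity N \<alpha> = integral {\<alpha>..\<beta>} F"
    if ab: "0 < \<alpha>" "\<alpha> \<le> \<beta>" "\<beta> < T" "\<alpha> \<notin> Z" "\<beta> \<notin> Z" for \<alpha> \<beta>
  proof -
    have "helicity N \<beta> - helicity N \<alpha> = (\<Sum>k\<in>cube (2*N) - {0}. hweight N k * integral {\<alpha>..\<beta>} (f k))"
      unfolding helicity_def sum_subtractf[symmetric] right_diff_distrib[symmetric]
      by (intro sum.cong refl arg_cong2[where f="(*)"] per_k ab) auto
    also have "\<dots> = integral {\<alpha>..\<beta>} F"
      unfolding F_def using fi
      by (subst Henstock_Kurzweil_Integration.integral_sum) (auto intro!: integrable_on_mult_right)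
    finally show ?thesis .
  qed
  have "AE r in lborel. \<forall>k\<in>cube (2*N). r \<in> {0<..<T} \<longrightarrow> freq k \<bullet> cosc k (V r) = 0 \<and> freq k \<bullet> sinc k (V r) = 0"
    by (intro AE_finite_allI div_free_cosc_sinc) simp
  then have F_flux: "AE r in lborel. r \<in> {0<..<T} \<longrightarrow> F r = 2 * flux N (U r) (V r)"
    using mean
  proof eventually_elim
    case (elim r)
    show ?case
    proof
      assume r: "r \<in> {0<..<T}"
      \<comment> \<open>The flux contains the zero mode and the helicity does not; the mismatch
        disappears because \<open>V r\<close> has mean zero.\<close>
      have "sinc 0 (V r) = 0" by (simp add: sinc_def)
      with elim r have z: "(lam N 0)\<^sup>2 * (cosc 0 (E r) \<bullet> cosc 0 (V r) + sinc 0 (E r) \<bullet> sinc 0 (V r)) = 0" by simp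
      have "F r = (\<Sum>k\<in>cube (2*N) - {0}. 2 * ((lam N k)\<^sup>2 * (cosc k (E r) \<bullet> cosc k (V r) + sinc k (E r) \<bullet> sinc k (V r))))"
        unfolding F_def
      proof (rule sum.cong)
        fix k assume k: "k \<in> cube (2*N) - {0}"
        then have nz: "freq k \<noteq> 0" by simp
        have "freq k \<bullet> cosc k (V r) = 0" "freq k \<bullet> sinc k (V r) = 0" using elim(1) r k by blast+
        from flux_density_identity[OF nz this, of "cosc k (E r)" "sinc k (E r)"]
        show "hweight N k * f k r = 2 * ((lam N k)\<^sup>2 * (cosc k (E r) \<bullet> cosc k (V r) + sinc k (E r) \<bullet> sinc k (V r)))"
          unfolding hweight_def f_def P_def Q_def P'_def Q'_def mult.assoc by (simp only: mult.left_commute[of 2])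
      qed simp
      also have "\<dots> = 2 * flux N (U r) (V r)"
        unfolding flux_eq_sum sum_distrib_left using z
        by (intro sum.mono_neutral_left) auto
      finally show "F r = 2 * flux N (U r) (V r)" .
    qed
  qed
  have Fm [measurable]: "F \<in> borel_measurable borel" unfolding F_def by measurable
  obtain C where C: "\<And>r. norm (F r) \<le> C"
  proof -
    obtain Ck where "\<And>k r. norm (f k r) \<le> Ck k" using fb by metis
    then have "norm (F r) \<le> (\<Sum>k\<in>cube (2*N) - {0}. \<bar>hweight N k\<bar> * Ck k)" for r
      unfolding F_def by (intro sum_norm_le) (auto simp: abs_mult intro!: mult_left_mono)
    then show ?thesis using that by blast
  qed
  show ?thesis
  proof (rule that[OF Z])
    fix \<alpha> \<beta> assume ab: "0 < \<alpha>" "\<alpha> \<le> \<beta>" "\<beta> < T" "\<alpha> \<notin> Z" "\<beta> \<notin> Z"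
    have "helicity N \<beta> - helicity N \<alpha> = (LINT r:{\<alpha>..\<beta>}|lborel. F r)"
      unfolding Fd[OF ab] by (rule set_borel_integral_eq_integral(2)[OF bounded_borel_integrable_on(2)[OF Fm C], symmetric])
    then have "ennreal \<bar>helicity N \<beta> - helicity N \<alpha>\<bar> \<le> (\<integral>\<^sup>+r. ennreal (norm (indicator {\<alpha>..\<beta>} r *\<^sub>R F r)) \<partial>lborel)"
      using ennreal_norm_integral_le[of lborel "\<lambda>r. indicator {\<alpha>..\<beta>} r *\<^sub>R F r"] by (simp add: set_lebesgue_integral_def)
    also have "\<dots> \<le> (\<integral>\<^sup>+t. ennreal (2 * \<bar>flux N (U t) (V t)\<bar>) * indicator {0<..<T} t \<partial>lborel)"
    proof (rule nn_integral_mono_AE)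
      show "AE r in lborel. ennreal (norm (indicator {\<alpha>..\<beta>} r *\<^sub>R F r)) \<le> ennreal (2 * \<bar>flux N (U r) (V r)\<bar>) * indicator {0<..<T} r"
        using F_flux
      proof eventually_elim
        case (elim r)
        then show ?case using ab by (auto simp: indicator_def abs_mult)
      qed
    qed
    finally show "ennreal \<bar>helicity N \<beta> - helicity N \<alpha>\<bar> \<le> (\<integral>\<^sup>+t. ennreal (2 * \<bar>flux N (U t) (V t)\<bar>) * indicator {0<..<T} t \<partial>lborel)" .
  qed
qed

text \<open>Testing the definition of the potential with single modes divides by 4 pi^2 |k|^2 for
  the inverse Laplacian and multiplies by 2 pi for the curl. The cosine and sine terms contribute 1
  / (2 pi |k|^2) each, and rewriting in \<open>P\<close> and \<open>Q\<close> costs a further |k|^2,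
  which gives \<open>hweight\<close>.\<close>

lemma helicity_eq_integral:
  assumes t: "AE x in torus. B t x = V t x" and pot: "is_vector_potential (B t) (A t)"
    and a: "L2per a" "AE x in torus. A t x = a x" and mean: "cosc 0 (V t) = 0"
  shows "helicity N t = (\<integral>x. a x \<bullet> conv N (conv N (V t)) x \<partial>torus)"
proof -
  obtain \<Phi> where \<Phi>: "is_inv_neg_laplacian (B t) \<Phi>" "is_weak_curl \<Phi> (A t)"
    using pot by (auto simp: is_vector_potential_def)
  have "torus_L2 \<Phi>" using \<Phi>(1) by (simp add: is_inv_neg_laplacian_def)
  then obtain \<phi> where \<phi>: "L2per \<phi>" "AE x in torus. \<Phi> x = \<phi> x" using torus_L2_representative by blast
  have sm: "smooth (\<lambda>x. cos (ph k x) *\<^sub>R v)" "smooth (\<lambda>x. sin (ph k x) *\<^sub>R v)" for k and v :: "real^3"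
    by (intro smooth_scaleR smooth_phase smooth_const)+
  have A_cos: "cosc k a \<bullet> v = sinc k \<phi> \<bullet> ((- (2 * pi)) *\<^sub>R (freq k \<times> v))" for k v
  proof -
    have "torus_integral (\<lambda>x. A t x \<bullet> (cos (ph k x) *\<^sub>R v)) = torus_integral (\<lambda>x. \<Phi> x \<bullet> curl (\<lambda>x. cos (ph k x) *\<^sub>R v) x)"
      using \<Phi>(2) sm(1)[of k v] periodic_ph(1)[of k v] unfolding is_weak_curl_def by blast
    then show ?thesis
      unfolding curl_cos torus_integral_inner_phase[OF a] torus_integral_inner_phase[OF \<phi>] .
  qed
  have A_sin: "sinc k a \<bullet> v = cosc k \<phi> \<bullet> ((2 * pi) *\<^sub>R (freq k \<times> v))" for k v
  proof -
    have "torus_integral (\<lambda>x. A t x \<bullet> (sin (ph k x) *\<^sub>R v)) = torus_integral (\<lambda>x. \<Phi> x \<bullet> curl (\<lambda>x. sin (ph k x) *\<^sub>R v) x)"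
      using \<Phi>(2) sm(2)[of k v] periodic_ph(2)[of k v] unfolding is_weak_curl_def by blast
    then show ?thesis
      unfolding curl_sin torus_integral_inner_phase[OF a] torus_integral_inner_phase[OF \<phi>] .
  qed
  have cos_lap: "- laplacian (\<lambda>x. cos (ph k x) *\<^sub>R v) x = cos (ph k x) *\<^sub>R ((4 * pi\<^sup>2 * (freq k \<bullet> freq k)) *\<^sub>R v)"
    and sin_lap: "- laplacian (\<lambda>x. sin (ph k x) *\<^sub>R v) x = sin (ph k x) *\<^sub>R ((4 * pi\<^sup>2 * (freq k \<bullet> freq k)) *\<^sub>R v)" for k v x
    by (simp_all add: laplacian_cos laplacian_sin)
  have lap: "4 * pi\<^sup>2 * (freq k \<bullet> freq k) * (cosc k \<phi> \<bullet> v) = cosc k (V t) \<bullet> v"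
    "4 * pi\<^sup>2 * (freq k \<bullet> freq k) * (sinc k \<phi> \<bullet> v) = sinc k (V t) \<bullet> v" for k v
  proof -
    have "torus_integral (\<lambda>x. \<Phi> x \<bullet> (- laplacian (\<lambda>x. cos (ph k x) *\<^sub>R v) x)) = torus_integral (\<lambda>x. B t x \<bullet> (cos (ph k x) *\<^sub>R v))"
      using \<Phi>(1) sm(1)[of k v] periodic_ph(1)[of k v] unfolding is_inv_neg_laplacian_def by blast
    then show "4 * pi\<^sup>2 * (freq k \<bullet> freq k) * (cosc k \<phi> \<bullet> v) = cosc k (V t) \<bullet> v"
      unfolding cos_lap torus_integral_inner_phase[OF \<phi>] torus_integral_inner_phase[OF VL2 t] unfolding inner_scaleR_right .
    have "torus_integral (\<lambda>x. \<Phi> x \<bullet> (- laplacian (\<lambda>x. sin (ph k x) *\<^sub>R v) x)) = torus_integral (\<lambda>x. B t x \<bullet> (sin (ph k x) *\<^sub>R v))"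
      using \<Phi>(1) sm(2)[of k v] periodic_ph(2)[of k v] unfolding is_inv_neg_laplacian_def by blast
    then show "4 * pi\<^sup>2 * (freq k \<bullet> freq k) * (sinc k \<phi> \<bullet> v) = sinc k (V t) \<bullet> v"
      unfolding sin_lap torus_integral_inner_phase[OF \<phi>] torus_integral_inner_phase[OF VL2 t] unfolding inner_scaleR_right .
  qed
  have "(\<integral>x. a x \<bullet> conv N (conv N (V t)) x \<partial>torus) = (\<Sum>k\<in>cube (2*N). (lam N k)\<^sup>2 * (cosc k a \<bullet> cosc k (V t) + sinc k a \<bullet> sinc k (V t)))"
    by (rule integral_conv_conv[OF L2perD(1,2,4)[OF a(1)] VL2])
  also have "\<dots> = (\<Sum>k\<in>cube (2*N) - {0}. (lam N k)\<^sup>2 * (cosc k a \<bullet> cosc k (V t) + sinc k a \<bullet> sinc k (V t)))"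
    using mean by (intro sum.mono_neutral_right) (auto simp: sinc_def)
  also have "\<dots> = helicity N t"
    unfolding helicity_def
  proof (rule sum.cong)
    fix k assume "k \<in> cube (2*N) - {0}"
    then have kk: "freq k \<bullet> freq k \<noteq> 0" by simp
    let ?C = "cosc k (V t)" and ?S = "sinc k (V t)" and ?\<kappa> = "freq k \<bullet> freq k"
    have PQ: "(freq k \<times> Q k t) \<bullet> P k t = ?\<kappa> * ((freq k \<times> ?S) \<bullet> ?C)"
      unfolding P_def Q_def inner_cross_cross[of "freq k" "freq k \<times> ?S"] by (simp add: dot_cross_self)
    have swap: "?S \<bullet> (freq k \<times> ?C) = - ((freq k \<times> ?S) \<bullet> ?C)" "?C \<bullet> (freq k \<times> ?S) = (freq k \<times> ?S) \<bullet> ?C"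
      by (simp_all add: cross3_simps)
    have "4 * pi\<^sup>2 * ?\<kappa> * (sinc k \<phi> \<bullet> (freq k \<times> ?C)) = - ((freq k \<times> ?S) \<bullet> ?C)"
      "4 * pi\<^sup>2 * ?\<kappa> * (cosc k \<phi> \<bullet> (freq k \<times> ?S)) = (freq k \<times> ?S) \<bullet> ?C"
      unfolding lap swap by simp_all
    then have "cosc k a \<bullet> ?C + sinc k a \<bullet> ?S = 1 / (pi * ?\<kappa>) * ((freq k \<times> ?S) \<bullet> ?C)"
      unfolding A_cos A_sin using kk by (simp add: field_simps power2_eq_square)
    then show "(lam N k)\<^sup>2 * (cosc k a \<bullet> ?C + sinc k a \<bullet> ?S) = hweight N k * ((freq k \<times> Q k t) \<bullet> P k t)"
      unfolding PQ hweight_def using kk by (simp add: power2_eq_square)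
  qed simp
  finally show ?thesis by simp
qed

end

subsection \<open>Conservation\<close>

lemma cis_freq_measurable [measurable]: "(\<lambda>x. cis (- 2 * pi * (freq k \<bullet> x))) \<in> borel_measurable borel"
  unfolding cis_conv_exp by (intro borel_measurable_continuous_onI continuous_intros)

text \<open>The norm depends on its argument only through Fourier coefficients, which ignore null
  sets; this carries the Besov hypotheses over to the representatives.\<close>

lemma besov_norm_cong_AE:
  assumes g [measurable]: "g \<in> borel_measurable borel" and eq: "AE x in torus. f x = g x"
  shows "besov_norm X s p f = besov_norm X s p g"
proof -
  have "fourier_coeff f k = fourier_coeff g k" for k
  proof -
    have "fourier_coeff f k = (\<integral>x. of_real (g x) * cis (- 2 * pi * (freq k \<bullet> x)) \<partial>torus)"
      unfolding fourier_coeff_def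
      by (rule torus_integral_AE) (measurable, use eq in \<open>auto elim!: eventually_mono\<close>)
    also have "\<dots> = fourier_coeff g k"
      unfolding fourier_coeff_def by (rule torus_integral_eq[symmetric]) measurable
    finally show ?thesis .
  qed
  then show ?thesis by (simp add: besov_norm_def lp_block_def[abs_def])
qed

text \<open>Each block depends on finitely many coefficients, which are measurable in time, and the
  supremum over blocks is countable.\<close>

lemma besov_norm_measurable:
  fixes W :: "real \<Rightarrow> real^3 \<Rightarrow> real"
  assumes X: "littlewood_paley_cutoff X"
    and W: "(\<lambda>z. W (fst z) (snd z)) \<in> borel_measurable borel" "\<And>t. integrable torus (W t)"
  shows "(\<lambda>t. besov_norm X s p (W t)) \<in> borel_measurable borel"
proof -
  have Wt [measurable]: "W t \<in> borel_measurable borel" for t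
    using jointly_measurable[OF W(1), of "\<lambda>_. t" borel "\<lambda>x. x"] by simp
  have Wp [measurable]: "(\<lambda>q. W (fst q) (snd q)) \<in> borel_measurable (borel \<Otimes>\<^sub>M torus)"
    by (rule jointly_measurable[OF W(1)]) measurable
  have c [measurable]: "(\<lambda>t. cosc k (W t)) \<in> borel_measurable borel" for k
    unfolding cosc_def by (rule torus.borel_measurable_lebesgue_integral) (simp add: split_beta')
  have s [measurable]: "(\<lambda>t. sinc k (W t)) \<in> borel_measurable borel" for k
    unfolding sinc_def by (rule torus.borel_measurable_lebesgue_integral) (simp add: split_beta')
  have [measurable]: "(\<lambda>t. fc (W t) k) \<in> borel_measurable borel" for k
    unfolding fc_def Complex_eq by measurable
  have eq: "torus_Lp_norm p (lp_block X n (W t)) =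
      (\<integral>x. norm (\<Sum>k\<in>cube (2 ^ (n+1)). (of_real (lp_multiplier X n (freq k)) * fc (W t) k) * ch k x) powr p \<partial>torus) powr (1 / p)" for n t
    unfolding torus_Lp_norm_def lp_block_eq[OF X Wt W(2) order_refl finite_cube]
    by (subst torus_integral_eq) measurable
  have "(\<lambda>t. \<integral>x. norm (\<Sum>k\<in>cube (2 ^ (n+1)). (of_real (lp_multiplier X n (freq k)) * fc (W t) k) * ch k x) powr p \<partial>torus) \<in> borel_measurable borel" for n
    by (rule torus.borel_measurable_lebesgue_integral) (simp add: split_beta')
  note [measurable] = this[folded eq]
  show ?thesis
    unfolding besov_norm_def eq by measurable
qed

text \<open>One finite, square integrable Borel function dominates the norms of all three
  components, so that pointwise estimates can be carried out in the reals.\<close>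

lemma L2_besov_envelope:
  assumes X: "littlewood_paley_cutoff X" and u: "L2_besov X T s 4 u"
    and W: "(\<lambda>z. W (fst z) (snd z)) \<in> borel_measurable borel" "\<And>t. L2per (W t)"
    and eq: "AE t in lborel. t \<in> {0<..<T} \<longrightarrow> (AE x in torus. u t x = W t x)"
  obtains \<beta> :: "real \<Rightarrow> real" where "\<beta> \<in> borel_measurable borel" "\<And>t. 0 \<le> \<beta> t"
    "(\<integral>\<^sup>+t. ennreal ((\<beta> t)\<^sup>2) * indicator {0<..<T} t \<partial>lborel) < \<infinity>"
    "AE t in lborel. t \<in> {0<..<T} \<longrightarrow> (\<forall>i. besov_norm X s 4 (\<lambda>x. W t x $ i) \<le> ennreal (\<beta> t))"
proof -
  define b where "b i t = besov_norm X s 4 (\<lambda>x. W t x $ i)" for i t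
  have [measurable]: "b i \<in> borel_measurable borel" for i
    unfolding b_def using L2perD(4)[OF L2per_component[OF W(2)]]
    by (intro besov_norm_measurable[OF X]) (auto intro: measurable_compose[OF W(1)])
  have fin: "(\<integral>\<^sup>+t. (b i t)\<^sup>2 * indicator {0<..<T} t \<partial>lborel) < \<infinity>" for i
  proof -
    have "(\<integral>\<^sup>+t. (b i t)\<^sup>2 * indicator {0<..<T} t \<partial>lborel) = (\<integral>\<^sup>+t. (b i t)\<^sup>2 * indicator {0<..<T} t \<partial>lebesgue)"
      by (rule nn_integral_completion[symmetric])
    also have "\<dots> = (\<integral>\<^sup>+t\<in>{0<..<T}. (besov_norm X s 4 (\<lambda>x. u t x $ i))\<^sup>2 \<partial>lebesgue)"
    proof (rule nn_integral_cong_AE)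
      have "AE t in lborel. (b i t)\<^sup>2 * indicator {0<..<T} t = (besov_norm X s 4 (\<lambda>x. u t x $ i))\<^sup>2 * indicator {0<..<T} t"
        using eq
      proof eventually_elim
        case (elim t)
        show ?case
        proof (cases "t \<in> {0<..<T}")
          case True
          with elim have "AE x in torus. u t x $ i = W t x $ i" by (auto elim!: eventually_mono)
          then have "besov_norm X s 4 (\<lambda>x. u t x $ i) = b i t"
            unfolding b_def by (rule besov_norm_cong_AE[OF L2perD(1)[OF L2per_component[OF W(2)]]])
          then show ?thesis by simp
        qed simp
      qed
      then show "AE t in lebesgue. (b i t)\<^sup>2 * indicator {0<..<T} t = (besov_norm X s 4 (\<lambda>x. u t x $ i))\<^sup>2 * indicator {0<..<T} t"
        by (simp add: AE_completion_iff)
    qed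
    also have "\<dots> < \<infinity>" using u by (simp add: L2_besov_def)
    finally show ?thesis .
  qed
  define S where "S t = (\<Sum>i\<in>UNIV. (b i t)\<^sup>2 * indicator {0<..<T} t)" for t
  have [measurable]: "S \<in> borel_measurable borel" unfolding S_def by measurable
  have Sfin: "(\<integral>\<^sup>+t. S t \<partial>lborel) < \<infinity>"
    unfolding S_def using fin by (subst nn_integral_sum) auto
  then have ae: "AE t in lborel. S t \<noteq> \<infinity>" by (intro nn_integral_noteq_infinite) auto
  \<comment> \<open>\<open>enn2real\<close> sends infinity to 0, so the domination fails only where
    \<open>S\<close> is infinite, a null set by \<open>ae\<close>.\<close>
  define \<beta> where "\<beta> t = sqrt (enn2real (S t))" for t
  have \<beta>m: "\<beta> \<in> borel_measurable borel" unfolding \<beta>_def by measurable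
  have sq: "ennreal ((\<beta> t)\<^sup>2) \<le> S t" for t by (cases "S t") (simp_all add: \<beta>_def)
  show ?thesis
  proof (rule that[of \<beta>])
    have "(\<integral>\<^sup>+t. ennreal ((\<beta> t)\<^sup>2) * indicator {0<..<T} t \<partial>lborel) \<le> (\<integral>\<^sup>+t. S t \<partial>lborel)"
      by (intro nn_integral_mono) (use sq in \<open>auto simp: indicator_def\<close>)
    then show "(\<integral>\<^sup>+t. ennreal ((\<beta> t)\<^sup>2) * indicator {0<..<T} t \<partial>lborel) < \<infinity>"
      using Sfin by (rule order.strict_trans1)
    show "AE t in lborel. t \<in> {0<..<T} \<longrightarrow> (\<forall>i. besov_norm X s 4 (\<lambda>x. W t x $ i) \<le> ennreal (\<beta> t))"
      using ae
    proof eventually_elim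
      case (elim t)
      show ?case
      proof (intro impI allI)
        fix i assume t: "t \<in> {0<..<T}"
        have "(b i t)\<^sup>2 \<le> S t"
          unfolding S_def using t member_le_sum[of i UNIV "\<lambda>i. (b i t)\<^sup>2"] by simp
        also have S: "S t = ennreal ((\<beta> t)\<^sup>2)" using elim by (cases "S t") (simp_all add: \<beta>_def)
        finally have le: "(b i t)\<^sup>2 \<le> ennreal ((\<beta> t)\<^sup>2)" .
        have "b i t \<le> ennreal (\<beta> t)"
        proof (cases "b i t")
          case (real r)
          then have "r\<^sup>2 \<le> (\<beta> t)\<^sup>2" using le by (simp add: ennreal_power)
          then have "r \<le> \<beta> t" by (rule power2_le_imp_le) (simp add: \<beta>_def)
          then show ?thesis using real by (simp add: ennreal_leI)
        next
          case top
          then show ?thesis using le by (simp add: power2_eq_square ennreal_top_mult top_unique)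
        qed
        then show "besov_norm X s 4 (\<lambda>x. W t x $ i) \<le> ennreal (\<beta> t)" by (simp add: b_def)
      qed
    qed
  qed (fact \<beta>m, simp add: \<beta>_def)
qed

context induction_solution
begin

text \<open>The flux at time \<open>t\<close> is at most \<open>flux_const\<close> times \<beta>u
  \<beta>v K, and 2 \<beta>u \<beta>v is bounded by the sum of squares, which is integrable in time.
  So the increments between almost all pairs of times are at most \<open>c r * d\<close>, which
  tends to 0.\<close>

lemma helicity_increment_tendsto:
  assumes mean: "AE t in lborel. t \<in> {0<..<T} \<longrightarrow> cosc 0 (V t) = 0"
    and X: "littlewood_paley_cutoff X" and ex: "0 < \<alpha>1" "\<alpha>1 < \<alpha>2" "\<alpha>2 < 1"
    and u: "L2_besov X T \<alpha>2 4 u" and B: "L2_besov X T (- \<alpha>1) 4 B"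
  obtains Z where "negligible Z" "\<And>s t. s \<in> {0<..<T} - Z \<Longrightarrow> t \<in> {0<..<T} - Z \<Longrightarrow>
    (\<lambda>r. helicity (2^r) s - helicity (2^r) t) \<longlonglongrightarrow> 0"
proof -
  \<comment> \<open>Both gaps are used: \<theta> < \<alpha>2 sums the blocks of \<open>u\<close>,
    and \<alpha>1 < \<theta> makes \<open>flux_const\<close> decay.\<close>
  define \<theta> where "\<theta> = (\<alpha>1 + \<alpha>2) / 2"
  have th: "\<alpha>1 < \<theta>" "\<theta> < \<alpha>2" using ex by (auto simp: \<theta>_def)
  obtain \<beta>u where \<beta>u [measurable]: "\<beta>u \<in> borel_measurable borel" and \<beta>u0: "\<And>t. 0 \<le> \<beta>u t"
    and \<beta>u_fin: "(\<integral>\<^sup>+t. ennreal ((\<beta>u t)\<^sup>2) * indicator {0<..<T} t \<partial>lborel) < \<infinity>"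
    and bu: "AE t in lborel. t \<in> {0<..<T} \<longrightarrow> (\<forall>i. besov_norm X \<alpha>2 4 (\<lambda>x. U t x $ i) \<le> ennreal (\<beta>u t))"
    using L2_besov_envelope[OF X u Um UL2 Ueq] by blast
  obtain \<beta>v where \<beta>v [measurable]: "\<beta>v \<in> borel_measurable borel" and \<beta>v0: "\<And>t. 0 \<le> \<beta>v t"
    and \<beta>v_fin: "(\<integral>\<^sup>+t. ennreal ((\<beta>v t)\<^sup>2) * indicator {0<..<T} t \<partial>lborel) < \<infinity>"
    and bv: "AE t in lborel. t \<in> {0<..<T} \<longrightarrow> (\<forall>i. besov_norm X (- \<alpha>1) 4 (\<lambda>x. V t x $ i) \<le> ennreal (\<beta>v t))"
    using L2_besov_envelope[OF X B Vm VL2 Veq] by blast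
  let ?D = "\<integral>\<^sup>+t. ennreal ((\<beta>u t)\<^sup>2) * indicator {0<..<T} t + ennreal ((\<beta>v t)\<^sup>2) * indicator {0<..<T} t \<partial>lborel"
  have "?D < \<infinity>" using \<beta>u_fin \<beta>v_fin by (subst nn_integral_add) auto
  then obtain d where d: "?D = ennreal d" "0 \<le> d" by (cases ?D) auto
  define c where "c r = \<bar>flux_const \<alpha>1 \<alpha>2 \<theta> r\<bar> * K" for r
  have c0: "0 \<le> c r" for r using K0 by (simp add: c_def)
  have flux_int: "(\<integral>\<^sup>+t. ennreal (2 * \<bar>flux (2^r) (U t) (V t)\<bar>) * indicator {0<..<T} t \<partial>lborel) \<le> ennreal (c r * d)" for r
  proof -
    have "(\<integral>\<^sup>+t. ennreal (2 * \<bar>flux (2^r) (U t) (V t)\<bar>) * indicator {0<..<T} t \<partial>lborel) \<le>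
        (\<integral>\<^sup>+t. ennreal (c r) * (ennreal ((\<beta>u t)\<^sup>2) * indicator {0<..<T} t + ennreal ((\<beta>v t)\<^sup>2) * indicator {0<..<T} t) \<partial>lborel)"
    proof (rule nn_integral_mono_AE)
      show "AE t in lborel. ennreal (2 * \<bar>flux (2^r) (U t) (V t)\<bar>) * indicator {0<..<T} t \<le>
          ennreal (c r) * (ennreal ((\<beta>u t)\<^sup>2) * indicator {0<..<T} t + ennreal ((\<beta>v t)\<^sup>2) * indicator {0<..<T} t)"
        using bu bv
      proof eventually_elim
        case (elim t)
        show ?case
        proof (cases "t \<in> {0<..<T}")
          case True
          have "\<bar>flux (2^r) (U t) (V t)\<bar> \<le> flux_const \<alpha>1 \<alpha>2 \<theta> r * \<beta>u t * \<beta>v t * K"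
            by (rule flux_bound[OF X UL2 VL2 ex(1) th ex(3) _ \<beta>u0 _ \<beta>v0 Vb K0]) (use elim True in auto)
          also have "\<dots> \<le> \<bar>flux_const \<alpha>1 \<alpha>2 \<theta> r\<bar> * \<beta>u t * \<beta>v t * K"
            using \<beta>u0 \<beta>v0 K0 by (intro mult_right_mono) auto
          finally have "2 * \<bar>flux (2^r) (U t) (V t)\<bar> \<le> c r * (2 * \<beta>u t * \<beta>v t)"
            by (simp add: c_def mult_ac)
          also have "\<dots> \<le> c r * ((\<beta>u t)\<^sup>2 + (\<beta>v t)\<^sup>2)"
            by (intro mult_left_mono sum_squares_bound c0)
          finally have "ennreal (2 * \<bar>flux (2^r) (U t) (V t)\<bar>) \<le> ennreal (c r * ((\<beta>u t)\<^sup>2 + (\<beta>v t)\<^sup>2))"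
            by (rule ennreal_leI)
          then show ?thesis using True c0[of r] by (simp add: ennreal_mult)
        qed simp
      qed
    qed
    also have "\<dots> = ennreal (c r) * ?D" by (rule nn_integral_cmult) measurable
    also have "\<dots> = ennreal (c r * d)" using d c0[of r] by (simp add: ennreal_mult)
    finally show ?thesis .
  qed
  \<comment> \<open>The exceptional set depends on \<open>r\<close>. Restricting to the dyadic
    orders leaves countably many sets, whose union is still null.\<close>
  have "\<exists>Z. negligible Z \<and> (\<forall>\<alpha> \<beta>. 0 < \<alpha> \<longrightarrow> \<alpha> \<le> \<beta> \<longrightarrow> \<beta> < T \<longrightarrow> \<alpha> \<notin> Z \<longrightarrow> \<beta> \<notin> Z \<longrightarrow>
      \<bar>helicity (2^r) \<beta> - helicity (2^r) \<alpha>\<bar> \<le> c r * d)" for r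
  proof -
    obtain Z where Z: "negligible Z" "\<And>\<alpha> \<beta>. 0 < \<alpha> \<Longrightarrow> \<alpha> \<le> \<beta> \<Longrightarrow> \<beta> < T \<Longrightarrow> \<alpha> \<notin> Z \<Longrightarrow> \<beta> \<notin> Z \<Longrightarrow>
      ennreal \<bar>helicity (2^r) \<beta> - helicity (2^r) \<alpha>\<bar> \<le> (\<integral>\<^sup>+t. ennreal (2 * \<bar>flux (2^r) (U t) (V t)\<bar>) * indicator {0<..<T} t \<partial>lborel)"
      using helicity_evolution[OF mean, of "2^r"] by blast
    have "0 \<le> c r * d" using c0[of r] d(2) by simp
    with Z order_trans[OF Z(2) flux_int] show ?thesis by (intro exI[of _ Z]) (auto simp: ennreal_le_iff)
  qed
  then obtain Z where Z: "\<And>r. negligible (Z r)" "\<And>r \<alpha> \<beta>. 0 < \<alpha> \<Longrightarrow> \<alpha> \<le> \<beta> \<Longrightarrow> \<beta> < T \<Longrightarrow> \<alpha> \<notin> Z r \<Longrightarrow> \<beta> \<notin> Z r \<Longrightarrow>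
      \<bar>helicity (2^r) \<beta> - helicity (2^r) \<alpha>\<bar> \<le> c r * d"
    by metis
  have "c \<longlonglongrightarrow> \<bar>0\<bar> * K" unfolding c_def
    by (intro tendsto_mult tendsto_rabs tendsto_const flux_const_tendsto th)
  then have lim: "(\<lambda>r. c r * d) \<longlonglongrightarrow> 0" by (intro tendsto_mult_left_zero) simp
  show ?thesis
  proof (rule that[of "\<Union>r. Z r"])
    show "negligible (\<Union>r. Z r)" using Z(1) by (intro negligible_countable_Union) auto
    fix s t assume st: "s \<in> {0<..<T} - (\<Union>r. Z r)" "t \<in> {0<..<T} - (\<Union>r. Z r)"
    have "norm (helicity (2^r) s - helicity (2^r) t) \<le> c r * d" for r
    proof (cases "s \<le> t")
      case True
      then show ?thesis using Z(2)[of s t r] st by (auto simp: abs_minus_commute)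
    next
      case False
      then show ?thesis using Z(2)[of t s r] st by auto
    qed
    then show "(\<lambda>r. helicity (2^r) s - helicity (2^r) t) \<longlonglongrightarrow> 0"
      by (intro Lim_null_comparison[OF _ lim]) simp
  qed
qed

text \<open>At a fixed time the potential lies in L2 and the twice mollified field converges to
  \<open>V t\<close> in L2, so the pairing converges with no use of the Besov bounds.\<close>

lemma helicity_tendsto:
  assumes t: "AE x in torus. B t x = V t x" and pot: "is_vector_potential (B t) (A t)" and mean: "cosc 0 (V t) = 0"
  shows "(\<lambda>r. helicity (2^r) t) \<longlonglongrightarrow> torus_integral (\<lambda>x. A t x \<bullet> B t x)"
proof -
  have "torus_L2 (A t)" using pot by (auto simp: is_vector_potential_def is_weak_curl_def)
  then obtain a where a: "L2per a" "AE x in torus. A t x = a x" using torus_L2_representative by blast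
  note [measurable] = L2perD(1)[OF a(1)]
  have c: "L2per (conv N (V t))" for N by (rule L2per_conv[OF L2perD(1,2,4)[OF VL2[of t]]])
  have cc: "L2per (conv N (conv N (V t)))" for N by (rule L2per_conv[OF L2perD(1,2,4)[OF c]])
  have "strict_mono (\<lambda>r. 2 ^ r :: nat)" by (simp add: strict_mono_def)
  from LIMSEQ_subseq_LIMSEQ[OF conv_conv_tendsto_L2[OF VL2[of t]] this]
  have "(\<lambda>r. \<integral>\<^sup>+x. ennreal (norm (conv (2^r) (conv (2^r) (V t)) x - V t x)) ^ 2 \<partial>torus) \<longlonglongrightarrow> 0"
    by (simp add: o_def)
  from tendsto_inner_L2per[OF cc VL2 a(1) this]
  have "(\<lambda>r. helicity (2^r) t) \<longlonglongrightarrow> (\<integral>x. V t x \<bullet> a x \<partial>torus)"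
    unfolding helicity_eq_integral[where A=A, OF t pot a mean] by (simp add: inner_commute)
  moreover have "torus_integral (\<lambda>x. A t x \<bullet> B t x) = (\<integral>x. V t x \<bullet> a x \<partial>torus)"
    by (rule torus_integral_AE) (measurable, use t a(2) in eventually_elim, simp add: inner_commute)
  ultimately show ?thesis by simp
qed

end

theorem theorem5p2:
  fixes T \<alpha>1 \<alpha>2 :: real
    and u B A :: "real \<Rightarrow> real^3 \<Rightarrow> real^3"
    and X :: "real^3 \<Rightarrow> real"
  assumes "0 < T"
    and "littlewood_paley_cutoff X"
    and "ideal_MHD_weak_solution T u B"
    and "AE t in lebesgue_on {0<..<T}. mean_free (B t)"
    and "AE t in lebesgue_on {0<..<T}. is_vector_potential (B t) (A t)"
    and "0 < \<alpha>1" and "\<alpha>1 < \<alpha>2" and "\<alpha>2 < 1"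
    and "L2_besov X T \<alpha>2 4 u"
    and "L2_besov X T (- \<alpha>1) 4 B"
  shows "AE t1 in lebesgue_on {0<..<T}. AE t2 in lebesgue_on {0<..<T}.
    torus_integral (\<lambda>x. A t1 x \<bullet> B t1 x) = torus_integral (\<lambda>x. A t2 x \<bullet> B t2 x)"
proof -
  have sol: "Linf_L2 T u" "Linf_L2 T B" "weakly_div_free T B"
    "\<And>\<psi>. div_free_test_function T \<psi> \<Longrightarrow>
        spacetime_integral T (\<lambda>t x. B t x \<bullet> time_deriv \<psi> t x
          + ddot (outer (u t x) (B t x)) (vgrad (\<psi> t) x)
          - ddot (outer (B t x) (u t x)) (vgrad (\<psi> t) x)) = 0"
    using assms(3) unfolding ideal_MHD_weak_solution_def by blast+
  obtain U K1 where U: "(\<lambda>z. U (fst z) (snd z)) \<in> borel_measurable borel" "\<And>t. L2per (U t)"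
    "\<And>t. (\<integral>\<^sup>+x. ennreal (norm (U t x)) ^ 2 \<partial>torus) \<le> ennreal (K1\<^sup>2)" "0 \<le> K1"
    "AE t in lborel. t \<in> {0<..<T} \<longrightarrow> (AE x in torus. u t x = U t x)"
    using Linf_L2_representative[OF sol(1)] by blast
  obtain V K2 where V: "(\<lambda>z. V (fst z) (snd z)) \<in> borel_measurable borel" "\<And>t. L2per (V t)"
    "\<And>t. (\<integral>\<^sup>+x. ennreal (norm (V t x)) ^ 2 \<partial>torus) \<le> ennreal (K2\<^sup>2)" "0 \<le> K2"
    "AE t in lborel. t \<in> {0<..<T} \<longrightarrow> (AE x in torus. B t x = V t x)"
    using Linf_L2_representative[OF sol(2)] by blast
  define K where "K = max K1 K2"
  have K: "ennreal (K1\<^sup>2) \<le> ennreal (K\<^sup>2)" "ennreal (K2\<^sup>2) \<le> ennreal (K\<^sup>2)" "0 \<le> K"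
    using U(4) V(4) by (auto simp: K_def intro!: ennreal_leI power_mono)
  interpret induction_solution T K u B U V
    by unfold_locales
       (fact K(3) U(1) V(1) U(2) V(2) order_trans[OF U(3) K(1)] order_trans[OF V(3) K(2)] U(5) V(5) sol(4) sol(3))+
  have mean: "AE t in lborel. t \<in> {0<..<T} \<longrightarrow> cosc 0 (V t) = 0"
    using assms(4)[unfolded AE_lebesgue_on_iff] V(5)
  proof eventually_elim
    case (elim t)
    then show ?case
      using torus_integral_AE[of "V t" "B t"] by (auto simp: mean_free_def cosc_def)
  qed
  obtain Z where Z: "negligible Z" "\<And>s t. s \<in> {0<..<T} - Z \<Longrightarrow> t \<in> {0<..<T} - Z \<Longrightarrow>
      (\<lambda>r. helicity (2^r) s - helicity (2^r) t) \<longlonglongrightarrow> 0"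
    using helicity_increment_tendsto[OF mean assms(2,6-10)] by blast
  \<comment> \<open>One set of full measure serves both quantifiers: for any two good times,
    vanishing increments and uniqueness of limits give equality.\<close>
  define good where "good t \<longleftrightarrow> t \<in> {0<..<T} - Z \<and> (\<lambda>r. helicity (2^r) t) \<longlonglongrightarrow> torus_integral (\<lambda>x. A t x \<bullet> B t x)" for t
  have "AE t in lborel. t \<notin> Z"
    using AE_not_in[of Z lebesgue] Z(1) by (simp only: negligible_iff_null_sets AE_completion_iff)
  then have good: "AE t in lebesgue_on {0<..<T}. good t"
    unfolding AE_lebesgue_on_iff using mean V(5) assms(5)[unfolded AE_lebesgue_on_iff]
    by eventually_elim (auto simp: good_def intro: helicity_tendsto)
  have eq: "torus_integral (\<lambda>x. A s x \<bullet> B s x) = torus_integral (\<lambda>x. A t x \<bullet> B t x)" if "good s" "good t" for s t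
  proof -
    have "(\<lambda>r. helicity (2^r) s - helicity (2^r) t) \<longlonglongrightarrow> torus_integral (\<lambda>x. A s x \<bullet> B s x) - torus_integral (\<lambda>x. A t x \<bullet> B t x)"
      using that by (intro tendsto_diff) (auto simp: good_def)
    moreover have "(\<lambda>r. helicity (2^r) s - helicity (2^r) t) \<longlonglongrightarrow> 0" using that by (intro Z(2)) (auto simp: good_def)
    ultimately show ?thesis using LIMSEQ_unique by fastforce
  qed
  show ?thesis
    using good
  proof eventually_elim
    case (elim s)
    show ?case using good by eventually_elim (rule eq[OF elim])
  qed
qed

end
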